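(* Let $\beta\in\{1,2,4\}$, let $m>n\ge1$ be integers, let $\Sigma\in S^\beta(m)$ be positive definite, and let $W\sim\mathcal{W}_m^\beta(n,\Sigma)$ be a singular beta-Wishart matrix. Then for $x>0$ the distribution function of the largest eigenvalue $\ell_1$ of $W$ is $$\Pr(\ell_1<x)=\frac{\Gamma_n^\beta\{(n-1)\beta/2+1\}\,(x\beta/2)^{\beta nm/2}}{\Gamma_n^\beta\{(n+m-1)\beta/2+1\}\,|\Sigma|^{n\beta/2}}\;{}_1F_1^{(\beta;m,n)}\left(\frac{m\beta}{2};\frac{(n+m-1)\beta}{2}+1;-\frac{\beta}{2}x\Sigma^{-1},I_n\right).$$
   Context: $\mathbb{F}_1=\mathbb{R}$, $\mathbb{F}_2=\mathbb{C}$, $\mathbb{F}_4=\mathbb{H}$ (quaternions). $S^\beta(m)$ is the space of $m\times m$ Hermitian matrices over $\mathbb{F}_\beta$ and $|\cdot|$ is the product of the (real) eigenvalues. $W\sim\mathcal{W}_m^\beta(n,\Sigma)$ means $W=XX^\ast$ where $X\in\mathbb{F}_\beta^{m\times n}$ is a random matrix with density (with respect to Lebesgue measure on $\mathbb{F}_\beta^{m\times n}\cong\mathbb{R}^{\beta mn}$) $$\frac{1}{(2\pi\beta^{-1})^{mn\beta/2}|\Sigma|^{\beta n/2}}\exp\left(-\frac{\beta}{2}\mathrm{tr}\,\Sigma^{-1}XX^\ast\right)$$ (for $\beta=4$ the trace means its real part). $\Gamma_n^\beta(c)=\pi^{n(n-1)\beta/4}\prod_{i=1}^n\Gamma\left(c-\frac{(i-1)\beta}{2}\right)$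 for $\mathrm{Re}(c)>(n-1)\beta/2$; $(a)_\kappa^\beta=\prod_i\left(a-\frac{i-1}{2}\beta\right)_{\kappa_i}$ with $(a)_k=a(a+1)\cdots(a+k-1)$, $(a)_0=1$. Jack polynomials: for a partition $\kappa$ of $k$, $C_\kappa^\beta(X)$ is the homogeneous symmetric polynomial of degree $k$ in the eigenvalues $x_1,\dots,x_m$ of $X$ determined by: (i) its lexicographically leading monomial is $x_1^{\kappa_1}\cdots x_m^{\kappa_m}$ up to a constant; (ii) it is an eigenfunction of $\sum_i x_i^2\partial_i^2+\beta\sum_{i\ne j}\frac{x_i^2}{x_i-x_j}\partial_i$; (iii) $\sum_\kappa C_\kappa^\beta(X)=(x_1+\cdots+x_m)^k$, the sum being over partitions of $k$ with at most $m$ parts. With $P_n^k$ the set of partitions of $k$ with at most $n$ nonzero parts, for $A\in S^\beta(m)$, $B\in S^\beta(n)$, $${}_1F_1^{(\beta;m,n)}(a;c;A,B)=\sum_{k=0}^\infty\sum_{\kappa\in P_n^k}\frac{(a)_\kappa^\beta}{(c)_\kappa^\beta}\frac{C_\kappa^\beta(A)C_\kappa^\beta(B)}{k!\,C_\kappa^\beta(I_m)}.$$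
   Formalization: In condition (i) on the Jack polynomials, "lexicographically leading" is read as leading in the dominance order, since with the lexicographic order (i)–(iii) do not determine C_κ: for k=6, (4,1,1) and (3,3) share an eigenvalue. *)

theory Defs
  imports "HOL-Probability.Probability"
begin

section \<open>Quaternions\<close>

codatatype quat = Quat (qRe: real) (qI: real) (qJ: real) (qK: real)

lemma quat_eq_iff: "p = q \<longleftrightarrow> qRe p = qRe q \<and> qI p = qI q \<and> qJ p = qJ q \<and> qK p = qK q"
  by (cases p; cases q) simp

lemma quat_eqI: "qRe p = qRe q \<Longrightarrow> qI p = qI q \<Longrightarrow> qJ p = qJ q \<Longrightarrow> qK p = qK q \<Longrightarrow> p = q"
  by (simp add: quat_eq_iff)

instantiation quat :: ring_1
begin

primcorec zero_quat where "qRe 0 = 0" | "qI 0 = 0" | "qJ 0 = 0" | "qK 0 = 0"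
primcorec one_quat where "qRe 1 = 1" | "qI 1 = 0" | "qJ 1 = 0" | "qK 1 = 0"
primcorec plus_quat where
  "qRe (p + q) = qRe p + qRe q" | "qI (p + q) = qI p + qI q"
| "qJ (p + q) = qJ p + qJ q" | "qK (p + q) = qK p + qK q"
primcorec minus_quat where
  "qRe (p - q) = qRe p - qRe q" | "qI (p - q) = qI p - qI q"
| "qJ (p - q) = qJ p - qJ q" | "qK (p - q) = qK p - qK q"
primcorec uminus_quat where
  "qRe (- p) = - qRe p" | "qI (- p) = - qI p" | "qJ (- p) = - qJ p" | "qK (- p) = - qK p"
primcorec times_quat where
  "qRe (p * q) = qRe p * qRe q - qI p * qI q - qJ p * qJ q - qK p * qK q"
| "qI (p * q) = qRe p * qI q + qI p * qRe q + qJ p * qK q - qK p * qJ q"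
| "qJ (p * q) = qRe p * qJ q - qI p * qK q + qJ p * qRe q + qK p * qI q"
| "qK (p * q) = qRe p * qK q + qI p * qJ q - qJ p * qI q + qK p * qRe q"

instance
proof
  fix p q r :: quat
  show "p * q * r = p * (q * r)"
    by (rule quat_eqI; simp; algebra)
  show "(p + q) * r = p * r + q * r" "p * (q + r) = p * q + p * r"
    by (rule quat_eqI; simp; algebra)+
qed (simp_all add: quat_eq_iff)

end

instantiation quat :: real_algebra_1
begin

primcorec scaleR_quat where
  "qRe (scaleR r q) = r * qRe q" | "qI (scaleR r q) = r * qI q"
| "qJ (scaleR r q) = r * qJ q" | "qK (scaleR r q) = r * qK q"

instance
  by standard (simp_all add: quat_eq_iff algebra_simps)

end

instantiation quat :: real_inner
begin

definition inner_quat_def: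
  "inner p q = qRe p * qRe q + qI p * qI q + qJ p * qJ q + qK p * qK q"

definition norm_quat_def: "norm (q::quat) = sqrt (inner q q)"

definition sgn_quat_def: "sgn (q::quat) = q /\<^sub>R norm q"

definition dist_quat_def: "dist (p::quat) q = norm (p - q)"

definition uniformity_quat_def:
  "(uniformity :: (quat \<times> quat) filter) = (INF e\<in>{0 <..}. principal {(x, y). dist x y < e})"

definition open_quat_def:
  "open (U :: quat set) \<longleftrightarrow> (\<forall>x\<in>U. eventually (\<lambda>(x', y). x' = x \<longrightarrow> y \<in> U) uniformity)"

instance
proof
  fix p q s :: quat and r :: real
  show "inner p q = inner q p"
    by (simp add: inner_quat_def algebra_simps)
  show "inner (p + q) s = inner p s + inner q s"
    by (simp add: inner_quat_def algebra_simps)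
  show "inner (r *\<^sub>R p) q = r * inner p q"
    by (simp add: inner_quat_def algebra_simps)
  show "0 \<le> inner p p"
    by (simp add: inner_quat_def)
  show "inner p p = 0 \<longleftrightarrow> p = 0"
  proof
    assume "inner p p = 0"
    then have "(qRe p)\<^sup>2 + (qI p)\<^sup>2 + (qJ p)\<^sup>2 + (qK p)\<^sup>2 = 0"
      by (simp add: inner_quat_def power2_eq_square)
    then have "(qRe p)\<^sup>2 = 0 \<and> (qI p)\<^sup>2 = 0 \<and> (qJ p)\<^sup>2 = 0 \<and> (qK p)\<^sup>2 = 0"
      using zero_le_power2[of "qRe p"] zero_le_power2[of "qI p"]
        zero_le_power2[of "qJ p"] zero_le_power2[of "qK p"] by linarith
    then show "p = 0"
      by (simp add: quat_eq_iff)
  qed (simp add: inner_quat_def)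
qed (rule norm_quat_def sgn_quat_def dist_quat_def uniformity_quat_def open_quat_def)+

end

instantiation quat :: euclidean_space
begin

definition Basis_quat_def:
  "Basis = {Quat 1 0 0 0, Quat 0 1 0 0, Quat 0 0 1 0, Quat 0 0 0 1}"

instance
proof
  fix u v p :: quat
  show "(Basis :: quat set) \<noteq> {}" "finite (Basis :: quat set)"
    by (simp_all add: Basis_quat_def)
  show "u \<in> Basis \<Longrightarrow> v \<in> Basis \<Longrightarrow> inner u v = (if u = v then 1 else 0)"
    unfolding Basis_quat_def by (elim insertE emptyE) (simp_all add: inner_quat_def)
  show "(\<forall>u\<in>Basis. inner p u = 0) \<longleftrightarrow> p = 0"
    unfolding Basis_quat_def ball_simps by (simp add: inner_quat_def quat_eq_iff[of p])
qed

end

primcorec qcnj :: "quat \<Rightarrow> quat" where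
  "qRe (qcnj q) = qRe q" | "qI (qcnj q) = - qI q" | "qJ (qcnj q) = - qJ q" | "qK (qcnj q) = - qK q"

section \<open>Matrices over the reals, the complex numbers and the quaternions\<close>

text \<open>
  The three division algebras are the subalgebras of the quaternions spanned over the reals by the
  first \<open>\<beta>\<close> of the units 1, i, j, k, where \<open>\<beta>\<close> is 1, 2 or 4.
\<close>

definition Falg :: "nat \<Rightarrow> quat set" where
  "Falg \<beta> = {q. (\<beta> < 2 \<longrightarrow> qI q = 0) \<and> (\<beta> < 4 \<longrightarrow> qJ q = 0 \<and> qK q = 0)}"

lemma quat_of_real: "of_real r = Quat r 0 0 0"
  unfolding of_real_def by (rule quat_eqI) simp_all

lemma Falg_1: "Falg 1 = range of_real"
  unfolding quat_of_real
proof
  show "Falg 1 \<subseteq> range (\<lambda>r. Quat r 0 0 0)"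
  proof
    fix q assume "q \<in> Falg 1"
    then have "q = Quat (qRe q) 0 0 0"
      by (simp add: Falg_def quat_eq_iff)
    then show "q \<in> range (\<lambda>r. Quat r 0 0 0)"
      by (rule range_eqI)
  qed
qed (auto simp: Falg_def)

lemma Falg_4: "Falg 4 = UNIV"
  by (auto simp: Falg_def)

lemma Falg_mult: "p \<in> Falg \<beta> \<Longrightarrow> q \<in> Falg \<beta> \<Longrightarrow> p * q \<in> Falg \<beta>"
  by (auto simp: Falg_def)

lemma Falg_qcnj: "q \<in> Falg \<beta> \<Longrightarrow> qcnj q \<in> Falg \<beta>"
  by (auto simp: Falg_def)

definition Fvec :: "nat \<Rightarrow> (quat^'m) set" where
  "Fvec \<beta> = {v. \<forall>i. v $ i \<in> Falg \<beta>}"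

definition Fmat :: "nat \<Rightarrow> (quat^'n^'m) set" where
  "Fmat \<beta> = {X. \<forall>i j. X $ i $ j \<in> Falg \<beta>}"

definition adjoint_mat :: "quat^'n^'m \<Rightarrow> quat^'m^'n" where
  "adjoint_mat X = (\<chi> i j. qcnj (X $ j $ i))"

definition hermitian :: "nat \<Rightarrow> (quat^'m^'m) set" where
  "hermitian \<beta> = {A \<in> Fmat \<beta>. adjoint_mat A = A}"

definition pos_def :: "nat \<Rightarrow> (quat^'m^'m) set" where
  "pos_def \<beta> = {A \<in> hermitian \<beta>. \<forall>v \<in> Fvec \<beta>. v \<noteq> 0 \<longrightarrow>
     0 < qRe (\<Sum>i\<in>UNIV. \<Sum>j\<in>UNIV. qcnj (v $ i) * (A $ i $ j) * (v $ j))}"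

text \<open>
  The multiplicity of a real eigenvalue is the dimension of its eigenspace over the division
  algebra, that is, the real dimension divided by \<open>\<beta>\<close>.
\<close>

definition eig_mult :: "nat \<Rightarrow> quat^'m^'m \<Rightarrow> real \<Rightarrow> nat" where
  "eig_mult \<beta> A l = dim {v \<in> Fvec \<beta>. A *v v = l *\<^sub>R v} div \<beta>"

text \<open>
  The real eigenvalues, listed with multiplicity in non-increasing order; for Hermitian \<open>A\<close> over
  the division algebra the spectral theorem says that this list has \<open>CARD('m)\<close> entries.
\<close>

definition eigvals :: "nat \<Rightarrow> quat^'m^'m \<Rightarrow> real list" where
  "eigvals \<beta> A = (THE xs. sorted_wrt (\<ge>) xs \<and> (\<forall>l. count_list xs l = eig_mult \<beta> A l))"

definition max_eigval :: "nat \<Rightarrow> quat^'m^'m \<Rightarrow> real" where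
  "max_eigval \<beta> A = Max (set (eigvals \<beta> A))"

definition hdet :: "nat \<Rightarrow> quat^'m^'m \<Rightarrow> real" where
  "hdet \<beta> A = prod_list (eigvals \<beta> A)"

section \<open>The beta-Wishart distribution\<close>

definition mat_of_coords :: "nat \<Rightarrow> ('m \<times> 'n \<times> nat \<Rightarrow> real) \<Rightarrow> quat^'n^'m" where
  "mat_of_coords \<beta> w = (\<chi> i j.
     let c = (\<lambda>l. if l < \<beta> then w (i, j, l) else 0) in Quat (c 0) (c 1) (c 2) (c 3))"

lemma mat_of_coords_measurable:
  assumes "\<beta> \<in> {1, 2, 4}"
  shows "mat_of_coords \<beta> \<in> measurable (PiM (UNIV \<times> UNIV \<times> {..<\<beta>}) (\<lambda>_. lborel))
     (restrict_space borel (Fmat \<beta> :: (quat^'n^'m) set))"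
proof (rule measurable_restrict_space2)
  let ?P = "PiM (UNIV \<times> UNIV \<times> {..<\<beta>}) (\<lambda>_. lborel) :: ('m \<times> 'n \<times> nat \<Rightarrow> real) measure"
  show "mat_of_coords \<beta> \<in> space ?P \<rightarrow> (Fmat \<beta> :: (quat^'n^'m) set)"
    using assms by (auto simp: mat_of_coords_def Fmat_def Falg_def Let_def)
  have coord: "(\<lambda>w. if l < \<beta> then w (i, j, l) else 0) \<in> borel_measurable ?P" for i j l
  proof (cases "l < \<beta>")
    case True
    then show ?thesis
      using measurable_component_singleton[of "(i, j, l)" "UNIV \<times> UNIV \<times> {..<\<beta>}" "\<lambda>_. lborel :: real measure"]
      by simp
  qed simp
  have "(\<lambda>w. mat_of_coords \<beta> w \<bullet> b) \<in> borel_measurable ?P" if "b \<in> Basis" for b :: "quat^'n^'m"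
  proof -
    obtain i c where "b = axis i c" and c: "c \<in> Basis"
      using \<open>b \<in> Basis\<close> unfolding Basis_vec_def[where 'b = 'm] by blast
    moreover obtain j q where "c = axis j q" and q: "q \<in> Basis"
      using c unfolding Basis_vec_def by blast
    ultimately have b: "mat_of_coords \<beta> w \<bullet> b = mat_of_coords \<beta> w $ i $ j \<bullet> q" for w
      by (simp add: inner_axis)
    consider "q = Quat 1 0 0 0" | "q = Quat 0 1 0 0" | "q = Quat 0 0 1 0" | "q = Quat 0 0 0 1"
      using q unfolding Basis_quat_def by blast
    then have "\<exists>l. \<forall>w. mat_of_coords \<beta> w \<bullet> b = (if l < \<beta> then w (i, j, l) else 0)"
      unfolding b by cases (rule exI, force simp: mat_of_coords_def inner_quat_def)+
    then obtain l where "\<And>w. mat_of_coords \<beta> w \<bullet> b = (if l < \<beta> then w (i, j, l) else 0)"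
      by blast
    then show ?thesis
      using coord[of l i j] by simp
  qed
  then show "mat_of_coords \<beta> \<in> measurable ?P (borel :: (quat^'n^'m) measure)"
    unfolding borel_measurable_euclidean_space[of "mat_of_coords \<beta> :: _ \<Rightarrow> quat^'n^'m"] by blast
qed

definition lebesgue_Fmat :: "nat \<Rightarrow> (quat^'n^'m) measure" where
  "lebesgue_Fmat \<beta> =
     distr (PiM (UNIV \<times> UNIV \<times> {..<\<beta>}) (\<lambda>_. lborel)) (restrict_space borel (Fmat \<beta>)) (mat_of_coords \<beta>)"

definition wishart_density :: "nat \<Rightarrow> quat^'m^'m \<Rightarrow> quat^'n^'m \<Rightarrow> real" where
  "wishart_density \<beta> \<Sigma> X =
     1 / ((2 * pi / real \<beta>) powr (real CARD('m) * real CARD('n) * real \<beta> / 2)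
          * hdet \<beta> \<Sigma> powr (real \<beta> * real CARD('n) / 2))
     * exp (- (real \<beta> / 2) * qRe (trace (matrix_inv \<Sigma> ** X ** adjoint_mat X)))"

text \<open>
  The number of columns \<open>n\<close> is the cardinality of the type \<open>'n\<close>, which has to be passed explicitly
  because it does not occur in the type of \<open>W\<close>.
\<close>

definition wishart ::
  "nat \<Rightarrow> 'n::finite itself \<Rightarrow> quat^'m^'m \<Rightarrow> 'a measure \<Rightarrow> ('a \<Rightarrow> quat^'m^'m) \<Rightarrow> bool" where
  "wishart \<beta> (_ :: 'n itself) \<Sigma> M W \<longleftrightarrow>
     (\<exists>X :: 'a \<Rightarrow> quat^'n^'m.
        distributed M (lebesgue_Fmat \<beta>) X (\<lambda>Y. ennreal (wishart_density \<beta> \<Sigma> Y)) \<and>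
        (\<forall>\<omega>\<in>space M. W \<omega> = X \<omega> ** adjoint_mat (X \<omega>)))"

section \<open>Jack polynomials\<close>

text \<open>
  Exponent vectors and partitions are functions on the naturals, indexed from 0 and vanishing from
  the number \<open>p\<close> of variables on.
\<close>

definition exponents :: "nat \<Rightarrow> nat \<Rightarrow> (nat \<Rightarrow> nat) set" where
  "exponents p k = {\<alpha>. (\<forall>i\<ge>p. \<alpha> i = 0) \<and> (\<Sum>i<p. \<alpha> i) = k}"

definition parts :: "nat \<Rightarrow> nat \<Rightarrow> (nat \<Rightarrow> nat) set" where
  "parts p k = {\<kappa> \<in> exponents p k. antimono \<kappa>}"

definition hom_poly :: "nat \<Rightarrow> nat \<Rightarrow> ((nat \<Rightarrow> nat) \<Rightarrow> real) \<Rightarrow> (nat \<Rightarrow> real) \<Rightarrow> real" where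
  "hom_poly p k a x = (\<Sum>\<alpha>\<in>exponents p k. a \<alpha> * (\<Prod>i<p. x i ^ \<alpha> i))"

definition dominated :: "(nat \<Rightarrow> nat) \<Rightarrow> (nat \<Rightarrow> nat) \<Rightarrow> bool" where
  "dominated \<alpha> \<kappa> \<longleftrightarrow> (\<forall>j. (\<Sum>i<j. \<alpha> i) \<le> (\<Sum>i<j. \<kappa> i))"

lemma dominated_imp_lex_less:
  assumes "dominated \<alpha> \<kappa>" "\<alpha> \<noteq> \<kappa>"
  shows "\<exists>j. (\<forall>i<j. \<alpha> i = \<kappa> i) \<and> \<alpha> j < \<kappa> j"
proof -
  define j where "j = (LEAST j. \<alpha> j \<noteq> \<kappa> j)"
  obtain j' where "\<alpha> j' \<noteq> \<kappa> j'"
    using assms(2) by (meson ext)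
  then have j: "\<alpha> j \<noteq> \<kappa> j"
    unfolding j_def by (rule LeastI)
  have least: "\<alpha> i = \<kappa> i" if "i < j" for i
    using not_less_Least[OF that[unfolded j_def]] by simp
  have "(\<Sum>i<Suc j. \<alpha> i) \<le> (\<Sum>i<Suc j. \<kappa> i)"
    using assms(1) unfolding dominated_def by blast
  moreover have "(\<Sum>i<j. \<alpha> i) = (\<Sum>i<j. \<kappa> i)"
    by (rule sum.cong) (use least in auto)
  ultimately have "\<alpha> j < \<kappa> j"
    using j by (simp add: lessThan_Suc)
  then show ?thesis
    using least by blast
qed

definition partial_deriv :: "nat \<Rightarrow> ((nat \<Rightarrow> real) \<Rightarrow> real) \<Rightarrow> (nat \<Rightarrow> real) \<Rightarrow> real" where
  "partial_deriv i f x = deriv (\<lambda>t. f (x(i := t))) (x i)"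

definition jack_operator :: "nat \<Rightarrow> nat \<Rightarrow> ((nat \<Rightarrow> real) \<Rightarrow> real) \<Rightarrow> (nat \<Rightarrow> real) \<Rightarrow> real" where
  "jack_operator \<beta> p f x =
     (\<Sum>i<p. (x i)\<^sup>2 * partial_deriv i (partial_deriv i f) x)
     + real \<beta> * (\<Sum>i<p. \<Sum>j\<in>{..<p} - {i}. (x i)\<^sup>2 / (x i - x j) * partial_deriv i f x)"

text \<open>
  \<open>jack_family \<beta> p k C\<close> says that the functions \<open>C \<kappa>\<close>, for \<open>\<kappa>\<close> a partition of \<open>k\<close> with at most \<open>p\<close>
  parts, are the Jack polynomials in \<open>p\<close> variables in the normalization summing to the \<open>k\<close>-th power
  of the first power sum. The leading term is taken with respect to the dominance order, which
  implies that it is lexicographically leading (\<open>dominated_imp_lex_less\<close>). Being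
  lexicographically leading alone would not determine the family: the operator has the same
  eigenvalue on the partitions (4,1,1) and (3,3), so a fraction of the polynomial of (3,3) could be
  moved over to that of (4,1,1).
\<close>

definition jack_family ::
  "nat \<Rightarrow> nat \<Rightarrow> nat \<Rightarrow> ((nat \<Rightarrow> nat) \<Rightarrow> (nat \<Rightarrow> real) \<Rightarrow> real) \<Rightarrow> bool" where
  "jack_family \<beta> p k C \<longleftrightarrow>
     (\<forall>\<kappa>\<in>parts p k.
        (\<exists>a. C \<kappa> = hom_poly p k a \<and> a \<kappa> \<noteq> 0 \<and>
             (\<forall>\<alpha>\<in>exponents p k. a \<alpha> \<noteq> 0 \<longrightarrow> dominated \<alpha> \<kappa>)) \<and>
        (\<forall>\<pi> x. \<pi> permutes {..<p} \<longrightarrow> C \<kappa> (x \<circ> \<pi>) = C \<kappa> x) \<and>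
        (\<exists>\<mu>. \<forall>x. inj_on x {..<p} \<longrightarrow> jack_operator \<beta> p (C \<kappa>) x = \<mu> * C \<kappa> x)) \<and>
     (\<forall>x. (\<Sum>\<kappa>\<in>parts p k. C \<kappa> x) = (\<Sum>i<p. x i) ^ k)"

definition jack :: "nat \<Rightarrow> nat \<Rightarrow> (nat \<Rightarrow> nat) \<Rightarrow> (nat \<Rightarrow> real) \<Rightarrow> real" where
  "jack \<beta> p \<kappa> = (THE f. \<exists>C. jack_family \<beta> p (\<Sum>i<p. \<kappa> i) C \<and> f = C \<kappa>)"

definition jack_mat :: "nat \<Rightarrow> (nat \<Rightarrow> nat) \<Rightarrow> quat^'m^'m \<Rightarrow> real" where
  "jack_mat \<beta> \<kappa> A = jack \<beta> CARD('m) \<kappa> (\<lambda>i. eigvals \<beta> A ! i)"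

section \<open>The multivariate gamma function and the hypergeometric function\<close>

definition mv_Gamma :: "nat \<Rightarrow> nat \<Rightarrow> real \<Rightarrow> real" where
  "mv_Gamma \<beta> n c =
     pi powr (real n * (real n - 1) * real \<beta> / 4) * (\<Prod>i=1..n. Gamma (c - (real i - 1) * real \<beta> / 2))"

text \<open>Parts are indexed from 0 and vanishing parts contribute the factor 1.\<close>

definition gen_pochhammer :: "nat \<Rightarrow> real \<Rightarrow> (nat \<Rightarrow> nat) \<Rightarrow> real" where
  "gen_pochhammer \<beta> a \<kappa> = (\<Prod>i | \<kappa> i \<noteq> 0. pochhammer (a - real i / 2 * real \<beta>) (\<kappa> i))"

definition hyp1F1 :: "nat \<Rightarrow> real \<Rightarrow> real \<Rightarrow> quat^'m^'m \<Rightarrow> quat^'n^'n \<Rightarrow> real" where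
  "hyp1F1 \<beta> a c A B =
     (\<Sum>k. \<Sum>\<kappa>\<in>parts CARD('n) k.
        gen_pochhammer \<beta> a \<kappa> / gen_pochhammer \<beta> c \<kappa>
        * (jack_mat \<beta> \<kappa> A * jack_mat \<beta> \<kappa> B / (fact k * jack_mat \<beta> \<kappa> (mat 1 :: quat^'m^'m))))"

end

theory Submission
 imports Defs
begin

text \<open>
 Put \<open>A = - (\<beta>/2) x \<Sigma>\<^sup>-\<^sup>1\<close>. After scaling, the probability is a constant times the integral of
 \<open>exp (Re tr (Y* A Y))\<close> over the \<open>m \<times> n\<close> matrices of operator norm less than 1, which are padded to
 square matrices whose last columns vanish. If the law of a bounded random matrix \<open>Z\<close> is unitarily
 invariant, then the averaging operator taking \<open>F\<close> to the expectation of \<open>F (Z* A Z)\<close> commutes with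
 the unitarily invariant second order operator \<open>LL\<close>, which restricts to the operator of the Jack
 polynomials on diagonal matrices. Averaging also respects the dominance order, so the Jack
 polynomials are its eigenfunctions, and the eigenvalue is the expectation of the leading coefficient
 of \<open>x \<mapsto> C (Z* diag(x) Z)\<close>. That coefficient is multiplicative along Gaussian elimination, so for
 the ball it can be integrated row by row. Applying this to all powers of the trace and exchanging
 \<open>Y\<close> and \<open>Y*\<close>, which gives the ratio of the values of \<open>C\<close> at \<open>I\<^sub>n\<close> and \<open>I\<^sub>m\<close>, yields the series.
\<close>

section \<open>Matrix algebra over the quaternions and its real subalgebras, and the unitary
  group\<close>

section \<open>Quaternions and matrices\<close>

text \<open>For \<beta> = 4 the entries do not commute, so no determinants or minors are used; the
  C_\<kappa> are handled through their eigenfunction property alone. The Jack operator has poles at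
  coinciding eigenvalues, its matrix form \<open>LL\<close> has none, and this is also how the
  existence of the Jack polynomials is obtained. Row integration produces the coefficient (n
  \<beta>/2)_\<kappa> / (c)_\<kappa> with c = (n + m - 1) \<beta>/2 + 1, whereas the series asks for
  (m \<beta>/2)_\<kappa> / (c)_\<kappa> times C_\<kappa>(I_n) / C_\<kappa>(I_m). The exchange of Y
  with its adjoint yields the identity that reconciles them: C_\<kappa>(I_n) (m \<beta>/2)_\<kappa>
  = C_\<kappa>(I_m) (n \<beta>/2)_\<kappa>. The quotient of multivariate Gamma functions is, up to a
  power of pi, the volume of the ball. Since \<open>jack\<close> is a definite description, each
  C_\<kappa> must be shown to be a nonzero multiple of the monic eigenfunction. That comes from
  polarization: powers of the forms tr(A C) generate all homogeneous polynomials on Hermitian A, so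
  the expansion of a power of the trace can omit no partition.\<close>

abbreviation adj :: "quat^'n^'m => quat^'m^'n" where
 "adj == adjoint_mat"

lemma qcnj_simps [simp]:
 "qcnj 0 = 0" "qcnj 1 = 1" "qcnj (qcnj q) = q" "qcnj (p + q) = qcnj p + qcnj q"
 "qcnj (p - q) = qcnj p - qcnj q" "qcnj (- q) = - qcnj q" "qcnj (r *\<^sub>R q) = r *\<^sub>R qcnj q"
 "qcnj (of_real r) = of_real r" by (simp_all add: quat_eq_iff quat_of_real)

lemma qcnj_mult: "qcnj (p * q) = qcnj q * qcnj p"
 by (simp add: quat_eq_iff)

lemma qcnj_sum: "qcnj (sum f S) = (\<Sum>i\<in>S. qcnj (f i))"
 by (induction S rule: infinite_finite_induct) auto

lemma qRe_of_real [simp]: "qRe (of_real r) = r"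
 by (simp add: quat_of_real)

lemma qRe_sum: "qRe (sum f S) = (\<Sum>i\<in>S. qRe (f i))"
 by (induction S rule: infinite_finite_induct) auto

lemma of_real_mult_quat [simp]:
 "qRe (q * of_real r) = r * qRe q" by (simp add: quat_of_real)

lemma of_real_mult_scaleR [simp]:
 "of_real r * (q::quat) = r *\<^sub>R q" "(q::quat) * of_real r = r *\<^sub>R q" by (simp_all add: of_real_def)

lemma qRe_mult_commute: "qRe (p * q) = qRe (q * p)"
 by simp

lemma inner_quat: "p \<bullet> q = qRe (qcnj p * q)"
 by (simp add: inner_quat_def)

lemma norm_quat_sq: "(norm q)\<^sup>2 = (qRe q)\<^sup>2 + (qI q)\<^sup>2 + (qJ q)\<^sup>2 + (qK q)\<^sup>2"
 unfolding power2_norm_eq_inner inner_quat_def by (simp add: power2_eq_square)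

lemma qcnj_mult_self: "qcnj q * q = of_real ((norm q)\<^sup>2)" "q * qcnj q = of_real ((norm q)\<^sup>2)"
 unfolding norm_quat_sq by (simp_all add: quat_eq_iff quat_of_real power2_eq_square)

lemma norm_quat_mult: "norm (p * q :: quat) = norm p * norm q"
proof -
 have "(norm (p * q))\<^sup>2 = (norm p * norm q)\<^sup>2" unfolding norm_quat_sq power_mult_distrib by (simp) algebra
 thus ?thesis by simp
qed

lemma norm_qcnj [simp]: "norm (qcnj q) = norm q"
proof -
 have "(norm (qcnj q))\<^sup>2 = (norm q)\<^sup>2" unfolding norm_quat_sq by simp
 thus ?thesis by simp
qed

instance quat :: real_normed_algebra_1
proof
 show "norm (p * q) <= norm p * norm q" for p q :: quat by (simp add: norm_quat_mult)
 have "(norm (1::quat))\<^sup>2 = 1\<^sup>2" unfolding norm_quat_sq by simp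
 thus "norm (1::quat) = 1" by (metis norm_ge_zero power2_eq_iff_nonneg zero_le_one)
qed

lemma subspace_Falg: "subspace (Falg \<beta>)"
 by (auto simp: subspace_def Falg_def)

lemma Falg_intros [simp, intro]:
 "0 \<in> Falg \<beta>" "1 \<in> Falg \<beta>" "of_real r \<in> Falg \<beta>"
 "p \<in> Falg \<beta> ==> q \<in> Falg \<beta> ==> p + q \<in> Falg \<beta>"
 "p \<in> Falg \<beta> ==> q \<in> Falg \<beta> ==> p - q \<in> Falg \<beta>"
 "p \<in> Falg \<beta> ==> - p \<in> Falg \<beta>"
 "p \<in> Falg \<beta> ==> r *\<^sub>R p \<in> Falg \<beta>"
 "p \<in> Falg \<beta> ==> q \<in> Falg \<beta> ==> p * q \<in> Falg \<beta>"
 "p \<in> Falg \<beta> ==> qcnj p \<in> Falg \<beta>" by (auto simp: Falg_def quat_of_real)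

lemma Falg_sum: "(!!i. i \<in> S ==> f i \<in> Falg \<beta>) ==> sum f S \<in> Falg \<beta>"
 using subspace_sum[OF subspace_Falg] by blast

lemma adjoint_nth [simp]: "adj X $ i $ j = qcnj (X $ j $ i)"
 by (simp add: adjoint_mat_def)

lemma matrix_mult_nth: "(A ** B) $ i $ j = (\<Sum>k\<in>UNIV. A $ i $ k * B $ k $ j)"
 by (simp add: matrix_matrix_mult_def)

lemma matrix_vector_nth: "(A *v v) $ i = (\<Sum>k\<in>UNIV. A $ i $ k * v $ k)"
 by (simp add: matrix_vector_mult_def)

lemma mat_eqI: "(!!i j. A $ i $ j = B $ i $ j) ==> A = B"
 by (simp add: vec_eq_iff)

lemma adjoint_adjoint [simp]: "adj (adj X) = X"
 by (rule mat_eqI) simp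

lemma adjoint_mult: "adj (A ** B) = adj B ** adj A"
 by (rule mat_eqI) (simp add: matrix_mult_nth qcnj_sum qcnj_mult)

lemma adjoint_simps [simp]:
 "adj (A + B) = adj A + adj B"
 "adj (A - B) = adj A - adj B"
 "adj (r *\<^sub>R A) = r *\<^sub>R adj A"
 "adj 0 = 0" "adj (mat 1) = mat 1" by (auto intro!: mat_eqI simp: mat_def)

lemma matrix_mult_distribs:
 fixes A :: "quat^'n^'m"
 shows "A ** (B + C) = A ** B + A ** C" "(D + E) ** A = D ** A + E ** A"
  "A ** (B - C) = A ** B - A ** C" "(D - E) ** A = D ** A - E ** A"
  "(r *\<^sub>R A) ** B = r *\<^sub>R (A ** B)" "A ** (r *\<^sub>R B) = r *\<^sub>R (A ** B)"
  "A ** 0 = 0" "0 ** A = 0"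
 by (rule mat_eqI; simp add: matrix_mult_nth sum.distrib sum_subtractf algebra_simps scaleR_sum_right)+

lemma matrix_vector_distribs:
 fixes A :: "quat^'n^'m"
 shows "A *v (v + w) = A *v v + A *v w" "A *v (v - w) = A *v v - A *v w"
  "A *v (r *\<^sub>R v) = r *\<^sub>R (A *v v)" "(r *\<^sub>R A) *v v = r *\<^sub>R (A *v v)"
  "(A + B) *v v = A *v v + B *v v" "(A - B) *v v = A *v v - B *v v" "A *v 0 = 0" "0 *v v = 0"
 by (simp_all add: vec_eq_iff matrix_vector_nth algebra_simps scaleR_sum_right)

lemma matrix_vector_one [simp]: "(mat 1 :: quat^'n^'n) *v v = v"
 by (simp cong: if_cong)

lemma subspace_Fmat: "subspace (Fmat \<beta> :: (quat^'n^'m) set)"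
 by (auto simp: subspace_def Fmat_def)

lemma subspace_Fvec: "subspace (Fvec \<beta> :: (quat^'m) set)"
 by (auto simp: subspace_def Fvec_def)

lemma Fmat_nth: "A \<in> Fmat \<beta> ==> A $ i $ j \<in> Falg \<beta>"
 by (simp add: Fmat_def)

lemma Fmat_intros [simp, intro]:
 "0 \<in> Fmat \<beta>" "A \<in> Fmat \<beta> ==> B \<in> Fmat \<beta> ==> A + B \<in> Fmat \<beta>"
 "A \<in> Fmat \<beta> ==> B \<in> Fmat \<beta> ==> A - B \<in> Fmat \<beta>"
 "A \<in> Fmat \<beta> ==> r *\<^sub>R A \<in> Fmat \<beta>"
 "A \<in> Fmat \<beta> ==> adj A \<in> Fmat \<beta>" by (auto simp: Fmat_def)

lemma Fmat_mult [simp, intro]: "A \<in> Fmat \<beta> ==> B \<in> Fmat \<beta> ==> A ** B \<in> Fmat \<beta>"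
 by (auto simp: Fmat_def matrix_mult_nth intro!: Falg_sum)

lemma Fmat_one [simp, intro]: "(mat 1 :: quat^'m^'m) \<in> Fmat \<beta>"
 by (auto simp: Fmat_def mat_def)

lemma Fvec_mult [simp, intro]: "A \<in> Fmat \<beta> ==> v \<in> Fvec \<beta> ==> A *v v \<in> Fvec \<beta>"
 by (auto simp: Fmat_def Fvec_def matrix_vector_nth intro!: Falg_sum)

lemma Fvec_intros [simp, intro]:
 "0 \<in> Fvec \<beta>" "v \<in> Fvec \<beta> ==> w \<in> Fvec \<beta> ==> v + w \<in> Fvec \<beta>"
 "v \<in> Fvec \<beta> ==> w \<in> Fvec \<beta> ==> v - w \<in> Fvec \<beta>"
 "v \<in> Fvec \<beta> ==> r *\<^sub>R v \<in> Fvec \<beta>" by (auto simp: Fvec_def)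

lemma hermitianI: "A \<in> Fmat \<beta> ==> adj A = A ==> A \<in> hermitian \<beta>"
 by (simp add: hermitian_def)

lemma hermitianD: "A \<in> hermitian \<beta> ==> A \<in> Fmat \<beta>" "A \<in> hermitian \<beta> ==> adj A = A"
 by (simp_all add: hermitian_def)

lemma hermitian_congruence:
 "A \<in> hermitian \<beta> ==> X \<in> Fmat \<beta> ==> adj X ** A ** X \<in> hermitian \<beta>"
 "A \<in> hermitian \<beta> ==> X \<in> Fmat \<beta> ==> X ** A ** adj X \<in> hermitian \<beta>"
 by (auto simp: hermitian_def adjoint_mult matrix_mul_assoc)

lemma hermitian_gram:
 "X \<in> Fmat \<beta> ==> adj X ** X \<in> hermitian \<beta>"
 "X \<in> Fmat \<beta> ==> X ** adj X \<in> hermitian \<beta>" by (auto simp: hermitian_def adjoint_mult)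

subsection \<open>The inner product over the division algebra\<close>

text \<open>The Hermitian form, conjugate-linear in the first slot; scalars act on vectors from the
  right, matrices from the left. Vanishing of \<open>fin\<close> is orthogonality over the division
  algebra, stronger than orthogonality for its real part, the Euclidean inner product.\<close>

definition fin :: "quat^'m => quat^'m => quat" where
 "fin v w = (\<Sum>i\<in>UNIV. qcnj (v $ i) * w $ i)"

lemma inner_fin: "v \<bullet> w = qRe (fin v w)"
 by (simp add: fin_def inner_vec_def inner_quat qRe_sum)

lemma qcnj_fin: "qcnj (fin v w) = fin w v"
 by (simp add: fin_def qcnj_sum qcnj_mult)

lemma fin_simps [simp]:
 "fin v (w + z) = fin v w + fin v z" "fin v (w - z) = fin v w - fin v z"
 "fin v (r *\<^sub>R w) = r *\<^sub>R fin v w" "fin (r *\<^sub>R v) w = r *\<^sub>R fin v w"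
 "fin v 0 = 0" "fin 0 w = 0" by (simp_all add: fin_def sum.distrib sum_subtractf algebra_simps scaleR_sum_right)

lemma fin_self: "fin v v = of_real ((norm v)\<^sup>2)"
 by (simp add: fin_def qcnj_mult_self norm_vec_def L2_set_def sum_nonneg)

lemma fin_in_Falg: "v \<in> Fvec \<beta> ==> w \<in> Fvec \<beta> ==> fin v w \<in> Falg \<beta>"
 by (auto simp: fin_def Fvec_def intro!: Falg_sum)

lemma fin_adjoint: "fin (A *v v) w = fin v (adj A *v w)"
proof -
 have "fin (A *v v) w = (\<Sum>i\<in>UNIV. \<Sum>k\<in>UNIV. qcnj (v $ k) * qcnj (A $ i $ k) * w $ i)"
  by (simp add: fin_def matrix_vector_nth qcnj_sum qcnj_mult sum_distrib_right)
 also have "... = (\<Sum>k\<in>UNIV. \<Sum>i\<in>UNIV. qcnj (v $ k) * qcnj (A $ i $ k) * w $ i)" by (rule sum.swap)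
 finally show ?thesis by (simp add: fin_def matrix_vector_nth sum_distrib_left mult.assoc)
qed

lemma inner_adjoint: "(A *v v) \<bullet> w = v \<bullet> (adj A *v w)"
 by (simp add: inner_fin fin_adjoint)

lemma inner_adjoint': "v \<bullet> (A *v w) = (adj A *v v) \<bullet> w"
 by (simp add: inner_adjoint)

lemma linear_matrix_vector: "linear ((*v) (A :: quat^'n^'m))"
 by (rule linearI) (simp_all add: matrix_vector_distribs)

text \<open>Quaternions commute only under the real part, so the trace is cyclic only after taking
  \<open>qRe\<close>.\<close>

lemma qRe_trace_commute: "qRe (trace (A ** B)) = qRe (trace (B ** A))"
proof -
 have "qRe (trace (A ** B)) = (\<Sum>i\<in>UNIV. \<Sum>k\<in>UNIV. qRe (A $ i $ k * B $ k $ i))"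
  by (simp add: trace_def matrix_mult_nth qRe_sum)
 also have "... = (\<Sum>i\<in>UNIV. \<Sum>k\<in>UNIV. qRe (B $ k $ i * A $ i $ k))" by (intro sum.cong refl qRe_mult_commute)
 also have "... = (\<Sum>k\<in>UNIV. \<Sum>i\<in>UNIV. qRe (B $ k $ i * A $ i $ k))" by (rule sum.swap)
 finally show ?thesis by (simp add: trace_def matrix_mult_nth qRe_sum)
qed

subsection \<open>Enumerated indices and diagonal matrices\<close>

text \<open>An arbitrary enumeration: Jack polynomials take variables indexed by naturals, and
  leading terms and elimination need an order on the indices. The inverse \<open>xi\<close> is
  meaningful only below \<open>CARD('m)\<close>.\<close>

definition ix :: "'m::finite => nat" where
 "ix = (SOME f. bij_betw f UNIV {..<CARD('m)})"

lemma bij_ix: "bij_betw (ix :: 'm::finite => nat) UNIV {..<CARD('m)}"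
proof -
 have "EX f :: 'm => nat. bij_betw f UNIV {..<CARD('m)}"
  using ex_bij_betw_finite_nat[OF finite, of "UNIV :: 'm set"] by (simp add: atLeast0LessThan)
 thus ?thesis unfolding ix_def by (rule someI_ex)
qed

lemma ix_less [simp]: "ix (i::'m::finite) < CARD('m)"
 using bij_ix bij_betwE by blast

lemma ix_inj [simp]: "ix i = ix j \<longleftrightarrow> i = j"
 using bij_ix by (auto simp: bij_betw_def inj_on_def)

lemma ix_surj: "n < CARD('m::finite) ==> EX i::'m. ix i = n"
proof -
 assume "n < CARD('m)"
 hence "n \<in> ix ` (UNIV :: 'm set)" using bij_ix[where 'm = 'm] by (simp add: bij_betw_def)
 thus ?thesis by auto
qed

definition xi :: "nat => 'm::finite" where
 "xi n = (THE i. ix i = n)"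

lemma xi_ix [simp]: "xi (ix i) = i"
 by (simp add: xi_def)

lemma ix_xi [simp]: "n < CARD('m::finite) ==> ix (xi n :: 'm) = n"
 using ix_surj[of n, where 'm = 'm] by auto

lemma sum_ix: "(\<Sum>i\<in>(UNIV::'m::finite set). f (ix i)) = (\<Sum>i<CARD('m). f i)"
 using sum.reindex_bij_betw[OF bij_ix] by blast

lemma prod_ix: "(\<Prod>i\<in>(UNIV::'m::finite set). f (ix i)) = (\<Prod>i<CARD('m). f i)"
 using prod.reindex_bij_betw[OF bij_ix] by blast

lemma card_ix: "card {i::'m::finite. P (ix i)} = card {i. i < CARD('m) & P i}"
proof -
 have "ix ` {i::'m. P (ix i)} = {i. i < CARD('m) & P i}" using ix_surj by force
 thus ?thesis by (metis (mono_tags, lifting) card_image inj_onI ix_inj)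
qed

definition dg :: "(nat => real) => quat^'m^'m" where
 "dg x = (\<chi> i j. if i = j then of_real (x (ix i)) else 0)"

lemma dg_nth: "dg x $ i $ j = (if i = j then of_real (x (ix i)) else 0)"
 by (simp add: dg_def)

lemma dg_mult_left: "(dg x ** A) $ i $ j = x (ix i) *\<^sub>R A $ i $ j"
proof -
 have "(dg x ** A) $ i $ j = (\<Sum>k\<in>UNIV. if k = i then of_real (x (ix i)) * A $ i $ j else 0)"
  unfolding matrix_mult_nth by (rule sum.cong) (auto simp: dg_nth)
 thus ?thesis by simp
qed

lemma dg_mult_right: "(A ** dg x) $ i $ j = x (ix j) *\<^sub>R A $ i $ j"
proof -
 have "(A ** dg x) $ i $ j = (\<Sum>k\<in>UNIV. if k = j then A $ i $ j * of_real (x (ix j)) else 0)"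
  unfolding matrix_mult_nth by (rule sum.cong) (auto simp: dg_nth)
 thus ?thesis by simp
qed

lemma dg_vec: "(dg x *v v) $ i = x (ix i) *\<^sub>R v $ i"
proof -
 have "(dg x *v v) $ i = (\<Sum>k\<in>UNIV. if k = i then of_real (x (ix i)) * v $ i else 0)"
  unfolding matrix_vector_nth by (rule sum.cong) (auto simp: dg_nth)
 thus ?thesis by simp
qed

lemma dg_mult_dg: "dg x ** dg y = dg (%i. x i * y i)"
 by (rule mat_eqI) (simp add: dg_mult_left dg_nth of_real_def)

lemma dg_simps [simp]:
 "adj (dg x) = dg x" "dg (%_. 1) = mat 1" "dg x \<in> Fmat \<beta>" "dg x \<in> hermitian \<beta>"
 by (auto intro!: mat_eqI simp: dg_nth mat_def Fmat_def hermitian_def)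

lemma dg_cong: "(!!i. i < CARD('m) ==> x i = y i) ==> (dg x :: quat^'m::finite^'m) = dg y"
 by (auto intro!: mat_eqI simp: dg_nth)

lemma qRe_trace_dg: "qRe (trace (dg x :: quat^'m::finite^'m)) = (\<Sum>i<CARD('m). x i)"
 by (simp add: trace_def dg_nth qRe_sum sum_ix)

subsection \<open>The unitary group\<close>

definition unitary :: "nat => (quat^'m^'m) set" where
 "unitary \<beta> = {U \<in> Fmat \<beta>. adj U ** U = mat 1 & U ** adj U = mat 1}"

lemma unitary_D:
 assumes "U \<in> unitary \<beta>"
 shows "U \<in> Fmat \<beta>" "adj U ** U = mat 1" "U ** adj U = mat 1"
 using assms by (simp_all add: unitary_def)

lemma unitary_cancel:
 assumes "U \<in> unitary \<beta>"
 shows "adj U ** (U ** A) = A" "U ** (adj U ** A) = A"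
  "A ** U ** adj U = A" "A ** adj U ** U = A"
  "adj U *v (U *v v) = v" "U *v (adj U *v v) = v"
proof -
 note U = unitary_D(2,3)[OF assms]
 show "adj U ** (U ** A) = A" "U ** (adj U ** A) = A" by (simp_all only: matrix_mul_assoc U matrix_mul_lid)
 show "A ** U ** adj U = A" "A ** adj U ** U = A" by (simp_all only: matrix_mul_assoc[symmetric] U matrix_mul_rid)
 show "adj U *v (U *v v) = v" "U *v (adj U *v v) = v"
  by (simp_all only: matrix_vector_mul_assoc U matrix_vector_one)
qed

lemma unitary_intros [simp, intro]:
 "mat 1 \<in> unitary \<beta>" "U \<in> unitary \<beta> ==> adj U \<in> unitary \<beta>"
 "U \<in> unitary \<beta> ==> V \<in> unitary \<beta> ==> U ** V \<in> unitary \<beta>"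
proof -
 assume UV: "U \<in> unitary \<beta>" "V \<in> unitary \<beta>"
 have "adj V ** adj U ** (U ** V) = adj V ** (adj U ** (U ** V))"
  "U ** V ** (adj V ** adj U) = U ** (V ** (adj V ** adj U))" by (simp_all only: matrix_mul_assoc)
 thus "U ** V \<in> unitary \<beta>"
  using unitary_D[OF UV(1)] unitary_D[OF UV(2)] unfolding unitary_cancel[OF UV(1)] unitary_cancel[OF UV(2)]
  by (simp add: unitary_def adjoint_mult)
qed (simp_all add: unitary_def)

lemma unitary_norm: "U \<in> unitary \<beta> ==> norm (U *v v) = norm v"
 by (simp add: norm_eq_sqrt_inner inner_adjoint unitary_cancel)

text \<open>With noncommuting entries the argument is linear algebra over the reals:
  \<open>A\<close> acts as a real-linear map of a finite-dimensional space, where injective implies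
  surjective.\<close>

lemma left_inverse_imp_right_inverse:
 fixes A B :: "quat^'m^'m"
 assumes "B ** A = mat 1"
 shows "A ** B = mat 1"
proof -
 have inv: "B *v (A *v v) = v" for v by (simp add: matrix_vector_mul_assoc assms)
 have "inj ((*v) A)" by (rule injI) (metis inv)
 hence "surj ((*v) A)" by (auto intro!: linear_injective_imp_surjective[OF linear_matrix_vector])
 hence AB: "A *v (B *v w) = w" for w by (metis inv surjD)
 have col: "C $ i $ j = (C *v axis j 1) $ i" for C :: "quat^'m^'m" and i j
  by (simp add: matrix_vector_nth axis_def if_distrib cong: if_cong)
 show ?thesis by (rule mat_eqI) (simp add: col AB[unfolded matrix_vector_mul_assoc])
qed

subsection \<open>Real dimension counts\<close>

lemma Basis_quat_Falg:
 "Basis \<inter> Falg \<beta> = (if \<beta> < 2 then {Quat 1 0 0 0} else if \<beta> < 4 then {Quat 1 0 0 0, Quat 0 1 0 0} else Basis)"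
 by (auto simp: Basis_quat_def Falg_def)

lemma card_Basis_Falg: "\<beta> \<in> {1, 2, 4} ==> card (Basis \<inter> Falg \<beta>) = \<beta>"
 unfolding Basis_quat_Falg by (auto simp: Basis_quat_def)

lemma Falg_iff: "q \<in> Falg \<beta> \<longleftrightarrow> (ALL b:Basis. b \<notin> Falg \<beta> --> q \<bullet> b = 0)"
 unfolding Basis_quat_def by (auto simp: inner_quat_def Falg_def)

lemma Fvec_supp_eq:
 "{u \<in> Fvec \<beta>. ALL i. i \<notin> S --> u $ i = 0} =
  {u :: quat^'m. ALL b:Basis. b \<notin> (%(i, q). axis i q) ` (S \<times> (Basis \<inter> Falg \<beta>)) --> u \<bullet> b = 0}"
proof -
 have mem: "axis i q \<in> (%(i, q). axis i q) ` (S \<times> (Basis \<inter> Falg \<beta>)) \<longleftrightarrow> i \<in> S & q \<in> Falg \<beta>"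
  if "q \<in> Basis" for i q using that by (auto simp: axis_eq_axis)
 have "(ALL b:Basis. b \<notin> (%(i, q). axis i q) ` (S \<times> (Basis \<inter> Falg \<beta>)) --> u \<bullet> b = 0) \<longleftrightarrow>
   (ALL i. ALL q:Basis. ~ (i \<in> S & q \<in> Falg \<beta>) --> u $ i \<bullet> q = 0)" for u :: "quat^'m"
  unfolding Basis_vec_def using mem by (auto simp: inner_axis)
 also have "... u \<longleftrightarrow> (ALL i. u $ i \<in> Falg \<beta> & (i \<notin> S --> u $ i = 0))" for u :: "quat^'m"
 proof -
  have "u $ i = 0 \<longleftrightarrow> (ALL q:Basis. u $ i \<bullet> q = 0)" for i by (simp add: euclidean_all_zero_iff)
  thus ?thesis unfolding Falg_iff[of "u $ _"] by blast
 qed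
 finally show ?thesis by (auto simp: Fvec_def)
qed

text \<open>Each coordinate carries exactly \<beta> basis vectors that lie in the division algebra.
  The count feeds the multiplicities in \<open>eig_mult\<close> and the kernel arguments by
  dimension.\<close>

lemma dim_Fvec_supp:
 assumes "\<beta> \<in> {1, 2, 4}"
 shows "dim {u \<in> Fvec \<beta> :: (quat^'m) set. ALL i. i \<notin> S --> u $ i = 0} = \<beta> * card S"
proof -
 have inj: "inj_on (%(i, q). axis i q :: quat^'m) (S \<times> (Basis \<inter> Falg \<beta>))"
  by (rule inj_onI) (auto simp: axis_eq_axis)
 have "(%(i, q). axis i q :: quat^'m) ` (S \<times> (Basis \<inter> Falg \<beta>)) \<subseteq> Basis" by auto
 thus ?thesis unfolding Fvec_supp_eq using card_Basis_Falg[OF assms]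
  by (simp add: dim_substandard card_image[OF inj] card_cartesian_product)
qed

lemma dim_Fvec: "\<beta> \<in> {1, 2, 4} ==> dim (Fvec \<beta> :: (quat^'m) set) = \<beta> * CARD('m)"
 using dim_Fvec_supp[of \<beta> "UNIV :: 'm set"] by simp

lemma linear_kernel_nontrivial:
 fixes f :: "'a::euclidean_space => 'b::euclidean_space"
 assumes "linear f" "subspace V" "f ` V \<subseteq> U" "dim U < dim V"
 shows "EX v:V. v ~= 0 & f v = 0"
proof (rule ccontr)
 assume *: "~ ?thesis"
 have "inj_on f V"
 proof (rule inj_onI)
  fix x y assume "x \<in> V" "y \<in> V" "f x = f y"
  hence "x - y \<in> V" "f (x - y) = 0" using assms(1,2) by (auto simp: linear_diff subspace_diff)
  thus "x = y" using * by auto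
 qed
 thus False
  using dim_image_eq[OF assms(1), of V] assms(2) dim_subset[OF assms(3)] assms(4) by (simp add: span_eq_iff[THEN iffD2])
qed

section \<open>Eigenvalues of Hermitian matrices: diagonalization, variational comparison,
  reflections\<close>

section \<open>The spectral theorem\<close>

text \<open>Deflation: on the \<open>fin\<close>-orthogonal complement of the eigenvectors found so
  far, a maximizer of the Rayleigh quotient over the unit sphere is the next eigenvector. The last
  conjunct bounds the quotient on that complement by each earlier eigenvalue; it is what keeps the
  eigenvalues non-increasing.\<close>

lemma eigenbasis_exists:
 fixes A :: "quat^'m^'m"
 assumes \<beta>: "\<beta> \<in> {1, 2, 4}" and A: "A \<in> hermitian \<beta>" and "r <= CARD('m)"
 shows "EX v x. (ALL i<r. v i \<in> Fvec \<beta> & A *v v i = x i *\<^sub>R v i)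
   & (ALL i<r. ALL j<r. fin (v i) (v j) = (if i = j then 1 else 0))
   & (ALL i j. i <= j --> j < r --> x j <= x i)
   & (ALL i<r. ALL w:Fvec \<beta>. (ALL j<r. fin (v j) w = 0) --> w \<bullet> (A *v w) <= x i * (norm w)\<^sup>2)" using assms(3)
proof (induction r)
 case (Suc r)
 from Suc.IH[OF Suc_leD[OF Suc.prems]] obtain v x where
  IH: "(ALL i<r. v i \<in> Fvec \<beta> & A *v v i = x i *\<^sub>R v i)
   & (ALL i<r. ALL j<r. fin (v i) (v j) = (if i = j then 1 else 0))
   & (ALL i j. i <= j --> j < r --> x j <= x i)
   & (ALL i<r. ALL w:Fvec \<beta>. (ALL j<r. fin (v j) w = 0) --> w \<bullet> (A *v w) <= x i * (norm w)\<^sup>2)" by auto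
 from IH have v: "v i \<in> Fvec \<beta>" "A *v v i = x i *\<^sub>R v i" if "i < r" for i using that by blast+
 from IH have orth: "fin (v i) (v j) = (if i = j then 1 else 0)" if "i < r" "j < r" for i j using that by blast
 from IH have x: "x j <= x i" if "i <= j" "j < r" for i j using that by blast
 from IH have max: "w \<bullet> (A *v w) <= x i * (norm w)\<^sup>2"
  if "i < r" "w \<in> Fvec \<beta>" "ALL j<r. fin (v j) w = 0" for i w using that by blast
 define W where "W = {w \<in> Fvec \<beta>. ALL i<r. fin (v i) w = 0}"
 have W: "subspace W" by (auto simp: W_def subspace_def)
 have AW: "A *v w \<in> W" if "w \<in> W" for w
 proof -
  have "fin (v i) (A *v w) = 0" if "i < r" for i
   using fin_adjoint[of A "v i" w] hermitianD(2)[OF A] v(2)[OF that] \<open>w \<in> W\<close> that by (simp add: W_def)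
  thus ?thesis using that hermitianD(1)[OF A] by (simp add: W_def)
 qed
 \<comment> \<open>The r orthogonality conditions are stored in the first r coordinates, so the
   image has real dimension at most \<beta> r, below that of the source: the complement contains a
   nonzero vector.\<close>
 define f :: "quat^'m => quat^'m" where "f = (%w. \<chi> i. if ix i < r then fin (v (ix i)) w else 0)"
 have "EX w:Fvec \<beta>. w ~= 0 & f w = 0"
 proof (rule linear_kernel_nontrivial[OF _ subspace_Fvec])
  show "linear f" by (rule linearI) (simp_all add: f_def vec_eq_iff)
  show "f ` Fvec \<beta> \<subseteq> {u \<in> Fvec \<beta>. ALL i. i \<notin> {i. ix i < r} --> u $ i = 0}"
   using v(1) by (auto simp: f_def Fvec_def intro!: fin_in_Falg[unfolded Fvec_def])
  have "{i. i < CARD('m) & i < r} = {..<r}" using Suc.prems by auto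
  hence "card {i::'m. ix i < r} = r" using card_ix[of "%i. i < r", where 'm = 'm] by simp
  hence "dim {u \<in> Fvec \<beta> :: (quat^'m) set. ALL i. i \<notin> {i. ix i < r} --> u $ i = 0} = \<beta> * r"
   using dim_Fvec_supp[OF \<beta>, of "{i::'m. ix i < r}"] by simp
  moreover have "\<beta> * r < \<beta> * CARD('m)" using Suc.prems \<beta> by (intro mult_strict_left_mono) auto
  ultimately show "dim {u \<in> Fvec \<beta> :: (quat^'m) set. ALL i. i \<notin> {i. ix i < r} --> u $ i = 0} < dim (Fvec \<beta> :: (quat^'m) set)"
   using dim_Fvec[OF \<beta>, where 'm = 'm] by metis
 qed
 then obtain w0 where w0: "w0 \<in> Fvec \<beta>" "w0 ~= 0" "f w0 = 0" by blast
 have "fin (v i) w0 = 0" if "i < r" for i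
 proof -
  obtain a :: 'm where "ix a = i" using ix_surj[of i, where 'm = 'm] \<open>i < r\<close> Suc.prems by auto
  thus ?thesis using arg_cong[OF w0(3), of "%u. u $ a"] that by (simp add: f_def)
 qed
 hence w0W: "w0 \<in> W" using w0 by (simp add: W_def)
 have "compact (W \<inter> sphere 0 1)" using closed_subspace[OF W] by (simp add: closed_Int_compact)
 moreover have "w0 /\<^sub>R norm w0 \<in> W \<inter> sphere 0 1" using w0W w0(2) W by (simp add: subspace_scale)
 hence "W \<inter> sphere 0 1 ~= {}" by blast
 moreover have "continuous_on (W \<inter> sphere 0 1) (%w. w \<bullet> (A *v w))" by (intro continuous_intros)
 ultimately obtain w where w': "w \<in> W \<inter> sphere 0 1"
  and wmax': "ALL u:W \<inter> sphere 0 1. u \<bullet> (A *v u) <= w \<bullet> (A *v w)"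
  using continuous_attains_sup[of "W \<inter> sphere 0 1" "%w. w \<bullet> (A *v w)"] by blast
 from w' have w: "w \<in> W" "norm w = 1" by auto
 have wmax: "u \<bullet> (A *v u) <= w \<bullet> (A *v w)" if "u \<in> W" "norm u = 1" for u using wmax' that by simp
 define l where "l = w \<bullet> (A *v w)"
 have q: "u \<bullet> (A *v u) <= l * (norm u)\<^sup>2" if "u \<in> W" for u
 proof (cases "u = 0")
  case False
  have "(u /\<^sub>R norm u) \<bullet> (A *v (u /\<^sub>R norm u)) <= l"
   unfolding l_def using that False W by (intro wmax) (simp_all add: subspace_scale)
  hence "(u \<bullet> (A *v u)) / (norm u)\<^sup>2 <= l"
   by (simp add: matrix_vector_distribs power2_eq_square divide_inverse mult_ac)
  thus ?thesis using False by (simp add: pos_divide_le_eq)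
 qed simp
 define z where "z = A *v w - l *\<^sub>R w"
 have zW: "z \<in> W" unfolding z_def using AW w W by (simp add: subspace_diff subspace_scale)
 have sym: "(A *v w) \<bullet> z = w \<bullet> (A *v z)" using inner_adjoint[of A w z] hermitianD(2)[OF A] by simp
 have "z = 0"
 proof (rule ccontr)
  assume "z ~= 0"
  define b where "b = z \<bullet> (A *v z) - l * (norm z)\<^sup>2"
  \<comment> \<open>First variation at the maximizer in the direction of the residual
    \<open>z\<close>: a linear term with slope 2 |z|^2 is incompatible with a maximum unless z =
    0.\<close>
  have t: "2 * t * (norm z)\<^sup>2 + t\<^sup>2 * b <= 0" for t
  proof -
   have "w + t *\<^sub>R z \<in> W" using w zW W by (simp add: subspace_add subspace_scale)
   from q[OF this] have "(w + t *\<^sub>R z) \<bullet> (A *v w + t *\<^sub>R (A *v z)) <= l * ((w + t *\<^sub>R z) \<bullet> (w + t *\<^sub>R z))"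
    by (simp add: power2_norm_eq_inner matrix_vector_distribs)
   hence "l + 2 * t * (z \<bullet> (A *v w)) + t\<^sup>2 * (z \<bullet> (A *v z)) <= l * (1 + 2 * t * (z \<bullet> w) + t\<^sup>2 * (norm z)\<^sup>2)"
    using w(2) sym unfolding power2_norm_eq_inner by (simp add: inner_add_right inner_commute l_def
      power2_eq_square algebra_simps norm_eq_1)
   moreover have zAw: "z \<bullet> (A *v w) = (norm z)\<^sup>2 + l * (z \<bullet> w)"
    by (simp add: z_def power2_norm_eq_inner[symmetric]) (simp add: z_def inner_diff_right power2_norm_eq_inner)
   ultimately show ?thesis by (simp add: b_def algebra_simps)
  qed
  define n2 where "n2 = (norm z)\<^sup>2"
  have n2: "n2 > 0" using \<open>z ~= 0\<close> by (simp add: n2_def)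
  \<comment> \<open>Small enough for the quadratic term to stay below half of the linear
    one.\<close>
  define t0 where "t0 = n2 / (\<bar>b\<bar> + 1)"
  have t0: "t0 > 0" using n2 by (simp add: t0_def)
  have "t0 * \<bar>b\<bar> < n2" using n2 by (simp add: t0_def field_simps)
  hence "t0 * (t0 * \<bar>b\<bar>) < t0 * n2" using t0 by simp
  moreover have "t0\<^sup>2 * b >= - (t0 * (t0 * \<bar>b\<bar>))"
  proof -
   have "t0\<^sup>2 * (- \<bar>b\<bar>) <= t0\<^sup>2 * b" by (rule mult_left_mono) auto
   thus ?thesis by (simp add: power2_eq_square)
  qed
  ultimately have "t0\<^sup>2 * b > - (t0 * n2)" by linarith
  thus False using t[of t0] mult_pos_pos[OF t0 n2] unfolding n2_def[symmetric] by linarith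
 qed
 hence Aw: "A *v w = l *\<^sub>R w" by (simp add: z_def)
 have xl: "l <= x i" if "i < r" for i using max[OF that, of w] w by (simp add: W_def l_def)
 have fw: "fin w (v i) = 0" if "i < r" for i using qcnj_fin[of "v i" w] w(1) that by (simp add: W_def)
 have fww: "fin w w = 1" by (simp add: fin_self w(2))
 define v' x' where "v' = v(r := w)" and "x' = x(r := l)"
 have "(ALL i<Suc r. v' i \<in> Fvec \<beta> & A *v v' i = x' i *\<^sub>R v' i)" using v Aw w(1) by (auto simp: v'_def x'_def W_def)
 moreover have "ALL i<Suc r. ALL j<Suc r. fin (v' i) (v' j) = (if i = j then 1 else 0)"
  using orth fw fww w(1) by (auto simp: v'_def W_def)
 moreover have "ALL i j. i <= j --> j < Suc r --> x' j <= x' i" using x xl by (auto simp: x'_def)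
 moreover have "ALL i<Suc r. ALL u:Fvec \<beta>. (ALL j<Suc r. fin (v' j) u = 0) --> u \<bullet> (A *v u) <= x' i * (norm u)\<^sup>2"
 proof (intro allI impI ballI)
  fix i u
  assume that: "i < Suc r" "u \<in> Fvec \<beta>" and fu: "ALL j<Suc r. fin (v' j) u = 0"
  have uf: "fin (v j) u = 0" if "j < r" for j using fu[rule_format, of j] that by (simp add: v'_def)
  show "u \<bullet> (A *v u) <= x' i * (norm u)\<^sup>2"
  proof (cases "i = r")
   case True
   thus ?thesis using q[of u] uf that(2) by (simp add: W_def x'_def)
  next
   case False
   thus ?thesis using max[of i u] uf that by (simp add: x'_def)
  qed
 qed
 ultimately show ?case by (intro exI[of _ v'] exI[of _ x'] conjI)
qed simp

lemma spectral_theorem: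
 fixes A :: "quat^'m^'m"
 assumes \<beta>: "\<beta> \<in> {1, 2, 4}" and A: "A \<in> hermitian \<beta>"
 shows "EX x. (ALL i j. i <= j --> j < CARD('m) --> x j <= x i) &
   (EX U:unitary \<beta>. A = U ** dg x ** adj U)"
proof -
 obtain v x where v: "ALL i<CARD('m). v i \<in> Fvec \<beta> & A *v v i = x i *\<^sub>R v i"
  and orth: "ALL i<CARD('m). ALL j<CARD('m). fin (v i) (v j) = (if i = j then 1 else 0)"
  and x: "ALL i j. i <= j --> j < CARD('m) --> x j <= x i"
  using eigenbasis_exists[OF \<beta> A order_refl] by blast
 define U :: "quat^'m^'m" where "U = (\<chi> a i. v (ix i) $ a)"
 have "adj U ** U = mat 1"
  using orth by (intro mat_eqI) (simp add: matrix_mult_nth U_def mat_def fin_def[symmetric])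
 moreover from this have "U ** adj U = mat 1" by (rule left_inverse_imp_right_inverse)
 ultimately have U: "U \<in> unitary \<beta>" using v by (simp add: U_def Fmat_def Fvec_def unitary_def)
 have "A ** U = U ** dg x"
 proof (rule mat_eqI)
  fix a i
  have "(A ** U) $ a $ i = (A *v v (ix i)) $ a" by (simp add: matrix_mult_nth matrix_vector_nth U_def)
  thus "(A ** U) $ a $ i = (U ** dg x) $ a $ i" using v by (simp add: dg_mult_right U_def)
 qed
 thus ?thesis using U x by (metis unitary_cancel(3)[OF U])
qed

text \<open>A choice from the spectral theorem, so values at indices from \<open>CARD('m)\<close> on
  are arbitrary; statements about it concern only the earlier indices.\<close>

definition eigv :: "nat => quat^'m^'m => nat => real" where
 "eigv \<beta> A = (SOME x. (ALL i j. i <= j --> j < CARD('m) --> x j <= x i) &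
   (EX U:unitary \<beta>. A = U ** dg x ** adj U))"

lemma eigv:
 fixes A :: "quat^'m^'m"
 assumes "\<beta> \<in> {1, 2, 4}" "A \<in> hermitian \<beta>"
 shows "i <= j ==> j < CARD('m) ==> eigv \<beta> A j <= eigv \<beta> A i"
  and "EX U:unitary \<beta>. A = U ** dg (eigv \<beta> A) ** adj U"
 using someI_ex[OF spectral_theorem[OF assms]] unfolding eigv_def by blast+

subsection \<open>Quadratic forms and eigenvalue multiplicities\<close>

lemma norm_vec_sq: "(norm (v :: quat^'m))\<^sup>2 = (\<Sum>i\<in>UNIV. (norm (v $ i))\<^sup>2)"
 by (simp add: norm_vec_def L2_set_def sum_nonneg)

lemma quadratic_dg: "v \<bullet> (dg x *v v) = (\<Sum>i\<in>UNIV. x (ix i) * (norm (v $ i))\<^sup>2)"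
 by (simp add: inner_vec_def dg_vec power2_norm_eq_inner)

lemma quadratic_unitary:
 assumes "A = U ** dg x ** adj U"
 shows "v \<bullet> (A *v v) = (\<Sum>i\<in>UNIV. x (ix i) * (norm ((adj U *v v) $ i))\<^sup>2)"
proof -
 have "v \<bullet> (A *v v) = v \<bullet> (U *v (dg x *v (adj U *v v)))"
  unfolding assms by (simp only: matrix_vector_mul_assoc matrix_mul_assoc)
 also have "... = (adj U *v v) \<bullet> (dg x *v (adj U *v v))" by (rule inner_adjoint')
 finally show ?thesis by (simp add: quadratic_dg)
qed

text \<open>\<open>U\<close> carries the vectors supported where \<open>x\<close> equals
  \<open>l\<close> onto the eigenspace. Their real dimension is \<beta> times the number of such
  positions, and the division in \<open>eig_mult\<close> recovers that number.\<close>

lemma eig_mult_unitary: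
 fixes A :: "quat^'m^'m"
 assumes \<beta>: "\<beta> \<in> {1, 2, 4}" and U: "U \<in> unitary \<beta>" and A: "A = U ** dg x ** adj U"
 shows "eig_mult \<beta> A l = card {i. i < CARD('m) & x i = l}"
proof -
 define S where "S = {u \<in> Fvec \<beta> :: (quat^'m) set. ALL i. i \<notin> {i. x (ix i) = l} --> u $ i = 0}"
 have "A *v v = l *\<^sub>R v \<longleftrightarrow> (ALL i. i \<notin> {i. x (ix i) = l} --> (adj U *v v) $ i = 0)" for v
 proof -
  have "A *v v = U *v (dg x *v (adj U *v v))" unfolding A by (simp only: matrix_vector_mul_assoc matrix_mul_assoc)
  moreover have "l *\<^sub>R v = U *v (l *\<^sub>R (adj U *v v))" by (simp add: matrix_vector_distribs unitary_cancel[OF U])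
  ultimately have "A *v v = l *\<^sub>R v \<longleftrightarrow> dg x *v (adj U *v v) = l *\<^sub>R (adj U *v v)" by (metis unitary_cancel(5)[OF U])
  thus ?thesis by (auto simp: vec_eq_iff dg_vec)
 qed
 hence "{v \<in> Fvec \<beta>. A *v v = l *\<^sub>R v} = (*v) U ` S" unfolding S_def using U unitary_D(1)[OF U]
  by (force simp: image_iff unitary_cancel[OF U] intro: exI[of _ "adj U *v _"])
 moreover have "dim ((*v) U ` S) = dim S"
  by (rule dim_image_eq[OF linear_matrix_vector]) (metis inj_onI unitary_cancel(5)[OF U])
 moreover have "dim S = \<beta> * card {i::'m. x (ix i) = l}" unfolding S_def by (rule dim_Fvec_supp[OF \<beta>])
 ultimately have "eig_mult \<beta> A l = (\<beta> * card {i::'m. x (ix i) = l}) div \<beta>" by (simp add: eig_mult_def)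
 thus ?thesis using \<beta> by (auto simp: card_ix[of "%i. x i = l"])
qed

text \<open>A sorted list is determined by its multiset of entries, so the definite description in
  \<open>eigvals\<close> has a unique solution.\<close>

lemma eigvals_unitary:
 fixes A :: "quat^'m^'m"
 assumes \<beta>: "\<beta> \<in> {1, 2, 4}" and U: "U \<in> unitary \<beta>" and A: "A = U ** dg x ** adj U"
  and x: "!!i j. i <= j ==> j < CARD('m) ==> x j <= x i"
 shows "eigvals \<beta> A = map x [0..<CARD('m)]"
proof -
 define ys where "ys = map x [0..<CARD('m)]"
 have count: "count_list ys l = eig_mult \<beta> A l" for l
 proof -
  have "count_list ys l = length (filter (%i. l = x i) [0..<CARD('m)])"
   by (simp add: ys_def count_list_eq_length_filter o_def)
  also have "... = card (set (filter (%i. l = x i) [0..<CARD('m)]))" by (rule distinct_card[symmetric]) simp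
  also have "set (filter (%i. l = x i) [0..<CARD('m)]) = {i. i < CARD('m) & x i = l}" by auto
  finally show ?thesis by (simp add: eig_mult_unitary[OF \<beta> U A])
 qed
 have sorted: "sorted_wrt (>=) ys" using x by (auto simp: ys_def sorted_wrt_iff_nth_less)
 have "zs = ys" if "sorted_wrt (>=) zs" "ALL l. count_list zs l = eig_mult \<beta> A l" for zs
 proof -
  have "mset (rev zs) = mset (rev ys)" using that(2) count by (simp add: multiset_eq_iff count_mset)
  moreover have "sorted (rev zs)" "sorted (rev ys)" using that(1) sorted by (simp_all add: sorted_wrt_rev)
  ultimately have "rev zs = rev ys" by (metis properties_for_sort)
  thus ?thesis by simp
 qed
 moreover have "sorted_wrt (>=) ys & (ALL l. count_list ys l = eig_mult \<beta> A l)" using sorted count by blast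
 ultimately have "eigvals \<beta> A = ys" unfolding eigvals_def by (intro the_equality) blast+
 thus ?thesis by (simp add: ys_def)
qed

lemma eigvals_ev:
 fixes A :: "quat^'m^'m"
 assumes "\<beta> \<in> {1, 2, 4}" "A \<in> hermitian \<beta>"
 shows "eigvals \<beta> A = map (eigv \<beta> A) [0..<CARD('m)]"
 using eigv[OF assms] eigvals_unitary[OF assms(1)] by blast

lemma eigv_unique:
 fixes A :: "quat^'m^'m"
 assumes "\<beta> \<in> {1, 2, 4}" "U \<in> unitary \<beta>" "A = U ** dg x ** adj U"
  and "!!i j. i <= j ==> j < CARD('m) ==> x j <= x i" and "i < CARD('m)"
 shows "eigv \<beta> A i = x i"
proof -
 have "A \<in> hermitian \<beta>" unfolding assms(3) using unitary_D(1)[OF assms(2)] by (intro hermitian_congruence) auto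
 from eigvals_ev[OF assms(1) this] eigvals_unitary[OF assms(1-4)] show ?thesis using assms(5) by simp
qed

lemma eigv_quadratic:
 fixes A :: "quat^'m^'m"
 assumes \<beta>: "\<beta> \<in> {1, 2, 4}" and A: "A \<in> hermitian \<beta>" and "i < CARD('m)"
 shows "EX v:Fvec \<beta>. norm v = 1 & v \<bullet> (A *v v) = eigv \<beta> A i"
proof -
 obtain U where U: "U \<in> unitary \<beta>" "A = U ** dg (eigv \<beta> A) ** adj U" using eigv(2)[OF \<beta> A] by blast
 obtain a :: 'm where a: "ix a = i" using ix_surj[OF assms(3)] by blast
 define v where "v = U *v axis a 1"
 have "v \<in> Fvec \<beta>" unfolding v_def by (rule Fvec_mult[OF unitary_D(1)[OF U(1)]]) (simp add: Fvec_def axis_def)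
 moreover have "norm v = 1"
 proof -
  have "(norm (axis a (1::quat)))\<^sup>2 = 1"
   unfolding norm_vec_sq by (simp add: axis_def if_distrib if_distribR cong: if_cong)
  thus ?thesis
   unfolding v_def unitary_norm[OF U(1)] by (metis norm_ge_zero power2_eq_iff_nonneg one_power2 zero_le_one)
 qed
 moreover have "adj U *v v = axis a 1" by (simp add: v_def unitary_cancel[OF U(1)])
 hence "v \<bullet> (A *v v) = eigv \<beta> A i"
  unfolding quadratic_unitary[OF U(2)] by (simp add: axis_def if_distrib if_distribR a[symmetric] cong: if_cong)
 ultimately show ?thesis by blast
qed

lemma max_eigval_less_iff:
 fixes A :: "quat^'m^'m"
 assumes \<beta>: "\<beta> \<in> {1, 2, 4}" and A: "A \<in> hermitian \<beta>"
 shows "max_eigval \<beta> A < c \<longleftrightarrow> (ALL v:Fvec \<beta>. v ~= 0 --> v \<bullet> (A *v v) < c * (norm v)\<^sup>2)"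
proof -
 have "max_eigval \<beta> A < c \<longleftrightarrow> (ALL i<CARD('m). eigv \<beta> A i < c)"
 proof -
  show ?thesis unfolding max_eigval_def by (auto simp: eigvals_ev[OF assms] Max_less_iff)
 qed
 also have "... \<longleftrightarrow> (ALL v:Fvec \<beta>. v ~= 0 --> v \<bullet> (A *v v) < c * (norm v)\<^sup>2)"
 proof (intro iffI allI ballI impI)
  fix v :: "quat^'m" assume less: "ALL i<CARD('m). eigv \<beta> A i < c" and v: "v \<in> Fvec \<beta>" "v ~= 0"
  obtain U where U: "U \<in> unitary \<beta>" "A = U ** dg (eigv \<beta> A) ** adj U" using eigv(2)[OF \<beta> A] by blast
  define u where "u = adj U *v v"
  have nu: "norm u = norm v" using U(1) by (simp add: u_def unitary_norm[of _ \<beta>])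
  then obtain j where "u $ j ~= 0" using v(2) by (metis norm_eq_zero vec_eq_iff zero_index)
  have "v \<bullet> (A *v v) = (\<Sum>i\<in>UNIV. eigv \<beta> A (ix i) * (norm (u $ i))\<^sup>2)"
   unfolding u_def by (rule quadratic_unitary[OF U(2)])
  also have "... < (\<Sum>i\<in>UNIV. c * (norm (u $ i))\<^sup>2)"
  proof (rule sum_strict_mono_ex1)
   show "ALL i:UNIV. eigv \<beta> A (ix i) * (norm (u $ i))\<^sup>2 <= c * (norm (u $ i))\<^sup>2"
    using less by (intro ballI mult_right_mono) (auto intro: less_imp_le)
   show "EX i:UNIV. eigv \<beta> A (ix i) * (norm (u $ i))\<^sup>2 < c * (norm (u $ i))\<^sup>2"
    using less \<open>u $ j ~= 0\<close> by (intro bexI[of _ j]) auto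
  qed simp
  also have "... = c * (norm v)\<^sup>2" by (simp add: nu[symmetric] norm_vec_sq sum_distrib_left)
  finally show "v \<bullet> (A *v v) < c * (norm v)\<^sup>2" .
 next
  fix i assume less: "ALL v:Fvec \<beta>. v ~= 0 --> v \<bullet> (A *v v) < c * (norm v)\<^sup>2" and "i < CARD('m)"
  then obtain v where "v \<in> Fvec \<beta>" "norm v = 1" "v \<bullet> (A *v v) = eigv \<beta> A i" using eigv_quadratic[OF assms] by blast
  thus "eigv \<beta> A i < c" using less by auto
 qed
 finally show ?thesis .
qed

lemma eigv_nonneg:
 fixes A :: "quat^'m^'m"
 assumes "\<beta> \<in> {1, 2, 4}" "A \<in> hermitian \<beta>" "!!v. v \<in> Fvec \<beta> ==> 0 <= v \<bullet> (A *v v)" "i < CARD('m)"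
 shows "0 <= eigv \<beta> A i"
 using eigv_quadratic[OF assms(1,2,4)] assms(3) by metis

lemma quadratic_congruence: "v \<bullet> ((adj X ** B ** X) *v v) = (X *v v) \<bullet> (B *v (X *v v))"
 unfolding matrix_vector_mul_assoc[symmetric] inner_adjoint' by simp

text \<open>A Courant--Fischer argument by counting dimensions.\<close>

lemma eigv_congruence_le:
 fixes B X :: "quat^'m^'m"
 assumes \<beta>: "\<beta> \<in> {1, 2, 4}" and B: "B \<in> hermitian \<beta>"
  and psd: "!!v. v \<in> Fvec \<beta> ==> 0 <= v \<bullet> (B *v v)"
  and X: "X \<in> Fmat \<beta>" and le: "!!v. v \<in> Fvec \<beta> ==> norm (X *v v) <= c * norm v"
  and i: "i < CARD('m)"
 shows "eigv \<beta> (adj X ** B ** X) i <= c\<^sup>2 * eigv \<beta> B i"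
proof (rule ccontr)
 define C where "C = adj X ** B ** X"
 assume "~ ?thesis"
 hence contra: "c\<^sup>2 * eigv \<beta> B i < eigv \<beta> C i" by (simp add: C_def)
 have C: "C \<in> hermitian \<beta>" unfolding C_def by (rule hermitian_congruence(1)[OF B X])
 obtain V where V: "V \<in> unitary \<beta>" "B = V ** dg (eigv \<beta> B) ** adj V" using eigv(2)[OF \<beta> B] by blast
 obtain U where U: "U \<in> unitary \<beta>" "C = U ** dg (eigv \<beta> C) ** adj U" using eigv(2)[OF \<beta> C] by blast
 define T where "T = adj V ** X ** U"
 have T: "T \<in> Fmat \<beta>" unfolding T_def using unitary_D(1)[OF V(1)] unitary_D(1)[OF U(1)] X by blast
 \<comment> \<open>Inputs are supported on the first i + 1 coordinates and only i outputs are kept.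
   A kernel vector gives \<open>v\<close> in the span of the top i + 1 eigenvectors of
   \<open>C\<close> with \<open>X *v v\<close> orthogonal to the top i eigenvectors of
   \<open>B\<close>.\<close>
 define f :: "quat^'m => quat^'m" where "f = (%u. \<chi> j. if ix j < i then (T *v u) $ j else 0)"
 have card1: "{j. j < CARD('m) & j < i} = {..<i}" and card2: "{j. j < CARD('m) & j <= i} = {..i}" using i by auto
 have "EX u:{u \<in> Fvec \<beta>. ALL j. j \<notin> {j. ix j <= i} --> u $ j = 0}. u ~= 0 & f u = 0"
 proof (rule linear_kernel_nontrivial)
  show "linear f" by (rule linearI) (simp_all add: f_def vec_eq_iff matrix_vector_distribs)
  show "subspace {u \<in> Fvec \<beta> :: (quat^'m) set. ALL j. j \<notin> {j. ix j <= i} --> u $ j = 0}"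
   by (auto simp: subspace_def)
  have "T *v u \<in> Fvec \<beta>" if "u \<in> Fvec \<beta>" for u using T that by simp
  thus "f ` {u \<in> Fvec \<beta>. ALL j. j \<notin> {j. ix j <= i} --> u $ j = 0}
    \<subseteq> {u \<in> Fvec \<beta>. ALL j. j \<notin> {j. ix j < i} --> u $ j = 0}" by (auto simp: f_def Fvec_def)
  show "dim {u \<in> Fvec \<beta> :: (quat^'m) set. ALL j. j \<notin> {j. ix j < i} --> u $ j = 0} <
    dim {u \<in> Fvec \<beta> :: (quat^'m) set. ALL j. j \<notin> {j. ix j <= i} --> u $ j = 0}"
   using card_ix[of "%j. j < i", where 'm = 'm] card_ix[of "%j. j <= i", where 'm = 'm] card1 card2 dim_Fvec_supp[OF \<beta>, of "{j::'m. ix j < i}"] dim_Fvec_supp[OF \<beta>, of "{j::'m. ix j <= i}"] \<beta> by fastforce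
 qed
 then obtain u where u: "u \<in> Fvec \<beta>" "!!j. i < ix j ==> u $ j = 0" "u ~= 0" "f u = 0" by auto
 have Tu: "(T *v u) $ j = 0" if "ix j < i" for j using arg_cong[OF u(4), of "%u. u $ j"] that by (simp add: f_def)
 define v where "v = U *v u"
 have v: "v \<in> Fvec \<beta>" "norm v = norm u" "adj U *v v = u"
  using u(1) unitary_D(1)[OF U(1)] by (simp_all add: v_def unitary_norm[OF U(1)] unitary_cancel[OF U(1)])
 have "adj V *v (X *v v) = T *v u" by (simp add: T_def v_def matrix_vector_mul_assoc matrix_mul_assoc)
 hence "(X *v v) \<bullet> (B *v (X *v v)) = (\<Sum>j\<in>UNIV. eigv \<beta> B (ix j) * (norm ((T *v u) $ j))\<^sup>2)"
  by (simp add: quadratic_unitary[OF V(2)])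
 also have "... <= (\<Sum>j\<in>UNIV. eigv \<beta> B i * (norm ((T *v u) $ j))\<^sup>2)"
 proof (rule sum_mono)
  fix j :: 'm
  show "eigv \<beta> B (ix j) * (norm ((T *v u) $ j))\<^sup>2 <= eigv \<beta> B i * (norm ((T *v u) $ j))\<^sup>2"
   using Tu[of j] eigv(1)[OF \<beta> B, of i "ix j"] by (cases "ix j < i") (auto intro!: mult_right_mono)
 qed
 also have "... = eigv \<beta> B i * (norm (X *v v))\<^sup>2"
 proof -
  have "T *v u = adj V *v (X *v v)" by (simp add: T_def v_def matrix_vector_mul_assoc matrix_mul_assoc)
  thus ?thesis using V(1) by (simp add: unitary_norm[of _ \<beta>] norm_vec_sq[symmetric] sum_distrib_left[symmetric])
 qed
 also have "... <= eigv \<beta> B i * (c * norm v)\<^sup>2"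
  using eigv_nonneg[OF \<beta> B psd i] le[OF v(1)] by (intro mult_left_mono power_mono) auto
 finally have "v \<bullet> (C *v v) <= c\<^sup>2 * eigv \<beta> B i * (norm u)\<^sup>2"
  by (simp add: C_def quadratic_congruence v(2) power_mult_distrib mult_ac)
 moreover have "v \<bullet> (C *v v) >= eigv \<beta> C i * (norm u)\<^sup>2"
 proof -
  have "eigv \<beta> C i * (norm (u $ j))\<^sup>2 <= eigv \<beta> C (ix j) * (norm (u $ j))\<^sup>2" for j
   using u(2)[of j] eigv(1)[OF \<beta> C, of "ix j" i] i by (cases "ix j <= i") (auto intro!: mult_right_mono)
  thus ?thesis unfolding quadratic_unitary[OF U(2)] v(3) norm_vec_sq sum_distrib_left by (rule sum_mono)
 qed
 moreover have "(norm u)\<^sup>2 > 0" using u(3) by simp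
 ultimately show False using contra by (meson mult_le_cancel_right not_le order_trans)
qed

subsection \<open>Reflections\<close>

text \<open>Over the quaternions a reflection can only carry \<open>a\<close> to \<open>\<parallel>a\<parallel> q e\<close> for a suitable unit \<open>q\<close>: the
 inner product of the two vectors has to be real.\<close>

lemma reflection_to_axis:
 fixes a :: "quat^'m"
 assumes a: "a \<in> Fvec \<beta>" and supp: "!!k. k \<notin> K ==> a $ k = 0" and j0: "j0 \<in> K"
 shows "EX W:unitary \<beta>. EX q:Falg \<beta>. norm q = 1
   & (ALL j. (\<Sum>k\<in>UNIV. a $ k * W $ k $ j) = (if j = j0 then norm a *\<^sub>R q else 0))
   & (ALL j k. j \<notin> K --> W $ j $ k = mat 1 $ j $ k & W $ k $ j = mat 1 $ k $ j)"
proof -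
 \<comment> \<open>The phase of the entry at \<open>j0\<close>, which makes
   \<open>a $ j0 * qcnj q\<close> the real number |a_j0|; 1 is the default when that entry is
   0.\<close>
 define q where "q = (if a $ j0 = 0 then 1 else a $ j0 /\<^sub>R norm (a $ j0))"
 have q: "q \<in> Falg \<beta>" "norm q = 1" using a by (auto simp: q_def Fvec_def)
 define v where "v = a - axis j0 (norm a *\<^sub>R q)"
 have v: "v \<in> Fvec \<beta>" "!!k. k \<notin> K ==> v $ k = 0" using a q(1) supp j0 by (auto simp: v_def Fvec_def axis_def)
 show ?thesis
 proof (cases "v = 0")
  case True
  hence a_eq: "a $ k = (if k = j0 then norm a *\<^sub>R q else 0)" for k by (simp add: v_def vec_eq_iff axis_def)
  have "(\<Sum>k\<in>UNIV. a $ k * (mat 1 :: quat^'m^'m) $ k $ j) = a $ j" for j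
   by (simp add: mat_def if_distrib cong: if_cong)
  thus ?thesis using q a_eq by (intro bexI[of _ "mat 1"]) auto
 next
  case False
  define s where "s = 2 / (norm v)\<^sup>2"
  define P :: "quat^'m^'m" where "P = (\<chi> k j. qcnj (v $ k) * v $ j)"
  define W where "W = mat 1 - s *\<^sub>R P"
  have PP: "P ** P = (norm v)\<^sup>2 *\<^sub>R P"
  proof (rule mat_eqI)
   fix k j
   have "(P ** P) $ k $ j = (\<Sum>l\<in>UNIV. qcnj (v $ k) * (v $ l * qcnj (v $ l)) * v $ j)"
    by (simp add: matrix_mult_nth P_def mult.assoc)
   also have "... = (\<Sum>l\<in>UNIV. qcnj (v $ k) * of_real ((norm (v $ l))\<^sup>2) * v $ j)" by (simp only: qcnj_mult_self(2))
   also have "... = qcnj (v $ k) * of_real ((norm v)\<^sup>2) * v $ j"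
    by (simp only: norm_vec_sq of_real_sum sum_distrib_left sum_distrib_right)
   also have "... = (norm v)\<^sup>2 *\<^sub>R (qcnj (v $ k) * v $ j)" by (simp only: of_real_mult_scaleR mult_scaleR_left)
   finally show "(P ** P) $ k $ j = ((norm v)\<^sup>2 *\<^sub>R P) $ k $ j" by (simp add: P_def)
  qed
  have "adj P = P" by (rule mat_eqI) (simp add: P_def qcnj_mult)
  hence adj: "adj W = W" by (simp add: W_def)
  have "W ** W = mat 1 - s *\<^sub>R P - (s *\<^sub>R P - s *\<^sub>R s *\<^sub>R (norm v)\<^sup>2 *\<^sub>R P)"
   by (simp only: W_def matrix_mult_distribs PP matrix_mul_lid matrix_mul_rid scaleR_diff_right)
  also have "s *\<^sub>R s *\<^sub>R (norm v)\<^sup>2 *\<^sub>R P = s *\<^sub>R P + s *\<^sub>R P" by (simp add: s_def scaleR_add_left[symmetric])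
  finally have WW: "W ** W = mat 1" by simp
  have "P \<in> Fmat \<beta>" using v(1) by (simp add: P_def Fmat_def Fvec_def)
  hence W: "W \<in> unitary \<beta>" using WW adj by (auto simp: W_def unitary_def)
  have aj: "a $ j0 * qcnj q = of_real (norm (a $ j0))" "norm a * norm (a $ j0) = norm a * (a $ j0 \<bullet> q)"
   by (auto simp: q_def qcnj_mult_self power2_eq_square power2_norm_eq_inner[symmetric])
  have "(norm v)\<^sup>2 = a \<bullet> a - 2 * (a $ j0 \<bullet> (norm a *\<^sub>R q)) + (norm a *\<^sub>R q) \<bullet> (norm a *\<^sub>R q)"
   by (simp add: power2_norm_eq_inner v_def inner_diff_right inner_axis inner_axis' inner_commute)
  also have "(norm a *\<^sub>R q) \<bullet> (norm a *\<^sub>R q) = (norm a)\<^sup>2"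
   unfolding power2_norm_eq_inner[symmetric] using q(2) by simp
  finally have nv: "(norm v)\<^sup>2 = 2 * ((norm a)\<^sup>2 - norm a * norm (a $ j0))"
   using aj(2) by (auto simp: power2_norm_eq_inner)
  \<comment> \<open>The pairing of \<open>a\<close> with \<open>v\<close> is real and equals half of
    |v|^2, so the reflection with factor 2 / |v|^2 subtracts exactly \<open>v\<close> from the row
    vector \<open>a\<close>.\<close>
  have dot: "(\<Sum>k\<in>UNIV. a $ k * qcnj (v $ k)) = of_real ((norm v)\<^sup>2 / 2)"
  proof -
   have "(\<Sum>k\<in>UNIV. a $ k * qcnj (v $ k)) = (\<Sum>k\<in>UNIV. of_real ((norm (a $ k))\<^sup>2)) -
     (\<Sum>k\<in>UNIV. if k = j0 then norm a *\<^sub>R (a $ j0 * qcnj q) else 0)" unfolding sum_subtractf[symmetric]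
    by (intro sum.cong refl) (simp add: v_def axis_def algebra_simps qcnj_mult_self)
   also have "... = of_real ((norm a)\<^sup>2 - norm a * norm (a $ j0))"
    by (simp add: aj(1) norm_vec_sq scaleR_conv_of_real del: of_real_mult_scaleR)
   also have "(norm a)\<^sup>2 - norm a * norm (a $ j0) = (norm v)\<^sup>2 / 2" using nv by simp
   finally show ?thesis .
  qed
  have aW: "(\<Sum>k\<in>UNIV. a $ k * W $ k $ j) = (if j = j0 then norm a *\<^sub>R q else 0)" for j
  proof -
   have "(\<Sum>k\<in>UNIV. a $ k * W $ k $ j) = (\<Sum>k\<in>UNIV. if k = j then a $ j else 0)
     - s *\<^sub>R ((\<Sum>k\<in>UNIV. a $ k * qcnj (v $ k)) * v $ j)"
    unfolding sum_distrib_right scaleR_sum_right sum_subtractf[symmetric]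
    by (intro sum.cong refl) (simp add: W_def P_def mat_def algebra_simps)
   also have "... = a $ j - v $ j" by (simp add: dot s_def)
   finally show ?thesis by (simp add: v_def axis_def)
  qed
  have "W $ j $ k = mat 1 $ j $ k & W $ k $ j = mat 1 $ k $ j" if "j \<notin> K" for j k
   using v(2)[OF that] by (simp add: W_def P_def)
  thus ?thesis using W q aW by blast
 qed
qed

section \<open>Polynomials in the eigenvalue variables, their coefficients, and the dominance
  order\<close>

section \<open>Homogeneous polynomials\<close>

definition mon :: "nat => (nat => nat) => (nat => real) => real" where
 "mon p al x = (\<Prod>i<p. x i ^ al i)"

lemma hom_poly_mon: "hom_poly p k a x = (\<Sum>al\<in>exponents p k. a al * mon p al x)"
 by (simp add: hom_poly_def mon_def)

lemma exponents_le: "al \<in> exponents p k ==> al i <= k"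
proof -
 assume al: "al \<in> exponents p k"
 show ?thesis
 proof (cases "i < p")
  case True
  hence "al i <= (\<Sum>i<p. al i)" by (intro member_le_sum) auto
  thus ?thesis using al by (simp add: exponents_def)
 qed (use al in \<open>simp add: exponents_def\<close>)
qed

lemma finite_exponents [simp]: "finite (exponents p k)"
proof (rule finite_subset)
 show "exponents p k \<subseteq> {f. ALL i. (i \<in> {..<p} --> f i \<in> {..k}) & (i \<notin> {..<p} --> f i = 0)}"
  using exponents_le by (auto simp: exponents_def)
 show "finite {f :: nat => nat. ALL i. (i \<in> {..<p} --> f i \<in> {..k}) & (i \<notin> {..<p} --> f i = 0)}"
  by (rule finite_set_of_finite_funs) auto
qed

lemma parts_subset: "parts p k \<subseteq> exponents p k"
 by (auto simp: parts_def)

lemma finite_parts [simp]: "finite (parts p k)"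
 using parts_subset finite_exponents by (rule finite_subset)

definition hp :: "nat => nat => ((nat => real) => real) => bool" where
 "hp p k f \<longleftrightarrow> (EX a. f = hom_poly p k a)"

lemma hp_hom_poly [simp, intro]: "hp p k (hom_poly p k a)"
 by (auto simp: hp_def)

lemma hp_add: "hp p k f ==> hp p k g ==> hp p k (%x. f x + g x)"
proof -
 assume "hp p k f" "hp p k g"
 then obtain a b where "f = hom_poly p k a" "g = hom_poly p k b" by (auto simp: hp_def)
 hence "(%x. f x + g x) = hom_poly p k (%al. a al + b al)" by (auto simp: hom_poly_def sum.distrib algebra_simps)
 thus ?thesis by auto
qed

lemma hp_scale: "hp p k f ==> hp p k (%x. c * f x)"
proof -
 assume "hp p k f"
 then obtain a where "f = hom_poly p k a" by (auto simp: hp_def)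
 hence "(%x. c * f x) = hom_poly p k (%al. c * a al)" by (auto simp: hom_poly_def sum_distrib_left algebra_simps)
 thus ?thesis by auto
qed

lemma hp_zero: "hp p k (%x. 0)"
proof -
 have "(%x. 0) = hom_poly p k (%_. 0)" by (auto simp: hom_poly_def)
 thus ?thesis by auto
qed

lemma hp_sum: "(!!i. i \<in> S ==> hp p k (f i)) ==> hp p k (%x. \<Sum>i\<in>S. f i x)"
 by (induction S rule: infinite_finite_induct) (auto intro: hp_zero hp_add)

lemma hp_mon: "al \<in> exponents p k ==> hp p k (mon p al)"
proof -
 assume al: "al \<in> exponents p k"
 have "mon p al = hom_poly p k (%ga. if ga = al then 1 else 0)"
 proof
  fix x
  have "hom_poly p k (%ga. if ga = al then 1 else 0) x = (\<Sum>ga\<in>exponents p k. if ga = al then mon p al x else 0)"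
   unfolding hom_poly_mon by (rule sum.cong) auto
  thus "mon p al x = hom_poly p k (%ga. if ga = al then 1 else 0) x" using al by simp
 qed
 thus ?thesis by auto
qed

lemma hp_const: "hp p 0 (%x. c)"
proof -
 have "hp p 0 (%x. c * mon p (%_. 0) x)" by (rule hp_scale[OF hp_mon]) (simp add: exponents_def)
 thus ?thesis by (simp add: mon_def)
qed

lemma hp_coordinate_power: "i < p ==> hp p k (%x. x i ^ k)"
proof -
 assume i: "i < p"
 have "mon p ((%_. 0)(i := k)) x = x i ^ k" for x
 proof -
  have "mon p ((%_. 0)(i := k)) x = (\<Prod>j<p. if j = i then x i ^ k else 1)" unfolding mon_def by (rule prod.cong) auto
  thus ?thesis using i by simp
 qed
 moreover have "(%_. 0)(i := k) \<in> exponents p k" using i by (simp add: exponents_def)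
 ultimately show ?thesis using hp_mon[of "(%_. 0)(i := k)" p k] by presburger
qed

lemma hp_mult:
 assumes "hp p k f" "hp p l g"
 shows "hp p (k + l) (%x. f x * g x)"
proof -
 obtain a b where ab: "f = hom_poly p k a" "g = hom_poly p l b" using assms by (auto simp: hp_def)
 have "hp p (k + l) (%x. \<Sum>al\<in>exponents p k. \<Sum>ga\<in>exponents p l. a al * b ga * mon p (%i. al i + ga i) x)"
  by (intro hp_sum hp_scale hp_mon) (auto simp: exponents_def sum.distrib)
 also have "(%x. \<Sum>al\<in>exponents p k. \<Sum>ga\<in>exponents p l. a al * b ga * mon p (%i. al i + ga i) x)
   = (%x. f x * g x)" unfolding ab hom_poly_mon sum_product
  by (intro ext sum.cong refl) (simp add: mon_def power_add prod.distrib)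
 finally show ?thesis .
qed

lemma hp_depends: "hp p k f ==> (!!i. i < p ==> x i = y i) ==> f x = f y"
 by (auto simp: hp_def hom_poly_mon mon_def intro!: prod.cong)

subsection \<open>Coefficients as limits along monomial curves\<close>

definition dec :: "nat => (nat => nat) => bool" where
 "dec p w \<longleftrightarrow> (ALL i j. i < j --> j < p --> w j < w i)"

text \<open>Points on the curve x_i = u^(w_i). A monomial becomes the power of u with exponent
  \<open>wt\<close>, so coefficients can be read off from growth as u tends to infinity. For
  strictly decreasing weights and u > 1 the coordinates are distinct and decreasing.\<close>

definition pt :: "real => (nat => nat) => nat => real" where
 "pt u w = (%i. u ^ w i)"

definition wt :: "nat => (nat => nat) => (nat => nat) => nat" where
 "wt p w al = (\<Sum>i<p. w i * al i)"

lemma mon_pt: "mon p al (pt u w) = u ^ wt p w al"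
 by (simp add: mon_def pt_def wt_def power_sum power_mult)

lemma pt_pos: "u > 0 ==> pt u w i > 0"
 by (simp add: pt_def)

lemma pt_inj:
 assumes "dec p w" "u > 1"
 shows "inj_on (pt u w) {..<p}"
proof (rule inj_onI)
 fix i j assume ij: "i \<in> {..<p}" "j \<in> {..<p}" "pt u w i = pt u w j"
 hence "w i = w j" using assms(2) by (simp add: pt_def)
 thus "i = j" using assms(1) ij unfolding dec_def by (metis lessThan_iff less_irrefl linorder_neqE_nat)
qed

lemma pt_sorted: "dec p w ==> u >= 1 ==> i <= j ==> j < p ==> pt u w j <= pt u w i"
 unfolding pt_def dec_def by (cases "i = j") (auto intro!: power_increasing simp: less_imp_le)

lemma tendsto_power_ratio:
 assumes "n <= N"
 shows "((%u::real. u ^ n / u ^ N) \<longlongrightarrow> (if n = N then 1 else 0)) at_top"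
proof (cases "n = N")
 case True
 have "\<forall>\<^sub>F u::real in at_top. 1 = u ^ n / u ^ N"
  using eventually_gt_at_top[of 0] by eventually_elim (simp add: True)
 thus ?thesis using True by (simp add: tendsto_eventually)
next
 case False
 have "\<forall>\<^sub>F u::real in at_top. inverse (u ^ (N - n)) = u ^ n / u ^ N"
  using eventually_gt_at_top[of 0] by eventually_elim (use assms in \<open>simp add: power_diff field_simps\<close>)
 moreover have "((%u::real. inverse (u ^ (N - n))) \<longlongrightarrow> 0) at_top"
  using False assms by (intro tendsto_inverse_0_at_top filterlim_pow_at_top filterlim_ident) auto
 ultimately show ?thesis using False by (simp add: Lim_transform_eventually)
qed

text \<open>The factors \<open>E\<close> make room for the quotients x_i / (x_i - x_j) of the Jack
  operator, which converge along these curves.\<close>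

lemma tendsto_leading:
 fixes a :: "(nat => nat) => real" and E :: "(nat => nat) => real => real"
 assumes "!!al. al \<in> exponents p k ==> a al ~= 0 ==> wt p w al <= N"
  and "!!al. al \<in> exponents p k ==> (E al \<longlongrightarrow> e al) at_top"
 shows "((%u. (\<Sum>al\<in>exponents p k. a al * (u ^ wt p w al * E al u)) / u ^ N) \<longlongrightarrow>
   (\<Sum>al\<in>exponents p k. if wt p w al = N then a al * e al else 0)) at_top"
proof -
 have "((%u. a al * (u ^ wt p w al / u ^ N) * E al u) \<longlongrightarrow> (if wt p w al = N then a al * e al else 0)) at_top"
  if "al \<in> exponents p k" for al
 proof (cases "a al = 0")
  case False
  have "((%u. a al * (u ^ wt p w al / u ^ N) * E al u) \<longlongrightarrow> a al * (if wt p w al = N then 1 else 0) * e al) at_top"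
   by (intro tendsto_mult tendsto_const tendsto_power_ratio assms(1)[OF that False] assms(2)[OF that])
  thus ?thesis by (auto split: if_splits)
 qed simp
 hence "((%u. \<Sum>al\<in>exponents p k. a al * (u ^ wt p w al / u ^ N) * E al u) \<longlongrightarrow>
   (\<Sum>al\<in>exponents p k. if wt p w al = N then a al * e al else 0)) at_top" by (rule tendsto_sum)
 thus ?thesis by (simp add: sum_divide_distrib mult.assoc)
qed

lemma tendsto_hom_poly:
 assumes "!!al. al \<in> exponents p k ==> a al ~= 0 ==> wt p w al <= N"
 shows "((%u. hom_poly p k a (pt u w) / u ^ N) \<longlongrightarrow>
   (\<Sum>al\<in>exponents p k. if wt p w al = N then a al else 0)) at_top"
 using tendsto_leading[where a = a and E = "%_ _. 1" and e = "%_. 1" and p = p and k = k, OF assms]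
 by (simp add: hom_poly_mon mon_pt cong: if_cong)

definition generic :: "nat => nat => (nat => nat) => bool" where
 "generic p k w \<longleftrightarrow> dec p w & inj_on (wt p w) (exponents p k)"

lemma digits_unique:
 fixes al ga :: "nat => nat"
 assumes "ALL i<p. al i < b" "ALL i<p. ga i < b"
  and "(\<Sum>i<p. b ^ (p - Suc i) * al i) = (\<Sum>i<p. b ^ (p - Suc i) * ga i)"
 shows "ALL i<p. al i = ga i"
 using assms
proof (induction p)
 case (Suc p)
 have step: "(\<Sum>i<Suc p. b ^ (Suc p - Suc i) * f i) = b * (\<Sum>i<p. b ^ (p - Suc i) * f i) + f p" for f
 proof -
  have "(\<Sum>i<p. b ^ (p - i) * f i) = b * (\<Sum>i<p. b ^ (p - Suc i) * f i)"
   unfolding sum_distrib_left by (intro sum.cong refl) (simp add: Suc_diff_Suc flip: power_Suc)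
  thus ?thesis by simp
 qed
 have eq: "b * (\<Sum>i<p. b ^ (p - Suc i) * al i) + al p = b * (\<Sum>i<p. b ^ (p - Suc i) * ga i) + ga p"
  using Suc.prems(3) unfolding step .
 have lt: "al p < b" "ga p < b" using Suc.prems by auto
 have p: "al p = ga p" using arg_cong[OF eq, of "%n. n mod b"] lt by simp
 hence "(\<Sum>i<p. b ^ (p - Suc i) * al i) = (\<Sum>i<p. b ^ (p - Suc i) * ga i)" using eq lt by simp
 hence "ALL i<p. al i = ga i" using Suc.prems(1,2) by (intro Suc.IH) auto
 thus ?case using p by (simp add: less_Suc_eq)
qed simp

text \<open>Exponents are at most k, so they are digits in base k + 2 and the weights separate them.
  Base k + 1 would separate too, but for k = 0 its powers would not decrease strictly.\<close>

lemma generic_exists: "generic p k (%i. (k + 2) ^ (p - Suc i))"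
 unfolding generic_def
proof
 show "dec p (%i. (k + 2) ^ (p - Suc i))" unfolding dec_def by (intro allI power_strict_increasing) auto
 show "inj_on (wt p (%i. (k + 2) ^ (p - Suc i))) (exponents p k)"
 proof (rule inj_onI)
  fix al ga assume *: "al \<in> exponents p k" "ga \<in> exponents p k"
   "wt p (%i. (k + 2) ^ (p - Suc i)) al = wt p (%i. (k + 2) ^ (p - Suc i)) ga"
  have "al i < k + 2" "ga i < k + 2" for i using exponents_le[OF *(1), of i] exponents_le[OF *(2), of i] by auto
  hence "ALL i<p. al i = ga i" using digits_unique[of p al "k + 2" ga] *(3) unfolding wt_def by blast
  thus "al = ga" using *(1,2) by (auto simp: exponents_def fun_eq_iff) (metis not_le)
 qed
qed

lemma generic_tendsto:
 assumes w: "generic p k w" and "al \<in> exponents p k"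
  and "!!ga. ga \<in> exponents p k ==> a ga ~= 0 ==> wt p w ga <= wt p w al"
 shows "((%u. hom_poly p k a (pt u w) / u ^ wt p w al) \<longlongrightarrow> a al) at_top"
proof -
 have "(\<Sum>ga\<in>exponents p k. if wt p w ga = wt p w al then a ga else 0) = (\<Sum>ga\<in>exponents p k. if ga = al then a al else 0)"
  using w assms(2) by (intro sum.cong) (auto simp: generic_def inj_on_def)
 hence "(\<Sum>ga\<in>exponents p k. if wt p w ga = wt p w al then a ga else 0) = a al" using assms(2) by simp
 with tendsto_hom_poly[where p = p and k = k and a = a and w = w and N = "wt p w al", OF assms(3)] show ?thesis
  by simp
qed

lemma top_exponent:
 assumes "EX al:exponents p k. a al ~= (0::real)"
 shows "EX al:exponents p k. a al ~= 0 & (ALL ga:exponents p k. a ga ~= 0 --> wt p w ga <= wt p w al)"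
proof -
 let ?S = "{al \<in> exponents p k. a al ~= 0}"
 have "finite (wt p w ` ?S)" "wt p w ` ?S ~= {}" using assms by auto
 then obtain al where "al \<in> ?S" "wt p w al = Max (wt p w ` ?S)" by (metis (no_types, lifting) Max_in imageE)
 thus ?thesis by auto
qed

lemma hom_poly_zero_coeffs:
 assumes "generic p k w" "\<forall>\<^sub>F u in at_top. hom_poly p k a (pt u w) = 0" "al \<in> exponents p k"
 shows "a al = 0"
proof (rule ccontr)
 assume "a al ~= 0"
 then obtain ga where ga: "ga \<in> exponents p k" "a ga ~= 0" "ALL \<delta>:exponents p k. a \<delta> ~= 0 --> wt p w \<delta> <= wt p w ga"
  using top_exponent[of p k a w] assms(3) by blast
 have "((%u. hom_poly p k a (pt u w) / u ^ wt p w ga) \<longlongrightarrow> a ga) at_top"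
  using ga by (intro generic_tendsto[OF assms(1)]) auto
 moreover have "((%u. hom_poly p k a (pt u w) / u ^ wt p w ga) \<longlongrightarrow> 0) at_top"
  by (rule tendsto_eventually, rule eventually_mono[OF assms(2)]) simp
 ultimately have "a ga = 0" by (rule tendsto_unique[OF trivial_limit_at_top_linorder])
 thus False using ga(2) by simp
qed

text \<open>The value 0 off \<open>exponents p k\<close> makes the coefficients unique, so that a
  nonzero value certifies an exponent vector of the right degree.\<close>

definition cf :: "nat => nat => ((nat => real) => real) => (nat => nat) => real" where
 "cf p k f = (SOME a. f = hom_poly p k a & (ALL al. al \<notin> exponents p k --> a al = 0))"

lemma cf:
 assumes "hp p k f"
 shows "f = hom_poly p k (cf p k f)" "al \<notin> exponents p k ==> cf p k f al = 0"
proof -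
 obtain a where "f = hom_poly p k a" using assms by (auto simp: hp_def)
 hence "f = hom_poly p k (%al. if al \<in> exponents p k then a al else 0)" by (auto simp: hom_poly_def)
 hence "EX a. f = hom_poly p k a & (ALL al. al \<notin> exponents p k --> a al = 0)" by auto
 from someI_ex[OF this] show "f = hom_poly p k (cf p k f)" "al \<notin> exponents p k ==> cf p k f al = 0"
  unfolding cf_def by blast+
qed

text \<open>The curves \<open>pt u w\<close> with u > 1 stay among points with distinct positive
  coordinates, so values there already determine the coefficients. There the Jack operator is
  regular and diagonal matrices have square roots.\<close>

lemma cf_eqI:
 assumes "!!x. inj_on x {..<p} ==> (!!i. 0 < x i) ==> f x = hom_poly p k a x"
  and "hp p k f" "al \<in> exponents p k"
 shows "cf p k f al = a al"
proof -
 have w: "generic p k (%i. (k + 2) ^ (p - Suc i))" (is "generic p k ?w") by (rule generic_exists)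
 have "\<forall>\<^sub>F u in at_top. hom_poly p k (%al. cf p k f al - a al) (pt u ?w) = 0" using eventually_gt_at_top[of 1]
 proof eventually_elim
  case (elim u)
  have "f (pt u ?w) = hom_poly p k a (pt u ?w)"
   using w elim by (intro assms(1) pt_inj pt_pos) (auto simp: generic_def)
  hence "hom_poly p k (cf p k f) (pt u ?w) = hom_poly p k a (pt u ?w)" using cf(1)[OF assms(2)] by simp
  thus ?case by (simp add: hom_poly_def left_diff_distrib sum_subtractf)
 qed
 from hom_poly_zero_coeffs[OF w this assms(3)] show ?thesis by simp
qed

lemma hp_eqI:
 assumes "hp p k f" "hp p k g" "!!x. inj_on x {..<p} ==> (!!i. 0 < x i) ==> f x = g x"
 shows "f = g"
proof -
 have "cf p k f al = cf p k g al" if "al \<in> exponents p k" for al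
  by (rule cf_eqI[OF _ assms(1) that]) (use assms(3) cf(1)[OF assms(2)] in metis)
 hence "hom_poly p k (cf p k f) = hom_poly p k (cf p k g)" by (auto simp: hom_poly_def)
 thus ?thesis using cf(1)[OF assms(1)] cf(1)[OF assms(2)] by simp
qed

lemma cf_hom_poly: "al \<in> exponents p k ==> cf p k (hom_poly p k a) al = a al"
 by (rule cf_eqI) auto

lemma cf_add:
 assumes "hp p k f" "hp p k g"
 shows "cf p k (%x. f x + g x) al = cf p k f al + cf p k g al"
proof (cases "al \<in> exponents p k")
 case True
 have "hom_poly p k (%al. cf p k f al + cf p k g al) x = hom_poly p k (cf p k f) x + hom_poly p k (cf p k g) x" for x
  by (simp add: hom_poly_def distrib_right sum.distrib)
 hence "(%x. f x + g x) = hom_poly p k (%al. cf p k f al + cf p k g al)"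
  by (auto simp only: cf(1)[OF assms(1), symmetric] cf(1)[OF assms(2), symmetric])
 thus ?thesis using cf_hom_poly[OF True] by metis
qed (simp add: cf(2) assms hp_add)

lemma cf_scale:
 assumes "hp p k f"
 shows "cf p k (%x. c * f x) al = c * cf p k f al"
proof (cases "al \<in> exponents p k")
 case True
 have "hom_poly p k (%al. c * cf p k f al) x = c * hom_poly p k (cf p k f) x" for x
  by (simp add: hom_poly_def sum_distrib_left mult.assoc)
 hence "(%x. c * f x) = hom_poly p k (%al. c * cf p k f al)" by (auto simp only: cf(1)[OF assms, symmetric])
 thus ?thesis using cf_hom_poly[OF True] by metis
qed (simp add: cf(2) assms hp_scale)

lemma cf_sum:
 assumes "!!i. i \<in> S ==> hp p k (f i)"
 shows "cf p k (%x. \<Sum>i\<in>S. f i x) al = (\<Sum>i\<in>S. cf p k (f i) al)"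
 using assms
proof (induction S rule: infinite_finite_induct)
 case (infinite A)
 thus ?case using cf_scale[OF hp_zero, of p k 0 al] by simp
next
 case empty
 thus ?case using cf_scale[OF hp_zero, of p k 0 al] by simp
next
 case (insert i S)
 thus ?case using cf_add[of p k "f i" "%x. \<Sum>i\<in>S. f i x"] by (simp add: hp_sum)
qed

subsection \<open>The dominance order\<close>

text \<open>A multiplicative Abel summation: the surplus of the partial sums of \<open>ka\<close>
  over those of \<open>al\<close> is carried as a power of some y below all variables used so far.
  Once all p variables are used, both sums equal k and the surplus is gone.\<close>

lemma mon_dominated:
 assumes "dominated al ka" "al \<in> exponents p k" "ka \<in> exponents p k"
  and x: "!!i j. i <= j ==> j < p ==> 0 <= x j & x j <= x i"
 shows "mon p al x <= mon p ka x"
proof -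
 have "mon q al x * y ^ ((\<Sum>i<q. ka i) - (\<Sum>i<q. al i)) <= mon q ka x"
  if "q <= p" "0 <= y" "ALL i<q. y <= x i" for q y using that
 proof (induction q arbitrary: y)
  case (Suc q)
  have nn: "0 <= x i" if "i <= q" for i using x[of i i] that Suc.prems by auto
  have nnm: "0 <= mon q ga x" for ga unfolding mon_def using nn by (intro prod_nonneg) auto
  have le: "(\<Sum>i<q. al i) <= (\<Sum>i<q. ka i)" "(\<Sum>i<Suc q. al i) <= (\<Sum>i<Suc q. ka i)"
   using assms(1) unfolding dominated_def by blast+
  have "mon (Suc q) al x * y ^ ((\<Sum>i<Suc q. ka i) - (\<Sum>i<Suc q. al i))
    <= mon (Suc q) al x * x q ^ ((\<Sum>i<Suc q. ka i) - (\<Sum>i<Suc q. al i))"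
   using Suc.prems nnm[of al] by (intro mult_left_mono power_mono) (auto simp: mon_def)
  also have "... = mon q al x * x q ^ (al q + ((\<Sum>i<Suc q. ka i) - (\<Sum>i<Suc q. al i)))"
   by (simp add: mon_def power_add)
  also have "al q + ((\<Sum>i<Suc q. ka i) - (\<Sum>i<Suc q. al i)) = ((\<Sum>i<q. ka i) - (\<Sum>i<q. al i)) + ka q" using le by simp
  also have "mon q al x * x q ^ (((\<Sum>i<q. ka i) - (\<Sum>i<q. al i)) + ka q)
    = mon q al x * x q ^ ((\<Sum>i<q. ka i) - (\<Sum>i<q. al i)) * x q ^ ka q" by (simp add: power_add)
  also have "... <= mon q ka x * x q ^ ka q" using Suc.prems x by (intro mult_right_mono Suc.IH) auto
  finally show ?case by (simp add: mon_def)
 qed (simp add: mon_def)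
 moreover have "ALL i<p. 0 <= x i" using x by blast
 ultimately show ?thesis using assms(2,3) by (force simp: exponents_def)
qed

text \<open>The monomial inequality at x_i = 2^(w_i), after taking logarithms.\<close>

lemma wt_dominated_le:
 assumes "dominated al ka" "al \<in> exponents p k" "ka \<in> exponents p k"
  and "!!i j. i <= j ==> j < p ==> w j <= w i"
 shows "wt p w al <= wt p w ka"
proof -
 have "mon p al (pt 2 w) <= mon p ka (pt 2 w)"
  using assms(4) by (intro mon_dominated[OF assms(1-3)]) (auto simp: pt_def)
 thus ?thesis by (simp add: mon_pt)
qed

lemma staircase_sum: "(\<Sum>i<p. (p - Suc i) * al i) = (\<Sum>j<p. \<Sum>i<j. al i :: nat)"
proof (induction p)
 case (Suc p)
 have "(\<Sum>i<p. (p - i) * al i) = (\<Sum>i<p. (p - Suc i) * al i + al i)"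
 proof (rule sum.cong)
  fix i assume "i \<in> {..<p}"
  hence "p - i = Suc (p - Suc i)" by auto
  thus "(p - i) * al i = (p - Suc i) * al i + al i" by simp
 qed simp
 thus ?case using Suc by (simp add: sum.distrib)
qed simp

text \<open>The staircase weight is the sum of the partial sums. The first difference of
  \<open>al\<close> and \<open>ka\<close> makes one partial sum strictly smaller, and it is not the
  total one because both totals are k.\<close>

lemma dominated_staircase_less:
 assumes "dominated al ka" "al \<in> exponents p k" "ka \<in> exponents p k" "al ~= ka"
 shows "(\<Sum>i<p. (p - Suc i) * al i) < (\<Sum>i<p. (p - Suc i) * ka i)"
 unfolding staircase_sum
proof (rule sum_strict_mono_ex1)
 show "ALL j:{..<p}. (\<Sum>i<j. al i) <= (\<Sum>i<j. ka i)" using assms(1) by (simp add: dominated_def)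
 obtain j where j: "ALL i<j. al i = ka i" "al j < ka j" using dominated_imp_lex_less[OF assms(1,4)] by blast
 have jp: "Suc j <= p"
 proof (rule ccontr)
  assume "~ Suc j <= p"
  thus False using assms(3) j(2) by (simp add: exponents_def)
 qed
 have less: "(\<Sum>i<Suc j. al i) < (\<Sum>i<Suc j. ka i)" using j by simp
 have "Suc j ~= p" using less assms(2,3) by (auto simp: exponents_def)
 thus "EX j:{..<p}. (\<Sum>i<j. al i) < (\<Sum>i<j. ka i)" using less jp by (intro bexI[of _ "Suc j"]) auto
qed simp

text \<open>Strictly decreasing weights are the staircase plus a weakly decreasing remainder; the
  staircase supplies the strictness.\<close>

lemma wt_dominated_less:
 assumes "dominated al ka" "al \<in> exponents p k" "ka \<in> exponents p k" "al ~= ka" "dec p w"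
 shows "wt p w al < wt p w ka"
proof -
 have ge: "p - Suc i <= w i" if "i < p" for i using that
 proof (induction "p - Suc i" arbitrary: i)
  case (Suc n)
  hence "p - Suc (Suc i) <= w (Suc i)" "w (Suc i) < w i" using assms(5) unfolding dec_def by auto
  thus ?case by simp
 qed simp
 define w' where "w' i = w i - (p - Suc i)" for i
 have split: "wt p w ga = wt p w' ga + (\<Sum>i<p. (p - Suc i) * ga i)" for ga
  unfolding wt_def w'_def sum.distrib[symmetric]
 proof (rule sum.cong)
  fix i assume "i \<in> {..<p}"
  hence "w i = (w i - (p - Suc i)) + (p - Suc i)" using ge[of i] by simp
  thus "w i * ga i = (w i - (p - Suc i)) * ga i + (p - Suc i) * ga i" by (metis distrib_right)
 qed simp
 have mono: "w' j <= w' i" if "i <= j" "j < p" for i j using that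
 proof (induction j rule: dec_induct)
  case (step n)
  hence "w (Suc n) < w n" using assms(5) unfolding dec_def by auto
  hence "w' (Suc n) <= w' n" unfolding w'_def using step.prems by linarith
  thus ?case using step by auto
 qed simp
 hence "wt p w' al <= wt p w' ka" by (intro wt_dominated_le[OF assms(1-3)]) auto
 thus ?thesis unfolding split using dominated_staircase_less[OF assms(1-4)] by simp
qed

text \<open>If an exponent of the support exceeded \<open>ka\<close> in its j-th partial sum,
  weights boosted on the first j variables would make that partial sum decisive, and the function
  would outgrow the monomial \<open>ka\<close> along the boosted curve.\<close>

lemma dominated_of_growth:
 assumes f: "hp p k f" and ka: "ka \<in> exponents p k"
  and growth: "!!w. dec p w ==> EX C. \<forall>\<^sub>F u in at_top. \<bar>f (pt u w)\<bar> <= C * u ^ wt p w ka"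
  and al: "cf p k f al ~= 0"
 shows "dominated al ka"
proof (rule ccontr)
 assume "~ dominated al ka"
 then obtain j where j: "(\<Sum>i<j. ka i) < (\<Sum>i<j. al i)" by (auto simp: dominated_def not_le)
 have \<alpha>e: "al \<in> exponents p k" using cf(2)[OF f] al by blast
 have jp: "j < p"
 proof (rule ccontr)
  assume "~ j < p"
  hence "(\<Sum>i<j. ga i) = k" if "ga \<in> exponents p k" for ga
   using that sum.mono_neutral_left[of "{..<j}" "{..<p}" ga] by (auto simp: exponents_def)
  thus False using j ka \<alpha>e by simp
 qed
 define w where "w = (%i. (k + 2) ^ (p - Suc i) :: nat)"
 have w: "dec p w" "inj_on (wt p w) (exponents p k)"
  using generic_exists[of p k] by (simp_all add: generic_def w_def)
 \<comment> \<open>Exceeds every weight in degree k: once \<open>B\<close> is added to the first j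
   weights, the j-th partial sum is compared first and \<open>w\<close> only breaks ties.\<close>
 define B where "B = Suc (Max (wt p w ` exponents p k))"
 have B: "wt p w ga < B" if "ga \<in> exponents p k" for ga
  unfolding B_def using that by (intro le_imp_less_Suc Max_ge) auto
 define w' where "w' = (%i. w i + (if i < j then B else 0))"
 have wt': "wt p w' ga = wt p w ga + B * (\<Sum>i<j. ga i)" for ga
 proof -
  have "wt p w' ga = wt p w ga + (\<Sum>i<p. if i < j then B * ga i else 0)"
   unfolding wt_def w'_def sum.distrib[symmetric] by (intro sum.cong refl) (simp add: algebra_simps)
  also have "(\<Sum>i<p. if i < j then B * ga i else 0) = (\<Sum>i\<in>{..<p} \<inter> {i. i < j}. B * ga i)"
   by (simp add: sum.inter_restrict)
  also have "{..<p} \<inter> {i. i < j} = {..<j}" using jp by auto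
  finally show ?thesis by (simp add: sum_distrib_left)
 qed
 have "generic p k w'" unfolding generic_def
 proof
  show "dec p w'" using w(1) unfolding dec_def w'_def by (auto intro: trans_less_add1)
  show "inj_on (wt p w') (exponents p k)"
  proof (rule inj_onI)
   fix ga \<delta> assume *: "ga \<in> exponents p k" "\<delta> \<in> exponents p k" "wt p w' ga = wt p w' \<delta>"
   have "wt p w ga = wt p w \<delta>" using arg_cong[OF *(3), of "%n. n mod B"] B[OF *(1)] B[OF *(2)] by (simp add: wt')
   thus "ga = \<delta>" using w(2) * by (auto simp: inj_on_def)
  qed
 qed
 note gen = this
 obtain ga where ga: "ga \<in> exponents p k" "cf p k f ga ~= 0"
  "ALL \<delta>:exponents p k. cf p k f \<delta> ~= 0 --> wt p w' \<delta> <= wt p w' ga"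
  using top_exponent[of p k "cf p k f" w'] al \<alpha>e by blast
 have "wt p w' ka < B * Suc (\<Sum>i<j. ka i)" using B[OF ka] by (simp add: wt')
 also have "... <= B * (\<Sum>i<j. al i)" using j by (intro mult_left_mono) auto
 also have "... <= wt p w' al" by (simp add: wt')
 also have "... <= wt p w' ga" using ga(3) al \<alpha>e by blast
 finally have less: "wt p w' ka < wt p w' ga" .
 obtain C where C: "\<forall>\<^sub>F u in at_top. \<bar>f (pt u w')\<bar> <= C * u ^ wt p w' ka"
  using growth gen by (auto simp: generic_def)
 have "((%u. f (pt u w') / u ^ wt p w' ga) \<longlongrightarrow> cf p k f ga) at_top"
  using generic_tendsto[OF gen ga(1), of "cf p k f"] ga(3) cf(1)[OF f] by auto
 moreover have "((%u. f (pt u w') / u ^ wt p w' ga) \<longlongrightarrow> 0) at_top"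
 proof (rule Lim_null_comparison)
  show "\<forall>\<^sub>F u in at_top. norm (f (pt u w') / u ^ wt p w' ga) <= C * (u ^ wt p w' ka / u ^ wt p w' ga)"
   using C eventually_gt_at_top[of 0] by eventually_elim (simp add: divide_right_mono)
  have "((%u. C * (u ^ wt p w' ka / u ^ wt p w' ga)) \<longlongrightarrow> C * 0) at_top"
   using tendsto_power_ratio[of "wt p w' ka" "wt p w' ga"] less by (intro tendsto_intros) auto
  thus "((%u. C * (u ^ wt p w' ka / u ^ wt p w' ga)) \<longlongrightarrow> 0) at_top" by simp
 qed
 ultimately have "cf p k f ga = 0" by (rule tendsto_unique[OF trivial_limit_at_top_linorder])
 thus False using ga(2) by simp
qed

text \<open>Triangularity with respect to \<open>ka\<close>; the coefficient at \<open>ka\<close>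
  itself may vanish, so these functions form a vector space.\<close>

definition domf :: "nat => nat => (nat => nat) => ((nat => real) => real) => bool" where
 "domf p k ka f \<longleftrightarrow> hp p k f & (ALL al. cf p k f al ~= 0 --> dominated al ka)"

lemma domf_hp: "domf p k ka f ==> hp p k f"
 by (simp add: domf_def)

lemma domf_bound:
 assumes f: "domf p k ka f" and ka: "ka \<in> exponents p k"
  and x: "!!i j. i <= j ==> j < p ==> 0 <= x j & x j <= x i"
 shows "\<bar>f x\<bar> <= (\<Sum>al\<in>exponents p k. \<bar>cf p k f al\<bar>) * mon p ka x"
proof -
 have "\<bar>f x\<bar> = \<bar>\<Sum>al\<in>exponents p k. cf p k f al * mon p al x\<bar>" using cf(1)[OF domf_hp[OF f]] by (metis hom_poly_mon)
 also have "... <= (\<Sum>al\<in>exponents p k. \<bar>cf p k f al * mon p al x\<bar>)" by (rule sum_abs)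
 also have "... <= (\<Sum>al\<in>exponents p k. \<bar>cf p k f al\<bar> * mon p ka x)"
 proof (rule sum_mono)
  fix al assume al: "al \<in> exponents p k"
  have "0 <= mon p al x" unfolding mon_def using x by (intro prod_nonneg zero_le_power) blast
  thus "\<bar>cf p k f al * mon p al x\<bar> <= \<bar>cf p k f al\<bar> * mon p ka x" using mon_dominated[of al ka p k x] f al ka x
   by (cases "cf p k f al = 0") (auto simp: abs_mult domf_def)
 qed
 finally show ?thesis by (simp add: sum_distrib_right)
qed

lemma domf_tendsto:
 assumes f: "domf p k ka f" and ka: "ka \<in> exponents p k" and w: "dec p w"
 shows "((%u. f (pt u w) / u ^ wt p w ka) \<longlongrightarrow> cf p k f ka) at_top"
proof -
 have "((%u. hom_poly p k (cf p k f) (pt u w) / u ^ wt p w ka) \<longlongrightarrow>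
   (\<Sum>al\<in>exponents p k. if wt p w al = wt p w ka then cf p k f al else 0)) at_top"
 proof (rule tendsto_hom_poly)
  fix al assume al: "al \<in> exponents p k" "cf p k f al ~= 0"
  thus "wt p w al <= wt p w ka" using f wt_dominated_less[of al ka p k w] ka w by (fastforce simp: domf_def)
 qed
 also have "(\<Sum>al\<in>exponents p k. if wt p w al = wt p w ka then cf p k f al else 0)
   = (\<Sum>al\<in>exponents p k. if al = ka then cf p k f ka else 0)"
 proof (rule sum.cong)
  fix al assume al: "al \<in> exponents p k"
  show "(if wt p w al = wt p w ka then cf p k f al else 0) = (if al = ka then cf p k f ka else 0)"
   using wt_dominated_less[of al ka p k w] al ka w f
   by (cases "al = ka"; cases "cf p k f al = 0") (auto simp: domf_def)
 qed simp
 finally show ?thesis using ka cf(1)[OF domf_hp[OF f]] by simp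
qed

lemma domf_add: "domf p k ka f ==> domf p k ka g ==> domf p k ka (%x. f x + g x)"
 by (auto simp: domf_def hp_add cf_add) (metis add.right_neutral)

lemma domf_scale: "domf p k ka f ==> domf p k ka (%x. c * f x)"
 by (auto simp: domf_def hp_scale cf_scale)

subsection \<open>Symmetric polynomials\<close>

definition symf :: "nat => ((nat => real) => real) => bool" where
 "symf p f \<longleftrightarrow> (ALL \<pi> x. \<pi> permutes {..<p} --> f (x \<circ> \<pi>) = f x)"

lemma exponents_permute:
 assumes "\<pi> permutes {..<p}" "al \<in> exponents p k"
 shows "al \<circ> \<pi> \<in> exponents p k"
proof -
 show ?thesis using sum.permute[OF assms(1), of al] assms permutes_not_in[OF assms(1)] by (auto simp: exponents_def)
qed

lemma mon_permute:
 assumes "\<pi> permutes {..<p}"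
 shows "mon p (al \<circ> \<pi>) (x \<circ> \<pi>) = mon p al x"
 using prod.permute[OF assms, of "%i. x i ^ al i"] by (simp add: mon_def)

lemma hp_permute:
 assumes \<pi>: "\<pi> permutes {..<p}"
 shows "hom_poly p k a (x \<circ> \<pi>) = hom_poly p k (%al. a (al \<circ> \<pi>)) x"
proof -
 have inv: "inv \<pi> permutes {..<p}" "\<pi> \<circ> inv \<pi> = id" "inv \<pi> \<circ> \<pi> = id"
  using \<pi> by (simp_all add: permutes_inv permutes_inv_o)
 have "hom_poly p k (%al. a (al \<circ> \<pi>)) x = (\<Sum>al\<in>exponents p k. a (al \<circ> \<pi>) * mon p (al \<circ> \<pi>) (x \<circ> \<pi>))"
  by (simp add: hom_poly_mon mon_permute[OF \<pi>])
 also have "... = (\<Sum>al\<in>exponents p k. a al * mon p al (x \<circ> \<pi>))"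
 proof (rule sum.reindex_bij_witness[of _ "%al. al \<circ> inv \<pi>" "%al. al \<circ> \<pi>"])
 qed (use inv \<pi> in \<open>auto simp: exponents_permute comp_assoc\<close>)
 finally show ?thesis by (simp add: hom_poly_mon)
qed

lemma cf_permute:
 assumes f: "hp p k f" "symf p f" and \<pi>: "\<pi> permutes {..<p}"
 shows "cf p k f (al \<circ> \<pi>) = cf p k f al"
proof (cases "al \<in> exponents p k")
 case True
 have "f x = hom_poly p k (%al. cf p k f (al \<circ> \<pi>)) x" for x
  using f(2) \<pi> cf(1)[OF f(1)] hp_permute[OF \<pi>] unfolding symf_def by metis
 from cf_eqI[OF this f(1) True] show ?thesis by simp
next
 case False
 have "al \<circ> \<pi> \<notin> exponents p k"
 proof
  assume "al \<circ> \<pi> \<in> exponents p k"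
  from exponents_permute[OF permutes_inv[OF \<pi>] this] show False
   using False by (simp add: comp_assoc permutes_inv_o[OF \<pi>])
 qed
 thus ?thesis using cf(2)[OF f(1)] False by simp
qed

text \<open>Were the top exponent not non-increasing, swapping an inverted pair would, by symmetry,
  give another exponent of the support, of larger weight because \<open>w\<close> decreases.\<close>

lemma top_exponent_parts:
 assumes f: "hp p k f" "symf p f" and w: "generic p k w" and al: "al \<in> exponents p k" "cf p k f al ~= 0"
  and top: "!!ga. ga \<in> exponents p k ==> cf p k f ga ~= 0 ==> wt p w ga <= wt p w al"
 shows "al \<in> parts p k"
proof -
 have "al j <= al i" if "i <= j" for i j
 proof (rule ccontr)
  assume less: "~ al j <= al i"
  hence j: "j < p" using al(1) by (auto simp: exponents_def) (metis not_le not_less0)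
  have ij: "i < j" using that less by (cases "i = j") auto
  define \<pi> where "\<pi> = Transposition.transpose i j"
  have \<pi>: "\<pi> permutes {..<p}" unfolding \<pi>_def using ij j by (intro permutes_swap_id) auto
  have split: "wt p w ga = (\<Sum>l\<in>{..<p} - {i, j}. w l * ga l) + w i * ga i + w j * ga j" for ga
  proof -
   have "wt p w ga = (\<Sum>l\<in>insert i (insert j ({..<p} - {i, j})). w l * ga l)"
    unfolding wt_def using ij j by (intro sum.cong) auto
   thus ?thesis using ij by simp
  qed
  have "w i * al j + w j * al i <= w i * al i + w j * al j"
   using cf_permute[OF f \<pi>] al(2) top exponents_permute[OF \<pi> al(1)] by (fastforce simp: split \<pi>_def)
  moreover have "w j * (al j - al i) < w i * (al j - al i)" using w ij j less by (simp add: generic_def dec_def)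
  moreover have "al j = al i + (al j - al i)" using less by simp
  hence "w i * al j = w i * al i + w i * (al j - al i)" "w j * al j = w j * al i + w j * (al j - al i)"
   by (metis distrib_left)+
  ultimately show False by linarith
 qed
 thus ?thesis using al(1) by (auto simp: parts_def antimono_def)
qed

section \<open>Coordinate-free polynomials, and polynomials with continuous parameters\<close>

section \<open>Homogeneous polynomials on a vector space\<close>

text \<open>Generated from linear forms rather than given by coefficients: Taylor expansion,
  restriction to linear families and averaging then become rule inductions.\<close>

inductive hmp :: "nat => ('v::euclidean_space => real) => bool" where
 hmp_const: "hmp 0 (%_. c)"
| hmp_linear: "linear f ==> hmp (Suc 0) f"
| hmp_add: "hmp k f ==> hmp k g ==> hmp k (%x. f x + g x)"
| hmp_mult: "hmp k f ==> hmp l g ==> hmp (k + l) (%x. f x * g x)"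

lemma hmp_scale: "hmp k f ==> hmp k (%x. c * f x)"
 using hmp_mult[OF hmp_const, of k f c] by simp

lemma hmp_zero: "hmp k (%_. 0)"
proof (induction k)
 case (Suc k)
 have "hmp (Suc 0) (%_::'a. 0 :: real)" by (rule hmp_linear) (simp add: linear_zero)
 from hmp_mult[OF this Suc] show ?case by simp
qed (rule hmp_const)

lemma hmp_sum: "(!!i. i \<in> S ==> hmp k (f i)) ==> hmp k (%x. \<Sum>i\<in>S. f i x)"
 by (induction S rule: infinite_finite_induct) (auto intro: hmp_zero hmp_add)

lemma hmp_continuous: "hmp k f ==> continuous_on S f"
proof (induction rule: hmp.induct)
 case (hmp_linear f)
 thus ?case by (simp add: linear_continuous_on linear_conv_bounded_linear)
qed (auto intro: continuous_intros)

text \<open>Continuity of the coefficients in the parameter is what allows the coefficients of a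
  congruence \<open>adj Z ** dg x ** Z\<close> to be integrated over \<open>Z\<close>.\<close>

definition hpc :: "nat => nat => ('z::topological_space => (nat => real) => real) => bool" where
 "hpc p k G \<longleftrightarrow> (EX h. (ALL al. continuous_on UNIV (h al)) &
   (ALL z x. G z x = (\<Sum>al\<in>exponents p k. h al z * mon p al x)))"

lemma hpc_add: "hpc p k F ==> hpc p k G ==> hpc p k (%z x. F z x + G z x)"
proof -
 assume "hpc p k F" "hpc p k G"
 then obtain g h where *: "ALL al. continuous_on UNIV (g al)" "ALL z x. F z x = (\<Sum>al\<in>exponents p k. g al z * mon p al x)"
  "ALL al. continuous_on UNIV (h al)" "ALL z x. G z x = (\<Sum>al\<in>exponents p k. h al z * mon p al x)"
  unfolding hpc_def by blast
 show ?thesis unfolding hpc_def using *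
  by (intro exI[of _ "%al z. g al z + h al z"]) (auto intro!: continuous_intros simp: distrib_right sum.distrib)
qed

lemma hpc_monomial:
 assumes "al \<in> exponents p k" "continuous_on UNIV c"
 shows "hpc p k (%z x. c z * mon p al x)"
proof -
 have "c z * mon p al x = (\<Sum>ga\<in>exponents p k. (if ga = al then c z else 0) * mon p ga x)" for z x
 proof -
  have "(\<Sum>ga\<in>exponents p k. (if ga = al then c z else 0) * mon p ga x) = (\<Sum>ga\<in>exponents p k. if ga = al then c z * mon p al x else 0)"
   by (rule sum.cong) auto
  thus ?thesis using assms(1) by simp
 qed
 moreover have "continuous_on UNIV (%z. if ga = al then c z else 0)" for ga
  using assms(2) by (cases "ga = al") simp_all
 ultimately show ?thesis unfolding hpc_def by (intro exI[of _ "%ga z. if ga = al then c z else 0"] allI) auto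
qed

lemma hpc_zero: "hpc p k (%z x. 0)"
 unfolding hpc_def by (intro exI[of _ "%_ _. 0"]) simp

lemma hpc_sum: "(!!i. i \<in> S ==> hpc p k (F i)) ==> hpc p k (%z x. \<Sum>i\<in>S. F i z x)"
 by (induction S rule: infinite_finite_induct) (auto intro: hpc_zero hpc_add)

lemma hpc_mult:
 assumes "hpc p k F" "hpc p l G"
 shows "hpc p (k + l) (%z x. F z x * G z x)"
proof -
 obtain g h where g: "ALL al. continuous_on UNIV (g al)" "!!z x. F z x = (\<Sum>al\<in>exponents p k. g al z * mon p al x)"
  and h: "ALL al. continuous_on UNIV (h al)" "!!z x. G z x = (\<Sum>al\<in>exponents p l. h al z * mon p al x)"
  using assms unfolding hpc_def by blast
 have "hpc p (k + l) (%z x. \<Sum>al\<in>exponents p k. \<Sum>ga\<in>exponents p l. (g al z * h ga z) * mon p (%i. al i + ga i) x)"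
  using g(1) h(1) by (intro hpc_sum hpc_monomial continuous_intros) (auto simp: exponents_def sum.distrib)
 also have "(%z x. \<Sum>al\<in>exponents p k. \<Sum>ga\<in>exponents p l. (g al z * h ga z) * mon p (%i. al i + ga i) x)
   = (%z x. F z x * G z x)" unfolding g(2) h(2) sum_product
  by (intro ext sum.cong refl) (simp add: mon_def power_add prod.distrib)
 finally show ?thesis .
qed

lemma hmp_hpc:
 fixes e :: "nat => 'z::topological_space => 'v::euclidean_space"
 assumes "hmp k F" and e: "!!i. continuous_on UNIV (e i)"
 shows "hpc p k (%z x. F (\<Sum>i<p. x i *\<^sub>R e i z))"
 using assms(1)
proof induction
 case (hmp_const c)
 have "hpc p 0 (%z x. c * mon p (%_. 0) x)" by (rule hpc_monomial) (auto simp: exponents_def)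
 thus ?case by (simp add: mon_def)
next
 case (hmp_linear f)
 have cont: "continuous_on UNIV f" using hmp_linear by (simp add: linear_continuous_on linear_conv_bounded_linear)
 have "hpc p (Suc 0) (%z x. \<Sum>i<p. f (e i z) * mon p ((%_. 0)(i := 1)) x)"
 proof (intro hpc_sum hpc_monomial)
  fix i assume "i \<in> {..<p}"
  moreover have "(\<Sum>j<p. ((%_. 0)(i := 1)) j) = (\<Sum>j<p. if j = i then 1 else (0::nat))" by (rule sum.cong) auto
  ultimately show "(%_. 0)(i := 1) \<in> exponents p (Suc 0)" by (simp add: exponents_def)
  show "continuous_on UNIV (%z. f (e i z))" using continuous_on_compose2[OF cont e] by auto
 qed
 moreover have "(\<Sum>i<p. f (e i z) * mon p ((%_. 0)(i := 1)) x) = f (\<Sum>i<p. x i *\<^sub>R e i z)" for z x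
 proof -
  have "mon p ((%_. 0)(i := 1)) x = x i" if "i < p" for i
  proof -
   have "mon p ((%_. 0)(i := 1)) x = (\<Prod>j<p. if j = i then x i else 1)" unfolding mon_def by (rule prod.cong) auto
   thus ?thesis using that by simp
  qed
  thus ?thesis by (simp add: linear_sum[OF hmp_linear] linear_scale[OF hmp_linear] mult.commute)
 qed
 ultimately show ?case by simp
qed (auto intro: hpc_add hpc_mult)

section \<open>Invariant matrix polynomials as symmetric functions of the eigenvalues\<close>

section \<open>Power sums of eigenvalues\<close>

primrec mpow :: "quat^'m^'m => nat => quat^'m^'m" where
 "mpow A 0 = mat 1"
| "mpow A (Suc j) = A ** mpow A j"

definition ptr :: "nat => quat^'m^'m => real" where
 "ptr j A = qRe (trace (mpow A j))"

text \<open>Entries of powers are quaternions while \<open>hmp\<close> is real-valued; quantifying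
  over all linear functionals \<open>c\<close> absorbs the left multiplications that the recursion
  produces.\<close>

lemma hmp_mpow:
 assumes "linear c"
 shows "hmp j (%A :: quat^'m^'m. c (mpow A j $ i $ l))"
 using assms
proof (induction j arbitrary: i l c)
 case 0
 thus ?case by (simp add: hmp_const)
next
 case (Suc j)
 have expand: "c (mpow A (Suc j) $ i $ l) = (\<Sum>k\<in>UNIV. \<Sum>b\<in>Basis. (A $ i $ k \<bullet> b) * c (b * mpow A j $ k $ l))"
  for A :: "quat^'m^'m"
 proof -
  have rep: "c (q * r) = (\<Sum>b\<in>Basis. (q \<bullet> b) * c (b * r))" for q r
  proof -
   have "c (q * r) = c ((\<Sum>b\<in>Basis. (q \<bullet> b) *\<^sub>R b) * r)" by (simp add: euclidean_representation)
   thus ?thesis by (simp add: sum_distrib_right linear_sum[OF Suc.prems] linear_scale[OF Suc.prems])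
  qed
  have "c (mpow A (Suc j) $ i $ l) = (\<Sum>k\<in>UNIV. c (A $ i $ k * mpow A j $ k $ l))"
   by (simp add: matrix_mult_nth linear_sum[OF Suc.prems])
  also have "... = (\<Sum>k\<in>UNIV. \<Sum>b\<in>Basis. (A $ i $ k \<bullet> b) * c (b * mpow A j $ k $ l))" by (intro sum.cong refl rep)
  finally show ?thesis .
 qed
 have "hmp (Suc 0 + j) (%A :: quat^'m^'m. (A $ i $ k \<bullet> b) * c (b * mpow A j $ k $ l))" for k b
 proof (rule hmp_mult)
  show "hmp (Suc 0) (%A :: quat^'m^'m. A $ i $ k \<bullet> b)"
   by (rule hmp_linear, rule linearI) (simp_all add: inner_add_left)
  have "linear (%r. c (b * r))"
   by (rule linearI) (simp_all add: distrib_left linear_add[OF Suc.prems] linear_scale[OF Suc.prems])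
  thus "hmp j (%A :: quat^'m^'m. c (b * mpow A j $ k $ l))" by (rule Suc.IH)
 qed
 thus ?case unfolding expand by (intro hmp_sum) simp
qed

lemma linear_qRe: "linear qRe"
 by (rule linearI) simp_all

lemma hmp_ptr: "hmp j (ptr j :: quat^'m^'m => real)"
proof -
 have "ptr j = (%A :: quat^'m^'m. \<Sum>i\<in>UNIV. qRe (mpow A j $ i $ i))"
  by (simp add: fun_eq_iff ptr_def trace_def qRe_sum)
 thus ?thesis by (auto intro: hmp_sum hmp_mpow[OF linear_qRe])
qed

lemma ptr_commute:
 fixes P Q :: "quat^'m^'m"
 shows "ptr j (P ** Q) = ptr j (Q ** P)"
proof (cases j)
 case (Suc n)
 have eq: "mpow (P ** Q) (Suc n) = P ** mpow (Q ** P) n ** Q"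
 proof (induction n)
  case (Suc n)
  have "mpow (P ** Q) (Suc (Suc n)) = P ** Q ** mpow (P ** Q) (Suc n)" by simp
  also have "... = P ** Q ** (P ** mpow (Q ** P) n ** Q)" by (simp only: Suc)
  finally show ?case by (simp add: matrix_mul_assoc)
 qed simp
 have "ptr j (P ** Q) = qRe (trace (P ** mpow (Q ** P) n ** Q))" by (simp only: ptr_def Suc eq)
 also have "... = qRe (trace (Q ** (P ** mpow (Q ** P) n)))" by (rule qRe_trace_commute)
 finally show ?thesis by (simp add: ptr_def Suc matrix_mul_assoc)
qed (simp add: ptr_def)

lemma mpow_dg: "mpow (dg x) j = dg (%i. x i ^ j)"
 by (induction j) (simp_all add: dg_mult_dg)

lemma ptr_dg: "ptr j (dg x :: quat^'m^'m) = (\<Sum>i<CARD('m). x i ^ j)"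
 by (simp add: ptr_def mpow_dg qRe_trace_dg)

text \<open>Beyond unitary invariance, polynomials in power traces satisfy F(P Q) = F(Q P) for all
  square matrices, Hermitian or not; this is what moves factors around inside a congruence.\<close>

inductive psum :: "nat => (quat^'m^'m => real) => bool" where
 psum_const: "psum 0 (%_. c)"
| psum_ptr: "psum j (ptr j)"
| psum_add: "psum k F ==> psum k G ==> psum k (%A. F A + G A)"
| psum_mult: "psum k F ==> psum l G ==> psum (k + l) (%A. F A * G A)"

lemma psum_hmp: "psum k F ==> hmp k F"
 by (induction rule: psum.induct) (auto intro: hmp.intros hmp_ptr)

lemma psum_commute: "psum k F ==> F (P ** Q) = F (Q ** P)"
 by (induction rule: psum.induct) (auto simp: ptr_commute)

lemma psum_unitary:
 assumes "psum k F" "U \<in> unitary \<beta>"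
 shows "F (U ** A ** adj U) = F A"
 unfolding psum_commute[OF assms(1), of "U ** A"] by (simp add: unitary_cancel[OF assms(2)])

lemma psum_scale: "psum k F ==> psum k (%A. c * F A)"
 using psum_mult[OF psum_const, of k F c] by simp

lemma psum_zero: "psum k (%_. 0)"
 using psum_scale[OF psum_ptr, of k 0] by simp

lemma psum_sum: "(!!i. i \<in> S ==> psum k (F i)) ==> psum k (%A. \<Sum>i\<in>S. F i A)"
 by (induction S rule: infinite_finite_induct) (auto intro: psum_zero psum_add)

lemma symf_power_sum: "symf p (%x. \<Sum>i<p. x i ^ j)"
 unfolding symf_def
proof (intro allI impI)
 fix \<pi> and x :: "nat => real" assume "\<pi> permutes {..<p}"
 thus "(\<Sum>i<p. (x \<circ> \<pi>) i ^ j) = (\<Sum>i<p. x i ^ j)" using sum.permute[of \<pi> "{..<p}" "%i. x i ^ j"] by simp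
qed

lemma psum_dg:
 assumes "psum k (F :: quat^'m^'m => real)"
 shows "hp CARD('m) k (%x. F (dg x)) & symf CARD('m) (%x. F (dg x))"
 using assms
proof induction
 case (psum_const c)
 thus ?case by (simp add: hp_const symf_def)
next
 case (psum_ptr j)
 have "hp CARD('m) j (%x. \<Sum>i<CARD('m). x i ^ j)" by (rule hp_sum) (simp add: hp_coordinate_power)
 thus ?case by (simp add: ptr_dg symf_power_sum)
next
 case (psum_add k F G)
 thus ?case by (simp add: hp_add symf_def)
next
 case (psum_mult k F l G)
 thus ?case by (simp add: hp_mult symf_def)
qed

subsection \<open>Power sums generate the symmetric polynomials\<close>

definition dlists :: "nat => nat => nat list set" where
 "dlists p r = {ys. length ys = r & distinct ys & set ys \<subseteq> {..<p}}"

text \<open>The augmented monomial symmetric function: a monomial occurs once for every injective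
  assignment of variables producing it, so no stabilizers have to be divided out.\<close>

definition aug :: "nat => nat list => (nat => real) => real" where
 "aug p L x = (\<Sum>ys\<in>dlists p (length L). \<Prod>i<length L. x (ys ! i) ^ (L ! i))"

lemma finite_dlists [simp]: "finite (dlists p r)"
 unfolding dlists_def by (rule finite_subset[OF _ finite_lists_length_eq[of "{..<p}" r]]) auto

text \<open>In the product with the power sum of degree l the new index either avoids the indices in
  use, giving the longer list, or coincides with the i-th one and raises that exponent by l.
  Everything on the right has shorter lists, which drives the induction in
  \<open>aug_psum\<close>.\<close>

lemma aug_Cons:
 "aug p (l # L) x = (\<Sum>i<p. x i ^ l) * aug p L x - (\<Sum>i<length L. aug p (L[i := L ! i + l]) x)"
proof -
 let ?r = "length L"
 let ?m = "%ys. \<Prod>i<?r. x (ys ! i) ^ (L ! i)"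
 have "dlists p (Suc ?r) = (%(ys, y). y # ys) ` (SIGMA ys:dlists p ?r. {..<p} - set ys)"
  by (auto simp: dlists_def length_Suc_conv)
 hence "aug p (l # L) x =
   (\<Sum>zs\<in>(%(ys, y). y # ys) ` (SIGMA ys:dlists p ?r. {..<p} - set ys). \<Prod>i<Suc ?r. x (zs ! i) ^ ((l # L) ! i))"
  by (simp add: aug_def)
 also have "... = (\<Sum>(ys, y)\<in>(SIGMA ys:dlists p ?r. {..<p} - set ys). x y ^ l * ?m ys)"
 proof (subst sum.reindex)
  show "inj_on (%(ys, y). y # ys) (SIGMA ys:dlists p ?r. {..<p} - set ys)" by (auto simp: inj_on_def)
 qed (auto intro!: sum.cong simp: prod.lessThan_Suc_shift simp del: prod.lessThan_Suc)
 also have "... = (\<Sum>ys\<in>dlists p ?r. \<Sum>y\<in>{..<p} - set ys. x y ^ l * ?m ys)" by (rule sum.Sigma[symmetric]) auto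
 also have "... = (\<Sum>ys\<in>dlists p ?r. (\<Sum>i<p. x i ^ l) * ?m ys - (\<Sum>i<?r. x (ys ! i) ^ l * ?m ys))"
  by (simp add: dlists_def sum_diff sum.distinct_set_conv_list sum_list_sum_nth atLeast0LessThan sum_distrib_right)
 also have "... = (\<Sum>i<p. x i ^ l) * aug p L x - (\<Sum>i<?r. \<Sum>ys\<in>dlists p ?r. x (ys ! i) ^ l * ?m ys)"
  by (simp add: sum_subtractf aug_def sum_distrib_left) (rule sum.swap)
 also have "(\<Sum>i<?r. \<Sum>ys\<in>dlists p ?r. x (ys ! i) ^ l * ?m ys) = (\<Sum>i<?r. aug p (L[i := L ! i + l]) x)"
 proof (rule sum.cong)
  fix i assume i: "i \<in> {..<?r}"
  have "x (ys ! i) ^ l * ?m ys = (\<Prod>j<?r. x (ys ! j) ^ (L[i := L ! i + l] ! j))" for ys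
  proof -
   have "(\<Prod>j<?r. x (ys ! j) ^ (L[i := L ! i + l] ! j)) =
     (\<Prod>j<?r. (if j = i then x (ys ! i) ^ l else 1) * x (ys ! j) ^ (L ! j))"
    by (rule prod.cong) (auto simp: power_add mult.commute)
   also have "... = (\<Prod>j<?r. (if j = i then x (ys ! i) ^ l else 1)) * ?m ys" by (rule prod.distrib)
   finally show ?thesis using i by simp
  qed
  thus "(\<Sum>ys\<in>dlists p ?r. x (ys ! i) ^ l * ?m ys) = aug p (L[i := L ! i + l]) x" by (simp add: aug_def)
 qed simp
 finally show ?thesis .
qed

lemma aug_psum: "EX F :: quat^'m^'m => real. psum (sum_list L) F & (ALL x. F (dg x) = aug CARD('m) L x)"
proof (induction "length L" arbitrary: L)
 case 0
 moreover have "{ys :: nat list. ys = [] & distinct ys & set ys \<subseteq> {..<CARD('m)}} = {[]}" by auto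
 ultimately show ?case by (intro exI[of _ "%_. 1"]) (auto simp: psum_const aug_def dlists_def)
next
 case (Suc r)
 then obtain l L' where L: "L = l # L'" by (cases L) auto
 obtain G :: "quat^'m^'m => real" where G: "psum (sum_list L') G" "!!x. G (dg x) = aug CARD('m) L' x"
  using Suc L by force
 have "ALL i<length L'. EX F :: quat^'m^'m => real. psum (sum_list L) F & (ALL x. F (dg x) = aug CARD('m) (L'[i := L' ! i + l]) x)"
 proof (intro allI impI)
  fix i assume i: "i < length L'"
  have "sum_list (L'[i := L' ! i + l]) = sum_list L" using i by (simp add: sum_list_update L)
  thus "EX F :: quat^'m^'m => real. psum (sum_list L) F & (ALL x. F (dg x) = aug CARD('m) (L'[i := L' ! i + l]) x)"
   using Suc L Suc.hyps(1)[of "L'[i := L' ! i + l]"] by simp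
 qed
 then obtain H :: "nat => quat^'m^'m => real" where
  H: "!!i. i < length L' ==> psum (sum_list L) (H i)"
  "!!i x. i < length L' ==> H i (dg x) = aug CARD('m) (L'[i := L' ! i + l]) x" by metis
 have "psum (sum_list L) (%A. ptr l A * G A + (-1) * (\<Sum>i<length L'. H i A))"
  using psum_mult[OF psum_ptr G(1), of l] H(1) by (intro psum_add psum_scale psum_sum) (auto simp: L)
 moreover have "ptr l (dg x :: quat^'m^'m) * G (dg x) + (-1) * (\<Sum>i<length L'. H i (dg x)) = aug CARD('m) L x" for x
  by (simp add: L aug_Cons ptr_dg G(2) H(2))
 ultimately show ?case by (intro exI[of _ "%A. ptr l A * G A + (-1) * (\<Sum>i<length L'. H i A)"]) blast
qed

text \<open>Averaging over all orderings of the variables writes a symmetric polynomial through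
  \<open>aug\<close>, and \<open>aug_psum\<close> turns these into power sums.\<close>

lemma symf_psum:
 assumes f: "hp CARD('m) k f" "symf CARD('m) f"
 shows "EX F :: quat^'m^'m => real. psum k F & (ALL x. F (dg x) = f x)"
proof -
 define p where "p = CARD('m)"
 define N where "N = real (card (dlists p p))"
 have "[0..<p] \<in> dlists p p" by (auto simp: dlists_def)
 hence N: "N > 0" unfolding N_def using finite_dlists card_gt_0_iff by fastforce
 have avg: "N * f x = (\<Sum>al\<in>exponents p k. cf p k f al * aug p (map al [0..<p]) x)" for x
 proof -
  have "f x = (\<Sum>al\<in>exponents p k. cf p k f al * (\<Prod>i<p. x (ys ! i) ^ al i))" if "ys \<in> dlists p p" for ys
  proof -
   define \<pi> where "\<pi> = (%i. if i < p then ys ! i else i)"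
   have ys: "length ys = p" "distinct ys" "set ys \<subseteq> {..<p}" using that by (auto simp: dlists_def)
   have "inj_on \<pi> {..<p}" using ys by (auto simp: inj_on_def \<pi>_def nth_eq_iff_index_eq)
   moreover have "\<pi> ` {..<p} \<subseteq> {..<p}" using ys nth_mem by (fastforce simp: \<pi>_def)
   ultimately have "bij_betw \<pi> {..<p} {..<p}" by (simp add: bij_betw_def endo_inj_surj)
   hence "\<pi> permutes {..<p}" by (rule bij_imp_permutes) (simp add: \<pi>_def)
   hence "f x = hom_poly p k (cf p k f) (x \<circ> \<pi>)" using f(2) cf(1)[OF f(1)] unfolding symf_def p_def by simp
   thus ?thesis unfolding hom_poly_def by (simp add: \<pi>_def)
  qed
  hence "N * f x = (\<Sum>ys\<in>dlists p p. \<Sum>al\<in>exponents p k. cf p k f al * (\<Prod>i<p. x (ys ! i) ^ al i))"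
   by (simp add: N_def sum_constant[symmetric] cong: sum.cong)
  also have "... = (\<Sum>al\<in>exponents p k. \<Sum>ys\<in>dlists p p. cf p k f al * (\<Prod>i<p. x (ys ! i) ^ al i))" by (rule sum.swap)
  finally show ?thesis unfolding aug_def sum_distrib_left by simp
 qed
 have "ALL al:exponents p k. EX F :: quat^'m^'m => real. psum k F & (ALL x. F (dg x) = aug p (map al [0..<p]) x)"
 proof
  fix al assume "al \<in> exponents p k"
  thus "EX F :: quat^'m^'m => real. psum k F & (ALL x. F (dg x) = aug p (map al [0..<p]) x)"
   using aug_psum[of "map al [0..<p]", where 'm = 'm] by (simp add: exponents_def interv_sum_list_conv_sum_set_nat atLeast0LessThan p_def)
 qed
 then obtain H :: "(nat => nat) => quat^'m^'m => real" where
  H: "!!al. al \<in> exponents p k ==> psum k (H al)" "!!al x. al \<in> exponents p k ==> H al (dg x) = aug p (map al [0..<p]) x"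
  by metis
 have "psum k (%A. (1 / N) * (\<Sum>al\<in>exponents p k. cf p k f al * H al A))" using H(1) by (intro psum_scale psum_sum)
 moreover have "(1 / N) * (\<Sum>al\<in>exponents p k. cf p k f al * H al (dg x)) = f x" for x
 proof -
  have "(\<Sum>al\<in>exponents p k. cf p k f al * H al (dg x)) = N * f x" unfolding avg by (simp add: H(2))
  thus ?thesis using N by simp
 qed
 ultimately show ?thesis by (intro exI[of _ "%A. (1 / N) * (\<Sum>al\<in>exponents p k. cf p k f al * H al A)"]) blast
qed

subsection \<open>Unitarily invariant polynomials\<close>

text \<open>Invariance is asked only on Hermitian matrices, where the values on diagonal matrices
  determine the function.\<close>

definition invp :: "nat => nat => (quat^'m^'m => real) => bool" where
 "invp \<beta> k F \<longleftrightarrow> hmp k F & (ALL U:unitary \<beta>. ALL A:hermitian \<beta>. F (U ** A ** adj U) = F A)"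

lemma invpD:
 "invp \<beta> k F ==> hmp k F"
 "invp \<beta> k F ==> U \<in> unitary \<beta> ==> A \<in> hermitian \<beta> ==> F (U ** A ** adj U) = F A" by (simp_all add: invp_def)

lemma psum_invp: "psum k F ==> invp \<beta> k F"
 by (simp add: invp_def psum_hmp psum_unitary)

lemma invp_hermitian:
 assumes \<beta>: "\<beta> \<in> {1, 2, 4}" and F: "invp \<beta> k F" and A: "A \<in> hermitian \<beta>"
 shows "F A = F (dg (eigv \<beta> A))"
proof -
 obtain U where U: "U \<in> unitary \<beta>" "A = U ** dg (eigv \<beta> A) ** adj U" using eigv(2)[OF \<beta> A] by blast
 have "F (U ** dg (eigv \<beta> A) ** adj U) = F (dg (eigv \<beta> A))" by (rule invpD(2)[OF F U(1)]) simp
 thus ?thesis using U(2) by simp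
qed

definition permutation_mat :: "(nat => nat) => quat^'m^'m" where
 "permutation_mat \<pi> = (\<chi> i j. if ix j = \<pi> (ix i) then 1 else 0)"

lemma permutation_mat:
 assumes \<pi>: "\<pi> permutes {..<CARD('m)}"
 shows "(permutation_mat \<pi> :: quat^'m::finite^'m) \<in> unitary \<beta>"
  and "permutation_mat \<pi> ** dg x ** adj (permutation_mat \<pi>) = (dg (x \<circ> \<pi>) :: quat^'m::finite^'m)"
proof -
 let ?P = "permutation_mat \<pi> :: quat^'m^'m"
 have lt: "\<pi> (ix i) < CARD('m)" for i :: 'm using permutes_in_image[OF \<pi>, of "ix i"] by simp
 have inj: "\<pi> (ix i) = \<pi> (ix j) \<longleftrightarrow> i = j" for i j :: 'm using inj_eq[OF permutes_inj[OF \<pi>]] by simp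
 have PD: "(?P ** dg y ** adj ?P) $ i $ j = dg (y \<circ> \<pi>) $ i $ j" for y i j
 proof -
  obtain a :: 'm where a: "ix a = \<pi> (ix i)" using ix_surj[OF lt] by blast
  have "(?P ** dg y ** adj ?P) $ i $ j = (\<Sum>k\<in>UNIV. y (ix k) *\<^sub>R ?P $ i $ k * qcnj (?P $ j $ k))"
   by (simp add: matrix_mult_nth[of "?P ** dg y"] dg_mult_right)
  also have "... = (\<Sum>k\<in>UNIV. if k = a then y (ix a) *\<^sub>R qcnj (?P $ j $ a) else 0)"
   by (rule sum.cong) (auto simp: permutation_mat_def a[symmetric])
  also have "... = dg (y \<circ> \<pi>) $ i $ j" by (simp add: permutation_mat_def dg_nth a inj of_real_def)
  finally show ?thesis .
 qed
 thus "permutation_mat \<pi> ** dg x ** adj (permutation_mat \<pi>) = (dg (x \<circ> \<pi>) :: quat^'m^'m)" by (rule mat_eqI)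
 have "?P ** adj ?P = mat 1" using PD[of "%_. 1"] by (intro mat_eqI) (simp)
 moreover from this have "adj ?P ** ?P = mat 1" by (rule left_inverse_imp_right_inverse)
 ultimately show "?P \<in> unitary \<beta>" by (simp add: unitary_def Fmat_def permutation_mat_def)
qed

lemma dg_expand: "(dg x :: quat^'m^'m) = (\<Sum>i<CARD('m). x i *\<^sub>R dg (%j. if j = i then 1 else 0))"
proof (rule mat_eqI)
 fix a b :: 'm
 have "(\<Sum>i<CARD('m). x i *\<^sub>R dg (%j. if j = i then 1 else 0)) $ a $ b =
   (\<Sum>i<CARD('m). if i = ix a then (if a = b then of_real (x (ix a)) else 0) else (0::quat))"
  unfolding sum_component by (rule sum.cong) (auto simp: dg_nth of_real_def)
 thus "(dg x :: quat^'m^'m) $ a $ b = (\<Sum>i<CARD('m). x i *\<^sub>R dg (%j. if j = i then 1 else 0)) $ a $ b"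
  by (simp add: dg_nth)
qed

lemma continuous_on_adjoint [continuous_intros]:
 "continuous_on S f ==> continuous_on S (%x. adj (f x :: quat^'n^'m))"
proof -
 have "linear (adj :: quat^'n^'m => _)" by (rule linearI) simp_all
 hence "continuous_on UNIV (adj :: quat^'n^'m => _)" by (simp add: linear_continuous_on linear_conv_bounded_linear)
 thus "continuous_on S f ==> continuous_on S (%x. adj (f x :: quat^'n^'m))" by (rule continuous_on_compose2) auto
qed

lemma continuous_on_matrix_mult [continuous_intros]:
 fixes f :: "'z::topological_space => quat^'n^'m" and g :: "'z => quat^'k^'n"
 shows "continuous_on S f ==> continuous_on S g ==> continuous_on S (%x. f x ** g x)"
 unfolding matrix_matrix_mult_def by (intro continuous_intros)

text \<open>The congruence is linear in x, with matrix coefficients that depend continuously on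
  \<open>Z\<close>.\<close>

lemma congruence_coeffs:
 assumes "hmp k (F :: quat^'m^'m => real)"
 shows "EX h. (ALL al. continuous_on UNIV (h al)) &
   (ALL (Z::quat^'m^'m) x. F (adj Z ** dg x ** Z) = hom_poly CARD('m) k (%al. h al Z) x)"
proof -
 let ?e = "%i (Z::quat^'m^'m). adj Z ** dg (%j. if j = i then 1 else 0) ** Z"
 have eq: "adj Z ** dg x ** Z = (\<Sum>i<CARD('m). x i *\<^sub>R ?e i Z)" for x and Z :: "quat^'m^'m"
 proof -
  have lin: "linear (%A. adj Z ** A ** Z)" by (rule linearI) (simp_all add: matrix_mult_distribs)
  show ?thesis by (subst dg_expand) (simp add: linear_sum[OF lin] linear_scale[OF lin])
 qed
 have "hpc CARD('m) k (%Z x. F (\<Sum>i<CARD('m). x i *\<^sub>R ?e i Z))" by (rule hmp_hpc[OF assms]) (intro continuous_intros)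
 moreover have "(%(Z::quat^'m^'m) x. F (adj Z ** dg x ** Z)) = (%Z x. F (\<Sum>i<CARD('m). x i *\<^sub>R ?e i Z))"
  by (intro ext arg_cong[where f = F] eq)
 ultimately have "hpc CARD('m) k (%(Z::quat^'m^'m) x. F (adj Z ** dg x ** Z))" by (simp only:)
 thus ?thesis by (simp add: hpc_def hom_poly_mon)
qed

lemma invp_dg:
 assumes F: "invp \<beta> k (F :: quat^'m^'m => real)"
 shows "hp CARD('m) k (%x. F (dg x))" "symf CARD('m) (%x. F (dg x))"
proof -
 obtain h where "!!(Z::quat^'m^'m) x. F (adj Z ** dg x ** Z) = hom_poly CARD('m) k (%al. h al Z) x"
  using congruence_coeffs[OF invpD(1)[OF F]] by blast
 from this[of "mat 1"] show "hp CARD('m) k (%x. F (dg x))" by auto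
 show "symf CARD('m) (%x. F (dg x))" unfolding symf_def
 proof (intro allI impI)
  fix \<pi> x assume \<pi>: "\<pi> permutes {..<CARD('m)}"
  have "F (permutation_mat \<pi> ** dg x ** adj (permutation_mat \<pi>)) = F (dg x)"
   by (rule invpD(2)[OF F permutation_mat(1)[OF \<pi>]]) simp
  thus "F (dg (x \<circ> \<pi>)) = F (dg x)" by (simp add: permutation_mat(2)[OF \<pi>])
 qed
qed

lemma invp_eq_psum:
 assumes \<beta>: "\<beta> \<in> {1, 2, 4}" and F: "invp \<beta> k (F :: quat^'m^'m => real)"
 shows "EX G. psum k G & (ALL A:hermitian \<beta>. F A = G A)"
proof -
 from symf_psum[OF invp_dg[OF F]] obtain G :: "quat^'m^'m => real"
  where "psum k G & (ALL x. G (dg x) = F (dg x))" ..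
 hence G: "psum k G" "!!x. G (dg x) = F (dg x)" by auto
 have "F A = G A" if "A \<in> hermitian \<beta>" for A
  using invp_hermitian[OF \<beta> F that] invp_hermitian[OF \<beta> psum_invp[OF G(1)] that] G(2) by simp
 thus ?thesis using G(1) by blast
qed

text \<open>On Hermitian matrices the invariant polynomial agrees with one in power traces, for
  which cyclicity holds although \<open>P\<close> itself need not be Hermitian.\<close>

lemma invp_gram:
 assumes "\<beta> \<in> {1, 2, 4}" "invp \<beta> k F" "P \<in> Fmat \<beta>"
 shows "F (adj P ** P) = F (P ** adj P)"
proof -
 from invp_eq_psum[OF assms(1,2)] obtain G where G: "psum k G & (ALL A:hermitian \<beta>. F A = G A)" ..
 hence "G (adj P ** P) = G (P ** adj P)" by (intro psum_commute[of k]) simp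
 thus ?thesis using G hermitian_gram[OF assms(3)] by simp
qed

section \<open>A Casimir-type operator for congruences and its radial part\<close>

section \<open>The invariant second order operator\<close>

text \<open>\<open>F1\<close> is the derivative, \<open>F2\<close> a bilinear form giving half of
  the second one. Along linear substitutions both stay homogeneous of degree k, so the operator
  preserves the degree; continuity bounds the remainder on compact sets, for limits under the
  integral.\<close>

definition taylor2 :: "nat => ('v::euclidean_space => real) => ('v => 'v => real) => ('v => 'v => 'v => real)
   => ('v \<times> 'v \<times> 'v \<times> real => real) => bool" where
 "taylor2 k F F1 F2 R \<longleftrightarrow> (ALL A. linear (F1 A)) & (ALL A. bilinear (F2 A))
   & (ALL M. linear M --> hmp k (%A. F1 A (M A)))
   & (ALL M N. linear M --> linear N --> hmp k (%A. F2 A (M A) (N A)))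
   & continuous_on UNIV (%z. F1 (fst z) (snd z))
   & continuous_on UNIV (%z. F2 (fst z) (fst (snd z)) (snd (snd z)))
   & continuous_on UNIV R
   & (ALL A B C e. F (A + e *\<^sub>R B + e\<^sup>2 *\<^sub>R C) =
     F A + e * F1 A B + e\<^sup>2 * (F1 A C + F2 A B B) + e ^ 3 * R (A, B, C, e))"

lemma taylor2D:
 assumes "taylor2 k F F1 F2 R"
 shows "linear (F1 A)" "bilinear (F2 A)" "linear M ==> hmp k (%A. F1 A (M A))"
  "linear M ==> linear N ==> hmp k (%A. F2 A (M A) (N A))"
  "continuous_on UNIV (%z. F1 (fst z) (snd z))"
  "continuous_on UNIV (%z. F2 (fst z) (fst (snd z)) (snd (snd z)))"
  "continuous_on UNIV R"
  "F (A + e *\<^sub>R B + e\<^sup>2 *\<^sub>R C) = F A + e * F1 A B + e\<^sup>2 * (F1 A C + F2 A B B) + e ^ 3 * R (A, B, C, e)"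
 using assms unfolding taylor2_def by blast+

lemma continuous_on_compose_pair:
 assumes "continuous_on UNIV (%z. H (fst z) (snd z))" "continuous_on S f" "continuous_on S g"
 shows "continuous_on S (%z. H (f z) (g z))"
 using continuous_on_compose2[OF assms(1) continuous_on_Pair[OF assms(2,3)]] by simp

lemma continuous_on_compose_triple:
 assumes "continuous_on UNIV (%z. H (fst z) (fst (snd z)) (snd (snd z)))"
  "continuous_on S f" "continuous_on S g" "continuous_on S h"
 shows "continuous_on S (%z. H (f z) (g z) (h z))"
 using continuous_on_compose2[OF assms(1) continuous_on_Pair[OF assms(2) continuous_on_Pair[OF assms(3,4)]]] by simp

lemma taylor2_exists: "hmp k F ==> EX F1 F2 R. taylor2 k F F1 F2 R"
proof (induction rule: hmp.induct)
 case (hmp_const c)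
 show ?case by (intro exI[of _ "%_ _. 0"] exI[of _ "%_ _ _. 0"] exI[of _ "%_. 0"])
    (simp add: taylor2_def hmp.hmp_const bilinear_def linear_zero)
next
 case (hmp_linear f)
 have "continuous_on UNIV (%z::'a \<times> 'a. f (snd z))"
  using linear_continuous_on[OF linear_conv_bounded_linear[THEN iffD1, OF hmp_linear]]
  by (rule continuous_on_compose2) (auto intro: continuous_intros)
 thus ?case using linear_compose[OF _ hmp_linear] hmp_linear
  by (intro exI[of _ "%_. f"] exI[of _ "%_ _ _. 0"] exI[of _ "%_. 0"])
    (auto simp: taylor2_def o_def bilinear_def linear_zero linear_add linear_scale intro!: hmp.hmp_linear)
next
 case (hmp_add k F G)
 then obtain F1 F2 R G1 G2 S where F: "taylor2 k F F1 F2 R" and G: "taylor2 k G G1 G2 S" by blast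
 note FD = taylor2D[OF F] and GD = taylor2D[OF G]
 have "taylor2 k (%x. F x + G x) (%A B. F1 A B + G1 A B) (%A B C. F2 A B C + G2 A B C) (%z. R z + S z)"
  unfolding taylor2_def
 proof (intro conjI allI impI)
  show "linear (%B. F1 A B + G1 A B)" for A by (intro linear_compose_add FD GD)
  show "bilinear (%B C. F2 A B C + G2 A B C)" for A
   using FD(2)[of A] GD(2)[of A] by (auto simp: bilinear_def intro!: linear_compose_add)
  show "F (A + e *\<^sub>R B + e\<^sup>2 *\<^sub>R C) + G (A + e *\<^sub>R B + e\<^sup>2 *\<^sub>R C) =
   F A + G A + e * (F1 A B + G1 A B) + e\<^sup>2 * (F1 A C + G1 A C + (F2 A B B + G2 A B B))
   + e ^ 3 * (R (A, B, C, e) + S (A, B, C, e))" for A B C e unfolding FD(8) GD(8) by algebra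
 qed (auto intro!: hmp.hmp_add continuous_intros FD(3-7) GD(3-7))
 thus ?case by blast
next
 case (hmp_mult k F l G)
 then obtain F1 F2 R G1 G2 S where F: "taylor2 k F F1 F2 R" and G: "taylor2 l G G1 G2 S" by blast
 note FD = taylor2D[OF F] and GD = taylor2D[OF G]
 \<comment> \<open>All terms of order at least three in the product of the two expansions, divided
   by e^3.\<close>
 define T where "T = (%z. let A = fst z; B = fst (snd z); C = fst (snd (snd z)); e = snd (snd (snd z));
   f0 = F A; f1 = F1 A B; f2 = F1 A C + F2 A B B; g0 = G A; g1 = G1 A B; g2 = G1 A C + G2 A B B in
   f0 * S z + f1 * g2 + f2 * g1 + R z * g0 + e * (f1 * S z + f2 * g2 + R z * g1)
    + e\<^sup>2 * (f2 * S z + R z * g2) + e ^ 3 * R z * S z)"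
 note cont = continuous_on_compose2[OF hmp_continuous[OF hmp_mult.hyps(1)] _ subset_UNIV] continuous_on_compose2[OF hmp_continuous[OF hmp_mult.hyps(2)] _ subset_UNIV]
  continuous_on_compose_pair[OF FD(5)] continuous_on_compose_pair[OF GD(5)] continuous_on_compose_triple[OF FD(6)] continuous_on_compose_triple[OF GD(6)]
 have "taylor2 (k + l) (%x. F x * G x) (%A B. F1 A B * G A + F A * G1 A B)
   (%A B C. F2 A B C * G A + F1 A B * G1 A C + F A * G2 A B C) T" unfolding taylor2_def
 proof (intro conjI allI impI)
  show "linear (%B. F1 A B * G A + F A * G1 A B)" for A
   using linear_add[OF FD(1)[of A]] linear_add[OF GD(1)[of A]] linear_scale[OF FD(1)[of A]] linear_scale[OF GD(1)[of A]]
   by (intro linearI) (simp_all add: algebra_simps)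
  show "bilinear (%B C. F2 A B C * G A + F1 A B * G1 A C + F A * G2 A B C)" for A
  proof -
   have l: "linear (F2 A x)" "linear (%x. F2 A x y)" "linear (G2 A x)" "linear (%x. G2 A x y)" for x y
    using FD(2)[of A] GD(2)[of A] by (simp_all add: bilinear_def)
   note add = linear_add[OF FD(1)[of A]] linear_add[OF GD(1)[of A]] l[THEN linear_add]
   note scale = linear_scale[OF FD(1)[of A]] linear_scale[OF GD(1)[of A]] l[THEN linear_scale]
   show ?thesis unfolding bilinear_def by (intro conjI allI linearI) (simp_all add: add scale algebra_simps)
  qed
  show "hmp (k + l) (%A. F1 A (M A) * G A + F A * G1 A (M A))" if "linear M" for M
   by (intro hmp.hmp_add hmp.hmp_mult FD(3) GD(3) hmp_mult that)
  show "hmp (k + l) (%A. F2 A (M A) (N A) * G A + F1 A (M A) * G1 A (N A) + F A * G2 A (M A) (N A))"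
   if "linear M" "linear N" for M N by (intro hmp.hmp_add hmp.hmp_mult FD(3,4) GD(3,4) hmp_mult that)
  show "continuous_on UNIV (%z. F1 (fst z) (snd z) * G (fst z) + F (fst z) * G1 (fst z) (snd z))"
   by (intro continuous_intros cont)
  show "continuous_on UNIV (%z. F2 (fst z) (fst (snd z)) (snd (snd z)) * G (fst z)
    + F1 (fst z) (fst (snd z)) * G1 (fst z) (snd (snd z)) + F (fst z) * G2 (fst z) (fst (snd z)) (snd (snd z)))"
   by (intro continuous_intros cont)
  show "continuous_on UNIV T" unfolding T_def Let_def by (intro continuous_intros cont FD(7) GD(7))
  show "F (A + e *\<^sub>R B + e\<^sup>2 *\<^sub>R C) * G (A + e *\<^sub>R B + e\<^sup>2 *\<^sub>R C) =
   F A * G A + e * (F1 A B * G A + F A * G1 A B)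
   + e\<^sup>2 * (F1 A C * G A + F A * G1 A C + (F2 A B B * G A + F1 A B * G1 A B + F A * G2 A B B))
   + e ^ 3 * T (A, B, C, e)" for A B C e unfolding FD(8) GD(8) T_def Let_def fst_conv snd_conv by algebra
 qed
 thus ?case by blast
qed

definition cline :: "quat^'m^'m => quat^'m^'m => real => quat^'m^'m" where
 "cline B E e = adj (mat 1 + e *\<^sub>R E) ** B ** (mat 1 + e *\<^sub>R E)"

lemma cline_expand:
 "cline B E e = B + e *\<^sub>R (B ** E + adj E ** B) + e\<^sup>2 *\<^sub>R (adj E ** B ** E)"
 by (simp add: cline_def matrix_mult_distribs scaleR_add_right power2_eq_square)

text \<open>Symmetric, so that odd orders cancel; the limit is the coefficient of e^2, half of the
  second derivative.\<close>

definition sdiff :: "(quat^'m^'m => real) => quat^'m^'m => quat^'m^'m => real => real" where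
 "sdiff F B E e = (F (cline B E e) + F (cline B E (- e)) - 2 * F B) / (2 * e\<^sup>2)"

definition LLq :: "(quat^'m^'m => real) => quat^'m^'m => quat^'m^'m => real" where
 "LLq F B E = Lim (at 0) (sdiff F B E)"

text \<open>The directions form an orthonormal basis of the matrices over the division algebra;
  summing over a full basis is what makes the operator unitarily invariant.\<close>

definition LL :: "nat => (quat^'m^'m => real) => quat^'m^'m => real" where
 "LL \<beta> F B = (\<Sum>E\<in>Basis \<inter> Fmat \<beta>. LLq F B E)"

lemma taylor2_second_difference:
 assumes T: "taylor2 k F F1 F2 R"
 shows "((%e. (F (A + e *\<^sub>R B + e\<^sup>2 *\<^sub>R C) + F (A + (- e) *\<^sub>R B + (- e)\<^sup>2 *\<^sub>R C) - 2 * F A) / (2 * e\<^sup>2))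
   \<longlongrightarrow> F1 A C + F2 A B B) (at 0)"
proof -
 have "continuous_on UNIV (%e. R (A, B, C, e))" "continuous_on UNIV (%e. R (A, B, C, - e))"
  by (rule continuous_on_compose2[OF taylor2D(7)[OF T]]; auto intro!: continuous_intros)+
 hence "((%e. R (A, B, C, e)) \<longlongrightarrow> R (A, B, C, 0)) (at 0)" "((%e. R (A, B, C, - e)) \<longlongrightarrow> R (A, B, C, - 0)) (at 0)"
  unfolding continuous_on_def by blast+
 hence "((%e. F1 A C + F2 A B B + e * (R (A, B, C, e) - R (A, B, C, - e)) / 2) \<longlongrightarrow>
   F1 A C + F2 A B B + 0 * (R (A, B, C, 0) - R (A, B, C, - 0)) / 2) (at 0)" by (intro tendsto_intros) auto
 hence "((%e. F1 A C + F2 A B B + e * (R (A, B, C, e) - R (A, B, C, - e)) / 2) \<longlongrightarrow>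
   F1 A C + F2 A B B) (at 0)" by simp
 moreover have "\<forall>\<^sub>F e in at 0. F1 A C + F2 A B B + e * (R (A, B, C, e) - R (A, B, C, - e)) / 2 =
   (F (A + e *\<^sub>R B + e\<^sup>2 *\<^sub>R C) + F (A + (- e) *\<^sub>R B + (- e)\<^sup>2 *\<^sub>R C) - 2 * F A) / (2 * e\<^sup>2)"
 proof (rule eventually_at_filter[THEN iffD2], rule always_eventually, intro allI impI)
  fix e :: real assume "e ~= 0"
  show "F1 A C + F2 A B B + e * (R (A, B, C, e) - R (A, B, C, - e)) / 2 =
    (F (A + e *\<^sub>R B + e\<^sup>2 *\<^sub>R C) + F (A + (- e) *\<^sub>R B + (- e)\<^sup>2 *\<^sub>R C) - 2 * F A) / (2 * e\<^sup>2)"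
   using \<open>e ~= 0\<close> unfolding taylor2D(8)[OF T] by (simp add: field_simps power2_eq_square power3_eq_cube)
 qed
 ultimately show ?thesis by (rule Lim_transform_eventually)
qed

lemma sdiff_tendsto:
 assumes T: "taylor2 k F F1 F2 R"
 shows "(sdiff F B E \<longlongrightarrow> F1 B (adj E ** B ** E)
   + F2 B (B ** E + adj E ** B) (B ** E + adj E ** B)) (at 0)"
proof -
 have "sdiff F B E = (%e. (F (B + e *\<^sub>R (B ** E + adj E ** B) + e\<^sup>2 *\<^sub>R (adj E ** B ** E))
  + F (B + (- e) *\<^sub>R (B ** E + adj E ** B) + (- e)\<^sup>2 *\<^sub>R (adj E ** B ** E)) - 2 * F B) / (2 * e\<^sup>2))"
  by (rule ext) (simp only: sdiff_def cline_expand)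
 thus ?thesis by (simp only: taylor2_second_difference[OF T])
qed

lemma LLq_eq:
 assumes T: "taylor2 k F F1 F2 R"
 shows "LLq F B E = F1 B (adj E ** B ** E)
   + F2 B (B ** E + adj E ** B) (B ** E + adj E ** B)"
 unfolding LLq_def by (rule tendsto_Lim[OF _ sdiff_tendsto[OF T]]) simp

lemma LLq_tendsto:
 assumes "hmp k F"
 shows "(sdiff F B E \<longlongrightarrow> LLq F B E) (at 0)"
proof -
 obtain F1 F2 R where T: "taylor2 k F F1 F2 R" using taylor2_exists[OF assms] by blast
 show ?thesis using sdiff_tendsto[OF T] LLq_eq[OF T] by simp
qed

lemma linear_mat_ops:
 "linear (%B :: quat^'m^'m. adj E ** B ** E')" "linear (%B :: quat^'m^'m. B ** E + adj E ** B)"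
 "linear (%E :: quat^'m^'m. B ** E + adj E ** B)" "linear (%E' :: quat^'m^'m. adj E ** B ** E')"
 "linear (%E :: quat^'m^'m. adj E ** B ** E')" by (rule linearI; simp add: matrix_mult_distribs scaleR_add_right)+

lemma hmp_LLq: "hmp k F ==> hmp k (%B. LLq F B E)"
proof -
 assume "hmp k F"
 then obtain F1 F2 R where T: "taylor2 k F F1 F2 R" using taylor2_exists by blast
 show ?thesis unfolding LLq_eq[OF T] by (intro hmp_add taylor2D(3,4)[OF T] linear_mat_ops)
qed

lemma LLq_bilinear: "hmp k F ==> EX b. bilinear b & (ALL E. LLq F B E = b E E)"
proof -
 assume "hmp k F"
 then obtain F1 F2 R where T: "taylor2 k F F1 F2 R" using taylor2_exists by blast
 let ?b = "%E E'. F1 B (adj E ** B ** E') + F2 B (B ** E + adj E ** B) (B ** E' + adj E' ** B)"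
 have F2: "linear (F2 B x)" "linear (%x. F2 B x y)" for x y
  using taylor2D(2)[OF T, of B] by (simp_all add: bilinear_def)
 have "bilinear ?b" unfolding bilinear_def
 proof (intro conjI allI linear_compose_add)
  show "linear (%E'. F1 B (adj E ** B ** E'))" for E
   using linear_compose[OF linear_mat_ops(4) taylor2D(1)[OF T]] by (simp add: o_def)
  show "linear (%E. F1 B (adj E ** B ** E'))" for E'
   using linear_compose[OF linear_mat_ops(5) taylor2D(1)[OF T]] by (simp add: o_def)
  show "linear (%E'. F2 B (B ** E + adj E ** B) (B ** E' + adj E' ** B))" for E
   using linear_compose[OF linear_mat_ops(3) F2(1)] by (simp add: o_def)
  show "linear (%E. F2 B (B ** E + adj E ** B) (B ** E' + adj E' ** B))" for E'
   using linear_compose[OF linear_mat_ops(3) F2(2)] by (simp add: o_def)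
 qed
 thus ?thesis using LLq_eq[OF T] by blast
qed

text \<open>The trace of a bilinear form does not depend on the orthonormal basis. A part
  \<open>D\<close> of the standard basis is used because the division algebra spans only a subspace
  of the quaternion matrices.\<close>

lemma sum_quadratic_form_isometry:
 fixes b :: "'v::euclidean_space => 'v => real"
 assumes D: "D \<subseteq> Basis" and b: "bilinear b"
  and \<phi>: "!!E c. E \<in> D ==> c \<in> Basis ==> c \<notin> D ==> \<phi> E \<bullet> c = 0"
  and \<psi>: "!!E c. E \<in> D ==> c \<in> Basis ==> c \<notin> D ==> \<psi> E \<bullet> c = 0"
  and adj: "!!E G. E \<in> D ==> G \<in> D ==> \<phi> E \<bullet> G = E \<bullet> \<psi> G"
  and iso: "!!G H. G \<in> D ==> H \<in> D ==> \<psi> G \<bullet> \<psi> H = G \<bullet> H"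
 shows "(\<Sum>E\<in>D. b (\<phi> E) (\<phi> E)) = (\<Sum>E\<in>D. b E E)"
proof -
 have fin: "finite D" using D finite_Basis by (rule finite_subset)
 have rep: "v = (\<Sum>G\<in>D. (v \<bullet> G) *\<^sub>R G)" if "!!c. c \<in> Basis ==> c \<notin> D ==> v \<bullet> c = 0" for v
 proof -
  have "(\<Sum>G\<in>D. (v \<bullet> G) *\<^sub>R G) = (\<Sum>G\<in>Basis. (v \<bullet> G) *\<^sub>R G)" using D that by (intro sum.mono_neutral_left) auto
  thus ?thesis by (simp add: euclidean_representation)
 qed
 have b1: "linear (%x. b x y)" and b2: "linear (b x)" for x y using b by (simp_all add: bilinear_def)
 have "b (\<phi> E) (\<phi> E) = (\<Sum>G\<in>D. \<Sum>H\<in>D. (E \<bullet> \<psi> G) * (E \<bullet> \<psi> H) * b G H)" if "E \<in> D" for E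
 proof -
  have "\<phi> E = (\<Sum>G\<in>D. (\<phi> E \<bullet> G) *\<^sub>R G)" using \<phi> that by (intro rep) auto
  hence e: "\<phi> E = (\<Sum>G\<in>D. (E \<bullet> \<psi> G) *\<^sub>R G)" using adj that by simp
  have "b (\<Sum>G\<in>D. (E \<bullet> \<psi> G) *\<^sub>R G) y = (\<Sum>G\<in>D. (E \<bullet> \<psi> G) * b G y)" for y
   by (simp add: linear_sum[OF b1] linear_scale[OF b1])
  hence "b (\<phi> E) (\<phi> E) = (\<Sum>G\<in>D. (E \<bullet> \<psi> G) * b G (\<phi> E))" by (simp add: e)
  moreover have "b G (\<phi> E) = (\<Sum>H\<in>D. (E \<bullet> \<psi> H) * b G H)" for G by (simp add: e linear_sum[OF b2] linear_scale[OF b2])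
  ultimately show ?thesis by (simp add: sum_distrib_left mult.assoc)
 qed
 hence "(\<Sum>E\<in>D. b (\<phi> E) (\<phi> E)) = (\<Sum>E\<in>D. \<Sum>G\<in>D. \<Sum>H\<in>D. (E \<bullet> \<psi> G) * (E \<bullet> \<psi> H) * b G H)" by simp
 also have "... = (\<Sum>G\<in>D. \<Sum>E\<in>D. \<Sum>H\<in>D. (E \<bullet> \<psi> G) * (E \<bullet> \<psi> H) * b G H)" by (rule sum.swap)
 also have "... = (\<Sum>G\<in>D. \<Sum>H\<in>D. \<Sum>E\<in>D. (E \<bullet> \<psi> G) * (E \<bullet> \<psi> H) * b G H)" by (intro sum.cong refl sum.swap)
 also have "... = (\<Sum>G\<in>D. \<Sum>H\<in>D. (if G = H then b G H else 0))"
 proof (intro sum.cong refl)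
  fix G H assume GH: "G \<in> D" "H \<in> D"
  have "(\<Sum>E\<in>D. (E \<bullet> \<psi> G) * (E \<bullet> \<psi> H)) = \<psi> G \<bullet> (\<Sum>E\<in>D. (\<psi> H \<bullet> E) *\<^sub>R E)"
   by (simp add: inner_sum_right inner_commute mult.commute)
  also have "(\<Sum>E\<in>D. (\<psi> H \<bullet> E) *\<^sub>R E) = \<psi> H" using \<psi> GH by (intro rep[symmetric]) auto
  finally show "(\<Sum>E\<in>D. (E \<bullet> \<psi> G) * (E \<bullet> \<psi> H) * b G H) = (if G = H then b G H else 0)"
   using iso GH D by (simp add: inner_Basis subset_iff sum_distrib_right[symmetric])
 qed
 also have "... = (\<Sum>G\<in>D. b G G)" using fin by simp
 finally show ?thesis .
qed

definition el :: "'m::finite => 'm => quat => quat^'m^'m" where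
 "el i l q = axis i (axis l q)"

lemma el_nth: "el i l q $ a $ b = (if a = i & b = l then q else 0)"
 by (simp add: el_def axis_def)

lemma Basis_Fmat:
 "Basis \<inter> Fmat \<beta> = (%(i, l, q). el i l q :: quat^'m^'m) ` (UNIV \<times> UNIV \<times> (Basis \<inter> Falg \<beta>))"
proof -
 have mem: "el i l q \<in> Fmat \<beta> \<longleftrightarrow> q \<in> Falg \<beta>" for i l :: 'm and q by (auto simp: Fmat_def el_nth dest: spec[of _ l])
 show ?thesis using mem by (force simp: Basis_vec_def el_def)
qed

lemma inj_el: "inj_on (%(i, l, q). el i l q :: quat^'m^'m) (UNIV \<times> UNIV \<times> (Basis \<inter> Falg \<beta>))"
proof (rule inj_onI)
 fix x y :: "'m \<times> 'm \<times> quat"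
 assume "x \<in> UNIV \<times> UNIV \<times> (Basis \<inter> Falg \<beta>)" and xy: "(%(i, l, q). el i l q) x = (%(i, l, q). el i l q) y"
 moreover obtain i l q where x: "x = (i, l, q)" by (cases x) auto
 moreover obtain i' l' q' where y: "y = (i', l', q')" by (cases y) auto
 ultimately have q: "q \<in> Basis" and eq: "el i l q = el i' l' q'" by auto
 show "x = y"
  using arg_cong[OF eq, of "%A. A $ i $ l"] nonzero_Basis[OF q] x y by (auto simp: el_nth split: if_splits)
qed

lemma Fmat_inner_Basis: "A \<in> Fmat \<beta> ==> c \<in> Basis ==> c \<notin> Basis \<inter> Fmat \<beta> ==> (A :: quat^'m^'m) \<bullet> c = 0"
proof -
 assume A: "A \<in> Fmat \<beta>" and c: "c \<in> Basis" "c \<notin> Basis \<inter> Fmat \<beta>"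
 obtain i l q where q: "c = el i l q" "q \<in> Basis" using c(1) by (auto simp: Basis_vec_def el_def)
 have "q \<notin> Falg \<beta>"
 proof
  assume "q \<in> Falg \<beta>"
  hence "c \<in> Basis \<inter> Fmat \<beta>" unfolding Basis_Fmat using q by (intro image_eqI[of _ _ "(i, l, q)"]) auto
  thus False using c(2) by blast
 qed
 thus ?thesis using A q Falg_iff[of "A $ i $ l" \<beta>] by (simp add: el_def inner_axis Fmat_def)
qed

lemma inner_mat: "A \<bullet> B = qRe (trace (adj A ** (B :: quat^'n^'m)))"
proof -
 have "A \<bullet> B = (\<Sum>i\<in>UNIV. \<Sum>j\<in>UNIV. qRe (qcnj (A $ i $ j) * B $ i $ j))" by (simp add: inner_vec_def inner_quat)
 also have "... = (\<Sum>j\<in>UNIV. \<Sum>i\<in>UNIV. qRe (qcnj (A $ i $ j) * B $ i $ j))" by (rule sum.swap)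
 finally show ?thesis by (simp add: trace_def matrix_mult_nth qRe_sum)
qed

text \<open>Conjugation by a unitary matrix is an isometry of the matrix space over the algebra, so
  it preserves the trace of the quadratic form E -> LLq F B E.\<close>

lemma sum_LLq_conj:
 assumes F: "hmp k F" and U: "U \<in> unitary \<beta>"
 shows "(\<Sum>E\<in>Basis \<inter> Fmat \<beta>. LLq F B (adj U ** E ** U)) = (\<Sum>E\<in>Basis \<inter> Fmat \<beta>. LLq F B E)"
proof -
 obtain b where b: "bilinear b" "!!E. LLq F B E = b E E" using LLq_bilinear[OF F] by blast
 note UF = unitary_D(1)[OF U]
 have inner: "(adj U ** E ** U) \<bullet> G = E \<bullet> (U ** G ** adj U)" for E G
 proof -
  have "(adj U ** E ** U) \<bullet> G = qRe (trace (adj U ** (adj E ** U ** G)))"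
   by (simp add: inner_mat adjoint_mult matrix_mul_assoc)
  also have "... = qRe (trace (adj E ** U ** G ** adj U))" by (rule qRe_trace_commute)
  finally show ?thesis by (simp add: inner_mat matrix_mul_assoc)
 qed
 have iso: "(U ** G ** adj U) \<bullet> (U ** H ** adj U) = G \<bullet> H" for G H
 proof -
  have "(U ** G ** adj U) \<bullet> (U ** H ** adj U) = (adj U ** (U ** G ** adj U) ** U) \<bullet> H" by (rule inner[symmetric])
  thus ?thesis by (simp add: matrix_mul_assoc unitary_D[OF U] unitary_cancel[OF U])
 qed
 show ?thesis unfolding b(2) by (rule sum_quadratic_form_isometry[where \<psi> = "%G. U ** G ** adj U", OF _ b(1)])
    (use UF in \<open>auto intro: Fmat_inner_Basis inner iso\<close>)
qed

lemma cline_hermitian: "B \<in> hermitian \<beta> ==> E \<in> Fmat \<beta> ==> cline B E e \<in> hermitian \<beta>"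
 unfolding cline_def by (intro hermitian_congruence) auto

lemma cline_unitary:
 assumes U: "U \<in> unitary \<beta>"
 shows "cline (U ** B ** adj U) E e = U ** cline B (adj U ** E ** U) e ** adj U"
proof -
 have "mat 1 + e *\<^sub>R (adj U ** E ** U) = adj U ** (mat 1 + e *\<^sub>R E) ** U"
  by (simp add: matrix_mult_distribs unitary_D[OF U])
 hence "U ** cline B (adj U ** E ** U) e ** adj U = (U ** adj U) ** adj (mat 1 + e *\<^sub>R E) ** (U ** B ** adj U) ** (mat 1 + e *\<^sub>R E) ** (U ** adj U)"
  by (simp only: cline_def adjoint_mult adjoint_adjoint matrix_mul_assoc)
 thus ?thesis by (simp only: cline_def unitary_D[OF U] matrix_mul_lid matrix_mul_rid)
qed

lemma invp_LL:
 assumes F: "invp \<beta> k (F :: quat^'m^'m => real)"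
 shows "invp \<beta> k (LL \<beta> F)"
 unfolding invp_def
proof (intro conjI ballI)
 show "hmp k (LL \<beta> F)" unfolding LL_def[abs_def] by (intro hmp_sum hmp_LLq invpD(1)[OF F])
 fix U B :: "quat^'m^'m" assume U: "U \<in> unitary \<beta>" and B: "B \<in> hermitian \<beta>"
 note UF = unitary_D(1)[OF U]
 have "LLq F (U ** B ** adj U) E = LLq F B (adj U ** E ** U)" if "E \<in> Fmat \<beta>" for E
 proof -
  have "F (U ** cline B (adj U ** E ** U) e ** adj U) = F (cline B (adj U ** E ** U) e)" for e
   by (intro invpD(2)[OF F U] cline_hermitian B Fmat_mult that Fmat_intros UF)
  hence "sdiff F (U ** B ** adj U) E = sdiff F B (adj U ** E ** U)"
   by (intro ext) (simp add: sdiff_def cline_unitary[OF U] invpD(2)[OF F U B])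
  thus ?thesis by (simp add: LLq_def)
 qed
 hence "LL \<beta> F (U ** B ** adj U) = (\<Sum>E\<in>Basis \<inter> Fmat \<beta>. LLq F B (adj U ** E ** U))" by (simp add: LL_def)
 thus "LL \<beta> F (U ** B ** adj U) = LL \<beta> F B" by (simp only: sum_LLq_conj[OF invpD(1)[OF F] U] LL_def)
qed

subsection \<open>The operator on diagonal matrices\<close>

lemma el_mult: "el i l q ** el j m r = (if l = j then el i m (q * r) else 0)"
proof (rule mat_eqI)
 fix a b
 have "(el i l q ** el j m r) $ a $ b = (\<Sum>k\<in>UNIV. if k = l then (if a = i & l = j & b = m then q * r else 0) else 0)"
  unfolding matrix_mult_nth by (rule sum.cong) (auto simp: el_nth)
 thus "(el i l q ** el j m r) $ a $ b = (if l = j then el i m (q * r) else 0) $ a $ b" by (simp add: el_nth)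
qed

lemma dg_el: "dg x ** el i l q = x (ix i) *\<^sub>R el i l q" "el i l q ** dg x = x (ix l) *\<^sub>R el i l q"
 by (rule mat_eqI; auto simp: dg_mult_left dg_mult_right el_nth)+

lemma adjoint_el: "adj (el i l q) = el l i (qcnj q)"
 by (rule mat_eqI) (auto simp: el_nth)

lemma el_simps [simp]: "el i l (q + r) = el i l q + el i l r" "el i l (- q) = - el i l q" "el i l 0 = 0"
 by (rule mat_eqI; auto simp: el_nth)+

lemma dg_add_el: "dg x + c *\<^sub>R el i i 1 = dg (x(ix i := x (ix i) + c))"
 by (rule mat_eqI) (auto simp: el_nth dg_nth of_real_def scaleR_add_left)

text \<open>The Euler operator x_i d/dx_i written on coefficients, free of differentiability
  conditions; \<open>th2\<close> is likewise x_i^2 times the second derivative.\<close>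

definition th :: "nat => nat => ((nat => real) => real) => nat => (nat => real) => real" where
 "th p k f i x = (\<Sum>al\<in>exponents p k. cf p k f al * real (al i) * mon p al x)"

definition th2 :: "nat => nat => ((nat => real) => real) => nat => (nat => real) => real" where
 "th2 p k f i x = (\<Sum>al\<in>exponents p k. cf p k f al * (real (al i) * (real (al i) - 1)) * mon p al x)"

lemma sum_th: "hp p k f ==> (\<Sum>i<p. th p k f i x) = real k * f x"
proof -
 assume f: "hp p k f"
 have "(\<Sum>i<p. th p k f i x) = (\<Sum>al\<in>exponents p k. \<Sum>i<p. cf p k f al * real (al i) * mon p al x)"
  unfolding th_def by (rule sum.swap)
 also have "... = (\<Sum>al\<in>exponents p k. real k * (cf p k f al * mon p al x))"
 proof (rule sum.cong)
  fix al assume "al \<in> exponents p k"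
  thus "(\<Sum>i<p. cf p k f al * real (al i) * mon p al x) = real k * (cf p k f al * mon p al x)"
   by (simp add: exponents_def sum_distrib_left[symmetric] sum_distrib_right[symmetric] flip: of_nat_sum)
 qed simp
 also have "... = real k * hom_poly p k (cf p k f) x" by (simp add: hom_poly_mon sum_distrib_left)
 finally show ?thesis by (simp only: cf(1)[OF f, symmetric])
qed

lemma mon_update:
 "i < p ==> mon p al (x(i := t)) = t ^ al i * (\<Prod>j\<in>{..<p} - {i}. x j ^ al j)"
proof -
 assume i: "i < p"
 have "mon p al (x(i := t)) = (x(i := t)) i ^ al i * (\<Prod>j\<in>{..<p} - {i}. (x(i := t)) j ^ al j)"
  unfolding mon_def using i by (intro prod.remove) auto
 thus ?thesis by simp
qed

lemma partial_deriv_hom_poly: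
 assumes i: "i < p"
 shows "partial_deriv i (hom_poly p k a) x =
  (\<Sum>al\<in>exponents p k. a al * (real (al i) * x i ^ (al i - 1) * (\<Prod>j\<in>{..<p} - {i}. x j ^ al j)))"
 unfolding partial_deriv_def hom_poly_mon mon_update[OF i]
 by (rule DERIV_imp_deriv) (auto intro!: derivative_eq_intros sum.cong)

lemma partial_deriv2_hom_poly:
 assumes i: "i < p"
 shows "partial_deriv i (partial_deriv i (hom_poly p k a)) x =
  (\<Sum>al\<in>exponents p k. a al * (real (al i) * (real (al i - 1) * x i ^ (al i - 2)) * (\<Prod>j\<in>{..<p} - {i}. x j ^ al j)))"
proof -
 show ?thesis
  unfolding partial_deriv_hom_poly[OF i] partial_deriv_def[of i "partial_deriv i (hom_poly p k a)"] by (simp, (rule DERIV_imp_deriv, auto intro!: derivative_eq_intros sum.cong simp: numeral_2_eq_2))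
qed

lemma euler_partial:
 assumes f: "hp p k f" and i: "i < p"
 shows "x i * partial_deriv i f x = th p k f i x"
  and "(x i)\<^sup>2 * partial_deriv i (partial_deriv i f) x = th2 p k f i x"
proof -
 let ?r = "%al. \<Prod>j\<in>{..<p} - {i}. x j ^ al j"
 have mon: "mon p al x = x i ^ al i * ?r al" for al using mon_update[OF i, of al x "x i"] by simp
 have "x i * partial_deriv i (hom_poly p k (cf p k f)) x = th p k f i x"
  unfolding partial_deriv_hom_poly[OF i] th_def sum_distrib_left
 proof (rule sum.cong)
  fix al
  have eq: "x i * (real (al i) * x i ^ (al i - 1)) = real (al i) * x i ^ al i" by (cases "al i") auto
  have "x i * (cf p k f al * (real (al i) * x i ^ (al i - 1) * ?r al)) =
    cf p k f al * (x i * (real (al i) * x i ^ (al i - 1))) * ?r al" by (simp only: mult_ac)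
  also have "... = cf p k f al * (real (al i) * x i ^ al i) * ?r al" by (simp only: eq)
  finally show "x i * (cf p k f al * (real (al i) * x i ^ (al i - 1) * ?r al)) = cf p k f al * real (al i) * mon p al x"
   by (simp only: mon)
 qed simp
 thus "x i * partial_deriv i f x = th p k f i x" by (simp only: cf(1)[OF f, symmetric])
 have "(x i)\<^sup>2 * partial_deriv i (partial_deriv i (hom_poly p k (cf p k f))) x = th2 p k f i x"
  unfolding partial_deriv2_hom_poly[OF i] th2_def sum_distrib_left
 proof (rule sum.cong)
  fix al
  have eq: "(x i)\<^sup>2 * (real (al i) * (real (al i - 1) * x i ^ (al i - 2))) = real (al i) * (real (al i) - 1) * x i ^ al i"
  proof (cases "al i < 2")
   case True
   thus ?thesis by auto
  next
   case False
   hence "(x i)\<^sup>2 * x i ^ (al i - 2) = x i ^ al i" by (metis le_add_diff_inverse not_less power_add)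
   thus ?thesis using False by simp
  qed
  have "(x i)\<^sup>2 * (cf p k f al * (real (al i) * (real (al i - 1) * x i ^ (al i - 2)) * ?r al)) =
    cf p k f al * ((x i)\<^sup>2 * (real (al i) * (real (al i - 1) * x i ^ (al i - 2)))) * ?r al" by (simp only: mult_ac)
  also have "... = cf p k f al * (real (al i) * (real (al i) - 1) * x i ^ al i) * ?r al" by (simp only: eq)
  finally show "(x i)\<^sup>2 * (cf p k f al * (real (al i) * (real (al i - 1) * x i ^ (al i - 2)) * ?r al)) =
    cf p k f al * (real (al i) * (real (al i) - 1)) * mon p al x" by (simp only: mon)
 qed simp
 thus "(x i)\<^sup>2 * partial_deriv i (partial_deriv i f) x = th2 p k f i x" by (simp only: cf(1)[OF f, symmetric])
qed

lemma jack_operator_eq: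
 assumes f: "hp p k f"
 shows "jack_operator \<beta> p f x = (\<Sum>i<p. th2 p k f i x)
  + real \<beta> * (\<Sum>i<p. \<Sum>j\<in>{..<p} - {i}. x i / (x i - x j) * th p k f i x)"
proof -
 have "(x i)\<^sup>2 / (x i - x j) * partial_deriv i f x = x i / (x i - x j) * th p k f i x" if "i < p" for i j
  unfolding euler_partial(1)[OF f that, symmetric] by (simp add: power2_eq_square)
 thus ?thesis unfolding jack_operator_def using euler_partial(2)[OF f] by (auto intro!: sum.cong)
qed

lemma hp_scaled:
 assumes f: "hp p k f" and i: "i < p"
 shows "f (x(i := s * x i)) = (\<Sum>al\<in>exponents p k. cf p k f al * mon p al x * s ^ al i)"
proof -
 have "mon p al (x(i := s * x i)) = mon p al x * s ^ al i" for al
  using mon_update[OF i, of al x "x i"] by (simp add: mon_update[OF i] power_mult_distrib)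
 hence "hom_poly p k (cf p k f) (x(i := s * x i)) = (\<Sum>al\<in>exponents p k. cf p k f al * mon p al x * s ^ al i)"
  by (simp add: hom_poly_mon mult.assoc)
 thus ?thesis by (simp only: cf(1)[OF f, symmetric])
qed

lemma hp_scaled2:
 assumes f: "hp p k f" and i: "i < p" "l < p" "i ~= l"
 shows "f (x(i := s * x i, l := s * x l)) = (\<Sum>al\<in>exponents p k. cf p k f al * mon p al x * s ^ (al i + al l))"
proof -
 have "mon p al (x(i := s * x i)) = mon p al x * s ^ al i" for al
  using mon_update[OF i(1), of al x "x i"] by (simp add: mon_update[OF i(1)] power_mult_distrib)
 thus ?thesis using hp_scaled[OF f i(2), of "x(i := s * x i)" s] i(3) by (simp add: power_add mult.assoc)
qed

lemma one_plus_power_expand: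
 "EX r. continuous_on UNIV r & (ALL e::real. (1 + e) ^ N = 1 + real N * e + real N * (real N - 1) / 2 * e\<^sup>2 + e ^ 3 * r e)"
proof (induction N)
 case 0
 show ?case by (intro exI[of _ "%_. 0"]) auto
next
 case (Suc N)
 then obtain r where r: "continuous_on UNIV r"
  "!!e. (1 + e) ^ N = 1 + real N * e + real N * (real N - 1) / 2 * e\<^sup>2 + e ^ 3 * r e" by blast
 have "(1 + e) ^ Suc N = 1 + real (Suc N) * e + real (Suc N) * (real (Suc N) - 1) / 2 * e\<^sup>2
   + e ^ 3 * (real N * (real N - 1) / 2 + (1 + e) * r e)" for e
  by (simp add: r(2) field_simps power2_eq_square power3_eq_cube)
 thus ?case
  using r(1) by (intro exI[of _ "%e. real N * (real N - 1) / 2 + (1 + e) * r e"]) (auto intro!: continuous_intros)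
qed

lemma tendsto_power_even:
 "((%e::real. ((1 + e) ^ N + (1 - e) ^ N - 2) / (2 * e\<^sup>2)) \<longlongrightarrow> real N * (real N - 1) / 2) (at 0)"
proof -
 obtain r where r: "continuous_on UNIV r"
  "!!e::real. (1 + e) ^ N = 1 + real N * e + real N * (real N - 1) / 2 * e\<^sup>2 + e ^ 3 * r e"
  using one_plus_power_expand by blast
 have "continuous_on UNIV (%e. r (- e))" by (rule continuous_on_compose2[OF r(1)]) (auto intro: continuous_intros)
 hence "continuous_on UNIV (%e. real N * (real N - 1) / 2 + e * (r e - r (- e)) / 2)"
  using r(1) by (intro continuous_intros) auto
 hence "((%e. real N * (real N - 1) / 2 + e * (r e - r (- e)) / 2) \<longlongrightarrow> real N * (real N - 1) / 2) (at 0)"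
  unfolding continuous_on_def by (drule_tac bspec[of _ _ 0]) auto
 moreover have "\<forall>\<^sub>F e in at 0. real N * (real N - 1) / 2 + e * (r e - r (- e)) / 2 = ((1 + e) ^ N + (1 - e) ^ N - 2) / (2 * e\<^sup>2)"
 proof (rule eventually_at_filter[THEN iffD2], rule always_eventually, intro allI impI)
  fix e :: real assume "e ~= 0"
  have "(1 + e) ^ N + (1 + (- e)) ^ N - 2 = (2 * e\<^sup>2) * (real N * (real N - 1) / 2 + e * (r e - r (- e)) / 2)"
   unfolding r(2) by (simp add: field_simps power2_eq_square power3_eq_cube)
  thus "real N * (real N - 1) / 2 + e * (r e - r (- e)) / 2 = ((1 + e) ^ N + (1 - e) ^ N - 2) / (2 * e\<^sup>2)"
   using \<open>e ~= 0\<close> by simp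
 qed
 ultimately show ?thesis by (rule Lim_transform_eventually)
qed

lemma tendsto_power_square:
 "((%e::real. ((1 + e\<^sup>2) ^ n - 1) / e\<^sup>2) \<longlongrightarrow> real n) (at 0)"
proof -
 obtain r where r: "continuous_on UNIV r"
  "!!e::real. (1 + e) ^ n = 1 + real n * e + real n * (real n - 1) / 2 * e\<^sup>2 + e ^ 3 * r e"
  using one_plus_power_expand by blast
 have "continuous_on UNIV (%e. r (e\<^sup>2))" by (rule continuous_on_compose2[OF r(1)]) (auto intro: continuous_intros)
 hence "continuous_on UNIV (%e. real n + real n * (real n - 1) / 2 * e\<^sup>2 + e\<^sup>2 * e\<^sup>2 * r (e\<^sup>2))"
  by (intro continuous_intros)
 hence "((%e. real n + real n * (real n - 1) / 2 * e\<^sup>2 + e\<^sup>2 * e\<^sup>2 * r (e\<^sup>2)) \<longlongrightarrow> real n) (at 0)"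
  unfolding continuous_on_def by (drule_tac bspec[of _ _ 0]) auto
 moreover have "\<forall>\<^sub>F e in at 0. real n + real n * (real n - 1) / 2 * e\<^sup>2 + e\<^sup>2 * e\<^sup>2 * r (e\<^sup>2) = ((1 + e\<^sup>2) ^ n - 1) / e\<^sup>2"
  by (rule eventually_at_filter[THEN iffD2], rule always_eventually)
    (simp add: r(2) field_simps power3_eq_cube)
 ultimately show ?thesis by (rule Lim_transform_eventually)
qed

lemma second_difference_even:
 assumes "!!e. g e = (\<Sum>al\<in>A. c al * (1 + e\<^sup>2) ^ n al)"
 shows "((%e. (g e + g (- e) - 2 * g 0) / (2 * e\<^sup>2)) \<longlongrightarrow> (\<Sum>al\<in>A. c al * real (n al))) (at (0::real))"
proof -
 have "(g e + g (- e) - 2 * g 0) / (2 * e\<^sup>2) = (\<Sum>al\<in>A. c al * (((1 + e\<^sup>2) ^ n al - 1) / e\<^sup>2))" for e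
 proof -
  have "g e + g (- e) - 2 * g 0 = 2 * (\<Sum>al\<in>A. c al * ((1 + e\<^sup>2) ^ n al - 1))"
   by (simp add: assms right_diff_distrib sum_subtractf)
  thus ?thesis by (simp add: sum_divide_distrib)
 qed
 thus ?thesis by (simp only:) (intro tendsto_sum tendsto_mult tendsto_const tendsto_power_square)
qed

context
 fixes F :: "quat^'m::finite^'m => real" and f :: "(nat => real) => real" and k :: nat
 assumes F: "hmp k F" and f: "!!x. F (dg x) = f x" and hpf: "hp CARD('m) k f"
begin

text \<open>Scaling x_i by (1 + e)^2 turns exponent a into the factor (1 + e)^(2 a), whose
  e^2-coefficient is a (2 a - 1) = 2 a (a - 1) + a.\<close>

lemma LLq_diag_real:
 "LLq F (dg x) (el a a 1) = 2 * th2 CARD('m) k f (ix a) x + th CARD('m) k f (ix a) x"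
proof -
 let ?i = "ix a"
 have "mat 1 + e *\<^sub>R el a a 1 = (dg ((%_. 1)(?i := 1 + e)) :: quat^'m^'m)" for e
  unfolding dg_simps(2)[symmetric] by (simp only: dg_add_el)
 hence "cline (dg x) (el a a 1) e = dg (x(?i := (1 + e)\<^sup>2 * x ?i))" for e
  by (auto simp: cline_def dg_mult_dg power2_eq_square intro!: dg_cong)
 hence "sdiff F (dg x) (el a a 1) = (%e. \<Sum>al\<in>exponents CARD('m) k. cf CARD('m) k f al * mon CARD('m) al x *
   (((1 + e) ^ (2 * al ?i) + (1 - e) ^ (2 * al ?i) - 2) / (2 * e\<^sup>2)))"
 proof (intro ext)
  fix e
  have "f x = (\<Sum>al\<in>exponents CARD('m) k. cf CARD('m) k f al * mon CARD('m) al x * 1 ^ al ?i)"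
   using hp_scaled[OF hpf, of ?i x 1] by simp
  moreover have "f (x(?i := (1 + c)\<^sup>2 * x ?i)) =
   (\<Sum>al\<in>exponents CARD('m) k. cf CARD('m) k f al * mon CARD('m) al x * (1 + c) ^ (2 * al ?i))" for c
   using hp_scaled[OF hpf, of ?i x "(1 + c)\<^sup>2"] by (simp add: power_mult)
  ultimately have "f (x(?i := (1 + e)\<^sup>2 * x ?i)) + f (x(?i := (1 + - e)\<^sup>2 * x ?i)) - 2 * f x =
   (\<Sum>al\<in>exponents CARD('m) k. cf CARD('m) k f al * mon CARD('m) al x * ((1 + e) ^ (2 * al ?i) + (1 - e) ^ (2 * al ?i) - 2))"
   by (simp only: sum_distrib_left sum.distrib[symmetric] sum_subtractf[symmetric])
     (intro sum.cong refl, simp add: algebra_simps)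
  thus "sdiff F (dg x) (el a a 1) e = (\<Sum>al\<in>exponents CARD('m) k. cf CARD('m) k f al * mon CARD('m) al x *
   (((1 + e) ^ (2 * al ?i) + (1 - e) ^ (2 * al ?i) - 2) / (2 * e\<^sup>2)))"
   by (simp add: sdiff_def \<open>!!e. cline (dg x) (el a a 1) e = _\<close> f sum_divide_distrib)
 qed
 hence "(sdiff F (dg x) (el a a 1) \<longlongrightarrow> (\<Sum>al\<in>exponents CARD('m) k. cf CARD('m) k f al * mon CARD('m) al x *
   (real (2 * al ?i) * (real (2 * al ?i) - 1) / 2))) (at 0)"
  by (simp only:) (intro tendsto_sum tendsto_mult tendsto_const tendsto_power_even)
 hence "LLq F (dg x) (el a a 1) = (\<Sum>al\<in>exponents CARD('m) k. cf CARD('m) k f al * mon CARD('m) al x *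
   (real (2 * al ?i) * (real (2 * al ?i) - 1) / 2))" unfolding LLq_def by (intro tendsto_Lim) auto
 also have "... = 2 * th2 CARD('m) k f ?i x + th CARD('m) k f ?i x"
  unfolding th_def th2_def sum_distrib_left sum.distrib[symmetric] by (intro sum.cong refl) (simp add: field_simps)
 finally show ?thesis .
qed

text \<open>For purely imaginary q the terms linear in e cancel and x_i is scaled by 1 + e^2, so
  each monomial contributes its exponent.\<close>

lemma LLq_diag_imaginary:
 assumes q: "qRe q = 0" "norm q = 1"
 shows "LLq F (dg x) (el a a q) = th CARD('m) k f (ix a) x"
proof -
 let ?i = "ix a"
 have qq: "q + qcnj q = 0" "qcnj q * q = 1" using q by (simp add: quat_eq_iff) (simp add: qcnj_mult_self q)
 have "dg x ** el a a q + adj (el a a q) ** dg x = x ?i *\<^sub>R el a a (q + qcnj q)"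
  by (simp add: adjoint_el dg_el scaleR_add_right)
 also have "... = 0" unfolding qq by simp
 finally have "cline (dg x) (el a a q) e = dg x + e\<^sup>2 *\<^sub>R (x ?i *\<^sub>R el a a 1)" for e
  by (simp add: cline_expand adjoint_el dg_el matrix_mult_distribs el_mult qq)
 hence c: "cline (dg x) (el a a q) e = dg (x(?i := (1 + e\<^sup>2) * x ?i))" for e by (simp add: dg_add_el algebra_simps)
 define g where "g e = f (x(?i := (1 + e\<^sup>2) * x ?i))" for e
 have "g e = (\<Sum>al\<in>exponents CARD('m) k. cf CARD('m) k f al * mon CARD('m) al x * (1 + e\<^sup>2) ^ al ?i)" for e
  unfolding g_def by (rule hp_scaled[OF hpf]) simp
 from second_difference_even[OF this]
 have "((%e. (g e + g (- e) - 2 * g 0) / (2 * e\<^sup>2)) \<longlongrightarrow> (\<Sum>al\<in>exponents CARD('m) k. cf CARD('m) k f al * mon CARD('m) al x * real (al ?i))) (at 0)" .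
 moreover have "sdiff F (dg x) (el a a q) = (%e. (g e + g (- e) - 2 * g 0) / (2 * e\<^sup>2))"
  by (intro ext) (simp add: sdiff_def c f g_def)
 ultimately show ?thesis unfolding LLq_def th_def by (intro tendsto_Lim) (auto simp: mult_ac)
qed

text \<open>A perturbation purely of second order isolates \<open>F1\<close>, since
  \<open>F2\<close> vanishes in the zero direction.\<close>

lemma first_order_diag:
 assumes T: "taylor2 k F F1 F2 R"
 shows "x (ix a) * F1 (dg x) (el a a 1) = th CARD('m) k f (ix a) x"
proof -
 let ?i = "ix a"
 define g where "g e = f (x(?i := (1 + e\<^sup>2) * x ?i))" for e
 have "g e = (\<Sum>al\<in>exponents CARD('m) k. cf CARD('m) k f al * mon CARD('m) al x * (1 + e\<^sup>2) ^ al ?i)" for e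
  unfolding g_def by (rule hp_scaled[OF hpf]) simp
 from second_difference_even[OF this]
 have "((%e. (g e + g (- e) - 2 * g 0) / (2 * e\<^sup>2)) \<longlongrightarrow> th CARD('m) k f ?i x) (at 0)" by (simp add: th_def mult_ac)
 moreover have "F (dg x + e *\<^sub>R 0 + e\<^sup>2 *\<^sub>R (x ?i *\<^sub>R el a a 1)) = g e" for e
  by (simp add: dg_add_el f g_def algebra_simps)
 hence "((%e. (g e + g (- e) - 2 * g 0) / (2 * e\<^sup>2)) \<longlongrightarrow> F1 (dg x) (x ?i *\<^sub>R el a a 1) + F2 (dg x) 0 0) (at 0)"
  using taylor2_second_difference[OF T, of "dg x" 0 "x ?i *\<^sub>R el a a 1"] f by (simp add: g_def)
 ultimately have "th CARD('m) k f ?i x = F1 (dg x) (x ?i *\<^sub>R el a a 1) + F2 (dg x) 0 0"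
  by (rule tendsto_unique[rotated]) simp
 thus ?thesis
  using taylor2D(2)[OF T, of "dg x"] by (simp add: bilinear_def linear_0 linear_scale[OF taylor2D(1)[OF T]])
qed

text \<open>The direction is anti-Hermitian and squares to minus the identity on the plane of the
  two indices, so 1 + e E is there a unitary matrix times sqrt(1 + e^2). By invariance the
  congruence only scales the two eigenvalues by 1 + e^2.\<close>

lemma LLq_rotation:
 assumes inv: "!!V A. V \<in> unitary \<beta> ==> A \<in> hermitian \<beta> ==> F (V ** A ** adj V) = F A"
  and q: "q \<in> Falg \<beta>" "norm q = 1" and al: "a ~= l"
 shows "LLq F (dg x) (el a l q - el l a (qcnj q)) = th CARD('m) k f (ix a) x + th CARD('m) k f (ix l) x"
proof -
 let ?i = "ix a" and ?l = "ix l"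
 define E where "E = el a l q - el l a (qcnj q)"
 have qq: "qcnj q * q = 1" "q * qcnj q = 1" using q(2) by (simp_all add: qcnj_mult_self)
 have il: "?i ~= ?l" using al by simp
 have adjE: "adj E = - E" by (simp add: E_def adjoint_el)
 have EE: "E ** E = - (el a a 1 + el l l 1)" using al by (simp add: E_def matrix_mult_distribs el_mult qq)
 have E_in: "E \<in> Fmat \<beta>" using q(1) by (auto simp: E_def Fmat_def el_nth)
 have cl: "cline (dg x) E e = V ** dg (x(?i := (1 + e\<^sup>2) * x ?i, ?l := (1 + e\<^sup>2) * x ?l)) ** adj V & V \<in> unitary \<beta>"
  if V: "V = (mat 1 - e *\<^sub>R E) ** dg ((%_. 1)(?i := 1 / sqrt (1 + e\<^sup>2), ?l := 1 / sqrt (1 + e\<^sup>2)))" for e V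
 proof -
  define \<sigma> where "\<sigma> = (%_::nat. 1::real)(?i := sqrt (1 + e\<^sup>2), ?l := sqrt (1 + e\<^sup>2))"
  define \<tau> where "\<tau> = (%_::nat. 1::real)(?i := 1 / sqrt (1 + e\<^sup>2), ?l := 1 / sqrt (1 + e\<^sup>2))"
  have pos: "1 + e\<^sup>2 > 0" by (smt (verit) zero_le_power2)
  have st: "dg \<sigma> ** dg \<tau> = (mat 1 :: quat^'m^'m)" "dg \<tau> ** dg \<sigma> = (mat 1 :: quat^'m^'m)"
   unfolding dg_mult_dg using pos by (auto simp: \<sigma>_def \<tau>_def dg_simps(2)[symmetric] simp del: dg_simps(2) intro!: dg_cong)
  have comm: "dg \<tau> ** E = E ** dg \<tau>" by (simp add: E_def \<tau>_def matrix_mult_distribs dg_el)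
  have Vdef: "V = (mat 1 - e *\<^sub>R E) ** dg \<tau>" using V by (simp add: \<tau>_def)
  have adjV: "adj V = dg \<tau> ** (mat 1 + e *\<^sub>R E)" by (simp add: Vdef adjoint_mult adjE)
  have prod: "(mat 1 + e *\<^sub>R E) ** (mat 1 - e *\<^sub>R E) = dg \<sigma> ** dg \<sigma>"
  proof -
   have "(mat 1 + e *\<^sub>R E) ** (mat 1 - e *\<^sub>R E) = dg (%_. 1) + e\<^sup>2 *\<^sub>R el a a 1 + e\<^sup>2 *\<^sub>R el l l 1"
    by (simp add: matrix_mult_distribs power2_eq_square scaleR_add_right EE scaleR_diff_right)
   also have "... = dg (%i. \<sigma> i * \<sigma> i)" unfolding dg_add_el using il pos by (intro dg_cong) (auto simp: \<sigma>_def)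
   finally show ?thesis by (simp add: dg_mult_dg)
  qed
  have "adj V ** V = dg \<tau> ** ((mat 1 + e *\<^sub>R E) ** (mat 1 - e *\<^sub>R E)) ** dg \<tau>"
   by (simp only: adjV, simp only: Vdef matrix_mul_assoc)
  also have "... = (dg \<tau> ** dg \<sigma>) ** (dg \<sigma> ** dg \<tau>)" unfolding prod by (simp only: matrix_mul_assoc)
  finally have VV: "adj V ** V = mat 1" by (simp only: st matrix_mul_lid)
  moreover have "V \<in> Fmat \<beta>" unfolding Vdef using E_in by (intro Fmat_mult Fmat_intros(3,4) Fmat_one dg_simps)
  ultimately have VU: "V \<in> unitary \<beta>" using left_inverse_imp_right_inverse[OF VV] by (simp add: unitary_def)
  have "mat 1 - e *\<^sub>R E = V ** dg \<sigma>" unfolding Vdef by (simp add: matrix_mul_assoc[symmetric] st)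
  moreover have "mat 1 + e *\<^sub>R E = dg \<sigma> ** adj V" unfolding adjV by (simp add: matrix_mul_assoc st)
  moreover have "cline (dg x) E e = (mat 1 - e *\<^sub>R E) ** dg x ** (mat 1 + e *\<^sub>R E)" by (simp add: cline_def adjE)
  ultimately have "cline (dg x) E e = V ** dg \<sigma> ** dg x ** (dg \<sigma> ** adj V)" by (simp only:)
  also have "... = V ** (dg \<sigma> ** dg x ** dg \<sigma>) ** adj V" by (simp only: matrix_mul_assoc)
  also have "dg \<sigma> ** dg x ** dg \<sigma> = (dg (x(?i := (1 + e\<^sup>2) * x ?i, ?l := (1 + e\<^sup>2) * x ?l)) :: quat^'m^'m)"
   unfolding dg_mult_dg using pos by (intro dg_cong) (auto simp: \<sigma>_def)
  finally show ?thesis using VU by blast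
 qed
 define g where "g e = f (x(?i := (1 + e\<^sup>2) * x ?i, ?l := (1 + e\<^sup>2) * x ?l))" for e
 have Fg: "F (cline (dg x) E e) = g e" for e using cl[OF refl, of e] inv by (simp add: f g_def)
 have "g e = (\<Sum>al\<in>exponents CARD('m) k. cf CARD('m) k f al * mon CARD('m) al x * (1 + e\<^sup>2) ^ (al ?i + al ?l))" for e
  unfolding g_def by (rule hp_scaled2[OF hpf]) (use il in simp_all)
 from second_difference_even[OF this]
 have "((%e. (g e + g (- e) - 2 * g 0) / (2 * e\<^sup>2)) \<longlongrightarrow>
   (\<Sum>al\<in>exponents CARD('m) k. cf CARD('m) k f al * mon CARD('m) al x * real (al ?i + al ?l))) (at 0)" .
 moreover have "sdiff F (dg x) E = (%e. (g e + g (- e) - 2 * g 0) / (2 * e\<^sup>2))"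
  by (intro ext) (simp add: sdiff_def Fg, simp add: f g_def)
 ultimately have "LLq F (dg x) E = (\<Sum>al\<in>exponents CARD('m) k. cf CARD('m) k f al * mon CARD('m) al x * real (al ?i + al ?l))"
  unfolding LLq_def by (intro tendsto_Lim) auto
 thus ?thesis by (simp add: E_def th_def sum.distrib[symmetric] algebra_simps)
qed

text \<open>The unknown second derivative Q along the Hermitian direction \<open>S\<close> also
  occurs, multiplied by (x_a - x_l)^2, in the rotation direction, whose value is known. Solving for
  Q creates the quotient by x_a - x_l.\<close>

lemma LLq_offdiag:
 assumes inv: "!!V A. V \<in> unitary \<beta> ==> A \<in> hermitian \<beta> ==> F (V ** A ** adj V) = F A"
  and q: "q \<in> Falg \<beta>" "norm q = 1" and al: "a ~= l" and x: "x (ix a) ~= x (ix l)"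
 shows "LLq F (dg x) (el a l q) =
  x (ix a) * (th CARD('m) k f (ix a) x - th CARD('m) k f (ix l) x) / (x (ix a) - x (ix l))"
proof -
 let ?i = "ix a" and ?l = "ix l"
 obtain F1 F2 R where T: "taylor2 k F F1 F2 R" using taylor2_exists[OF F] by blast
 note lin = taylor2D(1)[OF T, of "dg x"]
 have bil: "linear (F2 (dg x) y)" "linear (%y. F2 (dg x) y z)" for y z
  using taylor2D(2)[OF T, of "dg x"] by (simp_all add: bilinear_def)
 have qq: "qcnj q * q = 1" "q * qcnj q = 1" using q(2) by (simp_all add: qcnj_mult_self)
 define S where "S = el a l q + el l a (qcnj q)"
 define d where "d j = F1 (dg x) (el j j 1)" for j
 define Q where "Q = F2 (dg x) S S"
 define E where "E = el a l q - el l a (qcnj q)"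
 have adjE: "adj E = - E" by (simp add: E_def adjoint_el)
 have th: "th CARD('m) k f (ix j) x = x (ix j) * d j" for j
  unfolding d_def by (rule first_order_diag[OF T, symmetric])
 have scaleQ: "F2 (dg x) (c *\<^sub>R S) (c *\<^sub>R S) = c\<^sup>2 * Q" for c
  by (simp add: Q_def linear_scale[OF bil(1)] linear_scale[OF bil(2)] power2_eq_square)
 have "adj (el a l q) ** dg x ** el a l q = x ?i *\<^sub>R el l l 1"
  by (simp add: adjoint_el dg_el matrix_mult_distribs el_mult qq)
 moreover have "dg x ** el a l q + adj (el a l q) ** dg x = x ?i *\<^sub>R S"
  by (simp add: adjoint_el dg_el S_def scaleR_add_right)
 ultimately have L: "LLq F (dg x) (el a l q) = x ?i * d l + (x ?i)\<^sup>2 * Q"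
  unfolding LLq_eq[OF T] by (simp add: scaleQ d_def linear_scale[OF lin])
 have "adj E ** dg x ** E = x ?l *\<^sub>R el a a 1 + x ?i *\<^sub>R el l l 1"
  unfolding adjE using al by (simp add: E_def matrix_mult_distribs dg_el el_mult qq)
 moreover have "dg x ** E + adj E ** dg x = (x ?i - x ?l) *\<^sub>R S"
  unfolding adjE by (simp add: E_def S_def matrix_mult_distribs dg_el algebra_simps)
 ultimately have "LLq F (dg x) E = x ?l * d a + x ?i * d l + (x ?i - x ?l)\<^sup>2 * Q"
  unfolding LLq_eq[OF T] by (simp add: scaleQ d_def linear_scale[OF lin] linear_add[OF lin])
 hence "(x ?i - x ?l) * ((x ?i - x ?l) * Q) = (x ?i - x ?l) * (d a - d l)"
  using LLq_rotation[OF inv q al, of x] by (simp add: E_def th algebra_simps power2_eq_square)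
 hence "(x ?i - x ?l) * Q = d a - d l" using x by simp
 hence Q: "Q = (d a - d l) / (x ?i - x ?l)" using x by (simp add: field_simps)
 show ?thesis unfolding L Q th using x by (simp add: field_simps power2_eq_square)
qed

end

lemma sum_swap_offdiag:
 fixes p :: nat
 shows "(\<Sum>i<p. \<Sum>j\<in>{..<p} - {i}. h i j) = (\<Sum>i<p. \<Sum>j\<in>{..<p} - {i}. h j i :: real)"
proof -
 have s: "{..<p} - {i} = {j \<in> {..<p}. i ~= j}" "{..<p} - {i} = {j \<in> {..<p}. j ~= i}" for i by auto
 have "(\<Sum>i<p. \<Sum>j\<in>{j \<in> {..<p}. i ~= j}. h i j) = (\<Sum>j<p. \<Sum>i\<in>{i \<in> {..<p}. i ~= j}. h i j)"
  by (rule sum.swap_restrict) auto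
 thus ?thesis by (simp only: s(1)[symmetric] s(2)[symmetric])
qed

lemma LL_diag:
 assumes \<beta>: "\<beta> \<in> {1, 2, 4}" and F: "invp \<beta> k (F :: quat^'m^'m => real)" and f: "!!x. F (dg x) = f x"
  and x: "inj_on x {..<CARD('m)}"
 shows "LL \<beta> F (dg x) = 2 * jack_operator \<beta> CARD('m) f x - real \<beta> * (real CARD('m) - 2) * real k * f x"
proof -
 let ?p = "CARD('m)"
 let ?D = "Basis \<inter> Falg \<beta>"
 have fun_f: "f = (%x. F (dg x))" using f by auto
 have hpf: "hp ?p k f" unfolding fun_f by (rule invp_dg(1)[OF F])
 note loc = invpD(1)[OF F] f hpf
 define t where "t = (%i. th ?p k f i x)"
 define t2 where "t2 = (%i. th2 ?p k f i x)"
 have one: "1 \<in> ?D" by (auto simp: Basis_quat_def quat_eq_iff)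
 have qD: "qRe q = 0 & norm q = 1 & q \<in> Falg \<beta>" if "q \<in> ?D" "q ~= 1" for q
  using that by (auto simp: Basis_quat_def quat_eq_iff)
 \<comment> \<open>One real direction contributes 2 t2 + t, each of the \<beta> - 1 imaginary ones
   contributes t.\<close>
 have diag: "(\<Sum>q\<in>?D. LLq F (dg x) (el a a q)) = 2 * t2 (ix a) + real \<beta> * t (ix a)" for a
 proof -
  have "(\<Sum>q\<in>?D. LLq F (dg x) (el a a q)) = LLq F (dg x) (el a a 1) + (\<Sum>q\<in>?D - {1}. LLq F (dg x) (el a a q))"
   using one by (intro sum.remove) auto
  also have "(\<Sum>q\<in>?D - {1}. LLq F (dg x) (el a a q)) = (\<Sum>q\<in>?D - {1}. t (ix a))"
   using qD by (intro sum.cong) (auto simp: t_def intro!: LLq_diag_imaginary[OF loc])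
  finally show ?thesis
   using card_Basis_Falg[OF \<beta>] one \<beta> unfolding LLq_diag_real[OF loc] by (auto simp: of_nat_diff t_def t2_def algebra_simps)
 qed
 have off: "(\<Sum>q\<in>?D. LLq F (dg x) (el a l q)) = real \<beta> * (x (ix a) * (t (ix a) - t (ix l)) / (x (ix a) - x (ix l)))"
  if "a ~= l" for a l
 proof -
  have "x (ix a) ~= x (ix l)" using inj_onD[OF x, of "ix a" "ix l"] that by auto
  moreover have "norm q = 1 & q \<in> Falg \<beta>" if "q \<in> ?D" for q using that by auto
  ultimately have "(\<Sum>q\<in>?D. LLq F (dg x) (el a l q)) = (\<Sum>q\<in>?D. x (ix a) * (t (ix a) - t (ix l)) / (x (ix a) - x (ix l)))"
   by (intro sum.cong) (auto simp: t_def intro!: LLq_offdiag[OF loc invpD(2)[OF F]])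
  thus ?thesis by (simp add: card_Basis_Falg[OF \<beta>])
 qed
 define G where "G = (%i j. x i * (t i - t j) / (x i - x j))"
 have "LL \<beta> F (dg x) = (\<Sum>(a, l, q)\<in>UNIV \<times> UNIV \<times> ?D. LLq F (dg x) (el a l q))"
  unfolding LL_def Basis_Fmat by (subst sum.reindex[OF inj_el]) (simp add: case_prod_unfold)
 also have "... = (\<Sum>a\<in>UNIV. \<Sum>l\<in>UNIV. \<Sum>q\<in>?D. LLq F (dg x) (el a l q))" by (simp add: sum.cartesian_product)
 also have "... = (\<Sum>a\<in>(UNIV::'m set). \<Sum>l\<in>(UNIV::'m set). if ix l = ix a then 2 * t2 (ix a) + real \<beta> * t (ix a) else real \<beta> * G (ix a) (ix l))"
  by (intro sum.cong) (auto simp: diag off G_def)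
 also have "... = (\<Sum>a\<in>(UNIV::'m set). \<Sum>j<?p. if j = ix a then 2 * t2 (ix a) + real \<beta> * t (ix a) else real \<beta> * G (ix a) j)"
  by (subst sum_ix[symmetric]) simp
 also have "... = (\<Sum>i<?p. \<Sum>j<?p. if j = i then 2 * t2 i + real \<beta> * t i else real \<beta> * G i j)"
  by (rule sum_ix[of "%i. \<Sum>j<?p. if j = i then 2 * t2 i + real \<beta> * t i else real \<beta> * G i j"])
 also have "... = (\<Sum>i<?p. 2 * t2 i + real \<beta> * t i + (\<Sum>j\<in>{..<?p} - {i}. real \<beta> * G i j))"
  by (intro sum.cong refl) (simp add: sum.remove[where g = "%j. if j = _ then _ else _ j"])
 also have "... = 2 * (\<Sum>i<?p. t2 i) + real \<beta> * (\<Sum>i<?p. t i) + real \<beta> * (\<Sum>i<?p. \<Sum>j\<in>{..<?p} - {i}. G i j)"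
  by (simp add: sum.distrib sum_distrib_left)
 \<comment> \<open>Swapping i and j in the second half and writing x_j / (x_j - x_i) = 1 - x_i /
   (x_i - x_j) doubles the Jack term and subtracts p - 1 Euler sums. With the term \<beta> t_i of
   the diagonal directions this leaves the constant -\<beta> (p - 2) k.\<close>
 also have "(\<Sum>i<?p. \<Sum>j\<in>{..<?p} - {i}. G i j) =
   2 * (\<Sum>i<?p. \<Sum>j\<in>{..<?p} - {i}. x i / (x i - x j) * t i) - (real ?p - 1) * (\<Sum>i<?p. t i)"
 proof -
  have "(\<Sum>i<?p. \<Sum>j\<in>{..<?p} - {i}. G i j) =
    (\<Sum>i<?p. \<Sum>j\<in>{..<?p} - {i}. x i / (x i - x j) * t i) - (\<Sum>i<?p. \<Sum>j\<in>{..<?p} - {i}. x i / (x i - x j) * t j)"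
   by (simp add: G_def right_diff_distrib diff_divide_distrib sum_subtractf)
  also have "(\<Sum>i<?p. \<Sum>j\<in>{..<?p} - {i}. x i / (x i - x j) * t j) = (\<Sum>i<?p. \<Sum>j\<in>{..<?p} - {i}. x j / (x j - x i) * t i)"
   by (rule sum_swap_offdiag)
  also have "... = (\<Sum>i<?p. \<Sum>j\<in>{..<?p} - {i}. t i - x i / (x i - x j) * t i)"
  proof (intro sum.cong refl)
   fix i j assume "i \<in> {..<?p}" "j \<in> {..<?p} - {i}"
   hence "x i - x j ~= 0" "x j - x i ~= 0" using x by (auto simp: inj_on_def)
   thus "x j / (x j - x i) * t i = t i - x i / (x i - x j) * t i" by (simp add: field_simps)
  qed
  also have "... = (real ?p - 1) * (\<Sum>i<?p. t i) - (\<Sum>i<?p. \<Sum>j\<in>{..<?p} - {i}. x i / (x i - x j) * t i)"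
   by (simp add: sum_subtractf sum_distrib_left)
  finally show ?thesis by simp
 qed
 finally show ?thesis
  using sum_th[OF hpf, of x] unfolding jack_operator_eq[OF hpf] t_def t2_def by (simp add: algebra_simps)
qed

section \<open>Triangularity of the Jack operator and its monic eigenfunctions\<close>

section \<open>Jack polynomials\<close>

lemma tendsto_quotient_difference:
 assumes "b < a"
 shows "((%u::real. u ^ a / (u ^ a - u ^ b)) \<longlongrightarrow> 1) at_top"
  and "((%u::real. u ^ b / (u ^ b - u ^ a)) \<longlongrightarrow> 0) at_top"
proof -
 have r: "((%u::real. u ^ b / u ^ a) \<longlongrightarrow> 0) at_top" using tendsto_power_ratio[of b a] assms by simp
 have "((%u::real. 1 / (1 - u ^ b / u ^ a)) \<longlongrightarrow> 1 / (1 - 0)) at_top" by (intro tendsto_intros r) auto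
 hence "((%u::real. 1 / (1 - u ^ b / u ^ a)) \<longlongrightarrow> 1) at_top" by simp
 moreover have "\<forall>\<^sub>F u::real in at_top. 1 / (1 - u ^ b / u ^ a) = u ^ a / (u ^ a - u ^ b)"
  using eventually_gt_at_top[of 0] by eventually_elim (simp add: field_simps)
 ultimately show "((%u::real. u ^ a / (u ^ a - u ^ b)) \<longlongrightarrow> 1) at_top" by (rule Lim_transform_eventually)
 have "((%u::real. (u ^ b / u ^ a) / (u ^ b / u ^ a - 1)) \<longlongrightarrow> 0 / (0 - 1)) at_top" by (intro tendsto_intros r) auto
 hence "((%u::real. (u ^ b / u ^ a) / (u ^ b / u ^ a - 1)) \<longlongrightarrow> 0) at_top" by simp
 moreover have "\<forall>\<^sub>F u::real in at_top. (u ^ b / u ^ a) / (u ^ b / u ^ a - 1) = u ^ b / (u ^ b - u ^ a)"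
  using eventually_gt_at_top[of 0]
 proof eventually_elim
  case (elim u)
  hence "u ^ b / u ^ a - 1 = (u ^ b - u ^ a) / u ^ a" by (simp add: field_simps)
  thus ?case using elim by simp
 qed
 ultimately show "((%u::real. u ^ b / (u ^ b - u ^ a)) \<longlongrightarrow> 0) at_top" by (rule Lim_transform_eventually)
qed

lemma sum_le_sum_initial:
 assumes "antimono (ka :: nat => nat)" "finite S" "card S = j"
 shows "sum ka S <= sum ka {..<j}"
proof -
 have c: "card (S - {..<j}) = card ({..<j} - S)"
  using assms by (metis card_lessThan card_Diff_subset_Int finite_Int inf_commute)
 have "sum ka (S - {..<j}) <= card (S - {..<j}) * ka j"
  using assms(1) by (intro sum_bounded_above[where 'a = nat, simplified]) (auto simp: antimono_def)
 also have "... <= sum ka ({..<j} - S)"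
  unfolding c using assms(1) by (intro sum_bounded_below[where 'a = nat, simplified]) (auto simp: antimono_def)
 finally have "sum ka (S \<inter> {..<j}) + sum ka (S - {..<j}) <= sum ka (S \<inter> {..<j}) + sum ka ({..<j} - S)" by simp
 thus ?thesis using assms(2) sum.Int_Diff[of "{..<j}" ka S] by (simp add: sum.Int_Diff[symmetric] Int_commute)
qed

lemma dominated_permute:
 assumes ka: "ka \<in> parts p k" and \<pi>: "\<pi> permutes {..<p}"
 shows "dominated (ka \<circ> \<pi>) ka"
 unfolding dominated_def
proof
 fix j
 have "(\<Sum>i<j. (ka \<circ> \<pi>) i) = sum ka (\<pi> ` {..<j})"
  using permutes_inj[OF \<pi>] by (simp add: sum.reindex inj_on_subset[OF _ subset_UNIV])
 also have "... <= sum ka {..<j}"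
  using ka permutes_inj[OF \<pi>] by (intro sum_le_sum_initial) (auto simp: parts_def card_image inj_on_subset)
 finally show "(\<Sum>i<j. (ka \<circ> \<pi>) i) <= (\<Sum>i<j. ka i)" .
qed

text \<open>The sum runs over permutations rather than over the orbit, so every monomial is counted
  as often as the stabilizer of \<open>ka\<close> has elements; positivity of the leading
  coefficient suffices below.\<close>

definition msym :: "nat => (nat => nat) => (nat => real) => real" where
 "msym p ka x = (\<Sum>\<pi>\<in>{\<pi>. \<pi> permutes {..<p}}. mon p (ka \<circ> \<pi>) x)"

lemma cf_mon: "al \<in> exponents p k ==> cf p k (mon p al) ga = (if ga = al then 1 else 0)"
proof -
 assume al: "al \<in> exponents p k"
 show ?thesis
 proof (cases "ga \<in> exponents p k")
  case True
  have "mon p al x = hom_poly p k (%ga. if ga = al then 1 else 0) x" for x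
  proof -
   have "hom_poly p k (%ga. if ga = al then 1 else 0) x = (\<Sum>ga\<in>exponents p k. if ga = al then mon p al x else 0)"
    unfolding hom_poly_mon by (rule sum.cong) auto
   thus ?thesis using al by simp
  qed
  from cf_eqI[OF this hp_mon[OF al] True] show ?thesis by simp
 qed (use al cf(2)[OF hp_mon[OF al]] in auto)
qed

lemma msym:
 assumes ka: "ka \<in> parts p k"
 shows "domf p k ka (msym p ka)" "symf p (msym p ka)" "cf p k (msym p ka) ka > 0"
proof -
 let ?\<Pi> = "{\<pi>. \<pi> permutes {..<p}}"
 have fin: "finite ?\<Pi>" by (rule finite_permutations) simp
 have e: "ka \<circ> \<pi> \<in> exponents p k" if "\<pi> \<in> ?\<Pi>" for \<pi> using exponents_permute that ka parts_subset by blast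
 have hp: "hp p k (msym p ka)" unfolding msym_def[abs_def] by (intro hp_sum hp_mon e)
 have cf: "cf p k (msym p ka) al = (\<Sum>\<pi>\<in>?\<Pi>. if al = ka \<circ> \<pi> then 1 else 0)" for al
  unfolding msym_def[abs_def] using e by (subst cf_sum) (auto simp: hp_mon cf_mon intro!: sum.cong)
 show "domf p k ka (msym p ka)" unfolding domf_def
 proof (intro conjI allI impI hp)
  fix al assume "cf p k (msym p ka) al ~= 0"
  then obtain \<pi> where "\<pi> \<in> ?\<Pi>" "(if al = ka \<circ> \<pi> then 1 else 0 :: real) ~= 0"
   unfolding cf by (rule sum.not_neutral_contains_not_neutral)
  thus "dominated al ka" using dominated_permute[OF ka] by (simp split: if_splits)
 qed
 have "1 <= (\<Sum>\<pi>\<in>?\<Pi>. if ka = ka \<circ> \<pi> then 1 else (0::real))"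
  using member_le_sum[of id ?\<Pi> "%\<pi>. if ka = ka \<circ> \<pi> then 1 else (0::real)"] fin by simp
 thus "cf p k (msym p ka) ka > 0" unfolding cf by linarith
 show "symf p (msym p ka)" unfolding symf_def
 proof (intro allI impI)
  fix \<sigma> and x :: "nat => real" assume \<sigma>: "\<sigma> permutes {..<p}"
  have inv: "inv \<sigma> permutes {..<p}" "\<sigma> \<circ> inv \<sigma> = id" "inv \<sigma> \<circ> \<sigma> = id"
   using \<sigma> by (simp_all add: permutes_inv permutes_inv_o)
  have "msym p ka x = (\<Sum>\<pi>\<in>?\<Pi>. mon p (ka \<circ> \<pi> \<circ> \<sigma>) (x \<circ> \<sigma>))" by (simp add: msym_def mon_permute[OF \<sigma>])
  also have "... = (\<Sum>\<pi>\<in>?\<Pi>. mon p (ka \<circ> \<pi>) (x \<circ> \<sigma>))"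
   by (rule sum.reindex_bij_witness[of _ "%\<pi>. \<pi> \<circ> inv \<sigma>" "%\<pi>. \<pi> \<circ> \<sigma>"])
     (use \<sigma> inv in \<open>auto simp: comp_assoc intro: permutes_compose\<close>)
  finally show "msym p ka (x \<circ> \<sigma>) = msym p ka x" by (simp add: msym_def)
 qed
qed

lemma symf_add: "symf p f ==> symf p g ==> symf p (%x. f x + g x)"
 and symf_scale: "symf p f ==> symf p (%x. c * f x)"
 and symf_diff: "symf p f ==> symf p g ==> symf p (%x. f x - g x)"
 by (simp_all add: symf_def)

text \<open>The eigenvalue seen on a leading monomial: along monomial curves x_i / (x_i - x_j) tends
  to 1 for i < j and to 0 for i > j, and index i has p - 1 - i later indices.\<close>

definition rho :: "nat => nat => (nat => nat) => real" where
 "rho \<beta> p al = (\<Sum>i<p. real (al i) * (real (al i) - 1)) + real \<beta> * (\<Sum>i<p. real (al i) * real (p - Suc i))"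

text \<open>Both degrees are k, so the linear parts agree. The sum of squares weakly increases,
  using first \<open>al\<close> and then \<open>ka\<close> as weights, and the staircase part
  increases strictly.\<close>

lemma rho_less:
 assumes "\<beta> > 0" "al \<in> parts p k" "ka \<in> parts p k" "dominated al ka" "al ~= ka"
 shows "rho \<beta> p al < rho \<beta> p ka"
proof -
 have e: "al \<in> exponents p k" "ka \<in> exponents p k" and anti: "antimono al" "antimono ka"
  using assms(2,3) by (auto simp: parts_def)
 have "wt p al al <= wt p al ka" using anti(1) by (intro wt_dominated_le[OF assms(4) e]) (auto simp: antimono_def)
 also have "... = wt p ka al" by (simp add: wt_def mult.commute)
 also have "... <= wt p ka ka" using anti(2) by (intro wt_dominated_le[OF assms(4) e]) (auto simp: antimono_def)
 finally have sq: "(\<Sum>i<p. real (al i) * real (al i)) <= (\<Sum>i<p. real (ka i) * real (ka i))"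
  unfolding wt_def by (simp flip: of_nat_mult of_nat_sum)
 have lin: "(\<Sum>i<p. real (ga i)) = real k" if "ga \<in> exponents p k" for ga
  using that by (simp add: exponents_def flip: of_nat_sum)
 have "(\<Sum>i<p. (p - Suc i) * al i) < (\<Sum>i<p. (p - Suc i) * ka i)"
  by (rule dominated_staircase_less[OF assms(4) e assms(5)])
 hence "(\<Sum>i<p. real (al i) * real (p - Suc i)) < (\<Sum>i<p. real (ka i) * real (p - Suc i))"
  unfolding of_nat_less_iff[where 'a = real, symmetric] by (simp only: of_nat_sum of_nat_mult mult.commute)
 hence "real \<beta> * (\<Sum>i<p. real (al i) * real (p - Suc i)) < real \<beta> * (\<Sum>i<p. real (ka i) * real (p - Suc i))"
  using assms(1) by simp
 thus ?thesis using sq lin[OF e(1)] lin[OF e(2)] by (simp add: rho_def right_diff_distrib sum_subtractf)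
qed

text \<open>The operator has poles where variables coincide; that it nevertheless maps symmetric
  polynomials to polynomials is assumed here and supplied later by the pole-free matrix
  operator.\<close>

locale jack_setting =
 fixes \<beta> p :: nat
 assumes \<beta>_pos: "\<beta> > 0"
  and polynomial: "!!k f. hp p k f ==> symf p f ==>
   EX g. hp p k g & symf p g & (ALL x. inj_on x {..<p} --> jack_operator \<beta> p f x = g x)"
begin

text \<open>The polynomial extension of the operator across coinciding variables.\<close>

definition J :: "nat => ((nat => real) => real) => (nat => real) => real" where
 "J k f = (SOME g. hp p k g & symf p g & (ALL x. inj_on x {..<p} --> jack_operator \<beta> p f x = g x))"

lemma J:
 assumes "hp p k f" "symf p f"
 shows "hp p k (J k f)" "symf p (J k f)" "inj_on x {..<p} ==> jack_operator \<beta> p f x = J k f x"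
 using someI_ex[OF polynomial[OF assms]] unfolding J_def by blast+

lemma J_unique:
 assumes "hp p k f" "symf p f" "hp p k g" "!!x. inj_on x {..<p} ==> (!!i. 0 < x i) ==> jack_operator \<beta> p f x = g x"
 shows "J k f = g"
 by (rule hp_eqI[OF J(1)[OF assms(1,2)] assms(3)]) (use assms(4) J(3)[OF assms(1,2)] in metis)

lemma J_add:
 assumes f: "hp p k f" "symf p f" and g: "hp p k g" "symf p g"
 shows "J k (%x. f x + c * g x) = (%x. J k f x + c * J k g x)"
proof (rule J_unique)
 note hps = hp_add[OF f(1) hp_scale[OF g(1), of c]]
 show "hp p k (%x. f x + c * g x)" "symf p (%x. f x + c * g x)" "hp p k (%x. J k f x + c * J k g x)"
  by (intro hp_add hp_scale symf_add symf_scale f g J)+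
 fix x :: "nat => real" assume x: "inj_on x {..<p}"
 have cf: "cf p k (%x. f x + c * g x) al = cf p k f al + c * cf p k g al" for al
  by (simp add: cf_add f hp_scale g cf_scale)
 have "th p k (%x. f x + c * g x) i x = th p k f i x + c * th p k g i x"
  "th2 p k (%x. f x + c * g x) i x = th2 p k f i x + c * th2 p k g i x" for i
  unfolding th_def th2_def cf sum_distrib_left sum.distrib[symmetric]
  by (intro sum.cong refl; simp add: algebra_simps)+
 hence "jack_operator \<beta> p (%x. f x + c * g x) x = jack_operator \<beta> p f x + c * jack_operator \<beta> p g x"
  unfolding jack_operator_eq[OF hps] jack_operator_eq[OF f(1)] jack_operator_eq[OF g(1)]
  by (simp add: sum.distrib sum_distrib_left algebra_simps)
 thus "jack_operator \<beta> p (%x. f x + c * g x) x = J k f x + c * J k g x" by (simp add: J(3)[OF f x] J(3)[OF g x])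
qed

text \<open>Along the curve the operator multiplies each monomial by a factor converging to
  \<open>rho\<close>, so on the part of top weight it acts diagonally.\<close>

lemma J_tendsto:
 assumes f: "hp p k f" "symf p f" and w: "dec p w"
  and supp: "!!al. al \<in> exponents p k ==> cf p k f al ~= 0 ==> wt p w al <= N"
 shows "((%u. J k f (pt u w) / u ^ N) \<longlongrightarrow>
   (\<Sum>al\<in>exponents p k. if wt p w al = N then cf p k f al * rho \<beta> p al else 0)) at_top"
proof -
 define E where "E = (%al u. (\<Sum>i<p. real (al i) * (real (al i) - 1))
   + real \<beta> * (\<Sum>i<p. \<Sum>j\<in>{..<p} - {i}. real (al i) * (pt u w i / (pt u w i - pt u w j))))"
 have "(E al \<longlongrightarrow> rho \<beta> p al) at_top" for al
 proof -
  have "((%u. pt u w i / (pt u w i - pt u w j)) \<longlongrightarrow> (if i < j then 1 else 0)) at_top"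
   if "i < p" "j \<in> {..<p} - {i}" for i j
  proof (cases "i < j")
   case True
   hence "w j < w i" using w that by (simp add: dec_def)
   from tendsto_quotient_difference(1)[OF this] show ?thesis using True by (simp add: pt_def)
  next
   case False
   hence "w i < w j" using w that by (simp add: dec_def)
   from tendsto_quotient_difference(2)[OF this] show ?thesis using False by (simp add: pt_def)
  qed
  hence "(E al \<longlongrightarrow> (\<Sum>i<p. real (al i) * (real (al i) - 1))
    + real \<beta> * (\<Sum>i<p. \<Sum>j\<in>{..<p} - {i}. real (al i) * (if i < j then 1 else 0))) at_top"
   unfolding E_def by (intro tendsto_intros) auto
  moreover have "(\<Sum>j\<in>{..<p} - {i}. real (al i) * (if i < j then 1 else 0)) = real (al i) * real (p - Suc i)"
   if "i < p" for i
  proof -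
   have "(\<Sum>j\<in>{..<p} - {i}. if i < j then 1 else (0::real)) = real (card (({..<p} - {i}) \<inter> {j. i < j}))"
    by (simp add: sum.If_cases)
   also have "({..<p} - {i}) \<inter> {j. i < j} = {Suc i..<p}" by auto
   finally show ?thesis by (simp add: sum_distrib_left[symmetric])
  qed
  hence "(\<Sum>i<p. \<Sum>j\<in>{..<p} - {i}. real (al i) * (if i < j then 1 else 0)) = (\<Sum>i<p. real (al i) * real (p - Suc i))"
   by (intro sum.cong refl) blast
  ultimately show ?thesis by (simp only: rho_def)
 qed
 hence "((%u. (\<Sum>al\<in>exponents p k. cf p k f al * (u ^ wt p w al * E al u)) / u ^ N) \<longlongrightarrow>
   (\<Sum>al\<in>exponents p k. if wt p w al = N then cf p k f al * rho \<beta> p al else 0)) at_top"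
  by (intro tendsto_leading supp)
 moreover have "\<forall>\<^sub>F u in at_top. (\<Sum>al\<in>exponents p k. cf p k f al * (u ^ wt p w al * E al u)) / u ^ N = J k f (pt u w) / u ^ N"
  using eventually_gt_at_top[of 1]
 proof eventually_elim
  case (elim u)
  have "J k f (pt u w) = jack_operator \<beta> p f (pt u w)" using J(3)[OF f pt_inj[OF w elim]] by simp
  also have "... = (\<Sum>al\<in>exponents p k. cf p k f al * (u ^ wt p w al * E al u))"
  proof -
   have a: "(\<Sum>i<p. th2 p k f i (pt u w)) = (\<Sum>al\<in>exponents p k. cf p k f al * (u ^ wt p w al * (\<Sum>i<p. real (al i) * (real (al i) - 1))))"
    unfolding th2_def mon_pt by (subst sum.swap) (simp add: sum_distrib_left mult_ac)
   have "(\<Sum>j\<in>{..<p} - {i}. pt u w i / (pt u w i - pt u w j) * th p k f i (pt u w)) =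
    (\<Sum>al\<in>exponents p k. \<Sum>j\<in>{..<p} - {i}. cf p k f al * (u ^ wt p w al * (real (al i) * (pt u w i / (pt u w i - pt u w j)))))" for i
    unfolding th_def mon_pt sum_distrib_left by (subst sum.swap) (simp add: mult_ac)
   hence "(\<Sum>i<p. \<Sum>j\<in>{..<p} - {i}. pt u w i / (pt u w i - pt u w j) * th p k f i (pt u w)) =
     (\<Sum>i<p. \<Sum>al\<in>exponents p k. \<Sum>j\<in>{..<p} - {i}. cf p k f al * (u ^ wt p w al * (real (al i) * (pt u w i / (pt u w i - pt u w j)))))"
    by simp
   also have "... = (\<Sum>al\<in>exponents p k. cf p k f al * (u ^ wt p w al * (\<Sum>i<p. \<Sum>j\<in>{..<p} - {i}. real (al i) * (pt u w i / (pt u w i - pt u w j)))))"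
    by (subst sum.swap) (simp add: sum_distrib_left)
   finally show ?thesis unfolding jack_operator_eq[OF f(1)] a E_def
    by (simp add: distrib_left sum.distrib sum_distrib_left mult_ac)
  qed
  finally show ?case by simp
 qed
 ultimately show ?thesis by (rule Lim_transform_eventually)
qed

lemma J_support:
 assumes f: "hp p k f" "symf p f" and w: "generic p k w"
  and supp: "!!al. al \<in> exponents p k ==> cf p k f al ~= 0 ==> wt p w al <= N"
 shows "al \<in> exponents p k ==> cf p k (J k f) al ~= 0 ==> wt p w al <= N"
  and "al \<in> exponents p k ==> wt p w al = N ==> cf p k (J k f) al = rho \<beta> p al * cf p k f al"
proof -
 have dec: "dec p w" and inj: "inj_on (wt p w) (exponents p k)" using w by (simp_all add: generic_def)
 have top: "wt p w ga <= N" if ga: "ga \<in> exponents p k" "cf p k (J k f) ga ~= 0" for ga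
 proof (rule ccontr)
  assume less: "~ wt p w ga <= N"
  obtain \<delta> where \<delta>: "\<delta> \<in> exponents p k" "cf p k (J k f) \<delta> ~= 0"
   "ALL ep:exponents p k. cf p k (J k f) ep ~= 0 --> wt p w ep <= wt p w \<delta>"
   using top_exponent[of p k "cf p k (J k f)" w] ga by metis
  hence N: "N < wt p w \<delta>" using less ga by fastforce
  have "((%u. J k f (pt u w) / u ^ wt p w \<delta>) \<longlongrightarrow> cf p k (J k f) \<delta>) at_top"
   using generic_tendsto[OF w \<delta>(1), of "cf p k (J k f)"] \<delta>(3) cf(1)[OF J(1)[OF f]] by auto
  moreover have "((%u. J k f (pt u w) / u ^ wt p w \<delta>) \<longlongrightarrow>
    (\<Sum>al\<in>exponents p k. if wt p w al = wt p w \<delta> then cf p k f al * rho \<beta> p al else 0)) at_top"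
   using supp N by (intro J_tendsto[OF f dec]) force
  moreover have "(\<Sum>al\<in>exponents p k. if wt p w al = wt p w \<delta> then cf p k f al * rho \<beta> p al else 0) = 0"
   using supp N by (intro sum.neutral) force
  ultimately have "cf p k (J k f) \<delta> = 0" using tendsto_unique[OF trivial_limit_at_top_linorder] by metis
  thus False using \<delta>(2) by simp
 qed
 thus "al \<in> exponents p k ==> cf p k (J k f) al ~= 0 ==> wt p w al <= N" by blast
 assume al: "al \<in> exponents p k" "wt p w al = N"
 have "((%u. J k f (pt u w) / u ^ N) \<longlongrightarrow> cf p k (J k f) al) at_top"
  using generic_tendsto[OF w al(1), of "cf p k (J k f)"] top al(2) cf(1)[OF J(1)[OF f]] by auto
 moreover have "((%u. J k f (pt u w) / u ^ N) \<longlongrightarrow>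
    (\<Sum>al\<in>exponents p k. if wt p w al = N then cf p k f al * rho \<beta> p al else 0)) at_top"
  by (intro J_tendsto[OF f dec] supp)
 ultimately have "cf p k (J k f) al = (\<Sum>ga\<in>exponents p k. if wt p w ga = N then cf p k f ga * rho \<beta> p ga else 0)"
  by (rule tendsto_unique[OF trivial_limit_at_top_linorder])
 also have "... = (\<Sum>ga\<in>exponents p k. if ga = al then cf p k f al * rho \<beta> p al else 0)"
  using inj al by (intro sum.cong) (auto simp: inj_on_def)
 finally show "cf p k (J k f) al = rho \<beta> p al * cf p k f al" using al(1) by simp
qed

text \<open>By \<open>J_tendsto\<close> the growth along every decreasing weight is at most that of
  the monomial \<open>ka\<close>, and \<open>dominated_of_growth\<close> converts growth into
  dominance.\<close>

lemma domf_J: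
 assumes f: "domf p k ka f" "symf p f" and ka: "ka \<in> exponents p k"
 shows "domf p k ka (J k f)"
 unfolding domf_def
proof (intro conjI allI impI)
 note hpf = domf_hp[OF f(1)]
 show "hp p k (J k f)" by (rule J(1)[OF hpf f(2)])
 fix al assume "cf p k (J k f) al ~= 0"
 thus "dominated al ka"
 proof (rule dominated_of_growth[OF J(1)[OF hpf f(2)] ka, rotated])
  fix w assume w: "dec p w"
  have "wt p w ga <= wt p w ka" if "ga \<in> exponents p k" "cf p k f ga ~= 0" for ga
   using wt_dominated_less[of ga ka p k w] that ka w f(1) by (cases "ga = ka") (auto simp: domf_def)
  from J_tendsto[OF hpf f(2) w this] obtain L where
   "((%u. J k f (pt u w) / u ^ wt p w ka) \<longlongrightarrow> L) at_top" by blast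
  hence "\<forall>\<^sub>F u in at_top. dist (J k f (pt u w) / u ^ wt p w ka) L < 1" by (rule tendstoD) simp
  hence "\<forall>\<^sub>F u in at_top. \<bar>J k f (pt u w)\<bar> <= (\<bar>L\<bar> + 1) * u ^ wt p w ka" using eventually_gt_at_top[of 0]
  proof eventually_elim
   case (elim u)
   hence "\<bar>J k f (pt u w) / u ^ wt p w ka\<bar> <= \<bar>L\<bar> + 1" by (simp add: dist_real_def)
   thus ?case using elim(2) by (simp add: pos_divide_le_eq)
  qed
  thus "EX C. \<forall>\<^sub>F u in at_top. \<bar>J k f (pt u w)\<bar> <= C * u ^ wt p w ka" by blast
 qed
qed

lemma symf_zeroI:
 assumes f: "hp p k f" "symf p f" and "!!al. al \<in> parts p k ==> cf p k f al = 0"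
 shows "f = (%_. 0)"
proof -
 obtain w where w: "generic p k w" using generic_exists by blast
 have "cf p k f al = 0" if "al \<in> exponents p k" for al
  using top_exponent[of p k "cf p k f" w] top_exponent_parts[OF f w] assms(3) that by metis
 hence "hom_poly p k (cf p k f) = (%_. 0)" by (auto simp: hom_poly_def)
 thus ?thesis using cf(1)[OF f(1)] by simp
qed

text \<open>An eigenfunction whose support is dominated by \<open>ka\<close> is determined by its leading coefficient, since
 the eigenvalue \<open>rho\<close> strictly increases along the dominance order.\<close>

lemma eigenfunction_zero:
 assumes h: "domf p k ka h" "symf p h" and ka: "ka \<in> parts p k"
  and eig: "J k h = (%x. rho \<beta> p ka * h x)" and 0: "cf p k h ka = 0"
 shows "h = (%_. 0)"
proof (rule ccontr)
 assume "h ~= (%_. 0)"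
 note hph = domf_hp[OF h(1)]
 obtain w where w: "generic p k w" using generic_exists by blast
 obtain ga where "ga \<in> parts p k" "cf p k h ga ~= 0" using symf_zeroI[OF hph h(2)] \<open>h ~= _\<close> by blast
 then obtain al where al: "al \<in> exponents p k" "cf p k h al ~= 0"
  "!!ep. ep \<in> exponents p k ==> cf p k h ep ~= 0 ==> wt p w ep <= wt p w al"
  using top_exponent[of p k "cf p k h" w] parts_subset by blast
 have part: "al \<in> parts p k" by (rule top_exponent_parts[OF hph h(2) w al])
 have "cf p k (J k h) al = rho \<beta> p al * cf p k h al" by (rule J_support(2)[OF hph h(2) w al(3) al(1) refl])
 thus False using al(2) h(1) 0 rho_less[OF \<beta>_pos part ka] by (auto simp: eig cf_scale[OF hph] domf_def)
qed

lemma eigenfunction_unique: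
 assumes P: "domf p k ka P" "symf p P" "J k P = (%x. rho \<beta> p ka * P x)" "cf p k P ka = 1"
  and g: "domf p k ka g" "symf p g" "J k g = (%x. rho \<beta> p ka * g x)" and ka: "ka \<in> parts p k"
 shows "g = (%x. cf p k g ka * P x)"
proof -
 define h where "h = (%x. g x + (- cf p k g ka) * P x)"
 note hps = domf_hp[OF P(1)] domf_hp[OF g(1)]
 have "J k h = (%x. J k g x + (- cf p k g ka) * J k P x)"
  unfolding h_def by (rule J_add[OF hps(2) g(2) hps(1) P(2)])
 hence "J k h = (%x. rho \<beta> p ka * h x)" by (simp add: P(3) g(3) h_def algebra_simps)
 moreover have "domf p k ka h" "symf p h" unfolding h_def by (intro domf_add domf_scale symf_add symf_scale P g)+
 moreover have "cf p k h ka = 0"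
  unfolding h_def by (simp only: cf_add[OF hps(2) hp_scale[OF hps(1)]] cf_scale[OF hps(1)] P(4))
 ultimately have "h = (%_. 0)" by (intro eigenfunction_zero[OF _ _ ka])
 thus ?thesis by (auto simp: h_def fun_eq_iff)
qed

text \<open>Back substitution in a triangular system: the top exponent of \<open>g\<close> is a
  partition strictly below \<open>ka\<close>, where \<open>rho\<close> is smaller than at
  \<open>ka\<close>, so a multiple of \<open>msym\<close> removes it and leaves a right-hand side of
  smaller weight.\<close>

lemma solve_below:
 assumes w: "generic p k w" and ka: "ka \<in> parts p k"
 shows "domf p k ka g ==> symf p g ==> N <= wt p w ka ==>
  (!!al. al \<in> exponents p k ==> cf p k g al ~= 0 ==> wt p w al < N) ==>
  EX h. domf p k ka h & symf p h & (ALL al:exponents p k. cf p k h al ~= 0 --> wt p w al < N)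
   & (ALL x. J k h x + (- rho \<beta> p ka) * h x = g x)"
proof (induction N arbitrary: g rule: less_induct)
 case (less N)
 note hpg = domf_hp[OF less.prems(1)]
 have \<kappa>e: "ka \<in> exponents p k" using ka parts_subset by blast
 have J0: "J k (%_. 0) = (%_. 0)"
 proof (rule J_unique[OF hp_zero _ hp_zero])
  have "cf p k (%_. 0) al = 0" for al using cf_scale[OF hp_zero, of p k 0 al] by simp
  thus "jack_operator \<beta> p (%_. 0) x = 0" for x by (simp add: jack_operator_eq[OF hp_zero[of p k]] th_def th2_def)
 qed (simp add: symf_def)
 have cf0: "cf p k (%_. 0) al = 0" for al using cf_scale[OF hp_zero, of p k 0 al] by simp
 show ?case
 proof (cases "g = (%_. 0)")
  case True
  thus ?thesis by (intro exI[of _ "%_. 0"]) (simp add: J0 cf0 domf_def hp_zero symf_def)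
 next
  case False
  obtain ga where "ga \<in> parts p k" "cf p k g ga ~= 0" using symf_zeroI[OF hpg less.prems(2)] False by blast
  then obtain al where al: "al \<in> exponents p k" "cf p k g al ~= 0"
   "!!ep. ep \<in> exponents p k ==> cf p k g ep ~= 0 ==> wt p w ep <= wt p w al"
   using top_exponent[of p k "cf p k g" w] parts_subset by blast
  have part: "al \<in> parts p k" by (rule top_exponent_parts[OF hpg less.prems(2) w al])
  have \<alpha>N: "wt p w al < N" by (rule less.prems(4)[OF al(1,2)])
  have dom: "dominated al ka" using less.prems(1) al(2) by (simp add: domf_def)
  have "rho \<beta> p al < rho \<beta> p ka" using \<alpha>N less.prems(3) by (intro rho_less[OF \<beta>_pos part ka dom]) auto
  define m where "m = msym p al"
  note m = msym[OF part, folded m_def]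
  have m_dom: "domf p k ka m" using m(1) dom unfolding domf_def dominated_def by (meson order_trans)
  note hpm = domf_hp[OF m(1)]
  have m_supp: "wt p w ep <= wt p w al" if "ep \<in> exponents p k" "cf p k m ep ~= 0" for ep
   using m(1) that wt_dominated_less[of ep al p k w] al(1) w by (cases "ep = al") (auto simp: domf_def generic_def)
  \<comment> \<open>On the coefficient at \<open>al\<close> the operator J minus \<open>rho\<close>
    of \<open>ka\<close> acts by the nonzero factor in the denominator; this multiple cancels the
    top coefficient of \<open>g\<close>.\<close>
  define c where "c = cf p k g al / ((rho \<beta> p al - rho \<beta> p ka) * cf p k m al)"
  define g' where "g' = (%x. g x + (- c) * (J k m x + (- rho \<beta> p ka) * m x))"
  note hpJm = J(1)[OF hpm m(2)]
  have g'_dom: "domf p k ka g'" and g'_sym: "symf p g'"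
   unfolding g'_def by (intro domf_add domf_scale less.prems m_dom domf_J[OF m_dom m(2) \<kappa>e]
     symf_add symf_scale m(2) J(2)[OF hpm])+
  have cf_g': "cf p k g' ep = cf p k g ep + (- c) * (cf p k (J k m) ep + (- rho \<beta> p ka) * cf p k m ep)" for ep
   unfolding g'_def
   by (simp only: cf_add[OF hpg hp_scale[OF hp_add[OF hpJm hp_scale[OF hpm]]]] cf_scale[OF hp_add[OF hpJm hp_scale[OF hpm]]]
     cf_add[OF hpJm hp_scale[OF hpm]] cf_scale[OF hpm])
  have Jm: "cf p k (J k m) al = rho \<beta> p al * cf p k m al" by (rule J_support(2)[OF hpm m(2) w m_supp al(1) refl])
  have "cf p k g' al = cf p k g al - c * ((rho \<beta> p al - rho \<beta> p ka) * cf p k m al)"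
   by (simp add: cf_g' Jm algebra_simps)
  hence g'_\<alpha>: "cf p k g' al = 0" using m(3) \<open>rho \<beta> p al < rho \<beta> p ka\<close> by (simp add: c_def)
  have "wt p w ep < wt p w al" if ep: "ep \<in> exponents p k" "cf p k g' ep ~= 0" for ep
  proof -
   have "wt p w ep <= wt p w al"
    using ep(2) al(3) m_supp J_support(1)[OF hpm m(2) w m_supp] ep(1) unfolding cf_g' by fastforce
   thus ?thesis using ep(2) g'_\<alpha> w ep(1) al(1) by (fastforce simp: generic_def inj_on_def)
  qed
  with less.IH[OF \<alpha>N g'_dom g'_sym] \<alpha>N less.prems(3) obtain h' where h':
   "domf p k ka h'" "symf p h'" "ALL ep:exponents p k. cf p k h' ep ~= 0 --> wt p w ep < wt p w al"
   "!!x. J k h' x + (- rho \<beta> p ka) * h' x = g' x" by force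
  define h where "h = (%x. h' x + c * m x)"
  note hph' = domf_hp[OF h'(1)]
  have Jh: "J k h = (%x. J k h' x + c * J k m x)" unfolding h_def by (rule J_add[OF hph' h'(2) hpm m(2)])
  have "domf p k ka h" "symf p h" unfolding h_def by (intro domf_add domf_scale symf_add symf_scale h' m_dom m(2))+
  moreover have "wt p w ep < N" if "ep \<in> exponents p k" "cf p k h ep ~= 0" for ep
  proof -
   show ?thesis
    using that(2) h'(3) m_supp that(1) \<alpha>N unfolding h_def cf_add[OF hph' hp_scale[OF hpm]] cf_scale[OF hpm] by fastforce
  qed
  moreover have "J k h x + (- rho \<beta> p ka) * h x = g x" for x
   using h'(4)[of x] unfolding Jh by (simp add: h_def g'_def algebra_simps)
  ultimately show ?thesis by blast
 qed
qed

text \<open>The orbit sum is an eigenfunction up to terms strictly below \<open>ka\<close>. The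
  correction from \<open>solve_below\<close> is itself strictly below, so subtracting it keeps the
  leading coefficient, which is then scaled to 1.\<close>

lemma eigenfunction_exists:
 assumes ka: "ka \<in> parts p k"
 shows "EX P. domf p k ka P & symf p P & cf p k P ka = 1 & J k P = (%x. rho \<beta> p ka * P x)"
proof -
 obtain w where w: "generic p k w" using generic_exists by blast
 have \<kappa>e: "ka \<in> exponents p k" using ka parts_subset by blast
 define m where "m = msym p ka"
 note m = msym[OF ka, folded m_def]
 note hpm = domf_hp[OF m(1)]
 note hpJm = J(1)[OF hpm m(2)]
 have m_supp: "wt p w ep <= wt p w ka" if "ep \<in> exponents p k" "cf p k m ep ~= 0" for ep
  using m(1) that wt_dominated_less[of ep ka p k w] \<kappa>e w by (cases "ep = ka") (auto simp: domf_def generic_def)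
 define g where "g = (%x. J k m x + (- rho \<beta> p ka) * m x)"
 have g: "domf p k ka g" "symf p g"
  unfolding g_def by (intro domf_add domf_scale m domf_J[OF m(1,2) \<kappa>e] symf_add symf_scale J(2)[OF hpm])+
 have cfg: "cf p k g ep = cf p k (J k m) ep + (- rho \<beta> p ka) * cf p k m ep" for ep
  unfolding g_def by (simp only: cf_add[OF hpJm hp_scale[OF hpm]] cf_scale[OF hpm])
 have "cf p k (J k m) ka = rho \<beta> p ka * cf p k m ka" by (rule J_support(2)[OF hpm m(2) w m_supp \<kappa>e refl])
 hence "cf p k g ka = 0" by (simp add: cfg)
 have "wt p w ep < wt p w ka" if ep: "ep \<in> exponents p k" "cf p k g ep ~= 0" for ep
 proof -
  show ?thesis
   using g(1) ep(2) \<open>cf p k g ka = 0\<close> wt_dominated_less ep(1) \<kappa>e w by (fastforce simp: domf_def generic_def)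
 qed
 from solve_below[OF w ka g order_refl this] obtain h where h:
  "domf p k ka h" "symf p h" "!!al. al \<in> exponents p k ==> cf p k h al ~= 0 ==> wt p w al < wt p w ka"
  "!!x. J k h x + (- rho \<beta> p ka) * h x = g x" by blast
 note hph = domf_hp[OF h(1)]
 have "cf p k h ka = 0" using h(3)[OF \<kappa>e] by blast
 define P where "P = (%x. m x + (- 1) * h x)"
 have P: "domf p k ka P" "symf p P" unfolding P_def by (intro domf_add domf_scale symf_add symf_scale h m)+
 have JP: "J k P = (%x. J k m x + (- 1) * J k h x)" unfolding P_def by (rule J_add[OF hpm m(2) hph h(2)])
 have eig: "J k P = (%x. rho \<beta> p ka * P x)"
 proof
  fix x
  show "J k P x = rho \<beta> p ka * P x" using h(4)[of x] unfolding JP by (simp add: P_def g_def algebra_simps)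
 qed
 have cfP: "cf p k P ka = cf p k m ka"
  unfolding P_def cf_add[OF hpm hp_scale[OF hph]] cf_scale[OF hph] by (simp add: \<open>cf p k h ka = 0\<close>)
 note hpP = domf_hp[OF P(1)]
 define c where "c = 1 / cf p k m ka"
 have "J k (%x. P x + (c - 1) * P x) = (%x. J k P x + (c - 1) * J k P x)" by (rule J_add[OF hpP P(2) hpP P(2)])
 hence "J k (%x. c * P x) = (%x. rho \<beta> p ka * (c * P x))" by (simp add: eig algebra_simps)
 moreover have "cf p k (%x. c * P x) ka = 1"
 proof -
  have "c * cf p k P ka = 1" using m(3) by (simp add: c_def cfP)
  thus ?thesis by (simp only: cf_scale[OF hpP])
 qed
 ultimately show ?thesis using P by (intro exI[of _ "%x. c * P x"]) (simp add: domf_scale symf_scale)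
qed

definition PP :: "nat => (nat => nat) => (nat => real) => real" where
 "PP k ka = (SOME P. domf p k ka P & symf p P & cf p k P ka = 1 & J k P = (%x. rho \<beta> p ka * P x))"

lemma PP:
 assumes "ka \<in> parts p k"
 shows "domf p k ka (PP k ka)" "symf p (PP k ka)" "cf p k (PP k ka) ka = 1"
  "J k (PP k ka) = (%x. rho \<beta> p ka * PP k ka x)" "hp p k (PP k ka)"
 using someI_ex[OF eigenfunction_exists[OF assms]] unfolding PP_def by (auto intro: domf_hp)

lemma PP_independent:
 assumes "!!x. (\<Sum>ka\<in>parts p k. b ka * PP k ka x) = 0" "ka \<in> parts p k"
 shows "b ka = 0"
proof (rule ccontr)
 assume "b ka ~= 0"
 obtain w where w: "generic p k w" using generic_exists by blast
 let ?S = "{nu \<in> parts p k. b nu ~= 0}"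
 have "finite (wt p w ` ?S)" "wt p w ` ?S ~= {}" using assms(2) \<open>b ka ~= 0\<close> by auto
 hence "Max (wt p w ` ?S) \<in> wt p w ` ?S" by (rule Max_in)
 then obtain \<mu> where "Max (wt p w ` ?S) = wt p w \<mu>" "\<mu> \<in> ?S" by (rule imageE)
 hence \<mu>: "\<mu> \<in> parts p k" "b \<mu> ~= 0" "wt p w \<mu> = Max (wt p w ` ?S)" by auto
 have max: "wt p w nu <= wt p w \<mu>" if "nu \<in> parts p k" "b nu ~= 0" for nu
  unfolding \<mu>(3) using that \<open>finite (wt p w ` ?S)\<close> by (intro Max_ge) auto
 have e: "nu \<in> exponents p k" if "nu \<in> parts p k" for nu using that parts_subset by blast
 have "(%x. \<Sum>ka\<in>parts p k. b ka * PP k ka x) = (%x. 0 * (\<Sum>ka\<in>parts p k. b ka * PP k ka x))" using assms(1) by simp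
 moreover have hps: "hp p k (%x. \<Sum>ka\<in>parts p k. b ka * PP k ka x)" by (intro hp_sum hp_scale PP(5))
 ultimately have "cf p k (%x. \<Sum>ka\<in>parts p k. b ka * PP k ka x) \<mu> = 0" using cf_scale[OF hps, of 0 \<mu>] by simp
 hence "0 = (\<Sum>nu\<in>parts p k. cf p k (%x. b nu * PP k nu x) \<mu>)" by (subst (asm) cf_sum) (auto intro: hp_scale PP(5))
 also have "... = (\<Sum>nu\<in>parts p k. if nu = \<mu> then b \<mu> else 0)"
 proof (rule sum.cong)
  fix nu assume nu: "nu \<in> parts p k"
  have "b nu * cf p k (PP k nu) \<mu> = 0" if "nu ~= \<mu>"
  proof (rule ccontr)
   assume *: "b nu * cf p k (PP k nu) \<mu> ~= 0"
   hence "dominated \<mu> nu" using PP(1)[OF nu] by (simp add: domf_def)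
   hence "wt p w \<mu> < wt p w nu"
    using that w by (intro wt_dominated_less[where k = k] e \<mu> nu) (auto simp: generic_def)
   thus False using max[OF nu] * by auto
  qed
  thus "cf p k (%x. b nu * PP k nu x) \<mu> = (if nu = \<mu> then b \<mu> else 0)"
   using PP(3)[OF \<mu>(1)] by (simp add: cf_scale[OF PP(5)[OF nu]])
 qed simp
 finally show False using \<mu> by simp
qed

text \<open>Subtracting a multiple of \<open>PP\<close> at the top exponent, which is a partition,
  lowers the top weight.\<close>

lemma PP_spans:
 assumes f: "hp p k f" "symf p f"
 shows "EX b. ALL x. f x = (\<Sum>ka\<in>parts p k. b ka * PP k ka x)"
proof -
 obtain w where w: "generic p k w" using generic_exists by blast
 have "EX b. ALL x. g x = (\<Sum>ka\<in>parts p k. b ka * PP k ka x)"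
  if "hp p k g" "symf p g" "!!al. al \<in> exponents p k ==> cf p k g al ~= 0 ==> wt p w al < N" for g N using that
 proof (induction N arbitrary: g rule: less_induct)
  case (less N)
  show ?case
  proof (cases "g = (%_. 0)")
   case True
   thus ?thesis by (intro exI[of _ "%_. 0"]) simp
  next
   case False
   obtain ga where "ga \<in> parts p k" "cf p k g ga ~= 0" using symf_zeroI[OF less.prems(1,2)] False by blast
   then obtain al where al: "al \<in> exponents p k" "cf p k g al ~= 0"
    "!!ep. ep \<in> exponents p k ==> cf p k g ep ~= 0 ==> wt p w ep <= wt p w al"
    using top_exponent[of p k "cf p k g" w] parts_subset by blast
   have part: "al \<in> parts p k" by (rule top_exponent_parts[OF less.prems(1,2) w al])
   note P = PP[OF part]
   define g' where "g' = (%x. g x + (- cf p k g al) * PP k al x)"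
   have cfg': "cf p k g' ep = cf p k g ep + (- cf p k g al) * cf p k (PP k al) ep" for ep
    unfolding g'_def cf_add[OF less.prems(1) hp_scale[OF P(5)]] cf_scale[OF P(5)] ..
   have "wt p w ep < wt p w al" if ep: "ep \<in> exponents p k" "cf p k g' ep ~= 0" for ep
   proof -
    have ne: "ep ~= al" using ep(2) P(3) by (auto simp: cfg')
    have "cf p k g ep ~= 0 | cf p k (PP k al) ep ~= 0" using ep(2) unfolding cfg' by auto
    thus ?thesis
    proof
     assume "cf p k g ep ~= 0"
     thus ?thesis using al(1,3) ep(1) ne w by (fastforce simp: generic_def inj_on_def)
    next
     assume "cf p k (PP k al) ep ~= 0"
     thus ?thesis using P(1) ne ep(1) al(1) w by (intro wt_dominated_less) (auto simp: domf_def generic_def)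
    qed
   qed
   moreover have "hp p k g'" "symf p g'"
    unfolding g'_def by (intro hp_add hp_scale symf_add symf_scale less.prems P)+
   ultimately obtain b where b: "!!x. g' x = (\<Sum>ka\<in>parts p k. b ka * PP k ka x)"
    using less.IH[OF less.prems(3)[OF al(1,2)], of g'] by blast
   have "g x = (\<Sum>ka\<in>parts p k. (b ka + (if ka = al then cf p k g al else 0)) * PP k ka x)" for x
   proof -
    have "g x = g' x + cf p k g al * PP k al x" by (simp add: g'_def)
    also have "cf p k g al * PP k al x = (\<Sum>ka\<in>parts p k. (if ka = al then cf p k g al * PP k al x else 0))"
     using part by simp
    finally show ?thesis
     unfolding b sum.distrib[symmetric] by (simp add: if_distrib if_distribR distrib_right cong: if_cong)
   qed
   thus ?thesis by auto
  qed
 qed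
 from this[OF f, of "Suc (Max (wt p w ` exponents p k))"] show ?thesis by (simp add: less_Suc_eq_le)
qed

end

text \<open>A symmetric polynomial extends to an invariant matrix polynomial F, and
  \<open>LL\<close> of F is polynomial on diagonal matrices; \<open>LL_diag\<close> recovers the
  Jack operator from it up to a multiple of f.\<close>

lemma jack_setting:
 assumes \<beta>: "\<beta> \<in> {1, 2, 4}"
 shows "jack_setting \<beta> CARD('m::finite)"
proof
 show "\<beta> > 0" using \<beta> by auto
 fix k f assume f: "hp CARD('m) k f" "symf CARD('m) f"
 from symf_psum[OF f] obtain F :: "quat^'m^'m => real" where "psum k F & (ALL x. F (dg x) = f x)" ..
 hence F: "invp \<beta> k F" "!!x. F (dg x) = f x" using psum_invp by auto
 define c where "c = real \<beta> * (real CARD('m) - 2) * real k"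
 define g where "g = (%x. (1 / 2) * (LL \<beta> F (dg x) + c * f x))"
 have "hp CARD('m) k g" "symf CARD('m) g"
  unfolding g_def by (intro hp_add hp_scale symf_add symf_scale f invp_dg[OF invp_LL[OF F(1)]])+
 moreover have "jack_operator \<beta> CARD('m) f x = g x" if "inj_on x {..<CARD('m)}" for x
  using LL_diag[OF \<beta> F that] by (simp add: g_def c_def)
 ultimately show "EX g. hp CARD('m) k g & symf CARD('m) g &
   (ALL x. inj_on x {..<CARD('m)} --> jack_operator \<beta> CARD('m) f x = g x)" by blast
qed

section \<open>Lebesgue measure on subspaces, ball integrals and radial moments\<close>

section \<open>Lebesgue measure on subspaces\<close>

text \<open>For orthonormal e this is Lebesgue measure of the span, realised on the whole space so
  that different subspaces can be compared and combined by Fubini. For empty I it is the point mass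
  at 0.\<close>

definition leb :: "('i => 'v::euclidean_space) => 'i set => 'v measure" where
 "leb e I = distr (PiM I (%_. lborel)) borel (%w. \<Sum>i\<in>I. w i *\<^sub>R e i)"

definition orth :: "('i => 'v::euclidean_space) => 'i set => bool" where
 "orth e I \<longleftrightarrow> finite I & (ALL i:I. ALL j:I. e i \<bullet> e j = (if i = j then 1 else 0))"

lemma orthD:
 assumes "orth e I"
 shows "finite I" "i \<in> I ==> e i \<bullet> e i = 1" "i \<in> I ==> j \<in> I ==> i ~= j ==> e i \<bullet> e j = 0"
 using assms by (auto simp: orth_def)

lemma orth_subset: "orth e I ==> J \<subseteq> I ==> orth e J"
 unfolding orth_def by (meson finite_subset subsetD)

lemma space_leb [simp]: "space (leb e I) = UNIV" and sets_leb [measurable_cong, simp]: "sets (leb e I) = sets borel"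
 by (simp_all add: leb_def)

lemma nn_integral_leb:
 "f \<in> borel_measurable borel ==>
   (\<integral>\<^sup>+x. f x \<partial>leb e I) = (\<integral>\<^sup>+w. f (\<Sum>i\<in>I. w i *\<^sub>R e i) \<partial>PiM I (%_. lborel))"
 unfolding leb_def by (subst nn_integral_distr) auto

lemma sigma_finite_PiM_lborel: "finite I ==> sigma_finite_measure (PiM I (%_. lborel :: real measure))"
 by (intro product_sigma_finite.sigma_finite) (simp_all add: product_sigma_finite_def lborel.sigma_finite_measure_axioms)

lemma measurable_leb_integral [measurable (raw)]:
 assumes "finite I" and f: "case_prod f \<in> borel_measurable (M \<Otimes>\<^sub>M borel)"
 shows "(%x. \<integral>\<^sup>+y. f x y \<partial>leb e I) \<in> borel_measurable M"
proof -
 interpret sigma_finite_measure "PiM I (%_. lborel :: real measure)" by (rule sigma_finite_PiM_lborel) fact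
 have "(%x. \<integral>\<^sup>+w. f x (\<Sum>i\<in>I. w i *\<^sub>R e i) \<partial>PiM I (%_. lborel)) \<in> borel_measurable M" using f by measurable
 moreover have "f x \<in> borel_measurable borel" if "x \<in> space M" for x using measurable_Pair2[OF f that] by simp
 ultimately show ?thesis by (subst measurable_cong[OF nn_integral_leb]) auto
qed

lemma leb_swap:
 assumes "finite I" "finite J" and f[measurable]: "case_prod f \<in> borel_measurable (borel \<Otimes>\<^sub>M borel)"
 shows "(\<integral>\<^sup>+x. \<integral>\<^sup>+y. f x y \<partial>leb e' J \<partial>leb e I) = (\<integral>\<^sup>+y. \<integral>\<^sup>+x. f x y \<partial>leb e I \<partial>leb e' J)"
proof -
 interpret I: sigma_finite_measure "PiM I (%_. lborel :: real measure)" by (rule sigma_finite_PiM_lborel) fact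
 interpret J: sigma_finite_measure "PiM J (%_. lborel :: real measure)" by (rule sigma_finite_PiM_lborel) fact
 interpret pair_sigma_finite "PiM I (%_. lborel :: real measure)" "PiM J (%_. lborel :: real measure)" ..
 have g: "f x \<in> borel_measurable borel" "(%x. f x y) \<in> borel_measurable borel" for x y by measurable
 have m: "(%x. \<integral>\<^sup>+y. f x y \<partial>leb e' J) \<in> borel_measurable borel"
    "(%y. \<integral>\<^sup>+x. f x y \<partial>leb e I) \<in> borel_measurable borel" using assms(1,2) by measurable
 show ?thesis by (simp add: nn_integral_leb g) (rule Fubini'[symmetric], measurable)
qed

lemma leb_empty: "f \<in> borel_measurable borel ==> (\<integral>\<^sup>+x. f x \<partial>leb e {}) = f 0"
 by (simp add: nn_integral_leb PiM_empty)

lemma leb_insert: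
 assumes "finite I" "i \<notin> I" and f[measurable]: "f \<in> borel_measurable borel"
 shows "(\<integral>\<^sup>+x. f x \<partial>leb e (insert i I)) = (\<integral>\<^sup>+t. \<integral>\<^sup>+y. f (t *\<^sub>R e i + y) \<partial>leb e I \<partial>lborel)"
proof -
 interpret product_sigma_finite "%_. lborel :: real measure" ..
 have *: "(\<Sum>j\<in>insert i I. (w(i := t)) j *\<^sub>R e j) = t *\<^sub>R e i + (\<Sum>j\<in>I. w j *\<^sub>R e j)" for w t
 proof -
  have "(\<Sum>j\<in>I. (w(i := t)) j *\<^sub>R e j) = (\<Sum>j\<in>I. w j *\<^sub>R e j)" using assms(2) by (intro sum.cong) auto
  thus ?thesis using assms(1,2) by simp
 qed
 have "(\<integral>\<^sup>+x. f x \<partial>leb e (insert i I)) = (\<integral>\<^sup>+t. \<integral>\<^sup>+w. f (\<Sum>j\<in>insert i I. (w(i := t)) j *\<^sub>R e j) \<partial>PiM I (%_. lborel) \<partial>lborel)"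
  using assms by (simp only: nn_integral_leb[OF f]) (rule product_nn_integral_insert_rev, simp_all)
 thus ?thesis unfolding * by (subst nn_integral_leb) auto
qed

lemma leb_union:
 assumes "finite I" "finite J" "I \<inter> J = {}" and f: "f \<in> borel_measurable borel"
 shows "(\<integral>\<^sup>+x. f x \<partial>leb e (I \<union> J)) = (\<integral>\<^sup>+x. \<integral>\<^sup>+y. f (x + y) \<partial>leb e J \<partial>leb e I)"
 using assms(1,3,4)
proof (induction I arbitrary: f rule: finite_induct)
 case empty
 thus ?case using assms(2) by (subst leb_empty) (auto)
next
 case (insert i I)
 note [measurable] = insert.prems(2) and [simp] = assms(2) insert.hyps(1)
 have "(\<integral>\<^sup>+x. f x \<partial>leb e (insert i I \<union> J)) = (\<integral>\<^sup>+t. \<integral>\<^sup>+y. f (t *\<^sub>R e i + y) \<partial>leb e (I \<union> J) \<partial>lborel)"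
  using insert by (simp add: leb_insert)
 thus ?case using insert by ((subst leb_insert), (auto simp: add.assoc))
qed

lemma AE_leb: "AE x in leb e I. x \<in> span (e ` I)"
proof -
 have "(\<Sum>i\<in>I. w i *\<^sub>R e i) \<in> span (e ` I)" for w by (intro span_sum span_scale span_base) auto
 thus ?thesis unfolding leb_def by ((subst AE_distr_iff), auto)
qed

lemma leb_cong: "(!!x. x \<in> span (e ` I) ==> f x = g x) ==> (\<integral>\<^sup>+x. f x \<partial>leb e I) = (\<integral>\<^sup>+x. g x \<partial>leb e I)"
 by (intro nn_integral_cong_AE AE_mp[OF AE_leb AE_I2]) auto

lemma leb_translate:
 assumes "finite I" "v \<in> span (e ` I)" "f \<in> borel_measurable borel"
 shows "(\<integral>\<^sup>+x. f (v + x) \<partial>leb e I) = (\<integral>\<^sup>+x. f x \<partial>leb e I)"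
 using assms
proof (induction I arbitrary: f v rule: finite_induct)
 case empty
 thus ?case by simp
next
 case (insert i I)
 note [measurable] = insert.prems(2)
 obtain c u where v: "v = c *\<^sub>R e i + u" and u: "u \<in> span (e ` I)"
  using insert.prems(1) by (auto simp: span_insert) (metis add.commute diff_add_cancel)
 have [measurable]: "(%t. \<integral>\<^sup>+y. f (t *\<^sub>R e i + y) \<partial>leb e I) \<in> borel_measurable borel" using insert.hyps(1) by simp
 have "(\<integral>\<^sup>+x. f (v + x) \<partial>leb e (insert i I)) = (\<integral>\<^sup>+t. \<integral>\<^sup>+y. f (v + (t *\<^sub>R e i + y)) \<partial>leb e I \<partial>lborel)"
  using insert.hyps by (subst leb_insert) auto
 also have "... = (\<integral>\<^sup>+t. \<integral>\<^sup>+y. f ((c + t) *\<^sub>R e i + (u + y)) \<partial>leb e I \<partial>lborel)" by (simp add: v algebra_simps)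
 also have "... = (\<integral>\<^sup>+t. \<integral>\<^sup>+y. f ((c + t) *\<^sub>R e i + y) \<partial>leb e I \<partial>lborel)"
  by (intro nn_integral_cong insert.IH u) auto
 also have "... = (\<integral>\<^sup>+t. \<integral>\<^sup>+y. f (t *\<^sub>R e i + y) \<partial>leb e I \<partial>lborel)"
  by (subst (2) nn_integral_real_affine[of _ 1 c]) auto
 finally show ?case using insert.hyps by (simp add: leb_insert)
qed

lemma leb_scale:
 assumes "finite I" "c > 0" "f \<in> borel_measurable borel"
 shows "(\<integral>\<^sup>+x. f x \<partial>leb e I) = ennreal (c ^ card I) * (\<integral>\<^sup>+x. f (c *\<^sub>R x) \<partial>leb e I)"
 using assms(1,3)
proof (induction I arbitrary: f rule: finite_induct)
 case empty
 thus ?case by (simp add: leb_empty)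
next
 case (insert i I)
 note [measurable] = insert.prems
 have [measurable]: "(%t. \<integral>\<^sup>+y. f (t *\<^sub>R e i + y) \<partial>leb e I) \<in> borel_measurable borel"
  "(%t. \<integral>\<^sup>+y. f (t *\<^sub>R e i + c *\<^sub>R y) \<partial>leb e I) \<in> borel_measurable borel"
  "(%t. \<integral>\<^sup>+y. f (c *\<^sub>R (t *\<^sub>R e i + y)) \<partial>leb e I) \<in> borel_measurable borel" using insert.hyps(1) by auto
 have "(\<integral>\<^sup>+x. f x \<partial>leb e (insert i I)) = (\<integral>\<^sup>+t. \<integral>\<^sup>+y. f (t *\<^sub>R e i + y) \<partial>leb e I \<partial>lborel)"
  using insert.hyps by (simp add: leb_insert)
 also have "... = (\<integral>\<^sup>+t. ennreal (c ^ card I) * (\<integral>\<^sup>+y. f (t *\<^sub>R e i + c *\<^sub>R y) \<partial>leb e I) \<partial>lborel)"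
  by (intro nn_integral_cong insert.IH) auto
 also have "... = ennreal c * (\<integral>\<^sup>+t. ennreal (c ^ card I) * (\<integral>\<^sup>+y. f (c *\<^sub>R (t *\<^sub>R e i + y)) \<partial>leb e I) \<partial>lborel)"
  using \<open>c > 0\<close> by (subst nn_integral_real_affine[of _ c 0]) (auto simp: scaleR_add_right)
 also have "... = ennreal (c ^ card (insert i I)) * (\<integral>\<^sup>+t. \<integral>\<^sup>+y. f (c *\<^sub>R (t *\<^sub>R e i + y)) \<partial>leb e I \<partial>lborel)"
  using \<open>c > 0\<close> insert.hyps by (subst nn_integral_cmult) (auto simp: ennreal_mult' mult.assoc)
 finally show ?case using insert.hyps by ((subst leb_insert), auto)
qed

lemma span_orth_inner:
 assumes "orth e (insert i I)" "i \<notin> I" "y \<in> span (e ` I)"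
 shows "e i \<bullet> y = 0"
 using assms(3)
proof (induction rule: span_induct_alt)
 case (step c x y)
 thus ?case using orthD(3)[OF assms(1), of i] assms(2) by (auto simp: inner_right_distrib)
qed simp

lemma norm_orth_insert:
 assumes "orth e (insert i I)" "i \<notin> I" "y \<in> span (e ` I)"
 shows "(norm (t *\<^sub>R e i + y))\<^sup>2 = t\<^sup>2 + (norm y)\<^sup>2"
proof -
 show ?thesis
  using span_orth_inner[OF assms] orthD(2)[OF assms(1), of i] unfolding power2_norm_eq_inner by (simp add: inner_simps inner_commute power2_eq_square)
qed

text \<open>Up to a constant, the density that remains on a subspace after n further coordinates of
  a unit ball are integrated out. It is 0 on the unit sphere also for n = 0.\<close>

definition hball :: "nat => 'v::euclidean_space => real" where
 "hball n x = (if norm x < 1 then sqrt (1 - (norm x)\<^sup>2) ^ n else 0)"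

lemma hball_nonneg: "0 <= hball n x"
 by (auto simp: hball_def abs_square_le_1)

lemma hball_measurable [measurable]: "hball n \<in> borel_measurable borel"
 unfolding hball_def by measurable

lemma hball_split:
 assumes "(norm z)\<^sup>2 = (norm x)\<^sup>2 + (norm y)\<^sup>2" and "c = sqrt (1 - (norm x)\<^sup>2)"
 shows "hball n z = (if norm x < 1 then c ^ n * hball n (y /\<^sub>R c) else 0)"
proof (cases "norm x < 1")
 case True
 have c: "c > 0" "c\<^sup>2 = 1 - (norm x)\<^sup>2" using True abs_square_less_1[of "norm x"] assms(2) by auto
 have 1: "norm (y /\<^sub>R c) < 1 \<longleftrightarrow> norm z < 1"
 proof -
  have "norm (y /\<^sub>R c) < 1 \<longleftrightarrow> norm y < c" using c by (simp add: field_simps)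
  also have "... \<longleftrightarrow> (norm y)\<^sup>2 < c\<^sup>2"
   using c(1) by (metis less_le power2_less_imp_less norm_ge_zero power_strict_mono zero_less_numeral)
  also have "... \<longleftrightarrow> (norm z)\<^sup>2 < 1" unfolding c assms(1) by auto
  finally show ?thesis by (simp add: abs_square_less_1)
 qed
 have "c\<^sup>2 * (norm (y /\<^sub>R c))\<^sup>2 = (norm y)\<^sup>2" using c(1) by (simp add: power_mult_distrib power_inverse)
 hence "1 - (norm z)\<^sup>2 = c\<^sup>2 * (1 - (norm (y /\<^sub>R c))\<^sup>2)" using assms(1) c(2) by (simp add: right_diff_distrib)
 thus ?thesis using c(1) True 1 by (simp add: real_sqrt_mult hball_def power_mult_distrib)
next
 case False
 hence "~ (norm z)\<^sup>2 < 1" using assms(1) by (simp add: not_less add_increasing2)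
 thus ?thesis using False by (simp add: hball_def abs_square_less_1)
qed

definition ball_const :: "nat => nat => real" where
 "ball_const d n = pi powr (real d / 2) * Gamma (real n / 2 + 1) / Gamma (real (n + d) / 2 + 1)"

lemma ball_const_pos: "ball_const d n > 0"
 unfolding ball_const_def by (intro divide_pos_pos) (auto intro!: Gamma_real_pos add_nonneg_pos)

text \<open>The fibre over x is a ball of radius c = sqrt(1 - |x|^2); rescaling it produces c^n from
  the integrand and c^(card I) from the volume.\<close>

lemma leb_hball_shift:
 assumes "finite I" "!!y. y \<in> span (e ` I) ==> (norm (x + y))\<^sup>2 = (norm x)\<^sup>2 + (norm y)\<^sup>2"
 shows "(\<integral>\<^sup>+y. ennreal (hball n (x + y)) \<partial>leb e I) = ennreal (hball (n + card I) x) * (\<integral>\<^sup>+y. ennreal (hball n y) \<partial>leb e I)"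
proof (cases "norm x < 1")
 case True
 define c where "c = sqrt (1 - (norm x)\<^sup>2)"
 have c: "c > 0" using True abs_square_less_1[of "norm x"] by (simp add: c_def)
 have "(\<integral>\<^sup>+y. ennreal (hball n (x + y)) \<partial>leb e I) = (\<integral>\<^sup>+y. ennreal (c ^ n) * ennreal (hball n (y /\<^sub>R c)) \<partial>leb e I)"
 proof (rule leb_cong)
  fix y assume y: "y \<in> span (e ` I)"
  show "ennreal (hball n (x + y)) = ennreal (c ^ n) * ennreal (hball n (y /\<^sub>R c))"
   using True c hball_split[OF assms(2)[OF y] c_def, of n] by (simp add: ennreal_mult')
 qed
 also have "... = ennreal (c ^ n) * (\<integral>\<^sup>+y. ennreal (hball n (y /\<^sub>R c)) \<partial>leb e I)"
  by (rule nn_integral_cmult) measurable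
 also have "(\<integral>\<^sup>+y. ennreal (hball n (y /\<^sub>R c)) \<partial>leb e I) = ennreal (c ^ card I) * (\<integral>\<^sup>+y. ennreal (hball n y) \<partial>leb e I)"
  using c assms(1) by (subst leb_scale[OF _ c]) auto
 finally show ?thesis using True c by (simp add: hball_def c_def power_add ennreal_mult' mult.assoc)
next
 case False
 have "(\<integral>\<^sup>+y. ennreal (hball n (x + y)) \<partial>leb e I) = (\<integral>\<^sup>+y. 0 \<partial>leb e I)"
  using False hball_split[OF assms(2) refl] by (intro leb_cong) simp
 thus ?thesis using False by (simp add: hball_def)
qed

lemma leb_hball: "orth e I ==> (\<integral>\<^sup>+x. ennreal (hball n x) \<partial>leb e I) = ennreal (ball_const (card I) n)"
proof -
 assume o: "orth e I"
 from orthD(1)[OF o] o show ?thesis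
 proof (induction I rule: finite_induct)
  case empty
  have "Gamma (real n / 2 + 1) > 0" by (intro Gamma_real_pos) auto
  hence "ball_const 0 n = 1"
   unfolding ball_const_def by (metis add.right_neutral divide_eq_0_iff divide_self_if less_irrefl mult_1 of_nat_0 pi_neq_zero powr_zero_eq_one)
  thus ?case by (subst leb_empty) (auto simp: hball_def)
 next
  case (insert i I)
  let ?d = "card I"
  have oI: "orth e I" using insert.prems by (rule orth_subset) auto
  have ei: "norm (e i) = 1" using orthD(2)[OF insert.prems, of i] by (simp add: norm_eq_sqrt_inner)
  \<comment> \<open>At t = 1 and t = -1 the two sides can differ, since \<open>hball\<close>
    vanishes on the sphere while a zeroth power is 1; the two points are null.\<close>
  have "(\<integral>\<^sup>+y. ennreal (hball n (t *\<^sub>R e i + y)) \<partial>leb e I)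
    = indicator {-1..1} t * ennreal (sqrt (1 - t\<^sup>2) ^ (n + ?d)) * ennreal (ball_const ?d n)" if "t \<notin> {-1, 1}" for t
   unfolding insert.IH[OF oI, symmetric] by (subst leb_hball_shift)
     (use insert.hyps that norm_orth_insert[OF insert.prems insert.hyps(2)] in
      \<open>auto simp: ei hball_def[of "n + ?d"] indicator_def\<close>)
  hence *: "(\<integral>\<^sup>+x. ennreal (hball n x) \<partial>leb e (insert i I))
    = (\<integral>\<^sup>+t. indicator {-1..1} t * ennreal (sqrt (1 - t\<^sup>2) ^ (n + ?d)) * ennreal (ball_const ?d n) \<partial>lborel)"
   using insert.hyps AE_lborel_singleton[of "1::real"] AE_lborel_singleton[of "-1::real"]
   by (subst leb_insert) (auto intro!: nn_integral_cong_AE)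
  have "... = (\<integral>\<^sup>+t. indicator {-1..1} t * sqrt (1 - t\<^sup>2) ^ (n + ?d) \<partial>lborel) * ennreal (ball_const ?d n)"
   by (subst nn_integral_multc[symmetric])
     (auto intro!: nn_integral_cong simp: indicator_def)
  also have "... = ennreal (Beta (1 / 2) (real (n + ?d) / 2 + 1)) * ennreal (ball_const ?d n)"
   by (simp only: emeasure_cball_aux_integral)
  also have "... = ennreal (Beta (1 / 2) (real (n + ?d) / 2 + 1) * ball_const ?d n)"
   using ball_const_pos[of ?d n] by (simp add: ennreal_mult'')
  also have "Beta (1 / 2) (real (n + ?d) / 2 + 1) * ball_const ?d n = ball_const (card (insert i I)) n"
  proof -
   define u where "u = real (n + ?d) / 2 + 1"
   have "Gamma u ~= 0" unfolding u_def by (intro less_imp_neq[THEN not_sym] Gamma_real_pos add_nonneg_pos) auto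
   moreover have "pi powr (real (Suc ?d) / 2) = sqrt pi * pi powr (real ?d / 2)"
    by (simp add: powr_half_sqrt[symmetric] add_divide_distrib flip: powr_add)
   moreover have "1 / 2 + u = real (n + Suc ?d) / 2 + 1" "card (insert i I) = Suc ?d"
    using insert.hyps by (simp_all add: u_def field_simps)
   ultimately show ?thesis
    unfolding Beta_def ball_const_def u_def[symmetric] by (simp del: of_nat_add add: Gamma_one_half_real)
  qed
  finally show ?case unfolding * .
 qed
qed

text \<open>Uniqueness of Haar measure by Fubini: both measures are invariant under translations of
  the common span and give the unit ball the same mass. Integrating the ball indicator at x times
  f(x + y) in both orders yields that mass times either integral.\<close>

lemma leb_unique:
 assumes o: "orth e I" "orth e' J" and sp: "span (e ` I) = span (e' ` J)" and f: "f \<in> borel_measurable borel"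
 shows "(\<integral>\<^sup>+x. f x \<partial>leb e I) = (\<integral>\<^sup>+x. f x \<partial>leb e' J)"
proof -
 note fin = orthD(1)[OF o(1)] orthD(1)[OF o(2)]
 note [measurable] = f
 let ?A = "indicator (ball 0 1) :: 'b => ennreal"
 have A: "(\<integral>\<^sup>+x. ?A x \<partial>leb e I) = ennreal (ball_const (card I) 0)" if "orth e I" for e :: "'x => 'b" and I
 proof -
  have "?A = (%x. ennreal (hball 0 x))" by (auto simp: hball_def)
  thus ?thesis using leb_hball[OF that] by simp
 qed
 have card: "card I = card J"
 proof -
  have d: "card I = dim (span (e ` I))" if "orth e I" for e :: "'x => 'b" and I
  proof -
   have inj: "inj_on e I" using orthD(2,3)[OF that] by (metis inj_onI zero_neq_one)
   have "pairwise orthogonal (e ` I)" using orthD(3)[OF that] by (auto simp: pairwise_def orthogonal_def)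
   moreover have "0 \<notin> e ` I" using orthD(2)[OF that] by (metis imageE inner_zero_left zero_neq_one)
   ultimately have "independent (e ` I)" by (rule pairwise_orthogonal_independent)
   thus ?thesis using inj by (simp add: dim_eq_card_independent card_image)
  qed
  show ?thesis using d[OF o(1)] d[OF o(2)] sp by simp
 qed
 let ?c = "ennreal (ball_const (card I) 0)"
 have [measurable]: "?A \<in> borel_measurable borel" by (intro borel_measurable_indicator) auto
 have m1: "(%(x, y). ?A x * f (x + y)) \<in> borel_measurable (borel \<Otimes>\<^sub>M borel)" by measurable
 have m2: "(%(x, y). ?A (x - y) * f x) \<in> borel_measurable (borel \<Otimes>\<^sub>M borel)" by measurable
 have neg: "?A (x - y) = ?A (y - x)" for x y by (auto simp: indicator_def norm_minus_commute)
 have "?c * (\<integral>\<^sup>+y. f y \<partial>leb e' J) = (\<integral>\<^sup>+x. ?A x * (\<integral>\<^sup>+y. f y \<partial>leb e' J) \<partial>leb e I)"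
  by (subst nn_integral_multc) (auto simp: A[OF o(1)])
 also have "... = (\<integral>\<^sup>+x. \<integral>\<^sup>+y. ?A x * f (x + y) \<partial>leb e' J \<partial>leb e I)"
  using leb_translate[OF fin(2) _ f] sp by (intro leb_cong) (auto simp: nn_integral_cmult)
 also have "... = (\<integral>\<^sup>+y. \<integral>\<^sup>+x. ?A x * f (x + y) \<partial>leb e I \<partial>leb e' J)" using fin m1 by (intro leb_swap)
 also have "... = (\<integral>\<^sup>+y. \<integral>\<^sup>+x. ?A (x - y) * f x \<partial>leb e I \<partial>leb e' J)"
 proof (rule leb_cong)
  fix y assume "y \<in> span (e' ` J)"
  hence "(\<integral>\<^sup>+x. ?A ((y + x) - y) * f (y + x) \<partial>leb e I) = (\<integral>\<^sup>+x. ?A (x - y) * f x \<partial>leb e I)"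
   using sp by (intro leb_translate[OF fin(1), where f = "%x. ?A (x - y) * f x"]) auto
  thus "(\<integral>\<^sup>+x. ?A x * f (x + y) \<partial>leb e I) = (\<integral>\<^sup>+x. ?A (x - y) * f x \<partial>leb e I)" by (simp add: add.commute)
 qed
 also have "... = (\<integral>\<^sup>+x. \<integral>\<^sup>+y. ?A (x - y) * f x \<partial>leb e' J \<partial>leb e I)" using fin m2 by (intro leb_swap[symmetric])
 also have "... = (\<integral>\<^sup>+x. ?c * f x \<partial>leb e I)"
 proof (rule leb_cong)
  fix x assume "x \<in> span (e ` I)"
  hence "(\<integral>\<^sup>+y. ?A (- x + y) \<partial>leb e' J) = (\<integral>\<^sup>+y. ?A y \<partial>leb e' J)"
   using sp by (intro leb_translate[OF fin(2)]) (auto intro: span_neg)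
  hence "(\<integral>\<^sup>+y. ?A (x - y) \<partial>leb e' J) = ?c" using A[OF o(2)] card by (subst neg) simp
  thus "(\<integral>\<^sup>+y. ?A (x - y) * f x \<partial>leb e' J) = ?c * f x" by (subst nn_integral_multc) auto
 qed
 also have "... = ?c * (\<integral>\<^sup>+x. f x \<partial>leb e I)" by (rule nn_integral_cmult) measurable
 finally show ?thesis using ball_const_pos[of "card I" 0] by (simp add: ennreal_mult_cancel_left)
qed

lemma leb_isometry:
 assumes o: "orth e I" and g: "linear g" "!!x. x \<in> span (e ` I) ==> g x \<in> span (e ` I)"
  "!!x. x \<in> span (e ` I) ==> norm (g x) = norm x" and f: "f \<in> borel_measurable borel"
 shows "(\<integral>\<^sup>+x. f (g x) \<partial>leb e I) = (\<integral>\<^sup>+x. f x \<partial>leb e I)"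
proof -
 have inner: "g x \<bullet> g y = x \<bullet> y" if "x \<in> span (e ` I)" "y \<in> span (e ` I)" for x y
  using g(3)[OF that(1)] g(3)[OF that(2)] g(3)[OF span_add[OF that]]
  by (simp add: norm_eq_sqrt_inner linear_add[OF g(1)] inner_simps inner_commute)
 have base: "e i \<in> span (e ` I)" if "i \<in> I" for i using that by (intro span_base) auto
 have og: "orth (g \<circ> e) I" using o unfolding orth_def by (auto simp: inner base)
 have "span ((g \<circ> e) ` I) = g ` span (e ` I)" using linear_span_image[OF g(1), of "e ` I"] by (simp add: image_comp)
 also have "... = span (e ` I)"
 proof (rule subspace_dim_equal)
  have "inj_on g (span (e ` I))"
  proof (rule inj_onI)
   fix x y assume *: "x \<in> span (e ` I)" "y \<in> span (e ` I)" "g x = g y"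
   thus "x = y" using g(3)[OF span_diff[OF *(1,2)]] by (simp add: linear_diff[OF g(1)])
  qed
  thus "dim (span (e ` I)) <= dim (g ` span (e ` I))"
   using dim_image_eq[OF g(1), of "span (e ` I)"] by (simp add: span_span)
  show "subspace (g ` span (e ` I))" using g(1) by (intro linear_subspace_image subspace_span)
 qed (use g(2) in \<open>auto intro: subspace_span\<close>)
 finally have sp: "span ((g \<circ> e) ` I) = span (e ` I)" .
 have [measurable]: "g \<in> borel_measurable borel"
  using linear_continuous_on[OF linear_conv_bounded_linear[THEN iffD1, OF g(1)]] by (intro borel_measurable_continuous_onI)
 note [measurable] = f
 have "(\<integral>\<^sup>+x. f (g x) \<partial>leb e I) = (\<integral>\<^sup>+x. f x \<partial>leb (g \<circ> e) I)"
  by (simp add: nn_integral_leb linear_sum[OF g(1)] linear_scale[OF g(1)])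
 also have "... = (\<integral>\<^sup>+x. f x \<partial>leb e I)" by (rule leb_unique[OF og o sp f])
 finally show ?thesis .
qed

lemma span_orth_union:
 assumes "orth e (I \<union> J)" "I \<inter> J = {}" "x \<in> span (e ` I)" "y \<in> span (e ` J)"
 shows "x \<bullet> y = 0"
 using assms(3)
proof (induction rule: span_induct_alt)
 case (step c x z)
 then obtain i where i: "i \<in> I" "x = e i" by auto
 have "e i \<bullet> y = 0" using assms(2) i by (intro span_orth_inner[OF orth_subset[OF assms(1)] _ assms(4)]) auto
 thus ?case using step i by (simp add: inner_left_distrib)
qed simp

text \<open>As |x|^2 = 1 - (1 - |x|^2), the moment of order k + 1 with weight n is the difference of
  the moments of order k with weights n and n + 2.\<close>

lemma leb_hball_moment:
 assumes o: "orth e I"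
 shows "(\<integral>\<^sup>+x. ennreal (hball n x * norm x ^ (2 * k)) \<partial>leb e I)
  = ennreal (ball_const (card I) n * pochhammer (card I / 2) k / pochhammer ((n + card I) / 2 + 1) k)"
proof (induction k arbitrary: n)
 case 0
 thus ?case using leb_hball[OF o] by simp
next
 case (Suc k)
 let ?d = "card I"
 let ?m = "%n k. ball_const ?d n * pochhammer (?d / 2) k / pochhammer ((n + ?d) / 2 + 1) k"
 let ?I = "%n k. (\<integral>\<^sup>+x. ennreal (hball n x * norm x ^ (2 * k)) \<partial>leb e I)"
 have "hball n x * norm x ^ (2 * k) = hball n x * norm x ^ (2 * Suc k) + hball (n + 2) x * norm x ^ (2 * k)" for x :: 'b
 proof -
  have "hball (n + 2) x = hball n x * (1 - (norm x)\<^sup>2)"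
   using abs_square_less_1[of "norm x"] by (auto simp: hball_def power2_eq_square)
  hence "hball n x * norm x ^ (2 * k) = (hball n x * (norm x)\<^sup>2 + hball (n + 2) x) * norm x ^ (2 * k)"
   by (simp add: algebra_simps)
  thus ?thesis by (simp add: distrib_right mult.assoc power2_eq_square)
 qed
 hence "?I n k = (\<integral>\<^sup>+x. ennreal (hball n x * norm x ^ (2 * Suc k)) + ennreal (hball (n + 2) x * norm x ^ (2 * k)) \<partial>leb e I)"
  by (intro nn_integral_cong) (simp add: hball_nonneg)
 also have "... = ?I n (Suc k) + ?I (n + 2) k" by (rule nn_integral_add) measurable
 finally have eq: "ennreal (?m n k) = ?I n (Suc k) + ennreal (?m (n + 2) k)" unfolding Suc .
 have nn: "0 <= ?m (n + 2) k"
 proof (cases "?d = 0 & k > 0")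
  case False
  have "pochhammer (real (n + 2 + ?d) / 2 + 1) k > 0" by (intro pochhammer_pos add_nonneg_pos) auto
  moreover have "pochhammer (real ?d / 2) k >= 0"
   using False by (cases "k = 0") (auto intro!: pochhammer_pos less_imp_le)
  ultimately show ?thesis using ball_const_pos[of ?d "n + 2"] by simp
 qed (auto simp: pochhammer_0_left)
 have "?I n (Suc k) = ennreal (?m n k) - ennreal (?m (n + 2) k)"
  unfolding eq using nn by (subst ennreal_add_diff_cancel_right) auto
 also have "... = ennreal (?m n k - ?m (n + 2) k)" using nn by (rule ennreal_minus)
 also have "?m n k - ?m (n + 2) k = ?m n (Suc k)"
 proof -
  define a b where "a = real ?d / 2" and "b = real (n + ?d) / 2 + 1"
  have ab: "real n / 2 + 1 = b - a" "real (n + 2 + ?d) / 2 + 1 = b + 1" "b > 0"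
   by (simp_all add: a_def b_def field_simps)
  have pos_Gamma: "Gamma (z + 1) = z * Gamma z" if "z > 0" for z :: real using that by (intro Gamma_plus1) auto
  have G: "Gamma (real (n + 2) / 2 + 1) = (b - a) * Gamma (real n / 2 + 1)"
   using pos_Gamma[of "real n / 2 + 1"] unfolding ab(1)[symmetric] by (simp add: add_divide_distrib)
  have "Gamma (b + 1) = b * Gamma b" using ab(3) by (rule pos_Gamma)
  hence bc: "ball_const ?d (n + 2) = ball_const ?d n * (b - a) / b"
   unfolding ball_const_def G ab(2) b_def[symmetric] by (simp add: mult_ac)
  have pos: "pochhammer b k > 0" "pochhammer (b + 1) k > 0" using ab(3) by (auto intro!: pochhammer_pos)
  have p: "b * pochhammer (b + 1) k = pochhammer b k * (b + k)" by (metis pochhammer_Suc pochhammer_rec)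
  have "?m n k - ?m (n + 2) k = ball_const ?d n * pochhammer a k * (1 / pochhammer b k - (b - a) / (b * pochhammer (b + 1) k))"
   unfolding bc ab(2) a_def[symmetric] b_def[symmetric] by (simp add: algebra_simps)
  also have "1 / pochhammer b k - (b - a) / (b * pochhammer (b + 1) k) = (a + k) / pochhammer b (Suc k)"
  proof -
   define Q s where "Q = pochhammer b k" and "s = b + real k"
   have "Q ~= 0" "s ~= 0" "b - a = s - (a + k)" using pos(1) ab(3) by (auto simp: Q_def s_def)
   hence "1 / Q - (b - a) / (Q * s) = (a + k) / (Q * s)" by (simp add: divide_simps)
   thus ?thesis unfolding p pochhammer_Suc Q_def s_def .
  qed
  finally show ?thesis unfolding a_def[symmetric] b_def[symmetric] by (simp add: pochhammer_Suc[of a])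
 qed
 finally show ?case .
qed

text \<open>The coordinates on which \<open>g\<close> does not depend are integrated out; this
  raises the weight from n to n + card J, and the radial moment on the span over I remains.\<close>

lemma leb_hball_moment_part:
 assumes o: "orth e (I \<union> J)" "I \<inter> J = {}" and g: "!!x y. x \<in> span (e ` I) ==> y \<in> span (e ` J) ==> g (x + y) = norm x"
  and [measurable]: "g \<in> borel_measurable borel"
 shows "(\<integral>\<^sup>+x. ennreal (hball n x * g x ^ (2 * k)) \<partial>leb e (I \<union> J))
  = ennreal (ball_const (card (I \<union> J)) n * pochhammer (card I / 2) k / pochhammer ((n + card (I \<union> J)) / 2 + 1) k)"
proof -
 have oI: "orth e I" "orth e J" using o(1) by (auto intro: orth_subset)
 note fin = orthD(1)[OF oI(1)] orthD(1)[OF oI(2)]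
 have pyth: "(norm (x + y))\<^sup>2 = (norm x)\<^sup>2 + (norm y)\<^sup>2" if "x \<in> span (e ` I)" "y \<in> span (e ` J)" for x y
  using span_orth_union[OF o that] by (simp add: power2_norm_eq_inner inner_simps inner_commute)
 have card: "card (I \<union> J) = card I + card J" using fin o(2) by (rule card_Un_disjoint)
 have "(\<integral>\<^sup>+x. ennreal (hball n x * g x ^ (2 * k)) \<partial>leb e (I \<union> J))
   = (\<integral>\<^sup>+x. \<integral>\<^sup>+y. ennreal (hball n (x + y) * g (x + y) ^ (2 * k)) \<partial>leb e J \<partial>leb e I)"
  using fin o(2) by (intro leb_union) measurable
 also have "... = (\<integral>\<^sup>+x. \<integral>\<^sup>+y. ennreal (norm x ^ (2 * k)) * ennreal (hball n (x + y)) \<partial>leb e J \<partial>leb e I)"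
  by (intro leb_cong) (simp add: g mult.commute[of "hball _ _"] ennreal_mult')
 also have "... = (\<integral>\<^sup>+x. ennreal (norm x ^ (2 * k)) * (\<integral>\<^sup>+y. ennreal (hball n (x + y)) \<partial>leb e J) \<partial>leb e I)"
  by (intro nn_integral_cong nn_integral_cmult) measurable
 also have "... = (\<integral>\<^sup>+x. ennreal (hball (n + card J) x * norm x ^ (2 * k)) * ennreal (ball_const (card J) n) \<partial>leb e I)"
  using fin(2) pyth by (intro leb_cong, subst leb_hball_shift)
    (auto simp: leb_hball[OF oI(2)] ennreal_mult' hball_nonneg ac_simps)
 also have "... = (\<integral>\<^sup>+x. ennreal (hball (n + card J) x * norm x ^ (2 * k)) \<partial>leb e I) * ennreal (ball_const (card J) n)"
  by (rule nn_integral_multc) measurable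
 also have "... = ennreal (ball_const (card I) (n + card J) * pochhammer (card I / 2) k
   / pochhammer ((n + card J + card I) / 2 + 1) k * ball_const (card J) n)"
  using ball_const_pos[of "card J" n] unfolding leb_hball_moment[OF oI(1)] by (subst ennreal_mult'') auto
 also have "ball_const (card I) (n + card J) * ball_const (card J) n = ball_const (card (I \<union> J)) n"
 proof -
  have "Gamma (real (n + card J) / 2 + 1) ~= 0"
   by (intro less_imp_neq[THEN not_sym] Gamma_real_pos add_nonneg_pos) auto
  thus ?thesis by (simp add: add_divide_distrib ball_const_def card add_ac flip: powr_add)
 qed
 hence "ball_const (card I) (n + card J) * pochhammer (card I / 2) k
   / pochhammer ((n + card J + card I) / 2 + 1) k * ball_const (card J) n = ball_const (card (I \<union> J)) n * pochhammer (card I / 2) k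
   / pochhammer ((n + card (I \<union> J)) / 2 + 1) k" unfolding card by (simp add: ac_simps)
 finally show ?thesis .
qed

section \<open>Invariant averages of congruences and their eigenvalues\<close>

section \<open>Averaging operators\<close>

text \<open>\<open>JP \<beta> p k ka\<close> is the Jack polynomial with leading coefficient 1, and \<open>PM\<close> extends it to all
 matrices as a polynomial in traces of powers.\<close>

abbreviation JP :: "nat => nat => nat => (nat => nat) => (nat => real) => real" where
 "JP \<equiv> jack_setting.PP"

definition PM :: "nat => nat => (nat => nat) => quat^'m^'m => real" where
 "PM \<beta> k ka = (SOME F. psum k F & (ALL x. F (dg x) = JP \<beta> CARD('m) k ka x))"

lemma PM:
 assumes "\<beta> \<in> {1, 2, 4}" "ka \<in> parts CARD('m) k"
 shows "psum k (PM \<beta> k ka :: quat^'m^'m => real)" "PM \<beta> k ka (dg x :: quat^'m^'m) = JP \<beta> CARD('m) k ka x"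
proof -
 interpret jack_setting \<beta> "CARD('m)" by (rule jack_setting) fact
 have "EX F :: quat^'m^'m => real. psum k F & (ALL x. F (dg x) = PP k ka x)"
  using symf_psum[OF PP(5,2)[OF assms(2)]] .
 from someI_ex[OF this] show "psum k (PM \<beta> k ka :: quat^'m^'m => real)"
  "PM \<beta> k ka (dg x :: quat^'m^'m) = JP \<beta> CARD('m) k ka x" unfolding PM_def by auto
qed

lemma norm_matrix_vector_le:
 fixes A :: "quat^'m^'m"
 shows "norm (A *v v) <= (\<Sum>i\<in>UNIV. \<Sum>j\<in>UNIV. norm (A $ i $ j)) * norm v"
proof -
 have "norm (A *v v) <= (\<Sum>i\<in>UNIV. norm ((A *v v) $ i))" unfolding norm_vec_def by (rule L2_set_le_sum) simp
 also have "... <= (\<Sum>i\<in>UNIV. \<Sum>j\<in>UNIV. norm (A $ i $ j) * norm v)"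
 proof (rule sum_mono)
  fix i
  have "norm ((A *v v) $ i) <= (\<Sum>j\<in>UNIV. norm (A $ i $ j * v $ j))" unfolding matrix_vector_nth by (rule norm_sum)
  also have "... <= (\<Sum>j\<in>UNIV. norm (A $ i $ j) * norm v)"
   by (intro sum_mono) (auto simp: norm_quat_mult intro!: mult_left_mono Finite_Cartesian_Product.norm_nth_le)
  finally show "norm ((A *v v) $ i) <= (\<Sum>j\<in>UNIV. norm (A $ i $ j) * norm v)" .
 qed
 finally show ?thesis by (simp add: sum_distrib_right)
qed

lemma eigv_dg:
 assumes "\<beta> \<in> {1, 2, 4}" "!!i j. i <= j ==> j < CARD('m) ==> a j <= a i" "i < CARD('m)"
 shows "eigv \<beta> (dg a :: quat^'m^'m) i = a i"
 by (rule eigv_unique[of _ "mat 1"]) (use assms in auto)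

lemma mon_le:
 assumes "ka \<in> exponents p k" "!!i. i < p ==> 0 <= x i & x i <= c * y i"
 shows "mon p ka x <= c ^ k * mon p ka y"
proof -
 have "mon p ka x <= (\<Prod>i<p. (c * y i) ^ ka i)"
  unfolding mon_def using assms(2) by (intro prod_mono) (auto intro!: power_mono)
 thus ?thesis using assms(1) by (simp add: mon_def power_mult_distrib prod.distrib exponents_def flip: power_sum)
qed

lemma congruence_growth:
 fixes Z :: "quat^'m^'m"
 assumes \<beta>: "\<beta> \<in> {1, 2, 4}" and ka: "ka \<in> parts CARD('m) k"
  and B: "B \<in> hermitian \<beta>" "!!v. v \<in> Fvec \<beta> ==> 0 <= v \<bullet> (B *v v)" and Z: "Z \<in> Fmat \<beta>"
  and le: "!!v. norm (Z *v v) <= c * norm v"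
 shows "mon CARD('m) ka (eigv \<beta> (adj Z ** B ** Z)) <= (c\<^sup>2) ^ k * mon CARD('m) ka (eigv \<beta> B)"
proof (rule mon_le)
 show "ka \<in> exponents CARD('m) k" using ka parts_subset by blast
 fix i assume i: "i < CARD('m)"
 have "0 <= v \<bullet> ((adj Z ** B ** Z) *v v)" if "v \<in> Fvec \<beta>" for v
  using B(2)[of "Z *v v"] Z that by (simp add: quadratic_congruence)
 thus "0 <= eigv \<beta> (adj Z ** B ** Z) i & eigv \<beta> (adj Z ** B ** Z) i <= c\<^sup>2 * eigv \<beta> B i"
  using eigv_congruence_le[OF \<beta> B Z le i] eigv_nonneg[OF \<beta> hermitian_congruence(1)[OF B(1) Z] _ i] by simp
qed

text \<open>A congruence enlarges each eigenvalue by at most the factor c^2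
  (\<open>eigv_congruence_le\<close>), so along monomial curves the function grows no faster than
  the monomial \<open>ka\<close>; \<open>dominated_of_growth\<close> concludes.\<close>

lemma domf_congruence:
 fixes Z :: "quat^'m^'m"
 assumes \<beta>: "\<beta> \<in> {1, 2, 4}" and ka: "ka \<in> parts CARD('m) k" and Z: "Z \<in> Fmat \<beta>"
 shows "domf CARD('m) k ka (%x. PM \<beta> k ka (adj Z ** dg x ** Z))"
proof -
 interpret jack_setting \<beta> "CARD('m)" by (rule jack_setting) fact
 let ?p = "CARD('m)" and ?f = "%x. PM \<beta> k ka (adj Z ** dg x ** Z)"
 have ka': "ka \<in> exponents ?p k" using ka parts_subset by blast
 have hp: "hp ?p k ?f" using congruence_coeffs[OF psum_hmp[OF PM(1)[OF \<beta> ka]]] by auto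
 obtain c where c: "!!v. norm (Z *v v) <= c * norm v" using norm_matrix_vector_le by blast
 define S where "S = (\<Sum>al\<in>exponents ?p k. \<bar>cf ?p k (PP k ka) al\<bar>)"
 have S: "S >= 0" by (simp add: S_def)
 have "dominated al ka" if "cf ?p k ?f al ~= 0" for al
 proof (rule dominated_of_growth[OF hp ka' _ that])
  fix w assume w: "dec ?p w"
  have "\<bar>?f (pt u w)\<bar> <= S * (c\<^sup>2) ^ k * u ^ wt ?p w ka" if u: "u >= 1" for u
  proof -
   let ?B = "dg (pt u w) :: quat^'m^'m"
   let ?A = "adj Z ** ?B ** Z"
   have psd: "0 <= v \<bullet> (?B *v v)" for v
    using u pt_pos[of u w] unfolding quadratic_dg by (intro sum_nonneg mult_nonneg_nonneg) (auto intro: less_imp_le)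
   have A: "?A \<in> hermitian \<beta>" "!!v. 0 <= v \<bullet> (?A *v v)"
    using Z psd by (auto simp: quadratic_congruence intro: hermitian_congruence)
   have "?f (pt u w) = PP k ka (eigv \<beta> ?A)"
    by (simp add: invp_hermitian[OF \<beta> psum_invp[OF PM(1)[OF \<beta> ka]] A(1)] PM(2)[OF \<beta> ka])
   also have "\<bar>...\<bar> <= S * mon ?p ka (eigv \<beta> ?A)"
    unfolding S_def using eigv(1)[OF \<beta> A(1)] eigv_nonneg[OF \<beta> A(1)] A(2)
    by (intro domf_bound[OF PP(1)[OF ka] ka']) auto
   also have "... <= S * ((c\<^sup>2) ^ k * mon ?p ka (eigv \<beta> ?B))"
    using S psd Z c by (intro mult_left_mono congruence_growth[OF \<beta> ka]) auto
   also have "mon ?p ka (eigv \<beta> ?B) = mon ?p ka (pt u w)"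
    unfolding mon_def using pt_sorted[OF w u] by (intro prod.cong) (auto simp: eigv_dg[OF \<beta>])
   finally show ?thesis by (simp add: mon_pt)
  qed
  thus "EX C. \<forall>\<^sub>F u in at_top. \<bar>?f (pt u w)\<bar> <= C * u ^ wt ?p w ka"
   by (intro exI[of _ "S * (c\<^sup>2) ^ k"] eventually_mono[OF eventually_ge_at_top[of 1]])
 qed
 thus ?thesis using hp by (simp add: domf_def)
qed

text \<open>The leading coefficient of \<open>x \<mapsto> PM (Z* (dg x) Z)\<close>; it is the analogue of a product of powers
 of leading principal minors of \<open>Z Z*\<close>.\<close>

definition lead :: "nat => nat => (nat => nat) => quat^'m^'m => real" where
 "lead \<beta> k ka Z = cf CARD('m) k (%x. PM \<beta> k ka (adj Z ** dg x ** Z)) ka"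

lemma continuous_on_lead:
 assumes "\<beta> \<in> {1, 2, 4}" "ka \<in> parts CARD('m) k"
 shows "continuous_on UNIV (lead \<beta> k ka :: quat^'m^'m => real)"
proof -
 obtain h where h: "ALL al. continuous_on UNIV (h al)"
  "ALL (Z::quat^'m^'m) x. PM \<beta> k ka (adj Z ** dg x ** Z) = hom_poly CARD('m) k (%al. h al Z) x"
  using congruence_coeffs[OF psum_hmp[OF PM(1)[OF assms]]] by blast
 have "lead \<beta> k ka Z = h ka Z" for Z :: "quat^'m^'m"
  using assms(2) parts_subset unfolding lead_def h(2)[rule_format] by (intro cf_hom_poly) blast
 thus ?thesis using h(1) by simp
qed

lemma lead_one:
 assumes "\<beta> \<in> {1, 2, 4}" "ka \<in> parts CARD('m) k"
 shows "lead \<beta> k ka (mat 1 :: quat^'m^'m) = 1"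
 using jack_setting.PP(3)[OF jack_setting[OF assms(1)] assms(2)] by (simp add: lead_def PM(2)[OF assms])

lemma lead_unitary:
 assumes "\<beta> \<in> {1, 2, 4}" "ka \<in> parts CARD('m) k" "U \<in> unitary \<beta>"
 shows "lead \<beta> k ka (Z ** U :: quat^'m^'m) = lead \<beta> k ka Z"
proof -
 have "PM \<beta> k ka (adj (Z ** U) ** dg x ** (Z ** U)) = PM \<beta> k ka (adj Z ** dg x ** Z)" for x
  using psum_unitary[OF PM(1)[OF assms(1,2)] unitary_intros(2)[OF assms(3)], of "adj Z ** dg x ** Z"]
  by (simp add: adjoint_mult matrix_mul_assoc)
 thus ?thesis by (simp add: lead_def)
qed

definition qdiag :: "('m => quat) => quat^'m^'m" where
 "qdiag q = (\<chi> i j. if i = j then q i else 0)"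

lemma qdiag_mult: "(qdiag q ** Z) $ i $ j = q i * Z $ i $ j"
 by (simp add: qdiag_def matrix_mult_nth if_distrib[of "%x. x * _"] cong: if_cong)

text \<open>Scaling the rows of \<open>Z\<close> replaces each x_i by |q_i|^2 x_i, so the
  coefficient at \<open>ka\<close> picks up the monomial \<open>ka\<close> in the |q_i|^2.\<close>

lemma lead_qdiag:
 assumes "\<beta> \<in> {1, 2, 4}" "ka \<in> parts CARD('m) k"
 shows "lead \<beta> k ka (qdiag q ** Z :: quat^'m^'m) = (\<Prod>i\<in>UNIV. norm (q i) ^ (2 * ka (ix i))) * lead \<beta> k ka Z"
proof -
 let ?p = "CARD('m)" and ?y = "%l. (norm (q (xi l)))\<^sup>2"
 have ka': "ka \<in> exponents ?p k" using assms(2) parts_subset by blast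
 obtain h where h: "PM \<beta> k ka (adj Z ** dg x ** Z) = hom_poly ?p k h x" for x
  using congruence_coeffs[OF psum_hmp[OF PM(1)[OF assms]]] by metis
 have "adj (qdiag q) ** dg x ** qdiag q = dg (%l. ?y l * x l)" for x
 proof (rule mat_eqI)
  fix i j
  have "(adj (qdiag q) ** (dg x ** qdiag q)) $ i $ j
    = (\<Sum>a\<in>UNIV. if a = i then qcnj (q i) * (x (ix i) *\<^sub>R qdiag q $ i $ j) else 0)"
   unfolding matrix_mult_nth[of "adj _"] dg_mult_left by (intro sum.cong) (auto simp: qdiag_def)
  thus "(adj (qdiag q) ** dg x ** qdiag q) $ i $ j = dg (%l. ?y l * x l) $ i $ j"
   by (simp add: qdiag_def dg_nth qcnj_mult_self mult.commute matrix_mul_assoc)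
 qed
 hence "PM \<beta> k ka (adj (qdiag q ** Z) ** dg x ** (qdiag q ** Z)) = hom_poly ?p k h (%l. ?y l * x l)" for x
  unfolding h[symmetric] adjoint_mult by (simp only: matrix_mul_assoc[symmetric]) (simp only: matrix_mul_assoc)
 also have "hom_poly ?p k h (%l. ?y l * x l) = hom_poly ?p k (%al. (\<Prod>i<?p. ?y i ^ al i) * h al) x" for x
  unfolding hom_poly_def by (simp add: power_mult_distrib prod.distrib mult_ac)
 finally have "lead \<beta> k ka (qdiag q ** Z) = (\<Prod>i<?p. ?y i ^ ka i) * h ka"
  using ka' unfolding lead_def by (simp add: cf_hom_poly)
 moreover have "lead \<beta> k ka Z = h ka" using ka' unfolding lead_def h by (simp add: cf_hom_poly)
 moreover have "(\<Prod>i<?p. ?y i ^ ka i) = (\<Prod>i\<in>UNIV. norm (q i) ^ (2 * ka (ix i)))"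
  by (subst prod_ix[symmetric, where 'm = 'm]) (simp add: power_mult)
 ultimately show ?thesis by simp
qed

lemma mon_diff_le:
 assumes al: "al \<in> exponents p k" and c: "1 <= c"
  and x: "!!i. i < p ==> 0 <= x i & 0 <= y i & x i <= c * y i & y i <= c * x i"
 shows "\<bar>mon p al y - mon p al x\<bar> <= (c ^ k - 1) * c ^ k * mon p al x"
proof -
 have *: "mon p al x <= c ^ k * mon p al y" "mon p al y <= c ^ k * mon p al x"
  using x by (auto intro!: mon_le[OF al])
 have m: "0 <= mon p al x" "0 <= mon p al y" using x by (auto simp: mon_def intro!: prod_nonneg)
 have ck: "1 <= c ^ k" using c by simp
 have "mon p al y - mon p al x <= (c ^ k - 1) * mon p al x" using *(2) by (simp add: algebra_simps)
 also have "... <= (c ^ k - 1) * (c ^ k * mon p al x)"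
  using ck m by (intro mult_left_mono) (auto simp: mult_right_mono[of 1 "c ^ k" "mon p al x", simplified])
 finally have 1: "mon p al y - mon p al x <= (c ^ k - 1) * c ^ k * mon p al x" by simp
 have "mon p al x - mon p al y <= (c ^ k - 1) * mon p al y" using *(1) by (simp add: algebra_simps)
 also have "... <= (c ^ k - 1) * (c ^ k * mon p al x)" using ck *(2) by (intro mult_left_mono) auto
 finally show ?thesis using 1 by (simp add: abs_le_iff)
qed

lemma domf_near:
 assumes f: "domf p k ka f" and ka: "ka \<in> exponents p k" and c: "1 <= c"
  and xy: "!!i. i < p ==> x i <= c * y i & y i <= c * x i & 0 <= y i"
  and x: "!!i j. i <= j ==> j < p ==> 0 <= x j & x j <= x i"
 shows "\<bar>f y - f x\<bar> <= (\<Sum>al\<in>exponents p k. \<bar>cf p k f al\<bar>) * ((c ^ k - 1) * c ^ k * mon p ka x)"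
proof -
 have "f y - f x = (\<Sum>al\<in>exponents p k. cf p k f al * (mon p al y - mon p al x))"
  by (subst (1 2) cf(1)[OF domf_hp[OF f]]) (simp add: hom_poly_mon right_diff_distrib sum_subtractf)
 also have "\<bar>...\<bar> <= (\<Sum>al\<in>exponents p k. \<bar>cf p k f al\<bar> * ((c ^ k - 1) * c ^ k * mon p ka x))"
 proof (rule order_trans[OF sum_abs], rule sum_mono)
  fix al assume al: "al \<in> exponents p k"
  show "\<bar>cf p k f al * (mon p al y - mon p al x)\<bar> <= \<bar>cf p k f al\<bar> * ((c ^ k - 1) * c ^ k * mon p ka x)"
  proof (cases "cf p k f al = 0")
   case False
   hence "dominated al ka" using f by (simp add: domf_def)
   hence "mon p al x <= mon p ka x" using al ka x by (rule mon_dominated)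
   hence "(c ^ k - 1) * c ^ k * mon p al x <= (c ^ k - 1) * c ^ k * mon p ka x"
    using c by ((intro mult_left_mono), auto)
   thus ?thesis using mon_diff_le[OF al c, of x y] xy x unfolding abs_mult by (intro mult_left_mono) force+
  qed simp
 qed
 finally show ?thesis by (simp add: sum_distrib_right)
qed

lemma eigen_near:
 fixes B M L :: "quat^'m^'m"
 assumes \<beta>: "\<beta> \<in> {1, 2, 4}" and B: "B \<in> hermitian \<beta>" "!!v. v \<in> Fvec \<beta> ==> 0 <= v \<bullet> (B *v v)"
  and M: "M \<in> Fmat \<beta>" "!!v. norm (M *v v) <= c * norm v"
  and L: "L \<in> Fmat \<beta>" "!!v. norm (L *v v) <= c * norm v" "M ** L = mat 1" and i: "i < CARD('m)"
 shows "eigv \<beta> (adj M ** B ** M) i <= c\<^sup>2 * eigv \<beta> B i"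
  "eigv \<beta> B i <= c\<^sup>2 * eigv \<beta> (adj M ** B ** M) i" "0 <= eigv \<beta> (adj M ** B ** M) i"
proof -
 let ?A = "adj M ** B ** M"
 have A: "?A \<in> hermitian \<beta>" "!!v. v \<in> Fvec \<beta> ==> 0 <= v \<bullet> (?A *v v)"
  using B M(1) by (auto simp: quadratic_congruence intro: hermitian_congruence)
 show "eigv \<beta> ?A i <= c\<^sup>2 * eigv \<beta> B i" by (rule eigv_congruence_le[OF \<beta> B M i])
 show "0 <= eigv \<beta> ?A i" by (rule eigv_nonneg[OF \<beta> A i])
 have "adj L ** ?A ** L = adj (M ** L) ** B ** (M ** L)" by (simp add: adjoint_mult matrix_mul_assoc)
 thus "eigv \<beta> B i <= c\<^sup>2 * eigv \<beta> ?A i" using eigv_congruence_le[OF \<beta> A L(1,2) i] L(3) by simp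
qed

text \<open>Conjugating \<open>E\<close> by the diagonal matrix of the curve multiplies its entries
  by u^(w_i - w_s), at most 1/u because weights decrease. Seen from the curve, 1 + E is a
  perturbation of the identity of size C/u; the eigenvalues change by factors tending to 1, and the
  leading coefficient, being a limit, does not change.\<close>

lemma lead_lower:
 fixes X E :: "quat^'m^'m"
 assumes \<beta>: "\<beta> \<in> {1, 2, 4}" and ka: "ka \<in> parts CARD('m) k" and X: "X \<in> Fmat \<beta>" and E: "E \<in> Fmat \<beta>"
  and lower: "!!i j. E $ i $ j ~= 0 ==> j = s & ix s < ix i"
 shows "lead \<beta> k ka ((mat 1 + E) ** X) = lead \<beta> k ka X"
proof -
 interpret jack_setting \<beta> "CARD('m)" by (rule jack_setting) fact
 let ?p = "CARD('m)"
 let ?F = "PM \<beta> k ka :: quat^'m^'m => real"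
 define N where "N = mat 1 + E"
 have ka': "ka \<in> exponents ?p k" using ka parts_subset by blast
 have NX: "N ** X \<in> Fmat \<beta>" using X E by (auto simp: N_def)
 obtain w where "generic ?p k w" using generic_exists by blast
 hence w: "dec ?p w" by (simp add: generic_def)
 obtain b where b: "!!v. norm (X *v v) <= b * norm v" using norm_matrix_vector_le by blast
 define C where "C = (\<Sum>i\<in>UNIV. \<Sum>j\<in>UNIV. norm (E $ i $ j))"
 define S where "S = (\<Sum>al\<in>exponents ?p k. \<bar>cf ?p k (PP k ka) al\<bar>)"
 define S' where "S' = (\<Sum>al\<in>exponents ?p k. \<bar>cf ?p k (msym ?p ka) al\<bar>)"
 obtain G :: "quat^'m^'m => real" where G: "psum k G" "!!x. G (dg x) = msym ?p ka x"
  using symf_psum[OF domf_hp[OF msym(1)[OF ka]] msym(2)[OF ka]] by blast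
 \<comment> \<open>The curve is run with u^2, so that its diagonal matrix has the square root
   \<open>dg (pt u w)\<close>.\<close>
 define g where "g Z u = ?F (adj Z ** dg (pt (u\<^sup>2) w) ** Z) / (u\<^sup>2) ^ wt ?p w ka" for Z :: "quat^'m^'m" and u
 have u2: "filterlim (%u::real. u\<^sup>2) at_top at_top" by (intro filterlim_pow_at_top filterlim_ident) auto
 have lim: "(g Z \<longlongrightarrow> lead \<beta> k ka Z) at_top" if "Z \<in> Fmat \<beta>" for Z
  using filterlim_compose[OF domf_tendsto[OF domf_congruence[OF \<beta> ka that] ka' w] u2]
  by (simp add: g_def[abs_def] lead_def)
 have near: "\<bar>g (N ** X) u - g X u\<bar> <= S * ((((1 + C / u)\<^sup>2) ^ k - 1) * ((1 + C / u)\<^sup>2) ^ k * (S' * (b\<^sup>2) ^ k))" if u: "u >= 1" for u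
 proof -
  define R where "R = (dg (pt u w) :: quat^'m^'m)"
  define R' where "R' = (dg (%i. 1 / pt u w i) :: quat^'m^'m)"
  define K where "K = R ** E ** R'"
  define c where "c = 1 + C / u"
  have pos: "pt u w i > 0" for i using u by (intro pt_pos) auto
  have R: "R \<in> Fmat \<beta>" "adj R = R" "R ** R = dg (pt (u\<^sup>2) w)" "R ** R' = mat 1" "R' ** R = mat 1"
   using u by (auto simp: R_def R'_def dg_mult_dg pt_def power_mult_distrib power2_eq_square)
  have K: "K \<in> Fmat \<beta>" using E by (auto simp: K_def R_def R'_def)
  have Kij: "norm (K $ i $ j) <= norm (E $ i $ j) / u" for i j
  proof (cases "E $ i $ j = 0")
   case False
   hence "pt u w (ix i) / pt u w (ix j) * norm (E $ i $ j) <= 1 / u * norm (E $ i $ j)"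
    using lower[OF False] w power_increasing[OF Suc_leI u] u by (simp add: dec_def pt_def field_simps)
   thus ?thesis using pos[of "ix i"] pos[of "ix j"] by (simp add: K_def R_def R'_def dg_mult_left dg_mult_right)
  qed (simp add: K_def R_def R'_def dg_mult_left dg_mult_right)
  have c1: "1 <= c" using u by (simp add: C_def sum_nonneg c_def)
  have bnd: "norm ((mat 1 + A) *v v) <= c * norm v"
   if "!!i j. norm (A $ i $ j) <= norm (E $ i $ j) / u | norm (A $ i $ j) <= norm (E $ j $ i) / u" "A = K | A = - K | A = adj K | A = - adj K" for A v
  proof -
   have "(\<Sum>i\<in>UNIV. \<Sum>j\<in>UNIV. norm (A $ i $ j)) = (\<Sum>i\<in>UNIV. \<Sum>j\<in>UNIV. norm (K $ i $ j))"
    using that(2) by (elim disjE) (auto intro: sum.swap)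
   also have "... <= (\<Sum>i\<in>UNIV. \<Sum>j\<in>UNIV. norm (E $ i $ j) / u)" by (intro sum_mono Kij)
   also have "... = C / u" by (simp add: C_def sum_divide_distrib)
   finally have "norm (A *v v) <= C / u * norm v"
    by (rule order_trans[OF norm_matrix_vector_le mult_right_mono]) simp
   thus ?thesis using norm_triangle_ineq[of v "A *v v"] by (simp add: matrix_vector_distribs c_def distrib_right)
  qed
  \<comment> \<open>Nonzero entries lie in column s and below row s, so \<open>E\<close> and with it
    \<open>K\<close> square to 0, and 1 - adj K inverts 1 + adj K exactly.\<close>
  have EE: "E ** E = 0"
  proof (rule mat_eqI)
   fix i j
   have "E $ i $ a * E $ a $ j = 0" for a
    using lower[of i a] lower[of a j] by (metis less_irrefl mult_zero_left mult_zero_right)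
   thus "(E ** E) $ i $ j = 0 $ i $ j" by (simp add: matrix_mult_nth)
  qed
  have KK: "K ** K = 0"
  proof -
   have "K ** K = R ** E ** (R' ** R) ** E ** R'" by (simp add: K_def matrix_mul_assoc)
   also have "... = R ** (E ** E) ** R'" by (simp add: R matrix_mul_assoc)
   finally show ?thesis by (simp add: EE)
  qed
  let ?M = "mat 1 + adj K" and ?L = "mat 1 - adj K"
  have "adj K ** adj K = adj (K ** K)" by (simp add: adjoint_mult)
  hence M_inv: "?M ** ?L = mat 1" by (simp add: matrix_mult_distribs KK)
  let ?B = "R ** X ** adj X ** R"
  have B: "?B = adj (adj X ** R) ** (adj X ** R)" by (simp add: adjoint_mult R matrix_mul_assoc)
  have Bh: "?B \<in> hermitian \<beta>" unfolding B using X R by (intro hermitian_gram) auto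
  have Bpsd: "0 <= v \<bullet> (?B *v v)" for v using quadratic_congruence[of v "adj X ** R" "mat 1"] by (simp add: B)
  have RN: "R ** N = adj ?M ** R"
  proof -
   have "K ** R = R ** E ** (R' ** R)" by (simp add: K_def matrix_mul_assoc)
   thus ?thesis by (simp add: N_def R matrix_mult_distribs)
  qed
  have gN: "g (N ** X) u = PP k ka (eigv \<beta> (adj ?M ** ?B ** ?M)) / (u\<^sup>2) ^ wt ?p w ka"
  proof -
   have "adj (N ** X) ** (R ** R) ** (N ** X) = adj (R ** N ** X) ** (R ** N ** X)"
    by (simp only: adjoint_mult R(2) matrix_mul_assoc)
   hence "?F (adj (N ** X) ** (R ** R) ** (N ** X)) = ?F ((R ** N ** X) ** adj (R ** N ** X))"
    using psum_commute[OF PM(1)[OF \<beta> ka]] by simp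
   also have "(R ** N ** X) ** adj (R ** N ** X) = adj ?M ** ?B ** ?M"
    unfolding RN by (simp only: adjoint_mult adjoint_adjoint R(2) matrix_mul_assoc)
   finally show ?thesis
    using K invp_hermitian[OF \<beta> psum_invp[OF PM(1)[OF \<beta> ka]] hermitian_congruence(1)[OF Bh, of ?M]]
    by (simp add: g_def R PM(2)[OF \<beta> ka])
  qed
  have gX: "g X u = PP k ka (eigv \<beta> ?B) / (u\<^sup>2) ^ wt ?p w ka"
  proof -
   have "?F (adj X ** (R ** R) ** X) = ?F (adj (R ** X) ** (R ** X))"
    by (simp only: adjoint_mult R(2) matrix_mul_assoc)
   also have "... = ?F ((R ** X) ** adj (R ** X))" by (rule psum_commute[OF PM(1)[OF \<beta> ka]])
   also have "(R ** X) ** adj (R ** X) = ?B" by (simp only: adjoint_mult R(2) matrix_mul_assoc)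
   finally show ?thesis using invp_hermitian[OF \<beta> psum_invp[OF PM(1)[OF \<beta> ka]] Bh]
    by (simp add: g_def R PM(2)[OF \<beta> ka])
  qed
  note en = eigen_near[OF \<beta> Bh Bpsd, of ?M c ?L]
  have M: "?M \<in> Fmat \<beta>" "?L \<in> Fmat \<beta>" "norm (?M *v v) <= c * norm v" "norm (?L *v v) <= c * norm v" for v
   using K Kij bnd[of "adj K" v] bnd[of "- adj K" v] by auto
  have sorted: "i <= j ==> j < ?p ==> 0 <= eigv \<beta> ?B j & eigv \<beta> ?B j <= eigv \<beta> ?B i" for i j
   using eigv(1)[OF \<beta> Bh] eigv_nonneg[OF \<beta> Bh] Bpsd by auto
  have "\<bar>PP k ka (eigv \<beta> (adj ?M ** ?B ** ?M)) - PP k ka (eigv \<beta> ?B)\<bar>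
    <= S * (((c\<^sup>2) ^ k - 1) * (c\<^sup>2) ^ k * mon ?p ka (eigv \<beta> ?B))"
   unfolding S_def using en M M_inv sorted c1 by (intro domf_near[OF PP(1)[OF ka] ka']) auto
  also have "... <= S * (((c\<^sup>2) ^ k - 1) * (c\<^sup>2) ^ k * (S' * ((b\<^sup>2) ^ k * (u\<^sup>2) ^ wt ?p w ka)))"
  proof -
   let ?A = "adj X ** (R ** R) ** X"
   have A: "?A \<in> hermitian \<beta>" "R ** R \<in> hermitian \<beta>" using X by (auto intro!: hermitian_congruence simp: R(3))
   have psd: "0 <= v \<bullet> ((R ** R) *v v)" for v unfolding R(3) quadratic_dg by (intro sum_nonneg) (auto simp: pt_def)
   have Apsd: "0 <= v \<bullet> (?A *v v)" for v unfolding quadratic_congruence by (rule psd)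
   \<comment> \<open>\<open>?B\<close> and \<open>?A\<close> are cyclic rearrangements of one
     product and are compared through a symmetric function; the monomial is therefore first bounded
     by the orbit sum.\<close>
   have "mon ?p ka (eigv \<beta> ?B) <= msym ?p ka (eigv \<beta> ?B)" unfolding msym_def using sorted permutes_id[of "{..<?p}"]
    by (intro order_trans[OF _ member_le_sum[where i = id]]) (auto simp: mon_def finite_permutations intro!: prod_nonneg zero_le_power)
   also have "... = G ?A"
    using psum_commute[OF G(1), of "R ** X" "adj X ** R"] by (simp add: invp_hermitian[OF \<beta> psum_invp[OF G(1)] Bh] G(2) matrix_mul_assoc)
   also have "... = msym ?p ka (eigv \<beta> ?A)" by (simp add: invp_hermitian[OF \<beta> psum_invp[OF G(1)] A(1)] G(2))
   also have "... <= S' * mon ?p ka (eigv \<beta> ?A)"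
    unfolding S'_def using eigv(1)[OF \<beta> A(1)] eigv_nonneg[OF \<beta> A(1) Apsd]
    by (intro order_trans[OF abs_ge_self domf_bound[OF msym(1)[OF ka] ka']]) auto
   also have "... <= S' * ((b\<^sup>2) ^ k * mon ?p ka (eigv \<beta> (R ** R)))"
    using A(2) psd X b by (intro mult_left_mono congruence_growth[OF \<beta> ka]) (auto simp: S'_def)
   also have "mon ?p ka (eigv \<beta> (R ** R)) = mon ?p ka (pt (u\<^sup>2) w)"
    unfolding mon_def R(3) using pt_sorted[OF w, of "u\<^sup>2"] u by (intro prod.cong) (auto simp: eigv_dg[OF \<beta>])
   finally show ?thesis using c1 by (intro mult_left_mono) (auto simp: mon_pt S_def sum_nonneg)
  qed
  finally have "\<bar>PP k ka (eigv \<beta> (adj ?M ** ?B ** ?M)) - PP k ka (eigv \<beta> ?B)\<bar> / (u\<^sup>2) ^ wt ?p w ka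
    <= S * (((c\<^sup>2) ^ k - 1) * (c\<^sup>2) ^ k * (S' * (b\<^sup>2) ^ k))" using u by (simp add: pos_divide_le_eq)
  thus ?thesis unfolding gN gX diff_divide_distrib[symmetric] c_def[symmetric] by simp
 qed
 have "((%u. C / u) \<longlongrightarrow> 0) at_top" by (intro real_tendsto_divide_at_top[OF tendsto_const] filterlim_ident)
 hence "((%u. S * ((((1 + C / u)\<^sup>2) ^ k - 1) * ((1 + C / u)\<^sup>2) ^ k * (S' * (b\<^sup>2) ^ k))) \<longlongrightarrow>
   S * ((((1 + 0)\<^sup>2) ^ k - 1) * ((1 + 0)\<^sup>2) ^ k * (S' * (b\<^sup>2) ^ k))) at_top" (is "(?h \<longlongrightarrow> _) _")
  by (rule isCont_tendsto_compose[rotated]) (intro continuous_intros)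
 hence h0: "(?h \<longlongrightarrow> 0) at_top" by simp
 have "\<forall>\<^sub>F u in at_top. norm (g (N ** X) u - g X u) <= ?h u"
  unfolding real_norm_def by (rule eventually_mono[OF eventually_ge_at_top near])
 hence "((%u. g (N ** X) u - g X u) \<longlongrightarrow> 0) at_top" using h0 by (rule Lim_null_comparison)
 hence "lead \<beta> k ka (N ** X) - lead \<beta> k ka X = 0"
  by (intro tendsto_unique[OF _ tendsto_diff[OF lim[OF NX] lim[OF X]]]) simp_all
 thus ?thesis by (simp add: N_def)
qed

lemma continuous_congruence:
 "hmp k F ==> continuous_on UNIV (%Z. F (adj Z ** A ** (Z :: quat^'m^'m)))"
 by (rule continuous_on_compose2[OF hmp_continuous, of _ _ UNIV]) (auto intro!: continuous_intros)

text \<open>Invariance from the left becomes conjugation of \<open>A\<close> inside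
  \<open>adj Z ** A ** Z\<close>; continuous test functions cover the polynomial integrands. The
  almost sure bound makes all of them integrable.\<close>

locale inv_law = finite_measure \<mu> for \<mu> :: "(quat^'m^'m) measure" +
 fixes \<beta> :: nat
 assumes \<beta>: "\<beta> \<in> {1, 2, 4}" and sets_borel: "sets \<mu> = sets borel"
  and bound: "EX K. AE Z in \<mu>. Z \<in> Fmat \<beta> & (ALL v. norm (Z *v v) <= K * norm v)"
  and inv: "U \<in> unitary \<beta> ==> continuous_on UNIV f ==> (\<integral>Z. f (U ** Z) \<partial>\<mu>) = (\<integral>Z. f Z \<partial>\<mu> :: real)"
begin

lemma bound_norm: "EX K. AE Z in \<mu>. Z \<in> Fmat \<beta> & norm Z <= K"
proof -
 obtain K where K: "AE Z in \<mu>. Z \<in> Fmat \<beta> & (ALL v. norm (Z *v v) <= K * norm v)" using bound by blast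
 have "norm Z <= (\<Sum>i\<in>(UNIV::'m set). \<Sum>j\<in>(UNIV::'m set). K)" if Z: "!!v. norm (Z *v v) <= K * norm v" for Z :: "quat^'m^'m"
 proof -
  have "norm (Z $ i $ j) <= K" for i j
  proof -
   have "norm (Z $ i $ j) = norm ((Z *v axis j 1) $ i)"
    by (simp add: matrix_vector_nth axis_def if_distrib[of "%x. _ * x"] cong: if_cong)
   also have "... <= K * norm (axis j 1 :: quat^'m)"
    using Z Finite_Cartesian_Product.norm_nth_le order_trans by blast
   finally show ?thesis by (simp add: norm_eq_sqrt_inner inner_axis_axis inner_quat)
  qed
  hence "(\<Sum>i\<in>UNIV. \<Sum>j\<in>UNIV. norm (Z $ i $ j)) <= (\<Sum>i\<in>(UNIV::'m set). \<Sum>j\<in>(UNIV::'m set). K)" by (intro sum_mono)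
  moreover have "norm Z <= (\<Sum>i\<in>UNIV. norm (Z $ i))" "norm (Z $ i) <= (\<Sum>j\<in>UNIV. norm (Z $ i $ j))" for i
   by (simp_all add: norm_vec_def L2_set_le_sum)
  hence "norm Z <= (\<Sum>i\<in>UNIV. \<Sum>j\<in>UNIV. norm (Z $ i $ j))" by (meson order_trans sum_mono)
  ultimately show ?thesis by linarith
 qed
 with K show ?thesis by fastforce
qed

lemma measurable_cont: "continuous_on UNIV f ==> f \<in> borel_measurable \<mu>" for f :: "_ => real"
 by (simp add: borel_measurable_continuous_onI measurable_cong_sets[OF sets_borel refl])

lemma integrable_cont:
 assumes f: "continuous_on UNIV (f :: _ => real)"
 shows "integrable \<mu> f"
proof -
 obtain K where K: "AE Z in \<mu>. Z \<in> Fmat \<beta> & norm Z <= K" using bound_norm by blast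
 have "compact (f ` cball 0 K)" using f by (intro compact_continuous_image) (auto intro: continuous_on_subset)
 then obtain B where B: "!!Z. Z \<in> cball 0 K ==> norm (f Z) <= B"
  using compact_imp_bounded bounded_iff by (metis imageI)
 have "AE Z in \<mu>. norm (f Z) <= B" using K by eventually_elim (use B in auto)
 thus ?thesis by (rule integrable_const_bound) (rule measurable_cont[OF f])
qed

definition TT :: "(quat^'m^'m => real) => quat^'m^'m => real" where
 "TT F A = (\<integral>Z. F (adj Z ** A ** Z) \<partial>\<mu>)"

lemma TT_unitary:
 assumes "hmp k F" "U \<in> unitary \<beta>"
 shows "TT F (U ** A ** adj U) = TT F A"
 using inv[OF unitary_intros(2)[OF assms(2)] continuous_congruence[OF assms(1), of A]]
 by (simp add: TT_def adjoint_mult matrix_mul_assoc)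

lemma TT_AE_cong:
 assumes "A \<in> hermitian \<beta>" "!!B. B \<in> hermitian \<beta> ==> F B = G B" "hmp k F" "hmp l G"
 shows "TT F A = TT G A"
proof -
 obtain K where K: "AE Z in \<mu>. Z \<in> Fmat \<beta> & norm Z <= K" using bound_norm by blast
 show ?thesis unfolding TT_def using K
  by (intro integral_cong_AE measurable_cont continuous_congruence[OF assms(3)] continuous_congruence[OF assms(4)])
    (auto elim!: eventually_mono intro!: assms(2) hermitian_congruence(1)[OF assms(1)])
qed

end

text \<open>Sums of a polynomial in A times a continuous function of Z: integrating out Z visibly
  leaves a homogeneous polynomial in A.\<close>

inductive sep :: "nat => ('v::euclidean_space => 'z::topological_space => real) => bool" where
 sep_prod: "hmp k G ==> continuous_on UNIV h ==> sep k (%A Z. G A * h Z)"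
| sep_add: "sep k \<Phi> ==> sep k \<Psi> ==> sep k (%A Z. \<Phi> A Z + \<Psi> A Z)"

lemma sep_sum:
 assumes "finite S" "!!i. i \<in> S ==> sep k (\<Phi> i)"
 shows "sep k (%A Z. \<Sum>i\<in>S. \<Phi> i A Z)"
 using assms
proof (induction S rule: finite_induct)
 case empty
 thus ?case using sep_prod[OF hmp_zero, of "%_. 0"] by simp
next
 case (insert i S)
 hence "sep k (%A Z. \<Phi> i A Z + (\<Sum>i\<in>S. \<Phi> i A Z))" by (intro sep_add) simp_all
 thus ?case using insert.hyps by simp
qed

lemma sep_mult:
 assumes "sep k \<Phi>" "sep l \<Psi>"
 shows "sep (k + l) (%A Z. \<Phi> A Z * \<Psi> A Z)"
 using assms
proof (induction arbitrary: l \<Psi> rule: sep.induct)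
 case (sep_prod k G h)
 from sep_prod(3) show ?case
 proof (induction rule: sep.induct)
  case (sep_prod l G' h')
  thus ?case
   using sep.sep_prod[OF hmp_mult[OF \<open>hmp k G\<close> \<open>hmp l G'\<close>] continuous_on_mult[OF \<open>continuous_on UNIV h\<close> \<open>continuous_on UNIV h'\<close>]]
   by (simp add: mult_ac)
 next
  case (sep_add l \<Psi> \<Psi>')
  show ?case unfolding distrib_left by (rule sep.sep_add[OF sep_add.IH])
 qed
next
 case (sep_add k \<Phi> \<Phi>')
 show ?case unfolding distrib_right by (rule sep.sep_add[OF sep_add.IH[OF sep_add.prems]])
qed

lemma hmp_sep:
 assumes "hmp k F" and g: "!!f. linear f ==> sep 1 (%A Z. f (g A Z))"
 shows "sep k (%A Z. F (g A Z))"
 using assms(1)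
proof (induction rule: hmp.induct)
 case (hmp_const c)
 thus ?case using sep_prod[OF hmp.hmp_const[of c], of "%_. 1"] by simp
next
 case (hmp_linear f)
 thus ?case using g by simp
next
 case (hmp_add k f h)
 show ?case by (rule sep_add[OF hmp_add.IH])
next
 case (hmp_mult k f l h)
 show ?case by (rule sep_mult[OF hmp_mult.IH])
qed

lemma linear_sep:
 fixes g :: "'z::topological_space => 'v::euclidean_space => 'w::euclidean_space"
 assumes "!!Z. linear (g Z)" "!!A. continuous_on UNIV (%Z. g Z A)" "linear f"
 shows "sep 1 (%A Z. f (g Z A) :: real)"
proof -
 have eq: "f (g Z A) = (\<Sum>b\<in>Basis. (A \<bullet> b) * f (g Z b))" for A Z
  using linear_sum[OF linear_compose[OF assms(1)[of Z] assms(3)], of "%b. (A \<bullet> b) *\<^sub>R b" Basis]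
  by (simp add: euclidean_representation linear_scale[OF linear_compose[OF assms(1) assms(3)], unfolded o_def])
 have "(%A Z. f (g Z A)) = (%A Z. \<Sum>b\<in>Basis. (A \<bullet> b) * f (g Z b))" by (intro ext eq)
 moreover have "sep 1 (%A Z. \<Sum>b\<in>Basis. (A \<bullet> b) * f (g Z b))"
 proof (intro sep_sum)
  fix b :: 'v
  have "continuous_on UNIV (%Z. f (g Z b))"
   by (rule continuous_on_compose2[OF linear_continuous_on[OF linear_conv_bounded_linear[THEN iffD1, OF assms(3)]] assms(2)]) auto
  thus "sep 1 (%A Z. (A \<bullet> b) * f (g Z b))" using bounded_linear.linear sep_prod[OF hmp_linear] by force
 qed simp
 ultimately show ?thesis by (rule ssubst[where P = "sep 1"])
qed

lemma sep_congruence: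
 "hmp k F ==> sep k (%A Z. F (adj Z ** A ** (Z :: quat^'m^'m)))"
 by (erule hmp_sep, rule linear_sep) (auto intro!: continuous_intros linear_mat_ops)

context inv_law
begin

lemma sep_integral:
 "sep k \<Phi> ==> hmp k (%A. \<integral>Z. \<Phi> A Z \<partial>\<mu>) & (ALL A. integrable \<mu> (\<Phi> A))"
proof (induction rule: sep.induct)
 case (sep_prod k G h)
 hence "hmp k (%A. (\<integral>Z. h Z \<partial>\<mu>) * G A)" by (intro hmp_scale)
 thus ?case using integrable_cont[OF sep_prod(2)] by (simp add: mult.commute)
next
 case (sep_add k \<Phi> \<Psi>)
 hence "(%A. \<integral>Z. \<Phi> A Z + \<Psi> A Z \<partial>\<mu>) = (%A. (\<integral>Z. \<Phi> A Z \<partial>\<mu>) + (\<integral>Z. \<Psi> A Z \<partial>\<mu>))" by simp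
 moreover have "hmp k (%A. (\<integral>Z. \<Phi> A Z \<partial>\<mu>) + (\<integral>Z. \<Psi> A Z \<partial>\<mu>))" using sep_add.IH by (intro hmp_add) simp_all
 moreover have "integrable \<mu> (%Z. \<Phi> A Z + \<Psi> A Z)" for A
  using sep_add.IH by (intro Bochner_Integration.integrable_add) simp_all
 ultimately show ?case by presburger
qed

lemma TT_invp:
 assumes "hmp k F"
 shows "invp \<beta> k (TT F)"
 unfolding invp_def using sep_integral[OF sep_congruence[OF assms]] TT_unitary[OF assms] by (simp add: TT_def[abs_def])

lemma TT_add: "hmp k F ==> hmp l G ==> TT (%A. F A + G A) A = TT F A + TT G A"
 unfolding TT_def by (intro Bochner_Integration.integral_add integrable_cont continuous_congruence)

lemma TT_scale: "TT (%A. c * F A) A = c * TT F A"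
 unfolding TT_def by simp

lemma TT_sum: "(!!i. i \<in> S ==> hmp k (F i)) ==> TT (%A. \<Sum>i\<in>S. F i A) A = (\<Sum>i\<in>S. TT (F i) A)"
 unfolding TT_def by (intro Bochner_Integration.integral_sum integrable_cont continuous_congruence)

text \<open>The third order remainder is continuous, hence bounded on the compact set carrying the
  law, so the difference quotients converge uniformly there.\<close>

lemma integral_sdiff:
 assumes F: "hmp k F" and B: "continuous_on UNIV B"
 shows "((%e. \<integral>Z. sdiff F (B Z) E e \<partial>\<mu>) \<longlongrightarrow> (\<integral>Z. LLq F (B Z) E \<partial>\<mu>)) (at 0)"
proof -
 from taylor2_exists[OF F] obtain F1 F2 R where T: "taylor2 k F F1 F2 R" by auto
 obtain K where K: "AE Z in \<mu>. Z \<in> Fmat \<beta> & norm Z <= K" using bound_norm by blast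
 let ?b = "%Z. B Z ** E + adj E ** B Z" and ?c = "%Z. adj E ** B Z ** E"
 define r where "r Z e = R (B Z, ?b Z, ?c Z, e)" for Z e
 have bc: "continuous_on UNIV ?b" "continuous_on UNIV ?c" using B by (auto intro!: continuous_intros)
 have r: "continuous_on UNIV (%z. r (fst z) (snd z))" unfolding r_def
  by (rule continuous_on_compose2[OF taylor2D(7)[OF T] _ subset_UNIV])
    (intro continuous_on_Pair continuous_on_snd continuous_on_id continuous_on_compose2[OF B continuous_on_fst[OF continuous_on_id]]
     continuous_on_compose2[OF bc(1) continuous_on_fst[OF continuous_on_id]]
     continuous_on_compose2[OF bc(2) continuous_on_fst[OF continuous_on_id]] subset_UNIV)
 have re: "continuous_on UNIV (%Z. r Z e)" for e unfolding r_def
  by (rule continuous_on_compose2[OF taylor2D(7)[OF T] _ subset_UNIV])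
    (intro continuous_on_Pair B bc continuous_on_const)
 have cp: "compact ((%z. r (fst z) (snd z)) ` (cball 0 K \<times> {-1..1}))"
  using r by (intro compact_continuous_image compact_Times compact_Icc) (auto intro: continuous_on_subset)
 obtain M where M0: "ALL y:(%z. r (fst z) (snd z)) ` (cball 0 K \<times> {-1..1}). norm y <= M"
  using compact_imp_bounded[OF cp] unfolding bounded_iff by blast
 have M: "\<bar>r Z e\<bar> <= M" if "Z \<in> cball 0 K" "e \<in> {-1..1}" for Z e
  using M0[rule_format, of "r Z e"] image_eqI[of "r Z e" "%z. r (fst z) (snd z)" "(Z, e)"] that by simp
 have sd: "sdiff F (B Z) E e = LLq F (B Z) E + e * ((r Z e - r Z (- e)) / 2)" if "e ~= 0" for Z e
 proof -
  have *: "(x + e * y + e\<^sup>2 * l + e ^ 3 * p + (x + - e * y + (- e)\<^sup>2 * l + (- e) ^ 3 * q) - 2 * x) / (2 * e\<^sup>2)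
    = l + e * ((p - q) / 2)" for x y l p q using that by (simp add: field_simps power2_eq_square power3_eq_cube)
  show ?thesis
   unfolding sdiff_def cline_expand taylor2D(8)[OF T, of "B Z" e] taylor2D(8)[OF T, of "B Z" "- e"] LLq_eq[OF T] r_def
   by (rule *)
 qed
 have cL: "continuous_on UNIV (%Z. LLq F (B Z) E)"
  by (rule continuous_on_compose2[OF hmp_continuous[OF hmp_LLq[OF F]] B]) auto
 have near: "\<bar>(\<integral>Z. sdiff F (B Z) E e \<partial>\<mu>) - (\<integral>Z. LLq F (B Z) E \<partial>\<mu>)\<bar> <= \<bar>e\<bar> * (M * measure \<mu> (space \<mu>))"
  if e: "e ~= 0" "\<bar>e\<bar> <= 1" for e
 proof -
  have i: "integrable \<mu> (%Z. (r Z e - r Z (- e)) / 2)"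
   by (intro integrable_cont continuous_on_divide continuous_on_diff re continuous_on_const) simp
  have eq: "(\<integral>Z. sdiff F (B Z) E e \<partial>\<mu>) - (\<integral>Z. LLq F (B Z) E \<partial>\<mu>) = e * (\<integral>Z. (r Z e - r Z (- e)) / 2 \<partial>\<mu>)"
   unfolding sd[OF e(1)] Bochner_Integration.integral_add[OF integrable_cont[OF cL] integrable_mult_right[OF i]]
    integral_mult_right_zero by (rule add_diff_cancel_left')
  have le: "\<bar>\<integral>Z. (r Z e - r Z (- e)) / 2 \<partial>\<mu>\<bar> <= (\<integral>Z. M \<partial>\<mu>)"
  proof -
   have "AE Z in \<mu>. \<bar>(r Z e - r Z (- e)) / 2\<bar> <= M" using K
   proof eventually_elim
    case (elim Z)
    thus ?case using M[of Z e] M[of Z "- e"] e(2) by (simp add: abs_le_iff[of e])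
   qed
   hence "(\<integral>Z. \<bar>(r Z e - r Z (- e)) / 2\<bar> \<partial>\<mu>) <= (\<integral>Z. M \<partial>\<mu>)"
    by (rule integral_mono_AE[OF integrable_abs[OF i] integrable_const])
   thus ?thesis using integral_norm_bound[where M = \<mu> and f = "%Z. (r Z e - r Z (- e)) / 2"]
    unfolding real_norm_def by (rule order_trans[rotated])
  qed
  have c: "(\<integral>Z. M \<partial>\<mu>) = M * measure \<mu> (space \<mu>)" by simp
  show ?thesis unfolding eq abs_mult by (rule mult_left_mono[OF le[unfolded c] abs_ge_zero])
 qed
 have "\<forall>\<^sub>F e::real in at 0. e ~= 0 & \<bar>e\<bar> <= 1" by (auto simp: eventually_at intro!: exI[of _ 1])
 hence "\<forall>\<^sub>F e in at 0. norm ((\<integral>Z. sdiff F (B Z) E e \<partial>\<mu>) - (\<integral>Z. LLq F (B Z) E \<partial>\<mu>)) <= \<bar>e\<bar> * (M * measure \<mu> (space \<mu>))"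
  unfolding real_norm_def by (rule eventually_mono) (rule near, simp_all)
 moreover have "((%e. \<bar>e\<bar> * (M * measure \<mu> (space \<mu>))) \<longlongrightarrow> 0) (at 0)"
  by (intro tendsto_mult_left_zero tendsto_rabs_zero tendsto_ident_at)
 ultimately have "((%e. (\<integral>Z. sdiff F (B Z) E e \<partial>\<mu>) - (\<integral>Z. LLq F (B Z) E \<partial>\<mu>)) \<longlongrightarrow> 0) (at 0)"
  by (rule Lim_null_comparison)
 thus ?thesis by (rule LIM_zero_cancel)
qed

end

context inv_law
begin

text \<open>With H = 1 + e E, \<open>invp_gram\<close> for the average replaces
  \<open>adj H ** D ** D ** H\<close> by \<open>D ** H ** adj H ** D\<close>. Under the integral,
  cyclicity of F turns this into the congruence by H of \<open>D ** Z ** adj Z ** D\<close>, so the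
  variation has moved inside. Afterwards \<open>invp_gram\<close> for \<open>LL\<close> of F returns
  to \<open>adj Z ** D ** D ** Z\<close>. The square D D is what allows these exchanges.\<close>

lemma LL_TT:
 fixes d :: "nat => real"
 assumes F: "psum k F"
 defines "D \<equiv> dg d :: quat^'m^'m"
 shows "LL \<beta> (TT F) (D ** D) = TT (LL \<beta> F) (D ** D)"
proof -
 note hF = psum_hmp[OF F]
 have D: "D \<in> Fmat \<beta>" "adj D = D" by (simp_all add: D_def)
 let ?B = "%Z. D ** Z ** adj Z ** D"
 have cB: "continuous_on UNIV ?B" by (auto intro!: continuous_intros)
 have cl: "TT F (cline (D ** D) E e) = (\<integral>Z. F (cline (?B Z) E e) \<partial>\<mu>)" if E: "E \<in> Fmat \<beta>" for E e
 proof -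
  let ?H = "mat 1 + e *\<^sub>R E"
  have "TT F (cline (D ** D) E e) = TT F (adj (D ** ?H) ** (D ** ?H))"
   by (simp only: cline_def adjoint_mult D matrix_mul_assoc)
  also have "... = TT F ((D ** ?H) ** adj (D ** ?H))" using D E by (intro invp_gram[OF \<beta> TT_invp[OF hF]]) auto
  also have "... = (\<integral>Z. F ((adj Z ** D ** ?H) ** (adj ?H ** D ** Z)) \<partial>\<mu>)"
   by (simp only: TT_def adjoint_mult D matrix_mul_assoc)
  also have "... = (\<integral>Z. F (cline (?B Z) E e) \<partial>\<mu>)"
   by (subst psum_commute[OF F]) (simp only: cline_def matrix_mul_assoc)
  finally show ?thesis .
 qed
 have int: "integrable \<mu> (%Z. F (cline (?B Z) E e))" for E e
  by (intro integrable_cont continuous_on_compose2[OF hmp_continuous[OF hF] _ subset_UNIV])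
    (auto simp: cline_def intro!: continuous_intros)
 have "LLq (TT F) (D ** D) E = (\<integral>Z. LLq F (?B Z) E \<partial>\<mu>)" if E: "E \<in> Fmat \<beta>" for E
 proof (rule tendsto_unique[OF _ LLq_tendsto[OF invpD(1)[OF TT_invp[OF hF]]]])
  have cline0: "cline B E 0 = B" for B by (simp add: cline_def)
  have "sdiff (TT F) (D ** D) E e = (\<integral>Z. sdiff F (?B Z) E e \<partial>\<mu>)" for e
  proof -
   have "TT F (D ** D) = (\<integral>Z. F (?B Z) \<partial>\<mu>)" "integrable \<mu> (%Z. F (?B Z))"
    using cl[OF E, of 0] int[of E 0] by (simp_all only: cline0)
   thus ?thesis using int[of E e] int[of E "- e"] by (simp add: sdiff_def cl[OF E])
  qed
  thus "(sdiff (TT F) (D ** D) E \<longlongrightarrow> (\<integral>Z. LLq F (?B Z) E \<partial>\<mu>)) (at 0)"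
   using integral_sdiff[OF hF cB, of E] by (simp add: ext[of "sdiff (TT F) (D ** D) E" "%e. \<integral>Z. sdiff F (?B Z) E e \<partial>\<mu>"])
 qed simp
 hence "LL \<beta> (TT F) (D ** D) = (\<Sum>E\<in>Basis \<inter> Fmat \<beta>. \<integral>Z. LLq F (?B Z) E \<partial>\<mu>)" by (simp add: LL_def)
 also have "... = (\<integral>Z. LL \<beta> F (?B Z) \<partial>\<mu>)" unfolding LL_def
  by (intro Bochner_Integration.integral_sum[symmetric] integrable_cont continuous_on_compose2[OF hmp_continuous[OF hmp_LLq[OF hF]] cB subset_UNIV])
 also have "... = TT (LL \<beta> F) (D ** D)" unfolding TT_def
 proof (intro integral_cong_AE measurable_cont)
  note hL = invpD(1)[OF invp_LL[OF psum_invp[OF F]]]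
  show "continuous_on UNIV (%Z. LL \<beta> F (?B Z))"
   by (rule continuous_on_compose2[OF hmp_continuous[OF hL] cB subset_UNIV])
  show "continuous_on UNIV (%Z. LL \<beta> F (adj Z ** (D ** D) ** Z))" by (rule continuous_congruence[OF hL])
  obtain K where "AE Z in \<mu>. Z \<in> Fmat \<beta> & norm Z <= K" using bound_norm by blast
  thus "AE Z in \<mu>. LL \<beta> F (?B Z) = LL \<beta> F (adj Z ** (D ** D) ** Z)"
  proof eventually_elim
   case (elim Z)
   hence "adj Z ** D \<in> Fmat \<beta>" using D by auto
   from invp_gram[OF \<beta> invp_LL[OF psum_invp[OF F]] this] show ?case
    by (simp only: adjoint_mult adjoint_adjoint D matrix_mul_assoc)
  qed
 qed
 finally show ?thesis .
qed

lemma TT_eigen: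
 assumes ka: "ka \<in> parts CARD('m) k"
 shows "TT (PM \<beta> k ka) (dg x) = (\<integral>Z. lead \<beta> k ka Z \<partial>\<mu>) * JP \<beta> CARD('m) k ka x"
proof -
 interpret jack_setting \<beta> "CARD('m)" by (rule jack_setting[OF \<beta>])
 let ?p = "CARD('m)" and ?F = "PM \<beta> k ka :: quat^'m^'m => real"
 let ?g = "%x. TT ?F (dg x)"
 note F = PM(1)[OF \<beta> ka] and Fd = PM(2)[OF \<beta> ka]
 note hF = psum_hmp[OF F] and iF = psum_invp[OF F]
 note g = invp_dg[OF TT_invp[OF hF]]
 obtain h where h: "ALL al. continuous_on UNIV (h al)"
  "ALL (Z::quat^'m^'m) x. ?F (adj Z ** dg x ** Z) = hom_poly ?p k (%al. h al Z) x"
  using congruence_coeffs[OF hF] by blast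
 have "?g x = hom_poly ?p k (%al. \<integral>Z. h al Z \<partial>\<mu>) x" for x
  unfolding TT_def h(2)[rule_format] hom_poly_def using h(1) by (simp add: integrable_cont)
 hence cg: "cf ?p k ?g al = (\<integral>Z. h al Z \<partial>\<mu>)" if "al \<in> exponents ?p k" for al
  using cf_hom_poly[OF that, of "%al. \<integral>Z. h al Z \<partial>\<mu>"] by (metis (no_types, lifting) ext)
 have hZ: "cf ?p k (%x. ?F (adj Z ** dg x ** Z)) al = h al Z" if "al \<in> exponents ?p k" for al Z
  unfolding h(2)[rule_format] by (rule cf_hom_poly[OF that])
 have domg: "domf ?p k ka ?g" unfolding domf_def
 proof (intro conjI g(1) allI impI)
  fix al assume nz: "cf ?p k ?g al ~= 0"
  hence al: "al \<in> exponents ?p k" using cf(2)[OF g(1)] by blast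
  show "dominated al ka"
  proof (rule ccontr)
   assume nd: "~ dominated al ka"
   obtain K where "AE Z in \<mu>. Z \<in> Fmat \<beta> & norm Z <= K" using bound_norm by blast
   hence "AE Z in \<mu>. h al Z = 0"
   proof eventually_elim
    case (elim Z)
    thus ?case using domf_congruence[OF \<beta> ka, of Z] nd hZ[OF al, of Z] unfolding domf_def by metis
   qed
   hence "(\<integral>Z. h al Z \<partial>\<mu>) = 0" by (rule integral_eq_zero_AE)
   thus False using nz cg[OF al] by simp
  qed
 qed
 have ka': "ka \<in> exponents ?p k" using ka parts_subset by blast
 have lead: "cf ?p k ?g ka = (\<integral>Z. lead \<beta> k ka Z \<partial>\<mu>)" using cg[OF ka'] hZ[OF ka'] by (simp add: lead_def)
 define c where "c = 2 * rho \<beta> ?p ka - real \<beta> * (real ?p - 2) * real k"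
 have "(%x. LL \<beta> ?F (dg x)) = (%x. c * PP k ka x)"
 proof (rule hp_eqI[OF invp_dg(1)[OF invp_LL[OF iF]] hp_scale[OF PP(5)[OF ka]]])
  fix x :: "nat => real" assume x: "inj_on x {..<?p}"
  show "LL \<beta> ?F (dg x) = c * PP k ka x" unfolding LL_diag[OF \<beta> iF Fd x] J(3)[OF PP(5,2)[OF ka] x] PP(4)[OF ka]
   by (simp add: c_def algebra_simps)
 qed
 hence LLd: "LL \<beta> ?F (dg x) = c * PP k ka x" for x by (rule fun_cong)
 have LLF: "LL \<beta> ?F B = c * ?F B" if "B \<in> hermitian \<beta>" for B
  using invp_hermitian[OF \<beta> invp_LL[OF iF] that] invp_hermitian[OF \<beta> iF that] by (simp add: LLd Fd)
 have "J k ?g = (%x. rho \<beta> ?p ka * ?g x)"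
 proof (rule J_unique[OF g hp_scale[OF g(1)]])
  fix x :: "nat => real" assume x: "inj_on x {..<?p}" and pos: "!!i. 0 < x i"
  \<comment> \<open>At positive points the diagonal matrix is a square, as \<open>LL_TT\<close>
    requires, and \<open>J_unique\<close> asks for no other points.\<close>
  define d where "d = (%i. sqrt (x i))"
  have "dg x = (dg d ** dg d :: quat^'m^'m)" using pos by (simp add: dg_mult_dg d_def less_imp_le)
  hence "LL \<beta> (TT ?F) (dg x) = TT (LL \<beta> ?F) (dg x)" using LL_TT[OF F, of d] by simp
  also have "... = TT (%B. c * ?F B) (dg x)"
   by (rule TT_AE_cong[OF _ LLF invpD(1)[OF invp_LL[OF iF]] hmp_scale[OF hF]]) simp_all
  also have "... = c * ?g x" by (rule TT_scale)
  finally show "jack_operator \<beta> ?p ?g x = rho \<beta> ?p ka * ?g x"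
   unfolding LL_diag[OF \<beta> TT_invp[OF hF] refl x] c_def by (simp add: algebra_simps)
 qed
 hence "?g = (%x. cf ?p k ?g ka * PP k ka x)" by (rule eigenfunction_unique[OF PP(1,2,4,3)[OF ka] domg g(2) _ ka])
 thus ?thesis unfolding lead by (rule fun_cong)
qed

end

section \<open>Splitting one row off a strict contraction\<close>

section \<open>Blocks of matrices and the operator norm ball\<close>

definition Fblk :: "nat => 'm set => 'm set => (quat^'m^'m) set" where
 "Fblk \<beta> R C = {X \<in> Fmat \<beta>. ALL i j. X $ i $ j ~= 0 --> i \<in> R & j \<in> C}"

definition BB :: "nat => 'm set => 'm set => ('m \<times> 'm \<times> quat) set" where
 "BB \<beta> R C = R \<times> C \<times> (Basis \<inter> Falg \<beta>)"

definition LB :: "nat => 'm set => 'm set => (quat^'m^'m) measure" where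
 "LB \<beta> R C = leb (%(i, j, q). el i j q) (BB \<beta> R C)"

lemma FblkD: "X \<in> Fblk \<beta> R C ==> X \<in> Fmat \<beta>" "X \<in> Fblk \<beta> R C ==> i \<notin> R | j \<notin> C ==> X $ i $ j = 0"
 unfolding Fblk_def by auto

lemma orth_el: "orth (%(i, j, q). el i j q :: quat^'m^'m) (BB \<beta> R C)"
 unfolding orth_def BB_def el_def by (auto simp: inner_axis_axis inner_Basis)

lemma finite_BB [simp]: "finite (BB \<beta> R (C :: 'm::finite set))"
 using orthD(1)[OF orth_el] .

lemma card_BB: "\<beta> \<in> {1, 2, 4} ==> card (BB \<beta> R C) = \<beta> * (card R * card C)"
 unfolding BB_def by (simp add: card_cartesian_product card_Basis_Falg)

lemma subspace_Fblk: "subspace (Fblk \<beta> R C :: (quat^'m^'m) set)"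
 unfolding subspace_def Fblk_def by auto (metis add_0 scaleR_zero_right)+

lemma span_el: "span ((%(i, j, q). el i j q :: quat^'m^'m) ` BB \<beta> R C) = Fblk \<beta> R C"
proof
 have "(%(i, j, q). el i j q :: quat^'m^'m) ` BB \<beta> R C \<subseteq> Fblk \<beta> R C"
  by (auto simp: BB_def Fblk_def Fmat_def el_nth split: if_splits)
 thus "span ((%(i, j, q). el i j q :: quat^'m^'m) ` BB \<beta> R C) \<subseteq> Fblk \<beta> R C"
  by (rule span_minimal[OF _ subspace_Fblk])
 show "Fblk \<beta> R C \<subseteq> span ((%(i, j, q). el i j q :: quat^'m^'m) ` BB \<beta> R C)"
 proof
  fix X :: "quat^'m^'m" assume X: "X \<in> Fblk \<beta> R C"
  have "(X \<bullet> b) *\<^sub>R b \<in> span ((%(i, j, q). el i j q) ` BB \<beta> R C)" if "b \<in> Basis" for b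
  proof (cases "X \<bullet> b = 0")
   case False
   have "b \<in> (\<Union>i. \<Union>u\<in>(Basis :: (quat^'m) set). {axis i u})" using that by (subst (asm) Basis_vec_def)
   then obtain i c where "b = axis i c" and c: "c \<in> Basis" by blast
   moreover obtain j q where "c = axis j q" and "q \<in> Basis" using c unfolding Basis_vec_def by blast
   ultimately have b: "b = el i j q" "q \<in> Basis" by (simp_all add: el_def)
   have "(i, j, q) \<in> BB \<beta> R C"
    using False FblkD(2)[OF X, of i j] Fmat_nth[OF FblkD(1)[OF X], of i j] unfolding Falg_iff[of "X $ i $ j"] by (auto simp: b el_def inner_axis BB_def)
   thus ?thesis unfolding b(1) by (intro span_scale span_base) force
  qed (simp add: span_zero)
  hence "(\<Sum>b\<in>Basis. (X \<bullet> b) *\<^sub>R b) \<in> span ((%(i, j, q). el i j q) ` BB \<beta> R C)" by (intro span_sum)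
  thus "X \<in> span ((%(i, j, q). el i j q) ` BB \<beta> R C)" by (simp add: euclidean_representation)
 qed
qed

lemma space_LB [simp]: "space (LB \<beta> R C) = UNIV" and sets_LB [measurable_cong, simp]: "sets (LB \<beta> R C) = sets borel"
 by (simp_all add: LB_def)

lemma LB_cong: "(!!x. x \<in> Fblk \<beta> R C ==> f x = g x) ==> (\<integral>\<^sup>+x. f x \<partial>LB \<beta> R C) = (\<integral>\<^sup>+x. g x \<partial>LB \<beta> R (C :: 'm::finite set))"
 unfolding LB_def by (rule leb_cong) (simp add: span_el)

lemma LB_union:
 fixes f :: "quat^'m^'m => ennreal"
 assumes "BB \<beta> R C = BB \<beta> R1 C1 \<union> BB \<beta> R2 C2" "BB \<beta> R1 C1 \<inter> BB \<beta> R2 C2 = {}" "f \<in> borel_measurable borel"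
 shows "(\<integral>\<^sup>+x. f x \<partial>LB \<beta> R C) = (\<integral>\<^sup>+x. \<integral>\<^sup>+y. f (x + y) \<partial>LB \<beta> R2 C2 \<partial>LB \<beta> R1 C1)"
 unfolding LB_def assms(1) by (rule leb_union[OF _ _ assms(2,3)]) simp_all

lemma norm_mult_unitary:
 fixes Y W :: "quat^'m^'m"
 assumes "W \<in> unitary \<beta>"
 shows "norm (Y ** W) = norm Y"
proof -
 have "(Y ** W) \<bullet> (Y ** W) = qRe (trace ((adj W ** adj Y ** Y) ** W))"
  by (simp add: inner_mat adjoint_mult matrix_mul_assoc)
 also have "... = qRe (trace (W ** (adj W ** (adj Y ** Y))))"
  by (subst qRe_trace_commute) (simp add: matrix_mul_assoc)
 also have "... = Y \<bullet> Y" by (simp only: unitary_cancel[OF assms] inner_mat)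
 finally show ?thesis by (simp add: norm_eq_sqrt_inner)
qed

lemma linear_mult_right: "linear (%Y :: quat^'m^'m. Y ** W)"
 by (intro linearI) (simp_all add: matrix_mult_distribs)

text \<open>\<open>W\<close> acts only among the indices of \<open>K\<close>: multiplication from
  the right mixes columns inside \<open>K\<close> and leaves the others alone, so blocks on these
  columns are preserved.\<close>

definition idout :: "'m set => quat^'m^'m => bool" where
 "idout K W \<longleftrightarrow> (ALL a b. a \<notin> K | b \<notin> K --> W $ a $ b = mat 1 $ a $ b)"

lemma mat_1_nth: "(mat 1 :: quat^'m^'m) $ a $ b = (if a = b then 1 else 0)"
 by (simp add: mat_def)

lemma idoutD: "idout K W ==> a \<notin> K | b \<notin> K ==> W $ a $ b = (if a = b then 1 else 0)"
 unfolding idout_def mat_1_nth by blast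

lemma idout_mono: "idout K W ==> K \<subseteq> L ==> idout L W"
 unfolding idout_def by blast

lemma idout_mult_nth:
 assumes "idout K W" "b \<notin> K"
 shows "(Y ** W) $ a $ b = Y $ a $ b"
 unfolding matrix_mult_nth using idoutD[OF assms(1)] assms(2)
 by (simp add: if_distrib[of "%x. _ * x"] cong: if_cong)

lemma idout_mult_nth':
 assumes "idout K W" "a \<notin> K"
 shows "(W ** Y) $ a $ b = Y $ a $ b"
 unfolding matrix_mult_nth using idoutD[OF assms(1)] assms(2)
 by (simp add: if_distrib[of "%x. x * _"] cong: if_cong)

lemma idout_mult: "idout K U ==> idout K V ==> idout K (U ** V)"
 unfolding idout_def[of K "U ** V"] using idout_mult_nth[of K V] idout_mult_nth'[of K U] idoutD[of K] mat_1_nth by metis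

lemma idout_dg_commute:
 assumes W: "idout K W" and y: "!!a b. a \<in> K ==> b \<in> K ==> y (ix a) = y (ix b)"
 shows "W ** dg y = dg y ** W"
proof (rule mat_eqI)
 fix a b
 show "(W ** dg y) $ a $ b = (dg y ** W) $ a $ b"
  using idoutD[OF W, of a b] y[of a b] by (cases "a \<in> K & b \<in> K") (auto simp: dg_mult_left dg_mult_right)
qed

lemma idout_dg_absorb:
 assumes W: "idout K W" and y: "!!a. a \<in> K ==> y (ix a) = 0"
 shows "W ** dg y = dg y" "dg y ** W = dg y"
proof -
 show *: "dg y ** W = dg y"
 proof (rule mat_eqI)
  fix a b
  show "(dg y ** W) $ a $ b = dg y $ a $ b"
   using idoutD[OF W, of a b] y[of a] by (cases "a \<in> K") (auto simp: dg_mult_left dg_nth of_real_def)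
 qed
 show "W ** dg y = dg y" using idout_dg_commute[OF W, of y] y * by simp
qed

lemma Fblk_idout:
 assumes "Y \<in> Fblk \<beta> R C" "W \<in> Fmat \<beta>" "idout C W"
 shows "Y ** W \<in> Fblk \<beta> R C"
 unfolding Fblk_def
proof (intro CollectI conjI allI impI)
 show "Y ** W \<in> Fmat \<beta>" using FblkD(1)[OF assms(1)] assms(2) by auto
 fix i j assume nz: "(Y ** W) $ i $ j ~= 0"
 show "i \<in> R"
 proof (rule ccontr)
  assume "i \<notin> R"
  thus False using nz FblkD(2)[OF assms(1), of i] by (simp add: matrix_mult_nth)
 qed
 show "j \<in> C" using nz FblkD(2)[OF assms(1)] idout_mult_nth[OF assms(3)] by metis
qed

lemma LB_unitary:
 fixes f :: "quat^'m^'m => ennreal"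
 assumes W: "W \<in> unitary \<beta>" "idout C W" and f: "f \<in> borel_measurable borel"
 shows "(\<integral>\<^sup>+Y. f (Y ** W) \<partial>LB \<beta> R C) = (\<integral>\<^sup>+Y. f Y \<partial>LB \<beta> R C)"
 unfolding LB_def using Fblk_idout[OF _ unitary_D(1)[OF W(1)] W(2)] norm_mult_unitary[OF W(1)]
 by (intro leb_isometry[OF orth_el linear_mult_right _ _ f]) (auto simp: span_el)

definition cs :: "'m => real => quat^'m^'m" where
 "cs j c = qdiag (%i. if i = j then of_real c else 1)"

lemma cs_mult: "(Y ** cs j c) $ a $ b = (if b = j then c *\<^sub>R Y $ a $ b else Y $ a $ b)"
 by (simp add: cs_def qdiag_def matrix_mult_nth if_distrib[of "%x. _ * x"] cong: if_cong)

lemma cs_Fmat: "cs j c \<in> Fmat \<beta>"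
 by (auto simp: cs_def qdiag_def Fmat_def)

lemma cs_idout: "idout {j} (cs j c)"
 by (auto simp: cs_def qdiag_def idout_def mat_1_nth)

lemma continuous_mult_right: "continuous_on UNIV (%Y :: quat^'m^'m. Y ** W)"
 by (auto intro!: continuous_intros)

lemma measurable_mult_right [measurable]: "(%Y :: quat^'m^'m. Y ** W) \<in> borel_measurable borel"
 by (rule borel_measurable_continuous_onI[OF continuous_mult_right])

lemma LB_colscale:
 fixes f :: "quat^'m^'m => ennreal"
 assumes \<beta>: "\<beta> \<in> {1, 2, 4}" and j: "j \<in> C" and c: "c > 0" and f[measurable]: "f \<in> borel_measurable borel"
 shows "(\<integral>\<^sup>+Y. f (Y ** cs j (1 / c)) \<partial>LB \<beta> R C) = ennreal (c ^ (\<beta> * card R)) * (\<integral>\<^sup>+Y. f Y \<partial>LB \<beta> R C)"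
proof -
 have BB: "BB \<beta> R C = BB \<beta> R {j} \<union> BB \<beta> R (C - {j})" "BB \<beta> R {j} \<inter> BB \<beta> R (C - {j}) = {}"
  using j by (auto simp: BB_def)
 have meas: "(%x. \<integral>\<^sup>+y. f (x /\<^sub>R c + y) \<partial>LB \<beta> R (C - {j})) \<in> borel_measurable borel"
  unfolding LB_def by (intro measurable_leb_integral) auto
 have "(\<integral>\<^sup>+Y. f (Y ** cs j (1 / c)) \<partial>LB \<beta> R C) = (\<integral>\<^sup>+x. \<integral>\<^sup>+y. f ((x + y) ** cs j (1 / c)) \<partial>LB \<beta> R (C - {j}) \<partial>LB \<beta> R {j})"
  by (rule LB_union[OF BB]) measurable
 also have "... = (\<integral>\<^sup>+x. \<integral>\<^sup>+y. f (x /\<^sub>R c + y) \<partial>LB \<beta> R (C - {j}) \<partial>LB \<beta> R {j})"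
 proof (intro LB_cong arg_cong[where f = f] mat_eqI)
  fix x y :: "quat^'m^'m" and a b assume "x \<in> Fblk \<beta> R {j}" "y \<in> Fblk \<beta> R (C - {j})"
  thus "((x + y) ** cs j (1 / c)) $ a $ b = (x /\<^sub>R c + y) $ a $ b"
   using FblkD(2)[of x \<beta> R "{j}" a b] FblkD(2)[of y \<beta> R "C - {j}" a b] by (auto simp: cs_mult divide_inverse)
 qed
 also have "... = ennreal (c ^ card (BB \<beta> R {j})) * (\<integral>\<^sup>+x. \<integral>\<^sup>+y. f ((c *\<^sub>R x) /\<^sub>R c + y) \<partial>LB \<beta> R (C - {j}) \<partial>LB \<beta> R {j})"
  unfolding LB_def[of _ _ "{j}"] by (rule leb_scale[OF _ c meas]) simp
 finally show ?thesis using c by (simp add: card_BB[OF \<beta>] LB_union[OF BB f])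
qed

text \<open>By compactness of the unit sphere this says that the operator norm is below 1. The
  vectors are quaternionic for every \<beta>.\<close>

definition opb :: "quat^'m^'m => bool" where
 "opb X \<longleftrightarrow> (ALL v. v ~= 0 --> norm (X *v v) < norm v)"

lemma continuous_matrix_vector_pair: "continuous_on UNIV (%z. (snd z :: quat^'m^'m) *v fst z)"
 unfolding matrix_vector_mult_def by (auto intro!: continuous_intros)

lemma opb_unit: "opb X \<longleftrightarrow> (ALL v. norm v = 1 --> norm (X *v v) < 1)"
proof
 assume *: "ALL v. norm v = 1 --> norm (X *v v) < 1"
 show "opb X" unfolding opb_def
 proof (intro allI impI)
  fix v :: "quat^'a" assume v: "v ~= 0"
  hence "norm (X *v (v /\<^sub>R norm v)) < 1" using * by simp
  thus "norm (X *v v) < norm v" using v by (simp add: matrix_vector_distribs field_simps)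
 qed
next
 assume "opb X"
 thus "ALL v. norm v = 1 --> norm (X *v v) < 1" unfolding opb_def by (metis norm_zero zero_neq_one)
qed

lemma open_opb: "open {X :: quat^'m^'m. opb X}"
proof -
 have "closed {X. EX v. v \<in> sphere (0 :: quat^'m) 1 & (v, X) \<in> {z. 1 <= norm ((snd z :: quat^'m^'m) *v fst z)}}"
  by (intro closed_compact_projection compact_sphere closed_Collect_le continuous_on_const continuous_on_norm continuous_matrix_vector_pair)
 moreover have "{X. EX v. v \<in> sphere (0 :: quat^'m) 1 & (v, X) \<in> {z. 1 <= norm ((snd z :: quat^'m^'m) *v fst z)}} = - {X. opb X}"
  by (auto simp: opb_unit)
 ultimately show ?thesis by (simp add: closed_open)
qed

definition ob :: "quat^'m^'m => ennreal" where
 "ob X = (if opb X then 1 else 0)"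

lemma ob_measurable [measurable]: "(ob :: quat^'m^'m => _) \<in> borel_measurable borel"
proof -
 have eq: "(ob :: quat^'m^'m => _) = indicator {X. opb X}" by (auto simp: ob_def)
 show ?thesis unfolding eq by (intro borel_measurable_indicator borel_open open_opb)
qed

text \<open>As x fills only row i and Y the other rows, |(x + Y) W u|^2 = r^2 |u_j|^2 + |Y W u|^2.
  Requiring this to be below |u|^2 means |Y W u| < |D u|, where D scales u_j by sqrt(1 - r^2); its
  inverse is absorbed into column j of Y W.\<close>

lemma opb_row:
 fixes x Y W :: "quat^'m^'m"
 assumes W: "W \<in> unitary \<beta>" and x: "!!a b. a ~= i ==> x $ a $ b = 0" and Y: "!!b. Y $ i $ b = 0"
  and xW: "!!b. (x ** W) $ i $ b = (if b = j then r *\<^sub>R q else 0)" and q: "norm q = 1" and r: "0 <= r"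
 shows "opb (x + Y) \<longleftrightarrow> r < 1 & opb (Y ** W ** cs j (1 / sqrt (1 - r\<^sup>2)))"
proof -
 have eq: "(norm ((x + Y) *v (W *v u)))\<^sup>2 = r\<^sup>2 * (norm (u $ j))\<^sup>2 + (norm ((Y ** W) *v u))\<^sup>2" for u
 proof -
  have xu: "((x ** W) *v u) $ a = (if a = i then (r *\<^sub>R q) * u $ j else 0)" for a
  proof (cases "a = i")
   case True
   thus ?thesis by (simp add: matrix_vector_nth xW if_distrib[of "%x. x * _"] cong: if_cong)
  next
   case False
   thus ?thesis by (simp add: matrix_vector_nth matrix_mult_nth x)
  qed
  have Yu: "((Y ** W) *v u) $ i = 0" using Y by (simp add: matrix_vector_nth matrix_mult_nth)
  have "(norm ((x + Y) *v (W *v u)))\<^sup>2 = (\<Sum>a\<in>UNIV. (norm (((x ** W) *v u) $ a + ((Y ** W) *v u) $ a))\<^sup>2)"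
   by (simp add: norm_vec_sq matrix_vector_mul_assoc matrix_mult_distribs matrix_vector_distribs)
  also have "... = (\<Sum>a\<in>UNIV. (if a = i then r\<^sup>2 * (norm (u $ j))\<^sup>2 else 0) + (norm (((Y ** W) *v u) $ a))\<^sup>2)"
   using Yu q by (intro sum.cong) (auto simp: xu norm_quat_mult power_mult_distrib)
  finally show ?thesis by (simp add: sum.distrib norm_vec_sq)
 qed
 have "opb (x + Y) \<longleftrightarrow> (ALL u. u ~= 0 --> norm ((x + Y) *v (W *v u)) < norm u)"
 proof
  assume *: "ALL u. u ~= 0 --> norm ((x + Y) *v (W *v u)) < norm u"
  show "opb (x + Y)" unfolding opb_def
  proof (intro allI impI)
   fix v :: "quat^'m" assume v: "v ~= 0"
   thus "norm ((x + Y) *v v) < norm v"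
    using unitary_cancel(6)[OF W, of v] *[rule_format, of "adj W *v v"] unitary_norm[OF unitary_intros(2)[OF W], of v] by fastforce
  qed
 next
  assume "opb (x + Y)"
  thus "ALL u. u ~= 0 --> norm ((x + Y) *v (W *v u)) < norm u"
   unfolding opb_def using unitary_norm[OF W] by (metis norm_eq_zero)
 qed
 also have "... \<longleftrightarrow> (ALL u. u ~= 0 --> r\<^sup>2 * (norm (u $ j))\<^sup>2 + (norm ((Y ** W) *v u))\<^sup>2 < (norm u)\<^sup>2)"
  unfolding eq[symmetric] by (metis norm_ge_zero power2_less_imp_less power_strict_mono zero_less_numeral)
 also have "... \<longleftrightarrow> r < 1 & opb (Y ** W ** cs j (1 / sqrt (1 - r\<^sup>2)))" (is "?L \<longleftrightarrow> _")
 proof (cases "r < 1")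
  case False
  have "~ ?L"
   using False by (auto simp: norm_eq_sqrt_inner inner_axis_axis inner_quat not_less intro!: exI[of _ "axis j 1"] add_increasing2)
  thus ?thesis using False by simp
 next
  case True
  define c where "c = sqrt (1 - r\<^sup>2)"
  have c: "c > 0" "c\<^sup>2 = 1 - r\<^sup>2" using True r abs_square_less_1[of r] by (auto simp: c_def)
  have csv: "(cs j d *v u) $ a = (if a = j then d *\<^sub>R u $ a else u $ a)" for d u a
   by (simp add: cs_def qdiag_def matrix_vector_nth if_distrib[of "%x. x * _"] cong: if_cong)
  have ncs: "(norm (cs j c *v u))\<^sup>2 = (norm u)\<^sup>2 - r\<^sup>2 * (norm (u $ j))\<^sup>2" for u
  proof -
   have "(norm (cs j c *v u))\<^sup>2 = (\<Sum>a\<in>UNIV. (norm (u $ a))\<^sup>2 - (if a = j then r\<^sup>2 * (norm (u $ j))\<^sup>2 else 0))"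
    unfolding norm_vec_sq by (intro sum.cong) (auto simp: csv power_mult_distrib c left_diff_distrib)
   thus ?thesis by (simp add: sum_subtractf norm_vec_sq)
  qed
  have inv: "cs j c *v (cs j (1 / c) *v u) = u" "cs j (1 / c) *v (cs j c *v u) = u" for u
   using c(1) by (auto simp: vec_eq_iff csv)
  have "?L \<longleftrightarrow> (ALL u. u ~= 0 --> (norm ((Y ** W) *v u))\<^sup>2 < (norm (cs j c *v u))\<^sup>2)"
   unfolding ncs by (simp add: algebra_simps)
  also have "... \<longleftrightarrow> (ALL u. u ~= 0 --> norm ((Y ** W) *v u) < norm (cs j c *v u))"
   by (metis norm_ge_zero power2_less_imp_less power_strict_mono zero_less_numeral)
  also have "... \<longleftrightarrow> opb (Y ** W ** cs j (1 / c))" unfolding opb_def matrix_vector_mul_assoc[symmetric]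
   by (metis inv matrix_vector_distribs(7))
  finally show ?thesis using True by (simp add: c_def)
 qed
 finally show ?thesis .
qed

text \<open>Row i is split off by Fubini. Undoing the scaling of column j in the remaining rows has
  Jacobian sqrt(1 - |x|^2)^(\<beta> card R), which is the weight \<open>hball\<close>. The rotation
  in \<open>red\<close> may depend on x because the measure of the other rows is invariant under
  it.\<close>

lemma row_step:
 fixes \<Phi> G g :: "quat^'m^'m => ennreal"
 assumes \<beta>: "\<beta> \<in> {1, 2, 4}" and i: "i \<notin> R" and j: "j \<in> C"
  and [measurable]: "\<Phi> \<in> borel_measurable borel" "G \<in> borel_measurable borel" "g \<in> borel_measurable borel"
  and red: "!!x. x \<in> Fblk \<beta> {i} C ==> EX W:unitary \<beta>. EX q. idout C W & norm q = 1
   & (ALL b. (x ** W) $ i $ b = (if b = j then norm x *\<^sub>R q else 0))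
   & (ALL c. ALL Y:Fblk \<beta> R C. \<Phi> (x + Y) = g x * G (Y ** W ** cs j c))"
 shows "(\<integral>\<^sup>+X. ob X * \<Phi> X \<partial>LB \<beta> (insert i R) C)
  = (\<integral>\<^sup>+x. ennreal (hball (\<beta> * card R) x) * g x \<partial>LB \<beta> {i} C) * (\<integral>\<^sup>+Y. ob Y * G Y \<partial>LB \<beta> R C)"
proof -
 let ?I = "\<integral>\<^sup>+Y. ob Y * G Y \<partial>LB \<beta> R C"
 have BB: "BB \<beta> (insert i R) C = BB \<beta> {i} C \<union> BB \<beta> R C" "BB \<beta> {i} C \<inter> BB \<beta> R C = {}" using i by (auto simp: BB_def)
 have "(\<integral>\<^sup>+X. ob X * \<Phi> X \<partial>LB \<beta> (insert i R) C)
   = (\<integral>\<^sup>+x. \<integral>\<^sup>+Y. ob (x + Y) * \<Phi> (x + Y) \<partial>LB \<beta> R C \<partial>LB \<beta> {i} C)" by (rule LB_union[OF BB]) measurable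
 also have "... = (\<integral>\<^sup>+x. ennreal (hball (\<beta> * card R) x) * g x * ?I \<partial>LB \<beta> {i} C)"
 proof (rule LB_cong)
  fix x assume x: "x \<in> Fblk \<beta> {i} C"
  obtain W q where W: "W \<in> unitary \<beta>" "idout C W" and q: "norm q = 1"
   and xW: "!!b. (x ** W) $ i $ b = (if b = j then norm x *\<^sub>R q else 0)"
   and \<Phi>: "!!c Y. Y \<in> Fblk \<beta> R C ==> \<Phi> (x + Y) = g x * G (Y ** W ** cs j c)"
   using red[OF x] by metis
  define c where "c = sqrt (1 - (norm x)\<^sup>2)"
  have opb: "opb (x + Y) \<longleftrightarrow> norm x < 1 & opb (Y ** W ** cs j (1 / c))" if Y: "Y \<in> Fblk \<beta> R C" for Y
   unfolding c_def by (rule opb_row[OF W(1) _ _ xW q norm_ge_zero]) (use FblkD(2)[OF x] FblkD(2)[OF Y] i in auto)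
  show "(\<integral>\<^sup>+Y. ob (x + Y) * \<Phi> (x + Y) \<partial>LB \<beta> R C) = ennreal (hball (\<beta> * card R) x) * g x * ?I"
  proof (cases "norm x < 1")
   case True
   hence c: "c > 0" using abs_square_less_1[of "norm x"] by (simp add: c_def)
   have "(\<integral>\<^sup>+Y. ob (x + Y) * \<Phi> (x + Y) \<partial>LB \<beta> R C)
     = (\<integral>\<^sup>+Y. g x * (ob (Y ** W ** cs j (1 / c)) * G (Y ** W ** cs j (1 / c))) \<partial>LB \<beta> R C)"
    using True by (intro LB_cong) (simp add: \<Phi>[where c = "1 / c"] ob_def opb)
   also have "... = g x * (\<integral>\<^sup>+Y. ob (Y ** W ** cs j (1 / c)) * G (Y ** W ** cs j (1 / c)) \<partial>LB \<beta> R C)"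
    by (rule nn_integral_cmult) measurable
   also have "(\<integral>\<^sup>+Y. ob (Y ** W ** cs j (1 / c)) * G (Y ** W ** cs j (1 / c)) \<partial>LB \<beta> R C)
     = (\<integral>\<^sup>+Y. ob (Y ** cs j (1 / c)) * G (Y ** cs j (1 / c)) \<partial>LB \<beta> R C)"
    by (rule LB_unitary[OF W, where f = "%Y. ob (Y ** cs j (1 / c)) * G (Y ** cs j (1 / c))"]) measurable
   also have "... = ennreal (c ^ (\<beta> * card R)) * ?I"
    by (rule LB_colscale[OF \<beta> j c, where f = "%Y. ob Y * G Y"]) measurable
   finally show ?thesis using True by (simp add: hball_def c_def mult_ac)
  next
   case False
   hence "(\<integral>\<^sup>+Y. ob (x + Y) * \<Phi> (x + Y) \<partial>LB \<beta> R C) = (\<integral>\<^sup>+Y. 0 \<partial>LB \<beta> R C)" by (intro LB_cong) (simp add: ob_def opb)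
   thus ?thesis using False by (simp add: hball_def)
  qed
 qed
 also have "... = (\<integral>\<^sup>+x. ennreal (hball (\<beta> * card R) x) * g x \<partial>LB \<beta> {i} C) * ?I"
  by (rule nn_integral_multc) measurable
 finally show ?thesis .
qed

section \<open>Gaussian elimination under the integral: volume and mean leading coefficients\<close>

section \<open>Integrals over the operator norm ball\<close>

definition dgI :: "nat => quat^'m^'m" where
 "dgI s = dg (%l. if l < s then 1 else 0)"

text \<open>Together with \<open>dgI\<close> it describes a stage of the elimination: in
  \<open>dgI s + X ** dgP s N\<close> the first s rows are reduced to unit rows, and X contributes
  its columns s, ..., N - 1.\<close>

definition dgP :: "nat => nat => quat^'m^'m" where
 "dgP s N = dg (%l. if s <= l & l < N then 1 else 0)"

lemma dgI_nth: "dgI s $ a $ b = (if a = b & ix a < s then 1 else 0)"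
 by (simp add: dgI_def dg_nth)

lemma dgP_mult_nth:
 "(X ** dgP s N) $ a $ b = (if s <= ix b & ix b < N then X $ a $ b else 0)" by (simp add: dgP_def dg_mult_right)

lemma dgIP_Fmat [simp]: "dgI s \<in> Fmat \<beta>" "dgP s N \<in> Fmat \<beta>"
 by (simp_all add: dgI_def dgP_def)

lemma row_norm:
 assumes "!!a b. a ~= i ==> x $ a $ b = 0"
 shows "norm (x $ i) = norm (x :: quat^'m^'m)"
proof -
 have "(norm x)\<^sup>2 = (\<Sum>a\<in>UNIV. (norm (x $ a))\<^sup>2)" by (simp add: power2_norm_eq_inner inner_vec_def)
 also have "... = (\<Sum>a\<in>UNIV. if a = i then (norm (x $ i))\<^sup>2 else 0)"
  using assms by (intro sum.cong) (auto simp: vec_eq_iff)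
 finally show ?thesis by simp
qed

lemma row_reflection:
 fixes x :: "quat^'m^'m"
 assumes x: "x \<in> Fmat \<beta>" and row: "!!a b. a ~= i ==> x $ a $ b = 0" and supp: "!!b. b \<notin> K ==> x $ i $ b = 0" and j: "j \<in> K"
 shows "EX W:unitary \<beta>. EX q. idout K W & norm q = 1 & (ALL b. (x ** W) $ i $ b = (if b = j then norm x *\<^sub>R q else 0))"
proof -
 have "x $ i \<in> Fvec \<beta>" using x by (simp add: Fvec_def Fmat_def)
 from reflection_to_axis[OF this, of K j] obtain W q where W: "W \<in> unitary \<beta>" "norm q = 1"
  "!!b. (\<Sum>k\<in>UNIV. x $ i $ k * W $ k $ b) = (if b = j then norm (x $ i) *\<^sub>R q else 0)"
  "!!a b. a \<notin> K ==> W $ a $ b = mat 1 $ a $ b & W $ b $ a = mat 1 $ b $ a" using supp j by blast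
 have "idout K W" unfolding idout_def using W(4) by blast
 thus ?thesis using W(1-3) row_norm[OF row] by (auto simp: matrix_mult_nth intro!: exI[of _ q])
qed

text \<open>One elimination step. \<open>U\<close> rotates the kept part of row s onto the pivot
  column, so the pivot has size r = |x P|; it contributes r^(2 ka s) by \<open>lead_qdiag\<close>,
  and the entries below it are cleared by \<open>lead_lower\<close>. A second rotation
  \<open>V\<close> brings the whole row, kept columns or not, into column s, as
  \<open>opb_row\<close> requires.\<close>

lemma lead_row:
 fixes x :: "quat^'m^'m" and ka :: "nat => nat" and \<beta> k :: nat
 defines "j \<equiv> %s. xi s :: 'm" and "H \<equiv> %s N X. lead \<beta> k ka (dgI s + X ** dgP s N :: quat^'m^'m)"
 assumes \<beta>: "\<beta> \<in> {1, 2, 4}" and ka: "ka \<in> parts CARD('m) k" and s: "s < N" "N <= n" "n <= CARD('m)"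
  and x: "x \<in> Fblk \<beta> {j s} {b. ix b < n}"
 shows "EX W:unitary \<beta>. EX q. idout {b. ix b < n} W & norm q = 1
   & (ALL b. (x ** W) $ j s $ b = (if b = j s then norm x *\<^sub>R q else 0))
   & (ALL c. ALL Y:Fblk \<beta> {a. Suc s <= ix a} {b. ix b < n}.
     H s N (x + Y) = norm (x ** dgP s N) ^ (2 * ka s) * H (Suc s) N (Y ** W ** cs (j s) c))"
proof -
 let ?C = "{b::'m. ix b < n}" and ?J = "{b::'m. s <= ix b & ix b < N}"
 let ?i = "j s"
 let ?P = "dgP s N :: quat^'m^'m"
 have i: "ix ?i = s" using s by (simp add: j_def)
 have ai: "a = ?i \<longleftrightarrow> ix a = s" for a using ix_inj[of a ?i] i by simp
 have row: "x $ a $ b = 0" if "a ~= ?i" for a b using FblkD[OF x] that by auto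
 have xF: "x \<in> Fmat \<beta>" using FblkD[OF x] by auto
 define r where "r = norm (x ** ?P)"
 have "x ** ?P \<in> Fmat \<beta>" "!!a b. a ~= ?i ==> (x ** ?P) $ a $ b = 0" "!!b. b \<notin> ?J ==> (x ** ?P) $ ?i $ b = 0" "?i \<in> ?J"
  using xF row s i by (auto simp: dgP_mult_nth)
 from row_reflection[OF this] obtain U q1 where U: "U \<in> unitary \<beta>" "idout ?J U" "norm q1 = 1"
  and xU: "!!b. (x ** ?P ** U) $ ?i $ b = (if b = ?i then r *\<^sub>R q1 else 0)"
  unfolding r_def by blast
 have U_P: "U ** ?P = ?P ** U" unfolding dgP_def by (rule idout_dg_commute[OF U(2)]) auto
 have xUb: "(x ** U) $ ?i $ b = (if b = ?i then r *\<^sub>R q1 else 0)" if "b \<in> ?J" for b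
 proof -
  have "(x ** U) $ ?i $ b = (x ** U ** ?P) $ ?i $ b" using that by (simp add: dgP_mult_nth)
  also have "x ** U ** ?P = x ** ?P ** U" by (simp only: U_P matrix_mul_assoc[symmetric])
  finally show ?thesis by (simp add: xU)
 qed
 \<comment> \<open>\<open>V\<close> mixes column s only with columns outside the kept range, all of
   them annihilated by \<open>dgP (Suc s) N\<close>; so \<open>V\<close>, like the column scaling,
   leaves the next stage unchanged.\<close>
 let ?K = "insert ?i (?C - ?J)"
 have "(x ** U) $ ?i $ b = 0" if "b \<notin> ?K" for b
 proof (cases "b \<in> ?J")
  case False
  hence "b \<notin> ?C" using that by auto
  thus ?thesis using FblkD(2)[OF x, of ?i b] idout_mult_nth[OF U(2) False, of x ?i] by auto
 qed (use xUb that in auto)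
 moreover have "(x ** U) $ a $ b = 0" if "a ~= ?i" for a b using row[OF that] by (simp add: matrix_mult_nth)
 ultimately obtain V q where V: "V \<in> unitary \<beta>" "idout ?K V" and q: "norm q = 1"
  and xV: "!!b. (x ** U ** V) $ ?i $ b = (if b = ?i then norm x *\<^sub>R q else 0)"
  using row_reflection[of "x ** U" \<beta> ?i ?K ?i] xF unitary_D(1)[OF U(1)] norm_mult_unitary[OF U(1), of x] by auto
 have C: "?J \<subseteq> ?C" "?K \<subseteq> ?C" using s i by auto
 have id: "idout ?C (U ** V)" by (intro idout_mult idout_mono[OF U(2) C(1)] idout_mono[OF V(2) C(2)])
 have H: "H s N (x + Y) = r ^ (2 * ka s) * H (Suc s) N (Y ** (U ** V) ** cs ?i c)"
  if Y: "Y \<in> Fblk \<beta> {a. Suc s <= ix a} ?C" for Y c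
 proof -
  let ?P' = "dgP (Suc s) N :: quat^'m^'m" and ?I = "dgI s :: quat^'m^'m" and ?I' = "dgI (Suc s) :: quat^'m^'m"
  \<comment> \<open>The next stage; \<open>E\<close> holds the entries below the pivot, which left
    multiplication by 1 + E restores.\<close>
  define T where "T = ?I' + Y ** U ** ?P'"
  define E where "E = Y ** U ** dgP s (Suc s)"
  define S where "S = (%a. if a = ?i then r *\<^sub>R q1 else 1)"
  have Yrow: "Y $ a $ b = 0" if "~ Suc s <= ix a" for a b using FblkD[OF Y] that by auto
  have YF: "Y \<in> Fmat \<beta>" using FblkD[OF Y] by auto
  have YUrow: "(Y ** U) $ a $ b = 0" if "ix a <= s" for a b using Yrow that by (simp add: matrix_mult_nth)
  have ET: "(mat 1 + E) ** T = ?I' + Y ** U ** ?P"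
  proof (rule mat_eqI)
   fix a b
   have "(E ** T) $ a $ b = (\<Sum>d\<in>UNIV. if d = ?i then E $ a $ d * T $ d $ b else 0)"
    unfolding matrix_mult_nth[of E] by (intro sum.cong) (auto simp: E_def dgP_mult_nth ai)
   also have "... = E $ a $ ?i * T $ ?i $ b" by simp
   also have "T $ ?i $ b = (if b = ?i then 1 else 0)"
    using i YUrow[of ?i b] by (auto simp: T_def dgI_nth dgP_mult_nth)
   finally show "((mat 1 + E) ** T) $ a $ b = (?I' + Y ** U ** ?P) $ a $ b"
    using s ai[of b] by (auto simp: matrix_mult_distribs T_def E_def dgP_mult_nth)
  qed
  have ZU: "(?I + (x + Y) ** ?P) ** U = qdiag S ** (?I' + Y ** U ** ?P)"
  proof (rule mat_eqI)
   fix a b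
   have I: "?I ** U = ?I" unfolding dgI_def by (rule idout_dg_absorb[OF U(2)]) auto
   have YP: "Y ** ?P ** U = Y ** U ** ?P" by (simp only: U_P matrix_mul_assoc[symmetric])
   have xPU: "(x ** ?P ** U) $ a $ b = (if a = ?i & b = ?i then r *\<^sub>R q1 else 0)"
    using xU[of b] row by (cases "a = ?i") (simp_all add: matrix_mult_nth)
   show "((?I + (x + Y) ** ?P) ** U) $ a $ b = (qdiag S ** (?I' + Y ** U ** ?P)) $ a $ b"
    unfolding matrix_mult_distribs I YP qdiag_mult vector_add_component xPU
    using YUrow[of a b] i ai[of a] ai[of b] by (auto simp: S_def dgI_nth dgP_mult_nth distrib_left)
  qed
  have E: "E \<in> Fmat \<beta>" "T \<in> Fmat \<beta>" using YF unitary_D(1)[OF U(1)] by (auto simp: E_def T_def)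
  have lower: "E $ a $ b ~= 0 ==> b = ?i & ix ?i < ix a" for a b
   using YUrow[of a b] ai[of b] by (auto simp: E_def dgP_mult_nth linorder_not_le[symmetric] split: if_splits)
  have "H s N (x + Y) = lead \<beta> k ka ((?I + (x + Y) ** ?P) ** U)"
   unfolding H_def by (rule lead_unitary[OF \<beta> ka U(1), symmetric])
  also have "... = (\<Prod>a\<in>UNIV. norm (S a) ^ (2 * ka (ix a))) * lead \<beta> k ka ((mat 1 + E) ** T)"
   unfolding ZU ET by (rule lead_qdiag[OF \<beta> ka])
  also have "(\<Prod>a\<in>UNIV. norm (S a) ^ (2 * ka (ix a))) = (\<Prod>a\<in>UNIV. if a = ?i then r ^ (2 * ka s) else 1)"
   using i U(3) by (intro prod.cong) (auto simp: S_def r_def)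
  also have "... = r ^ (2 * ka s)" by simp
  also have "lead \<beta> k ka ((mat 1 + E) ** T) = lead \<beta> k ka T" by (rule lead_lower[OF \<beta> ka E(2,1) lower])
  also have "T = ?I' + Y ** (U ** V) ** cs ?i c ** ?P'"
  proof -
   have "cs ?i c ** ?P' = ?P'" unfolding dgP_def by (rule idout_dg_absorb[OF cs_idout]) (simp add: i)
   moreover have "V ** ?P' = ?P'" unfolding dgP_def by (rule idout_dg_absorb[OF V(2)]) (auto simp: i)
   ultimately have "Y ** (U ** V) ** cs ?i c ** ?P' = Y ** U ** ?P'" by (simp only: matrix_mul_assoc[symmetric])
   thus ?thesis by (simp add: T_def)
  qed
  finally show ?thesis by (simp add: H_def)
 qed
 show ?thesis using id q xV H U(1) V(1) unfolding r_def[symmetric]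
  by (intro bexI[of _ "U ** V"]) (auto simp: matrix_mul_assoc)
qed

text \<open>A partition with more than N parts meets a zero pivot; this is why the final series runs
  over at most n parts.\<close>

lemma lead_dgI:
 assumes "\<beta> \<in> {1, 2, 4}" "ka \<in> parts CARD('m) k"
 shows "lead \<beta> k ka (dgI N :: quat^'m^'m) = (if ALL i. N <= i --> ka i = 0 then 1 else 0)"
proof -
 have eq: "dgI N = qdiag (%a::'m. if ix a < N then 1 else 0)" by (rule mat_eqI) (auto simp: dgI_nth qdiag_def)
 have *: "lead \<beta> k ka (dgI N :: quat^'m^'m) = (\<Prod>a\<in>(UNIV::'m set). norm (if ix a < N then 1 else 0 :: quat) ^ (2 * ka (ix a)))"
  using lead_qdiag[OF assms, of "%a. if ix a < N then 1 else 0" "mat 1"] unfolding eq by (simp add: lead_one[OF assms])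
 show ?thesis
 proof (cases "ALL i. N <= i --> ka i = 0")
  case True
  thus ?thesis unfolding * by (auto intro!: prod.neutral)
 next
  case False
  then obtain i where i: "N <= i" "ka i ~= 0" by blast
  hence "i < CARD('m)"
   using assms(2) unfolding parts_def exponents_def by (metis (mono_tags, lifting) mem_Collect_eq not_less)
  hence "EX a:(UNIV::'m set). norm (if ix a < N then 1 else 0 :: quat) ^ (2 * ka (ix a)) = 0"
   using i by ((intro bexI[of _ "xi i"]), auto)
  hence "(\<Prod>a\<in>(UNIV::'m set). norm (if ix a < N then 1 else 0 :: quat) ^ (2 * ka (ix a))) = 0"
   by (intro prod_zero) auto
  thus ?thesis unfolding * using False by auto
 qed
qed

lemma insert_row: "s < CARD('m::finite) ==> {a::'m. s <= ix a} = insert (xi s) {a. Suc s <= ix a}"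
 by (auto simp: Suc_le_eq) (metis le_neq_implies_less xi_ix)

text \<open>Pivots enter with even powers. Nonnegativity allows the row recursion to be run with
  \<open>nn_integral\<close>, where Fubini needs no integrability.\<close>

lemma lead_nonneg:
 fixes X :: "quat^'m^'m"
 assumes \<beta>: "\<beta> \<in> {1, 2, 4}" and ka: "ka \<in> parts CARD('m) k" and "N <= n" "n <= CARD('m)" "s <= N"
  and "X \<in> Fblk \<beta> {a. s <= ix a} {b. ix b < n}"
 shows "0 <= lead \<beta> k ka (dgI s + X ** dgP s N :: quat^'m^'m)"
 using assms(5,6)
proof (induction arbitrary: X rule: inc_induct)
 case base
 have "X ** dgP N N = 0" by (rule mat_eqI) (auto simp: dgP_mult_nth)
 thus ?case by (simp add: lead_dgI[OF \<beta> ka])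
next
 case (step s)
 let ?C = "{b::'m. ix b < n}"
 define x Y where "x = (\<chi> a b. if a = xi s then X $ a $ b else 0)" and "Y = (\<chi> a b. if a = xi s then 0 else X $ a $ b)"
 have XY: "X = x + Y" by (rule mat_eqI) (simp add: x_def Y_def)
 have a: "a = xi s \<longleftrightarrow> ix a = s" for a :: 'm using step.hyps assms(3,4) by auto
 have x: "x \<in> Fblk \<beta> {xi s} ?C" and Y: "Y \<in> Fblk \<beta> {a. Suc s <= ix a} ?C"
  using step.prems a by (auto simp: Fblk_def Fmat_def x_def Y_def le_neq_implies_less Suc_le_eq split: if_splits)
 obtain W where W: "W \<in> unitary \<beta>" "idout ?C W" "lead \<beta> k ka (dgI s + (x + Y) ** dgP s N :: quat^'m^'m)
   = norm (x ** dgP s N) ^ (2 * ka s) * lead \<beta> k ka (dgI (Suc s) + (Y ** W ** cs (xi s) 1) ** dgP (Suc s) N)"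
  using lead_row[OF \<beta> ka step.hyps(2) assms(3,4) x] Y by blast
 have "Y ** W ** cs (xi s) 1 \<in> Fblk \<beta> {a. Suc s <= ix a} ?C"
  using step.hyps assms(3,4) idout_mono[OF cs_idout, of "xi s" ?C 1]
  by (intro Fblk_idout[OF Fblk_idout[OF Y unitary_D(1)[OF W(1)] W(2)] cs_Fmat]) auto
 thus ?case unfolding XY W(3) by (intro mult_nonneg_nonneg step.IH) auto
qed

text \<open>The volume of the ball of m x n matrices: a row split off while r others remain ranges
  over a ball of real dimension \<beta> n with weight (1 - |x|^2)^(\<beta> r / 2).\<close>

definition vol :: "nat => nat => nat => real" where
 "vol \<beta> m n = (\<Prod>r<m. ball_const (\<beta> * n) (\<beta> * r))"

lemma card_ix_ge: "card {a::'m::finite. s <= ix a} = CARD('m) - s"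
proof -
 have "{i. i < CARD('m) & s <= i} = {s..<CARD('m)}" by auto
 thus ?thesis by (simp add: card_ix[where P = "%l. s <= l"])
qed

lemma card_ix_less: "n <= CARD('m::finite) ==> card {a::'m. ix a < n} = n"
proof -
 assume "n <= CARD('m)"
 hence "{i. i < CARD('m) & i < n} = {..<n}" by auto
 thus ?thesis by (simp add: card_ix[where P = "%l. l < n"])
qed

lemma ball_volume:
 assumes \<beta>: "\<beta> \<in> {1, 2, 4}" and n: "0 < n" "n <= CARD('m::finite)" and "s <= CARD('m)"
 shows "(\<integral>\<^sup>+X. ob X \<partial>LB \<beta> {a::'m. s <= ix a} {b. ix b < n}) = ennreal (vol \<beta> (CARD('m) - s) n)"
 using assms(4)
proof (induction rule: inc_induct)
 case base
 have "BB \<beta> {a::'m. CARD('m) <= ix a} {b. ix b < n} = {}" by (simp add: not_le BB_def)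
 moreover have "ob (0 :: quat^'m^'m) = 1" by (simp add: ob_def opb_def)
 ultimately show ?case unfolding LB_def by (simp add: leb_empty vol_def)
next
 case (step s)
 let ?C = "{b::'m. ix b < n}" and ?R = "{a::'m. Suc s <= ix a}"
 have "(\<integral>\<^sup>+X. ob X * 1 \<partial>LB \<beta> (insert (xi s) ?R) ?C)
   = (\<integral>\<^sup>+x. ennreal (hball (\<beta> * card ?R) x) * 1 \<partial>LB \<beta> {xi s} ?C) * (\<integral>\<^sup>+Y. ob Y * 1 \<partial>LB \<beta> ?R ?C)"
 proof (rule row_step[OF \<beta>, where j = "xi 0"])
  fix x :: "quat^'m^'m" assume x: "x \<in> Fblk \<beta> {xi s} ?C"
  show "EX W:unitary \<beta>. EX q. idout ?C W & norm q = 1 & (ALL b. (x ** W) $ xi s $ b = (if b = xi 0 then norm x *\<^sub>R q else 0))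
    & (ALL c. ALL Y:Fblk \<beta> ?R ?C. (1::ennreal) = 1 * 1)"
   using row_reflection[OF FblkD(1)[OF x], of "xi s" ?C "xi 0"] FblkD(2)[OF x] n by auto
 qed (use step.hyps n in auto)
 also have "(\<integral>\<^sup>+x. ennreal (hball (\<beta> * card ?R) x) * 1 \<partial>LB \<beta> {xi s} ?C) = ennreal (ball_const (\<beta> * n) (\<beta> * (CARD('m) - Suc s)))"
  using leb_hball[OF orth_el[where \<beta> = \<beta> and R = "{xi s}" and C = ?C], where n = "\<beta> * card ?R", folded LB_def]
  by (simp add: card_BB[OF \<beta>] card_ix_less[OF n(2)] card_ix_ge)
 finally have "(\<integral>\<^sup>+X. ob X \<partial>LB \<beta> {a::'m. s <= ix a} ?C)
   = ennreal (ball_const (\<beta> * n) (\<beta> * (CARD('m) - Suc s))) * ennreal (vol \<beta> (CARD('m) - Suc s) n)"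
  using step.IH insert_row[OF step.hyps(2)] by simp
 also have "... = ennreal (vol \<beta> (CARD('m) - s) n)"
 proof -
  have "CARD('m) - s = Suc (CARD('m) - Suc s)" using step.hyps by simp
  thus ?thesis
   using ball_const_pos[of "\<beta> * n"] by (simp add: vol_def ennreal_mult'' prod_nonneg less_imp_le mult.commute)
 qed
 finally show ?case .
qed

lemma measurable_lead:
 assumes "\<beta> \<in> {1, 2, 4}" "ka \<in> parts CARD('m) k"
 shows "(%X. ennreal (lead \<beta> k ka (A + X ** B :: quat^'m^'m))) \<in> borel_measurable borel"
 by (intro measurable_compose[OF _ measurable_ennreal] borel_measurable_continuous_onI continuous_on_compose2[OF continuous_on_lead[OF assms] _ subset_UNIV])
   (auto intro!: continuous_intros)

lemma ball_lead:
 fixes ka :: "nat => nat"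
 assumes \<beta>: "\<beta> \<in> {1, 2, 4}" and ka: "ka \<in> parts CARD('m::finite) k" and N: "0 < N" "N <= n" "n <= CARD('m)" and "s <= N"
 shows "(\<integral>\<^sup>+X. ob X * ennreal (lead \<beta> k ka (dgI s + X ** dgP s N :: quat^'m^'m)) \<partial>LB \<beta> {a. s <= ix a} {b. ix b < n})
  = ennreal (vol \<beta> (CARD('m) - s) n * (\<Prod>t=s..<N. pochhammer (real \<beta> * (real N - real t) / 2) (ka t)
   / pochhammer (real \<beta> * (real n + real CARD('m) - 1 - real t) / 2 + 1) (ka t)) * (if ALL i. N <= i --> ka i = 0 then 1 else 0))"
  (is "_ = ennreal (_ * (\<Prod>t=s..<N. ?r t) * ?z)") using assms(6)
proof (induction rule: inc_induct)
 case base
 have "X ** dgP N N = 0" for X :: "quat^'m^'m" by (rule mat_eqI) (auto simp: dgP_mult_nth)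
 hence "(\<integral>\<^sup>+X. ob X * ennreal (lead \<beta> k ka (dgI N + X ** dgP N N :: quat^'m^'m)) \<partial>LB \<beta> {a. N <= ix a} {b. ix b < n})
   = (\<integral>\<^sup>+X. ob X \<partial>LB \<beta> {a::'m. N <= ix a} {b. ix b < n}) * ennreal ?z"
  unfolding lead_dgI[OF \<beta> ka] by (subst nn_integral_multc[symmetric]) (auto simp: lead_dgI[OF \<beta> ka])
 also have "... = ennreal (vol \<beta> (CARD('m) - N) n) * ennreal ?z" using N by (subst ball_volume[OF \<beta>]) auto
 finally show ?case by simp
next
 case (step s)
 let ?C = "{b::'m. ix b < n}" and ?R = "{a::'m. Suc s <= ix a}" and ?J = "{b::'m. s <= ix b & ix b < N}"
 let ?i = "xi s :: 'm" and ?P = "dgP s N :: quat^'m^'m"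
 have s: "s < CARD('m)" using step.hyps N by simp
 have JC: "BB \<beta> {?i} ?J \<union> BB \<beta> {?i} (?C - ?J) = BB \<beta> {?i} ?C" "BB \<beta> {?i} ?J \<inter> BB \<beta> {?i} (?C - ?J) = {}"
  using N by (auto simp: BB_def)
 have cardJ: "card ?J = N - s"
 proof -
  have "{i. i < CARD('m) & s <= i & i < N} = {s..<N}" using N by auto
  thus ?thesis by (simp add: card_ix[where P = "%l. s <= l & l < N"])
 qed
 have [measurable]: "(%x::quat^'m^'m. norm (x ** ?P)) \<in> borel_measurable borel" by measurable
 \<comment> \<open>Only N - s of the n columns enter the pivot: a radial moment in \<beta> (N - s)
   of \<beta> n real coordinates with weight \<beta> (m - 1 - s). Hence the Pochhammer parameters
   \<beta> (N - s)/2 and \<beta> (n + m - 1 - s)/2 + 1.\<close>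
 have rad: "(\<integral>\<^sup>+x. ennreal (hball (\<beta> * card ?R) x * norm (x ** ?P) ^ (2 * ka s)) \<partial>LB \<beta> {?i} ?C)
   = ennreal (ball_const (\<beta> * n) (\<beta> * (CARD('m) - Suc s)) * ?r s)"
 proof -
  have "(\<integral>\<^sup>+x. ennreal (hball (\<beta> * card ?R) x * norm (x ** ?P) ^ (2 * ka s)) \<partial>LB \<beta> {?i} ?C)
   = ennreal (ball_const (card (BB \<beta> {?i} ?C)) (\<beta> * card ?R) * pochhammer (card (BB \<beta> {?i} ?J) / 2) (ka s)
     / pochhammer (real (\<beta> * card ?R + card (BB \<beta> {?i} ?C)) / 2 + 1) (ka s))" unfolding LB_def JC(1)[symmetric]
  proof (rule leb_hball_moment_part[OF _ JC(2)])
   fix x y :: "quat^'m^'m"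
   assume "x \<in> span ((%(i, j, q). el i j q) ` BB \<beta> {?i} ?J)" "y \<in> span ((%(i, j, q). el i j q) ` BB \<beta> {?i} (?C - ?J))"
   hence xy: "x \<in> Fblk \<beta> {?i} ?J" "y \<in> Fblk \<beta> {?i} (?C - ?J)" by (simp_all add: span_el)
   have "(x + y) ** ?P = x"
    by (rule mat_eqI) (use FblkD(2)[OF xy(1)] FblkD(2)[OF xy(2)] in \<open>auto simp: dgP_mult_nth\<close>)
   thus "norm ((x + y) ** ?P) = norm x" by simp
  qed (simp_all add: JC(1) orth_el)
  also have "real (card (BB \<beta> {?i} ?J)) / 2 = real \<beta> * (real N - real s) / 2"
   using step.hyps by (simp add: card_BB[OF \<beta>] cardJ)
  also have "real (\<beta> * card ?R + card (BB \<beta> {?i} ?C)) / 2 + 1 = real \<beta> * (real n + real CARD('m) - 1 - real s) / 2 + 1"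
  proof -
   have c: "real (CARD('m) - Suc s) = real CARD('m) - 1 - real s" using s by simp
   have e: "real (\<beta> * card ?R + card (BB \<beta> {?i} ?C)) = real \<beta> * real (CARD('m) - Suc s) + real \<beta> * real n"
    by (simp add: card_BB[OF \<beta>] card_ix_ge card_ix_less[OF N(3)])
   show ?thesis unfolding e c by (simp add: algebra_simps)
  qed
  also have "ball_const (card (BB \<beta> {?i} ?C)) (\<beta> * card ?R) = ball_const (\<beta> * n) (\<beta> * (CARD('m) - Suc s))"
   by (simp add: card_BB[OF \<beta>] card_ix_ge card_ix_less[OF N(3)])
  finally show ?thesis by simp
 qed
 have "(\<integral>\<^sup>+X. ob X * ennreal (lead \<beta> k ka (dgI s + X ** ?P)) \<partial>LB \<beta> (insert ?i ?R) ?C)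
   = (\<integral>\<^sup>+x. ennreal (hball (\<beta> * card ?R) x) * ennreal (norm (x ** ?P) ^ (2 * ka s)) \<partial>LB \<beta> {?i} ?C)
    * (\<integral>\<^sup>+Y. ob Y * ennreal (lead \<beta> k ka (dgI (Suc s) + Y ** dgP (Suc s) N)) \<partial>LB \<beta> ?R ?C)"
 proof (rule row_step[OF \<beta>, where j = ?i])
  fix x assume x: "x \<in> Fblk \<beta> {?i} ?C"
  show "EX W:unitary \<beta>. EX q. idout ?C W & norm q = 1 & (ALL b. (x ** W) $ ?i $ b = (if b = ?i then norm x *\<^sub>R q else 0))
    & (ALL c. ALL Y:Fblk \<beta> ?R ?C. ennreal (lead \<beta> k ka (dgI s + (x + Y) ** ?P))
     = ennreal (norm (x ** ?P) ^ (2 * ka s)) * ennreal (lead \<beta> k ka (dgI (Suc s) + (Y ** W ** cs ?i c) ** dgP (Suc s) N)))"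
  proof -
   have e: "ennreal (norm (x ** ?P) ^ (2 * ka s)) * ennreal z = ennreal (norm (x ** ?P) ^ (2 * ka s) * z)" for z
    by (rule ennreal_mult'[symmetric]) simp
   show ?thesis unfolding e using lead_row[OF \<beta> ka step.hyps(2) N(2,3) x] by metis
  qed
 qed (use step.hyps N s in \<open>auto intro!: measurable_lead[OF \<beta> ka]\<close>)
 also have "... = ennreal (ball_const (\<beta> * n) (\<beta> * (CARD('m) - Suc s)) * ?r s)
   * ennreal (vol \<beta> (CARD('m) - Suc s) n * (\<Prod>t=Suc s..<N. ?r t) * ?z)"
  unfolding step.IH rad[symmetric] by (simp add: ennreal_mult' hball_nonneg)
 also have "... = ennreal (ball_const (\<beta> * n) (\<beta> * (CARD('m) - Suc s)) * ?r s * (vol \<beta> (CARD('m) - Suc s) n * (\<Prod>t=Suc s..<N. ?r t) * ?z))"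
 proof (rule ennreal_mult'[symmetric])
  show "0 <= ball_const (\<beta> * n) (\<beta> * (CARD('m) - Suc s)) * ?r s"
   using step.hyps s ball_const_pos[of "\<beta> * n" "\<beta> * (CARD('m) - Suc s)"] \<beta>
   by (intro mult_nonneg_nonneg divide_nonneg_nonneg less_imp_le[OF pochhammer_pos]) (auto simp: add_nonneg_pos)
 qed
 also have "ball_const (\<beta> * n) (\<beta> * (CARD('m) - Suc s)) * ?r s * (vol \<beta> (CARD('m) - Suc s) n * (\<Prod>t=Suc s..<N. ?r t) * ?z)
   = vol \<beta> (CARD('m) - s) n * (\<Prod>t=s..<N. ?r t) * ?z"
 proof -
  have "CARD('m) - s = Suc (CARD('m) - Suc s)" using s by simp
  hence "vol \<beta> (CARD('m) - s) n = vol \<beta> (CARD('m) - Suc s) n * ball_const (\<beta> * n) (\<beta> * (CARD('m) - Suc s))"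
   by (simp add: vol_def)
  moreover have "(\<Prod>t=s..<N. ?r t) = ?r s * (\<Prod>t=Suc s..<N. ?r t)"
   using step.hyps(2) by (rule prod.atLeast_Suc_lessThan)
  ultimately show ?thesis by (simp only: mult_ac)
 qed
 finally show ?case by (simp only: insert_row[OF s])
qed

text \<open>Left unnormalised: the total mass is the volume, which supplies the Gamma factors at the
  end.\<close>

definition ball_law :: "nat => nat => (quat^'m^'m) measure" where
 "ball_law \<beta> n = density (LB \<beta> UNIV {b. ix b < n}) ob"

text \<open>Right multiplication keeps the left invariance. \<open>P\<close> will select columns,
  weight them by a diagonal matrix, or encode a form tr(A C) with
  \<open>C = P ** adj P\<close>.\<close>

definition proj_law :: "nat => nat => quat^'m^'m => (quat^'m^'m) measure" where
 "proj_law \<beta> n P = distr (ball_law \<beta> n) borel (%Y. Y ** P)"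

lemma sets_ball_law [measurable_cong, simp]: "sets (ball_law \<beta> n) = sets borel"
 and space_ball_law [simp]: "space (ball_law \<beta> n) = UNIV"
 by (simp_all add: ball_law_def)

lemma nn_integral_ball_law:
 fixes f :: "quat^'m^'m => ennreal"
 shows "f \<in> borel_measurable borel ==> (\<integral>\<^sup>+Y. f Y \<partial>ball_law \<beta> n) = (\<integral>\<^sup>+Y. ob Y * f Y \<partial>LB \<beta> UNIV {b. ix b < n})"
 unfolding ball_law_def by (rule nn_integral_density) auto

lemma AE_ball_law: "AE Y in ball_law \<beta> n. opb Y & Y \<in> Fblk \<beta> UNIV {b. ix b < n}"
proof -
 have "AE Y in LB \<beta> UNIV {b. ix b < n}. Y \<in> Fblk \<beta> UNIV {b. ix b < n}"
  unfolding LB_def span_el[symmetric] by (rule AE_leb)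
 hence "AE Y in LB \<beta> UNIV {b. ix b < n}. 0 < ob Y --> opb Y & Y \<in> Fblk \<beta> UNIV {b. ix b < n}"
  by eventually_elim (simp add: ob_def split: if_splits)
 thus ?thesis unfolding ball_law_def by (subst AE_density) auto
qed

lemma emeasure_ball_law:
 assumes "\<beta> \<in> {1, 2, 4}" "0 < n" "n <= CARD('m::finite)"
 shows "emeasure (ball_law \<beta> n :: (quat^'m^'m) measure) UNIV = ennreal (vol \<beta> CARD('m) n)"
proof -
 have "emeasure (ball_law \<beta> n :: (quat^'m^'m) measure) UNIV = (\<integral>\<^sup>+Y. 1 \<partial>(ball_law \<beta> n :: (quat^'m^'m) measure))"
  by simp
 also have "... = (\<integral>\<^sup>+Y. ob Y * 1 \<partial>LB \<beta> (UNIV :: 'm set) {b. ix b < n})" by (rule nn_integral_ball_law) simp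
 finally show ?thesis using ball_volume[OF assms, of 0] by simp
qed

lemma finite_measure_ball_law:
 assumes "\<beta> \<in> {1, 2, 4}" "0 < n" "n <= CARD('m::finite)"
 shows "finite_measure (ball_law \<beta> n :: (quat^'m^'m) measure)"
 by (rule finite_measureI) (simp add: emeasure_ball_law[OF assms])

lemma measurable_mult_left [measurable]: "(%Y :: quat^'m^'m. W ** Y) \<in> borel_measurable borel"
 by (rule borel_measurable_continuous_onI) (auto intro!: continuous_intros)

lemma ball_law_isometry:
 fixes g :: "quat^'m^'m => quat^'m^'m"
 assumes g: "linear g" "!!Y. Y \<in> Fblk \<beta> UNIV {b. ix b < n} ==> g Y \<in> Fblk \<beta> UNIV {b. ix b < n}" "!!Y. norm (g Y) = norm Y"
  and opb: "!!Y. opb (g Y) \<longleftrightarrow> opb Y" and f: "f \<in> borel_measurable borel"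
 shows "(\<integral>Y. f (g Y) \<partial>ball_law \<beta> n) = (\<integral>Y. f Y \<partial>ball_law \<beta> n :: real)"
proof -
 have [measurable]: "g \<in> borel_measurable borel"
  using linear_continuous_on[OF linear_conv_bounded_linear[THEN iffD1, OF g(1)]] by (intro borel_measurable_continuous_onI)
 have "distr (ball_law \<beta> n) borel g = ball_law \<beta> n"
 proof (rule measure_eqI)
  fix A assume "A \<in> sets (distr (ball_law \<beta> n) borel g)"
  hence A[measurable]: "A \<in> sets borel" by simp
  let ?f = "%Y. ob Y * indicator A Y"
  have "emeasure (distr (ball_law \<beta> n) borel g) A = (\<integral>\<^sup>+Y. indicator A Y \<partial>distr (ball_law \<beta> n) borel g)" by simp
  also have "... = (\<integral>\<^sup>+Y. indicator A (g Y) \<partial>ball_law \<beta> n)" by (rule nn_integral_distr) auto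
  also have "... = (\<integral>\<^sup>+Y. ?f (g Y) \<partial>LB \<beta> UNIV {b. ix b < n})"
   by (subst nn_integral_ball_law) (auto simp: ob_def opb)
  also have "... = (\<integral>\<^sup>+Y. ?f Y \<partial>LB \<beta> UNIV {b. ix b < n})"
   unfolding LB_def by (rule leb_isometry[OF orth_el g(1)]) (auto simp: span_el g)
  also have "... = (\<integral>\<^sup>+Y. indicator A Y \<partial>ball_law \<beta> n)" by (rule nn_integral_ball_law[symmetric]) simp
  finally show "emeasure (distr (ball_law \<beta> n) borel g) A = emeasure (ball_law \<beta> n) A" by simp
 qed simp
 hence "(\<integral>Y. f Y \<partial>ball_law \<beta> n) = (\<integral>Y. f Y \<partial>distr (ball_law \<beta> n) borel g)" by simp
 also have "... = (\<integral>Y. f (g Y) \<partial>ball_law \<beta> n)" by (rule integral_distr) (auto simp: f)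
 finally show ?thesis ..
qed

lemma integral_proj_law:
 fixes f :: "quat^'m^'m => real"
 shows "f \<in> borel_measurable borel ==> (\<integral>Z. f Z \<partial>proj_law \<beta> n P) = (\<integral>Y. f (Y ** P) \<partial>ball_law \<beta> n)"
 unfolding proj_law_def by (rule integral_distr) auto

lemma opb_unitary_left: "U \<in> unitary \<beta> ==> opb (U ** Y) \<longleftrightarrow> opb Y"
 by (simp add: opb_def matrix_vector_mul_assoc[symmetric] unitary_norm)

lemma norm_unitary_mult:
 fixes Y U :: "quat^'m^'m"
 assumes "U \<in> unitary \<beta>"
 shows "norm (U ** Y) = norm Y"
proof -
 have "adj Y ** adj U ** (U ** Y) = adj Y ** (adj U ** (U ** Y))" by (simp only: matrix_mul_assoc)
 thus ?thesis by (simp add: norm_eq_sqrt_inner inner_mat adjoint_mult unitary_cancel[OF assms])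
qed

lemma inv_law_proj:
 fixes P :: "quat^'m^'m"
 assumes \<beta>: "\<beta> \<in> {1, 2, 4}" and n: "0 < n" "n <= CARD('m)" and P: "P \<in> Fmat \<beta>"
 shows "inv_law (proj_law \<beta> n P) \<beta>"
proof -
 interpret B: finite_measure "ball_law \<beta> n :: (quat^'m^'m) measure" by (rule finite_measure_ball_law[OF \<beta> n])
 have fin: "finite_measure (proj_law \<beta> n P)" unfolding proj_law_def by (rule B.finite_measure_distr) simp
 obtain K where K: "!!v. norm (P *v v) <= K * norm v" using norm_matrix_vector_le by blast
 let ?Q = "%Z :: quat^'m^'m. Z \<in> Fmat \<beta> & (ALL v. norm (Z *v v) <= K * norm v)"
 have AE: "AE Y in ball_law \<beta> n. ?Q (Y ** P)" using AE_ball_law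
 proof eventually_elim
  case (elim Y)
  have "norm (Y *v w) <= norm w" for w using elim by (cases "w = 0") (auto simp: opb_def less_imp_le)
  thus ?case using elim P K FblkD(1) order_trans unfolding matrix_vector_mul_assoc[symmetric] by blast
 qed
 have cl: "closed {Z. ?Q Z}"
 proof -
  have eq: "{Z. ?Q Z} = Fmat \<beta> \<inter> (\<Inter>v. {Z. norm (Z *v v) <= K * norm v})" by auto
  have cv: "continuous_on UNIV (%Z :: quat^'m^'m. Z *v v)" for v
  proof -
   have "continuous_on UNIV (%Z :: quat^'m^'m. (v, Z))"
    by (intro continuous_on_Pair continuous_on_const continuous_on_id)
   from continuous_on_compose2[OF continuous_matrix_vector_pair this subset_UNIV] show ?thesis by simp
  qed
  show ?thesis
   unfolding eq by (intro closed_Int closed_INT ballI closed_subspace[OF subspace_Fmat] closed_Collect_le continuous_on_norm continuous_on_const cv)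
 qed
 have AE': "AE Z in proj_law \<beta> n P. ?Q Z" unfolding proj_law_def
  using AE borel_closed[OF cl] by (subst AE_distr_iff) simp_all
 have "(\<integral>Z. f (U ** Z) \<partial>proj_law \<beta> n P) = (\<integral>Z. f Z \<partial>proj_law \<beta> n P)"
  if U: "U \<in> unitary \<beta>" and f: "continuous_on UNIV f" for U and f :: "quat^'m^'m => real"
 proof -
  have [measurable]: "f \<in> borel_measurable borel" by (rule borel_measurable_continuous_onI[OF f])
  have "(\<integral>Y. f (U ** Y ** P) \<partial>ball_law \<beta> n) = (\<integral>Y. f (Y ** P) \<partial>ball_law \<beta> n)"
  proof (rule ball_law_isometry[where g = "%Y. U ** Y" and f = "%Y. f (Y ** P)"])
   show "linear (%Y. U ** Y :: quat^'m^'m)" by (intro linearI) (simp_all add: matrix_mult_distribs)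
   fix Y :: "quat^'m^'m" assume Y: "Y \<in> Fblk \<beta> UNIV {b. ix b < n}"
   show "U ** Y \<in> Fblk \<beta> UNIV {b. ix b < n}" unfolding Fblk_def
   proof (intro CollectI conjI allI impI)
    show "U ** Y \<in> Fmat \<beta>" using unitary_D(1)[OF U] FblkD(1)[OF Y] by auto
    fix i j assume nz: "(U ** Y) $ i $ j ~= 0"
    show "ix j < n"
    proof (rule ccontr)
     assume "~ ix j < n"
     thus False using FblkD(2)[OF Y, of _ j] nz by (simp add: matrix_mult_nth)
    qed
   qed simp
  qed (simp_all add: norm_unitary_mult[OF U] opb_unitary_left[OF U])
  thus ?thesis by (simp add: integral_proj_law matrix_mul_assoc)
 qed
 moreover have "sets (proj_law \<beta> n P) = sets borel" by (simp add: proj_law_def)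
 ultimately show ?thesis using AE' by (intro inv_law.intro[OF fin] inv_law_axioms.intro[OF \<beta>] exI[of _ K])
qed

text \<open>The mean leading coefficient over the ball with n columns of which N are kept;
  \<open>tval_eq\<close> writes it as the volume times (N \<beta>/2)_\<kappa> / ((n + m - 1)
  \<beta>/2 + 1)_\<kappa> when \<kappa> has at most N parts.\<close>

definition tval :: "nat => nat => nat => (nat => nat) => nat => real" where
 "tval \<beta> m n ka N = vol \<beta> m n * (\<Prod>s<N. pochhammer (real \<beta> * (real N - real s) / 2) (ka s)
   / pochhammer (real \<beta> * (real n + real m - 1 - real s) / 2 + 1) (ka s)) * (if ALL i. N <= i --> ka i = 0 then 1 else 0)"

lemma vol_pos: "vol \<beta> m n > 0"
 unfolding vol_def by (intro prod_pos) (simp add: ball_const_pos)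

lemma tval_pos:
 assumes "\<beta> > 0" "N <= n" "n <= m" "!!i. N <= i ==> ka i = 0"
 shows "tval \<beta> m n ka N > 0"
proof -
 have "real \<beta> * (real n + real m - 1 - real s) / 2 + 1 > 0" if "s < N" for s
  using that assms(2,3) by (intro add_nonneg_pos mult_nonneg_nonneg) auto
 thus ?thesis unfolding tval_def using assms vol_pos[of \<beta> m n]
  by (auto intro!: mult_pos_pos prod_pos divide_pos_pos pochhammer_pos)
qed

lemma integral_lead:
 assumes \<beta>: "\<beta> \<in> {1, 2, 4}" and ka: "ka \<in> parts CARD('m::finite) k" and N: "0 < N" "N <= n" "n <= CARD('m)"
 shows "(\<integral>Z. lead \<beta> k ka Z \<partial>proj_law \<beta> n (dgP 0 N :: quat^'m^'m)) = tval \<beta> CARD('m) n ka N"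
proof -
 let ?f = "%Y. lead \<beta> k ka (Y ** dgP 0 N :: quat^'m^'m)"
 have I0: "dgI 0 + X = (X :: quat^'m^'m)" for X by (rule mat_eqI) (simp add: dgI_nth)
 have U: "{a::'m. 0 <= ix a} = UNIV" by simp
 note m = measurable_lead[OF \<beta> ka, of "dgI 0" "dgP 0 N", unfolded I0]
 have "AE Y in ball_law \<beta> n. 0 <= ?f Y"
  using AE_ball_law by eventually_elim (use lead_nonneg[OF \<beta> ka N(2,3), of 0] in \<open>simp add: I0\<close>)
 hence "(\<integral>Y. ?f Y \<partial>ball_law \<beta> n) = enn2real (\<integral>\<^sup>+Y. ennreal (?f Y) \<partial>ball_law \<beta> n)" by (intro integral_eq_nn_integral)
    (simp_all add: measurable_cong_sets[OF sets_ball_law refl] borel_measurable_continuous_onI continuous_on_compose2[OF continuous_on_lead[OF \<beta> ka] continuous_mult_right])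
 also have "(\<integral>\<^sup>+Y. ennreal (?f Y) \<partial>ball_law \<beta> n) = ennreal (tval \<beta> CARD('m) n ka N)"
  using ball_lead[OF \<beta> ka N, of 0] unfolding nn_integral_ball_law[OF m] I0 U tval_def
  by (simp add: atLeast0LessThan)
 also have "enn2real ... = tval \<beta> CARD('m) n ka N"
  using tval_pos[of \<beta> N n "CARD('m)" ka] \<beta> N by (auto simp: tval_def[of _ _ _ _ N])
 finally show ?thesis
  using integral_proj_law[of "lead \<beta> k ka" \<beta> n "dgP 0 N :: quat^'m^'m"] borel_measurable_continuous_onI[OF continuous_on_lead[OF \<beta> ka]] by simp
qed

lemma proj_law_self: "proj_law \<beta> n (dgP 0 n :: quat^'m^'m) = ball_law \<beta> n"
proof -
 have "AE Y in ball_law \<beta> n. Y ** dgP 0 n = (Y :: quat^'m^'m)" using AE_ball_law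
 proof eventually_elim
  case (elim Y)
  show ?case by (rule mat_eqI) (use FblkD(2) elim in \<open>force simp: dgP_mult_nth\<close>)
 qed
 hence "distr (ball_law \<beta> n) borel (%Y. Y ** dgP 0 n) = distr (ball_law \<beta> n) borel (%Y :: quat^'m^'m. Y)"
  by (intro distr_cong_AE) auto
 thus ?thesis unfolding proj_law_def by (simp add: distr_id2)
qed

section \<open>Normalization, stability and values at the identity of the Jack polynomials\<close>

section \<open>The Jack family\<close>

definition qtr :: "quat^'m^'m => real" where
 "qtr A = qRe (trace A)"

text \<open>Unique by \<open>PP_independent\<close>; it turns out to be the factor between the monic
  polynomial and C_\<kappa>.\<close>

definition p1coef :: "nat => nat => nat => (nat => nat) => real" where
 "p1coef \<beta> p k = (SOME c. ALL x. (\<Sum>i<p. x i) ^ k = (\<Sum>ka\<in>parts p k. c ka * JP \<beta> p k ka x))"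

lemma psum_qtr: "psum k (%A :: quat^'m^'m. qtr A ^ k)"
proof (induction k)
 case 0
 thus ?case by (simp add: psum_const)
next
 case (Suc k)
 have "ptr 1 A = qtr A" for A :: "quat^'m^'m" by (simp add: ptr_def qtr_def)
 thus ?case using psum_mult[OF psum_ptr[of 1] Suc] by simp
qed

lemma qtr_dg: "qtr (dg x :: quat^'m^'m) = (\<Sum>i<CARD('m). x i)"
 by (simp add: qtr_def qRe_trace_dg)

lemma p1coef:
 assumes \<beta>: "\<beta> \<in> {1, 2, 4}"
 shows "(\<Sum>i<CARD('m::finite). x i) ^ k = (\<Sum>ka\<in>parts CARD('m) k. p1coef \<beta> CARD('m) k ka * JP \<beta> CARD('m) k ka x)"
proof -
 have "EX c. ALL x. (\<Sum>i<CARD('m). x i) ^ k = (\<Sum>ka\<in>parts CARD('m) k. c ka * JP \<beta> CARD('m) k ka x)"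
  using psum_dg[OF psum_qtr[where 'm = 'm], of k] unfolding qtr_dg
  by (intro jack_setting.PP_spans[OF jack_setting[OF \<beta>]]) simp_all
 from someI_ex[OF this] show ?thesis unfolding p1coef_def by blast
qed

lemma qtr_expand:
 assumes \<beta>: "\<beta> \<in> {1, 2, 4}" and A: "A \<in> hermitian \<beta>"
 shows "qtr (A :: quat^'m^'m) ^ k = (\<Sum>ka\<in>parts CARD('m) k. p1coef \<beta> CARD('m) k ka * PM \<beta> k ka A)"
proof -
 have "PM \<beta> k ka A = JP \<beta> CARD('m) k ka (eigv \<beta> A)" if "ka \<in> parts CARD('m) k" for ka
  using invp_hermitian[OF \<beta> psum_invp[OF PM(1)[OF \<beta> that]] A] PM(2)[OF \<beta> that] by simp
 thus ?thesis using invp_hermitian[OF \<beta> psum_invp[OF psum_qtr] A, of k] by (simp add: qtr_dg p1coef[OF \<beta>])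
qed

lemma (in inv_law) TT_qtr:
 "TT (%A. qtr A ^ k) (dg x) = (\<Sum>ka\<in>parts CARD('m) k. p1coef \<beta> CARD('m) k ka * (\<integral>Z. lead \<beta> k ka Z \<partial>\<mu>) * JP \<beta> CARD('m) k ka x)"
proof -
 let ?G = "%A. \<Sum>ka\<in>parts CARD('m) k. p1coef \<beta> CARD('m) k ka * PM \<beta> k ka (A :: quat^'m^'m)"
 have h: "hmp k (%A. p1coef \<beta> CARD('m) k ka * PM \<beta> k ka (A :: quat^'m^'m))" if "ka \<in> parts CARD('m) k" for ka
  by (rule hmp_scale[OF psum_hmp[OF PM(1)[OF \<beta> that]]])
 have "TT (%A. qtr A ^ k) (dg x) = TT ?G (dg x)"
  by (rule TT_AE_cong[OF _ qtr_expand[OF \<beta>] psum_hmp[OF psum_qtr] hmp_sum[OF h]]) simp_all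
 also have "... = (\<Sum>ka\<in>parts CARD('m) k. TT (%A. p1coef \<beta> CARD('m) k ka * PM \<beta> k ka A) (dg x))"
  by (rule TT_sum[OF h])
 finally show ?thesis by (simp add: TT_scale TT_eigen mult.assoc)
qed

definition psd :: "nat => quat^'m^'m => bool" where
 "psd \<beta> C \<longleftrightarrow> C \<in> hermitian \<beta> & (ALL v:Fvec \<beta>. 0 <= v \<bullet> (C *v v))"

lemma psd_factor:
 fixes C :: "quat^'m^'m"
 assumes \<beta>: "\<beta> \<in> {1, 2, 4}" and C: "psd \<beta> C"
 shows "EX P:Fmat \<beta> :: (quat^'m^'m) set. C = P ** adj P"
proof -
 have h: "C \<in> hermitian \<beta>" using C by (simp add: psd_def)
 obtain U where U: "U \<in> unitary \<beta>" "C = U ** dg (eigv \<beta> C) ** adj U" using eigv(2)[OF \<beta> h] by blast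
 let ?S = "dg (%i. sqrt (eigv \<beta> C i)) :: quat^'m^'m"
 have "0 <= eigv \<beta> C i" if "i < CARD('m)" for i using C that by (intro eigv_nonneg[OF \<beta> h]) (auto simp: psd_def)
 hence "?S ** ?S = dg (eigv \<beta> C)" unfolding dg_mult_dg by (intro dg_cong) simp
 hence "C = U ** (?S ** ?S) ** adj U" using U(2) by simp
 also have "... = (U ** ?S) ** adj (U ** ?S)" by (simp only: adjoint_mult dg_simps matrix_mul_assoc)
 finally show ?thesis using Fmat_mult[OF unitary_D(1)[OF U(1)] dg_simps(3)] by blast
qed

lemma psd_add_scale: "psd \<beta> C ==> psd \<beta> D ==> 0 <= s ==> psd \<beta> (C + s *\<^sub>R D)"
 by (auto simp: psd_def hermitian_def matrix_vector_distribs inner_simps)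

text \<open>The form is represented by a Hermitian matrix; adding a large multiple of the identity
  makes it positive semidefinite, and the same multiple is subtracted again.\<close>

lemma linear_form_psd:
 fixes F :: "quat^'m^'m => real"
 assumes "linear F"
 shows "EX C D. psd \<beta> C & psd \<beta> D & (ALL A:hermitian \<beta>. F A = qtr (A ** C) - qtr (A ** D))"
proof -
 define M where "M = (\<Sum>b\<in>Basis \<inter> Fmat \<beta>. F b *\<^sub>R (b :: quat^'m^'m))"
 define H where "H = (1 / 2) *\<^sub>R (M + adj M)"
 have M: "M \<in> Fmat \<beta>" unfolding M_def by (intro subspace_sum[OF subspace_Fmat]) auto
 have H: "H \<in> hermitian \<beta>" using M by (auto intro!: hermitianI simp: H_def)
 have FM: "F A = A \<bullet> M" if "A \<in> Fmat \<beta>" for A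
 proof -
  have "F A = (\<Sum>b\<in>Basis. (A \<bullet> b) * F b)"
   using linear_sum[OF assms, of "%b. (A \<bullet> b) *\<^sub>R b" Basis] by (simp add: euclidean_representation linear_scale[OF assms])
  also have "... = (\<Sum>b\<in>Basis \<inter> Fmat \<beta>. (A \<bullet> b) * F b)"
   using Fmat_inner_Basis[OF that] by (intro sum.mono_neutral_right) auto
  finally show ?thesis by (simp add: M_def inner_sum_right mult.commute)
 qed
 have FH: "F A = qtr (A ** H)" if "A \<in> hermitian \<beta>" for A
 proof -
  note A = hermitianD[OF that]
  have "qtr (A ** adj M) = qtr (adj (M ** A))" by (simp add: adjoint_mult A)
  also have "... = qtr (M ** A)" by (simp add: qtr_def trace_def qRe_sum)
  also have "... = qtr (A ** M)" unfolding qtr_def by (rule qRe_trace_commute)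
  moreover have "qtr (r *\<^sub>R X) = r * qtr X" "qtr (X + Y) = qtr X + qtr Y" for r and X Y :: "quat^'m^'m"
   by (simp_all add: qtr_def trace_def qRe_sum sum_distrib_left sum.distrib)
  ultimately show ?thesis
   using FM[OF A(1)] A(2) by (simp add: H_def matrix_mult_distribs inner_mat) (simp add: qtr_def)
 qed
 obtain K where K: "!!v. norm (H *v v) <= K * norm v" using norm_matrix_vector_le by blast
 define r where "r = \<bar>K\<bar>"
 have one: "psd \<beta> (r *\<^sub>R (mat 1 :: quat^'m^'m))"
  unfolding psd_def hermitian_def by (auto simp: matrix_vector_distribs r_def)
 have "- (r * (v \<bullet> v)) <= v \<bullet> (H *v v)" for v
 proof -
  have "\<bar>v \<bullet> (H *v v)\<bar> <= norm v * (K * norm v)"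
   by (rule order_trans[OF Cauchy_Schwarz_ineq2 mult_left_mono[OF K]]) simp
  also have "... <= r * (v \<bullet> v)" using mult_right_mono[OF abs_ge_self, of "norm v * norm v" K]
   by (simp add: r_def dot_square_norm power2_eq_square mult_ac)
  finally show ?thesis by simp
 qed
 hence "0 <= v \<bullet> (H *v v) + r * (v \<bullet> v)" for v
  by (simp add: algebra_simps minus_le_iff) (metis add.commute add.right_inverse add_left_mono)
 hence "psd \<beta> (H + r *\<^sub>R mat 1)"
  using H unfolding psd_def hermitian_def by (auto simp: matrix_vector_distribs inner_simps)
 moreover have "qtr (A ** H) = qtr (A ** (H + r *\<^sub>R mat 1)) - qtr (A ** (r *\<^sub>R mat 1))" for A :: "quat^'m^'m"
  by (simp add: matrix_mult_distribs qtr_def trace_def sum.distrib)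
 ultimately show ?thesis using one FH by (intro exI[of _ "H + r *\<^sub>R mat 1"] exI[of _ "r *\<^sub>R mat 1"]) auto
qed

text \<open>Products of linear forms with positive semidefinite \<open>C\<close>; by polarization a linear functional that
 vanishes on all \<open>k\<close>-th powers of such forms vanishes on all homogeneous polynomials of degree \<open>k\<close>.\<close>

inductive cprod :: "nat => nat => (quat^'m^'m => real) => bool" for \<beta> where
 cprod_one: "cprod \<beta> 0 (%_. 1)"
| cprod_mult: "cprod \<beta> j G ==> psd \<beta> C ==> cprod \<beta> (Suc j) (%A. qtr (A ** C) * G A)"

lemma hmp_qtr: "hmp (Suc 0) (%A :: quat^'m^'m. qtr (A ** C))"
proof (rule hmp_linear)
 show "linear (%A :: quat^'m^'m. qtr (A ** C))"
  by (intro linearI) (simp_all add: matrix_mult_distribs qtr_def trace_def qRe_sum sum.distrib sum_distrib_left)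
qed

lemma hmp_power:
 assumes "hmp (Suc 0) f"
 shows "hmp n (%A. f A ^ n)"
proof (induction n)
 case 0
 thus ?case by (simp add: hmp_const)
next
 case (Suc n)
 thus ?case using hmp_mult[OF assms Suc] by simp
qed

lemma hmp_cprod: "cprod \<beta> j G ==> hmp j G"
proof (induction rule: cprod.induct)
 case cprod_one
 thus ?case by (rule hmp_const)
next
 case (cprod_mult j G C)
 thus ?case using hmp_mult[OF hmp_qtr cprod_mult.IH] by simp
qed

lemma poly_zero_nonneg:
 fixes a :: "nat => real"
 assumes "!!s. 0 <= s ==> (\<Sum>i\<le>n. a i * s ^ i) = 0" "i <= n"
 shows "a i = 0"
proof (rule ccontr)
 assume "a i ~= 0"
 hence "finite {s. (\<Sum>i\<le>n. a i * s ^ i) = 0}" using polyfun_rootbound[of n a] assms(2) by blast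
 moreover have "{0..} \<subseteq> {s. (\<Sum>i\<le>n. a i * s ^ i) = 0}" using assms(1) by auto
 ultimately show False using infinite_Ici finite_subset by blast
qed

lemma polarization:
 fixes q :: "(quat^'m^'m => real) => real"
 assumes add: "!!F G c. hmp k F ==> hmp k G ==> q (%A. F A + c * G A) = q F + c * q G"
  and cong: "!!F G. hmp k F ==> hmp k G ==> (!!A. A \<in> hermitian \<beta> ==> F A = G A) ==> q F = q G"
  and pow: "!!C. psd \<beta> C ==> q (%A. qtr (A ** C) ^ k) = 0"
  and F: "hmp k F"
 shows "q F = 0"
proof -
 have q0: "q (%_. 0) = 0" using add[OF hmp_zero hmp_zero, of 1] by simp
 have q_sum: "q (%A. \<Sum>i\<in>S. c i * F i A) = (\<Sum>i\<in>S. c i * q (F i))" if "finite S" "!!i. i \<in> S ==> hmp k (F i)"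
  for S :: "nat set" and c F using that
 proof (induction S rule: finite_induct)
  case empty
  thus ?case by (simp add: q0)
 next
  case (insert i S)
  have "q (%A. (\<Sum>i\<in>S. c i * F i A) + c i * F i A) = q (%A. \<Sum>i\<in>S. c i * F i A) + c i * q (F i)"
   using insert.prems by (intro add hmp_sum hmp_scale) auto
  thus ?case using insert by (simp add: add.commute)
 qed
 \<comment> \<open>One factor is split off at a time: with C + s C' in place of C the identity holds
   for all s >= 0, where positivity persists, so every coefficient of the polynomial in s vanishes,
   and the linear one has a single factor with C'.\<close>
 have step: "q (%A. G A * qtr (A ** C) ^ (k - j)) = 0" if "cprod \<beta> j G" "j <= k" "psd \<beta> C" for j G C using that
 proof (induction arbitrary: C rule: cprod.induct)
  case cprod_one
  thus ?case by (simp add: pow)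
 next
  case (cprod_mult j G C')
  define n where "n = k - j"
  have n: "n = Suc (k - Suc j)" "j + n = k" using cprod_mult.prems by (auto simp: n_def)
  let ?H = "%i A. G A * (qtr (A ** C') ^ i * qtr (A ** C) ^ (n - i))"
  have H: "hmp k (?H i)" if "i <= n" for i
  proof -
   have "hmp (j + (i + (n - i))) (?H i)" by (intro hmp_mult hmp_power hmp_qtr hmp_cprod[OF cprod_mult.hyps(1)])
   thus ?thesis using that n by simp
  qed
  have "(\<Sum>i\<le>n. (real (n choose i) * q (?H i)) * s ^ i) = 0" if s: "0 <= s" for s
  proof -
   have "G A * qtr (A ** (C + s *\<^sub>R C')) ^ n = (\<Sum>i\<in>{..n}. (real (n choose i) * s ^ i) * ?H i A)" for A
   proof -
    have "qtr (A ** (C + s *\<^sub>R C')) = s * qtr (A ** C') + qtr (A ** C)"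
     by (simp add: matrix_mult_distribs qtr_def trace_def qRe_sum sum.distrib sum_distrib_left)
    thus ?thesis by (simp add: binomial_ring sum_distrib_left power_mult_distrib mult_ac)
   qed
   hence "q (%A. \<Sum>i\<in>{..n}. (real (n choose i) * s ^ i) * ?H i A) = 0"
    using cprod_mult.IH[OF _ psd_add_scale[OF cprod_mult.prems(2) cprod_mult.hyps(2) s]] cprod_mult.prems(1)
    by (simp add: n_def)
   thus ?thesis using H by (subst (asm) q_sum) (auto simp: mult_ac)
  qed
  thus ?case
   using poly_zero_nonneg[where a = "%i. real (n choose i) * q (?H i)" and i = 1 and n = n] n by (simp add: mult_ac)
 qed
 \<comment> \<open>A polynomial built from sums and products is processed from left to right:
   \<open>D\<close> collects the forms already treated, \<open>F\<close> is the current factor,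
   \<open>G\<close> what remains, and the degrees i, l, r add up to k.\<close>
 have main: "q (%A. D A * (F A * G A)) = 0"
  if "hmp l F" "hmp r G" "cprod \<beta> i D" "i + l + r = k"
   "!!D. cprod \<beta> (i + l) D ==> q (%A. D A * G A) = 0" for i l r D F G using that
 proof (induction arbitrary: i r D G rule: hmp.induct)
  case (hmp_const c)
  have "q (%A. 0 + c * (D A * G A)) = q (%_. 0) + c * q (%A. D A * G A)"
   using hmp_const by (intro add hmp_zero) (metis add_0_right hmp_mult hmp_cprod)
  thus ?case using hmp_const(4)[of D] hmp_const(2) by (simp add: q0 mult_ac)
 next
  case (hmp_linear f)
  obtain C C' where C: "psd \<beta> C" "psd \<beta> C'" "!!A. A \<in> hermitian \<beta> ==> f A = qtr (A ** C) - qtr (A ** C')"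
   using linear_form_psd[OF hmp_linear(1)] by blast
  let ?G = "%C A. (qtr (A ** C) * D A) * G A"
  have deg: "Suc i + r = k" using hmp_linear by simp
  have hG: "hmp k (?G C)" for C
   using hmp_mult[OF hmp_mult[OF hmp_qtr hmp_cprod[OF hmp_linear(3)]] hmp_linear(2)] deg by simp
  have "q (%A. D A * (f A * G A)) = q (%A. ?G C A + (- 1) * ?G C' A)"
   using hmp_mult[OF hmp_cprod[OF hmp_linear(3)] hmp_mult[OF hmp.hmp_linear[OF hmp_linear(1)] hmp_linear(2)]] deg by ((intro cong hmp_add hmp_scale hG), (auto simp: C(3) algebra_simps))
  also have "... = q (?G C) + (- 1) * q (?G C')" by (rule add[OF hG hG])
  finally show ?case
   using hmp_linear(5)[of "%A. qtr (A ** _) * D A"] cprod.cprod_mult[OF hmp_linear(3)] C(1,2) by simp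
 next
  case (hmp_add l f g)
  have h: "hmp k (%A. D A * (f A * G A))" "hmp k (%A. D A * (g A * G A))"
   using hmp_mult[OF hmp_cprod[OF hmp_add.prems(2)] hmp_mult[OF hmp_add.hyps(1) hmp_add.prems(1)]]
    hmp_mult[OF hmp_cprod[OF hmp_add.prems(2)] hmp_mult[OF hmp_add.hyps(2) hmp_add.prems(1)]] hmp_add.prems(3)
   by (simp_all add: add.assoc)
  have "q (%A. D A * ((f A + g A) * G A)) = q (%A. D A * (f A * G A) + 1 * (D A * (g A * G A)))"
   by (simp add: algebra_simps)
  also have "... = 0" unfolding add[OF h] using hmp_add.IH[OF hmp_add.prems(1-3)] hmp_add.prems(4) by simp
  finally show ?case .
 next
  case (hmp_mult l1 f l2 g)
  have "q (%A. D A * (f A * (g A * G A))) = 0"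
  proof (rule hmp_mult.IH(1)[OF hmp.hmp_mult[OF hmp_mult.hyps(2) hmp_mult.prems(1)] hmp_mult.prems(2)])
   show "i + l1 + (l2 + r) = k" using hmp_mult.prems(3) by simp
   fix D :: "quat^'m^'m => real" assume D: "cprod \<beta> (i + l1) D"
   have "i + l1 + l2 + r = k" "i + l1 + l2 = i + (l1 + l2)" using hmp_mult.prems(3) by simp_all
   thus "q (%A. D A * (g A * G A)) = 0"
    using hmp_mult.prems(4) by (intro hmp_mult.IH(2)[OF hmp_mult.prems(1) D]) metis+
  qed
  thus ?case by (simp add: mult.assoc)
 qed
 have "q (%A. D A * 1) = 0" if "cprod \<beta> k D" for D
  using step[OF that order_refl, of 0] by (simp add: psd_def hermitian_def)
 thus ?thesis using main[OF F hmp_const[of 1] cprod_one] by simp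
qed

text \<open>Let q read off the coefficient at \<open>ka\<close> of an averaged polynomial. For
  \<open>C = P ** adj P\<close>, averaging tr(A C)^k over the ball is averaging the k-th power of
  the trace over the law of Y P, so q of it has the factor \<open>p1coef\<close>. Were that 0,
  polarization would make q vanish on every polynomial, yet on \<open>PM\<close> its value is
  \<open>tval\<close> > 0.\<close>

lemma p1coef_nonzero:
 assumes \<beta>: "\<beta> \<in> {1, 2, 4}" and ka: "ka \<in> parts CARD('m::finite) k"
 shows "p1coef \<beta> CARD('m) k ka ~= 0"
proof
 assume c0: "p1coef \<beta> CARD('m) k ka = 0"
 let ?p = "CARD('m)" and ?one = "dgP 0 CARD('m) :: quat^'m^'m"
 interpret jack_setting \<beta> ?p by (rule jack_setting[OF \<beta>])
 interpret B: inv_law "ball_law \<beta> ?p :: (quat^'m^'m) measure" \<beta>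
  using inv_law_proj[OF \<beta> _ order_refl, of ?one] unfolding proj_law_self by simp
 define q where "q F = (SOME b. ALL x. B.TT F (dg x) = (\<Sum>nu\<in>parts ?p k. b nu * PP k nu x)) ka" for F
 have q_eq: "q F = b ka" if "!!x. B.TT F (dg x) = (\<Sum>nu\<in>parts ?p k. b nu * PP k nu x)" for F b
 proof -
  define b' where "b' = (SOME b. ALL x. B.TT F (dg x) = (\<Sum>nu\<in>parts ?p k. b nu * PP k nu x))"
  have "ALL x. B.TT F (dg x) = (\<Sum>nu\<in>parts ?p k. b' nu * PP k nu x)"
   unfolding b'_def by (rule someI[of _ b]) (use that in blast)
  hence "(\<Sum>nu\<in>parts ?p k. (b' nu - b nu) * PP k nu x) = 0" for x
   using that[of x] by (simp add: left_diff_distrib sum_subtractf)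
  thus ?thesis using PP_independent[OF _ ka, of "%nu. b' nu - b nu"] by (simp add: q_def b'_def)
 qed
 have ex: "EX b. ALL x. B.TT F (dg x) = (\<Sum>nu\<in>parts ?p k. b nu * PP k nu x)" if "hmp k F" for F
  using invp_dg[OF B.TT_invp[OF that]] by (rule PP_spans)
 have "q (PM \<beta> k ka) = 0"
 proof (rule polarization[where k = k and \<beta> = \<beta> and q = q])
  fix F G :: "quat^'m^'m => real" and c assume F: "hmp k F" and G: "hmp k G"
  obtain b b' where b: "!!x. B.TT F (dg x) = (\<Sum>nu\<in>parts ?p k. b nu * PP k nu x)"
   "!!x. B.TT G (dg x) = (\<Sum>nu\<in>parts ?p k. b' nu * PP k nu x)" using ex[OF F] ex[OF G] by blast
  have "q (%A. F A + c * G A) = b ka + c * b' ka" by (rule q_eq[where b = "%nu. b nu + c * b' nu"])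
     (simp add: B.TT_add[OF F hmp_scale[OF G]] B.TT_scale b sum.distrib sum_distrib_left distrib_right mult.assoc)
  thus "q (%A. F A + c * G A) = q F + c * q G" using q_eq[OF b(1)] q_eq[OF b(2)] by simp
 next
  fix F G :: "quat^'m^'m => real" assume F: "hmp k F" and G: "hmp k G" and eq: "!!A. A \<in> hermitian \<beta> ==> F A = G A"
  show "q F = q G" using B.TT_AE_cong[OF _ eq F G] by (simp add: q_def)
 next
  fix C :: "quat^'m^'m" assume "psd \<beta> C"
  then obtain P :: "quat^'m^'m" where P: "P \<in> Fmat \<beta>" "C = P ** adj P" using psd_factor[OF \<beta>] by blast
  interpret P: inv_law "proj_law \<beta> ?p P" \<beta> by (rule inv_law_proj[OF \<beta> _ order_refl P(1)]) simp
  have "B.TT (%A. qtr (A ** C) ^ k) (dg x) = P.TT (%A. qtr A ^ k) (dg x)" for x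
  proof -
   have "qtr (adj Y ** dg x ** Y ** C) = qtr (adj (Y ** P) ** dg x ** (Y ** P))" for Y :: "quat^'m^'m"
    using qRe_trace_commute[of "adj Y ** dg x ** Y ** P" "adj P"]
    by (simp add: qtr_def P(2) adjoint_mult matrix_mul_assoc)
   moreover have "(%Z :: quat^'m^'m. qtr (adj Z ** dg x ** Z) ^ k) \<in> borel_measurable borel"
    by (rule borel_measurable_continuous_onI[OF continuous_congruence[OF psum_hmp[OF psum_qtr]]])
   ultimately show ?thesis unfolding B.TT_def P.TT_def by (simp add: integral_proj_law)
  qed
  thus "q (%A. qtr (A ** C) ^ k) = 0"
   using q_eq[where b = "%nu. p1coef \<beta> ?p k nu * (\<integral>Z. lead \<beta> k nu Z \<partial>proj_law \<beta> ?p P)"] c0 by (simp add: P.TT_qtr)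
 qed (rule psum_hmp[OF PM(1)[OF \<beta> ka]])
 moreover have "q (PM \<beta> k ka) = (if ka = ka then tval \<beta> ?p ?p ka ?p else 0)"
 proof (rule q_eq[where b = "%nu. if nu = ka then tval \<beta> ?p ?p ka ?p else 0"])
  have "(\<integral>Z. lead \<beta> k ka Z \<partial>(ball_law \<beta> ?p :: (quat^'m^'m) measure)) = tval \<beta> ?p ?p ka ?p"
   using integral_lead[OF \<beta> ka, of ?p ?p] unfolding proj_law_self by simp
  thus "B.TT (PM \<beta> k ka) (dg x) = (\<Sum>nu\<in>parts ?p k. (if nu = ka then tval \<beta> ?p ?p ka ?p else 0) * PP k nu x)" for x
   using ka by (simp add: B.TT_eigen[OF ka] if_distrib[of "%x. x * _"] cong: if_cong)
 qed
 moreover have "tval \<beta> ?p ?p ka ?p > 0" using \<beta> ka by (intro tval_pos) (auto simp: parts_def exponents_def)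
 ultimately show False by simp
qed

text \<open>Comparing leading coefficients forces the eigenvalue to be \<open>rho\<close>, so each
  member is a multiple of \<open>PP\<close>; the prescribed sum and linear independence fix the
  multiples.\<close>

lemma jack_family_unique:
 assumes \<beta>: "\<beta> \<in> {1, 2, 4}" and C: "jack_family \<beta> CARD('m::finite) k C" and ka: "ka \<in> parts CARD('m) k"
 shows "C ka = (%x. p1coef \<beta> CARD('m) k ka * JP \<beta> CARD('m) k ka x)"
proof -
 let ?p = "CARD('m)"
 interpret jack_setting \<beta> ?p by (rule jack_setting[OF \<beta>])
 have mult: "C nu = (%x. cf ?p k (C nu) nu * PP k nu x)" if nu: "nu \<in> parts ?p k" for nu
 proof -
  have nu': "nu \<in> exponents ?p k" using nu parts_subset by blast
  obtain a \<mu> where a: "C nu = hom_poly ?p k a" "a nu ~= 0" "ALL al:exponents ?p k. a al ~= 0 --> dominated al nu"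
   and sym: "ALL \<pi> x. \<pi> permutes {..<?p} --> C nu (x \<circ> \<pi>) = C nu x"
   and eig: "!!x. inj_on x {..<?p} ==> jack_operator \<beta> ?p (C nu) x = \<mu> * C nu x"
   using C nu unfolding jack_family_def by metis
  have cfa: "al \<in> exponents ?p k ==> cf ?p k (C nu) al = a al" for al unfolding a(1) by (rule cf_hom_poly)
  have hpC: "hp ?p k (C nu)" unfolding a(1) by simp
  have dom: "domf ?p k nu (C nu)" unfolding domf_def using hpC a(3) cfa cf(2)[OF hpC] by metis
  have s: "symf ?p (C nu)" using sym by (simp add: symf_def)
  have J\<mu>: "J k (C nu) = (%x. \<mu> * C nu x)" by (rule J_unique[OF hpC s hp_scale[OF hpC] eig])
  obtain w where w: "generic ?p k w" using generic_exists by blast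
  have "cf ?p k (J k (C nu)) nu = rho \<beta> ?p nu * cf ?p k (C nu) nu"
  proof (rule J_support(2)[OF hpC s w _ nu' refl])
   fix al assume "al \<in> exponents ?p k" "cf ?p k (C nu) al ~= 0"
   thus "wt ?p w al <= wt ?p w nu"
    using a(3) cfa w nu' by (intro wt_dominated_le[where k = k]) (auto simp: generic_def dec_def le_less)
  qed
  hence "\<mu> = rho \<beta> ?p nu" using a(2) unfolding J\<mu> cf_scale[OF hpC] by (simp add: cfa[OF nu'])
  thus ?thesis using J\<mu> by (intro eigenfunction_unique[OF PP(1,2,4,3)[OF nu] dom s _ nu]) simp
 qed
 have "(\<Sum>nu\<in>parts ?p k. (cf ?p k (C nu) nu - p1coef \<beta> ?p k nu) * PP k nu x) = 0" for x
 proof -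
  have "(\<Sum>nu\<in>parts ?p k. cf ?p k (C nu) nu * PP k nu x) = (\<Sum>nu\<in>parts ?p k. C nu x)"
   by (rule sum.cong) (use fun_cong[OF mult] in auto)
  thus ?thesis using C by (simp add: jack_family_def left_diff_distrib sum_subtractf p1coef[OF \<beta>])
 qed
 hence "cf ?p k (C ka) ka - p1coef \<beta> ?p k ka = 0" by (rule PP_independent[OF _ ka])
 thus ?thesis using mult[OF ka] by simp
qed

lemma jack_family_p1coef:
 assumes \<beta>: "\<beta> \<in> {1, 2, 4}"
 shows "jack_family \<beta> CARD('m::finite) k (%ka x. p1coef \<beta> CARD('m) k ka * JP \<beta> CARD('m) k ka x)"
proof -
 let ?p = "CARD('m)"
 interpret jack_setting \<beta> ?p by (rule jack_setting[OF \<beta>])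
 let ?C = "%ka x. p1coef \<beta> ?p k ka * PP k ka x"
 have "(EX a. ?C ka = hom_poly ?p k a & a ka ~= 0 & (ALL al:exponents ?p k. a al ~= 0 --> dominated al ka))
   & (ALL \<pi> x. \<pi> permutes {..<?p} --> ?C ka (x \<circ> \<pi>) = ?C ka x)
   & (EX \<mu>. ALL x. inj_on x {..<?p} --> jack_operator \<beta> ?p (?C ka) x = \<mu> * ?C ka x)"
  if ka: "ka \<in> parts ?p k" for ka
 proof -
  have d: "domf ?p k ka (?C ka)" "hp ?p k (?C ka)" "symf ?p (?C ka)"
   using domf_scale[OF PP(1)[OF ka]] hp_scale[OF PP(5)[OF ka]] symf_scale[OF PP(2)[OF ka]] by blast+
  have "cf ?p k (?C ka) ka ~= 0" using p1coef_nonzero[OF \<beta> ka] by (simp add: cf_scale[OF PP(5)[OF ka]] PP(3)[OF ka])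
  moreover have "jack_operator \<beta> ?p (?C ka) x = rho \<beta> ?p ka * ?C ka x" if "inj_on x {..<?p}" for x
  proof -
   \<comment> \<open>Homogeneity of \<open>J\<close> is extracted from \<open>J_add\<close> with a
     zero first summand.\<close>
   have "J k (%x. 0 * PP k ka x + p1coef \<beta> ?p k ka * PP k ka x) = (%x. J k (%x. 0 * PP k ka x) x + p1coef \<beta> ?p k ka * J k (PP k ka) x)"
    by (rule J_add[OF hp_scale[OF PP(5)[OF ka]] symf_scale[OF PP(2)[OF ka]] PP(5,2)[OF ka]])
   thus ?thesis
    using J_add[OF hp_zero _ hp_zero, of k "- 1"] J(3)[OF d(2,3) that] by (simp add: symf_def PP(4)[OF ka])
  qed
  ultimately show ?thesis using d cf(1)[OF d(2)] unfolding domf_def symf_def by blast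
 qed
 thus ?thesis unfolding jack_family_def using p1coef[OF \<beta>, where 'm = 'm] by simp
qed

lemma jack_eqI:
 assumes \<beta>: "\<beta> \<in> {1, 2, 4}" and C: "jack_family \<beta> CARD('m::finite) k C" and ka: "ka \<in> parts CARD('m) k"
 shows "jack \<beta> CARD('m) ka = C ka"
proof -
 have k: "(\<Sum>i<CARD('m). ka i) = k" using ka by (simp add: parts_def exponents_def)
 show ?thesis using jack_family_unique[OF \<beta> _ ka] C unfolding jack_def k by force
qed

lemma jack_eq:
 assumes "\<beta> \<in> {1, 2, 4}" "ka \<in> parts CARD('m::finite) k"
 shows "jack \<beta> CARD('m) ka x = p1coef \<beta> CARD('m) k ka * JP \<beta> CARD('m) k ka x"
 using jack_eqI[OF assms(1) jack_family_p1coef[OF assms(1)] assms(2)] by simp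

definition ct :: "nat => (nat => real) => nat => real" where
 "ct n x = (%i. if i < n then x i else 0)"

lemma exponents_mono: "n <= m ==> exponents n k \<subseteq> exponents m k"
proof
 fix al assume "n <= m" "al \<in> exponents n k"
 moreover from this have "(\<Sum>i<m. al i) = (\<Sum>i<n. al i)" by (intro sum.mono_neutral_right) (auto simp: exponents_def)
 ultimately show "al \<in> exponents m k" by (auto simp: exponents_def)
qed

lemma exponents_restrict:
 assumes "n <= m" "al \<in> exponents m k" "!!i. n <= i ==> i < m ==> al i = 0"
 shows "al \<in> exponents n k"
proof -
 have "(\<Sum>i<m. al i) = (\<Sum>i<n. al i)" using assms by (intro sum.mono_neutral_right) auto
 thus ?thesis using assms(2,3) unfolding exponents_def by (auto) (metis not_less)
qed

lemma sum_ct: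
 assumes n: "n <= m"
 shows "(\<Sum>al\<in>exponents m k. g al * mon m al (ct n x)) = (\<Sum>al\<in>exponents n k. g al * mon n al x)"
proof -
 have "(\<Sum>al\<in>exponents m k. g al * mon m al (ct n x)) = (\<Sum>al\<in>exponents n k. g al * mon m al (ct n x))"
 proof (rule sum.mono_neutral_right)
  show "ALL al:exponents m k - exponents n k. g al * mon m al (ct n x) = 0"
  proof
   fix al assume "al \<in> exponents m k - exponents n k"
   then obtain i where "n <= i" "i < m" "al i ~= 0" using exponents_restrict[OF n, of al k] by blast
   thus "g al * mon m al (ct n x) = 0" unfolding mon_def ct_def by (auto intro!: bexI[of _ i])
  qed
 qed (simp_all add: exponents_mono[OF n])
 also have "... = (\<Sum>al\<in>exponents n k. g al * mon n al x)"
 proof (rule sum.cong)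
  fix al assume "al \<in> exponents n k"
  hence "mon m al (ct n x) = (\<Prod>i<n. ct n x i ^ al i)"
   unfolding mon_def using n by (intro prod.mono_neutral_right) (auto simp: exponents_def)
  thus "g al * mon m al (ct n x) = g al * mon n al x" by (simp add: mon_def ct_def)
 qed simp
 finally show ?thesis .
qed

lemma hom_poly_ct: "n <= m ==> hom_poly m k a (ct n x) = hom_poly n k a x"
 unfolding hom_poly_mon by (rule sum_ct)

text \<open>The last variable e tends to 0 in the eigenvalue equation. Pairs (i, p) contribute the
  Euler sum in the remaining variables, which is k f, and pairs (p, j) vanish in the limit; so the
  eigenvalue drops by \<beta> k.\<close>

lemma jack_cut_step:
 assumes f: "hp (Suc p) k f" and eig: "!!x. inj_on x {..<Suc p} ==> jack_operator \<beta> (Suc p) f x = \<mu> * f x"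
  and x: "inj_on x {..<p}"
 shows "jack_operator \<beta> p (%x. f (ct p x)) x = (\<mu> - real \<beta> * real k) * f (ct p x)"
proof -
 let ?a = "cf (Suc p) k f" and ?f = "%x. f (ct p x)"
 define y where "y e = (ct p x)(p := e)" for e
 have y: "y e i = x i" if "i < p" for e i using that by (simp add: y_def ct_def)
 have fa: "f = hom_poly (Suc p) k ?a" by (rule cf(1)[OF f])
 have fct: "?f = hom_poly p k ?a" by (rule ext, subst fa) (simp add: hom_poly_ct)
 have hpf: "hp p k ?f" unfolding fct by simp
 have cfct: "cf p k ?f al = ?a al" if "al \<in> exponents p k" for al unfolding fct by (rule cf_hom_poly[OF that])
 have T: "((%e. \<Sum>al\<in>exponents (Suc p) k. g al * mon (Suc p) al (y e)) \<longlongrightarrow> (\<Sum>al\<in>exponents p k. g al * mon p al x)) (at 0)" for g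
 proof -
  have "((%e. \<Sum>al\<in>exponents (Suc p) k. g al * mon (Suc p) al (y e)) \<longlongrightarrow>
    (\<Sum>al\<in>exponents (Suc p) k. g al * mon (Suc p) al (y 0))) (at 0)"
   unfolding mon_def y_def by (intro tendsto_sum tendsto_mult tendsto_prod tendsto_power) (auto intro: tendsto_eq_intros)
  moreover have "y 0 = ct p x" by (auto simp: y_def ct_def)
  ultimately show ?thesis using sum_ct[where n = p and m = "Suc p" and g = g and k = k and x = x] by simp
 qed
 have th: "((%e. th (Suc p) k f i (y e)) \<longlongrightarrow> th p k ?f i x) (at 0)"
  "((%e. th2 (Suc p) k f i (y e)) \<longlongrightarrow> th2 p k ?f i x) (at 0)" for i
  using T[of "%al. ?a al * real (al i)"] T[of "%al. ?a al * (real (al i) * (real (al i) - 1))"]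
  by (simp_all add: th_def th2_def cfct cong: sum.cong)
 have p0: "th p k ?f p x = 0" "th2 p k ?f p x = 0" by (simp_all add: th_def th2_def exponents_def)
 \<comment> \<open>For x_i = 0 both sides are 0, because the Euler operator carries a factor
   x_i.\<close>
 have l1: "((%e. x i / (x i - e) * th (Suc p) k f i (y e)) \<longlongrightarrow> th p k ?f i x) (at 0)" if i: "i < p" for i
 proof (cases "x i = 0")
  case True
  thus ?thesis using euler_partial(1)[OF hpf i, of x] by simp
 next
  case False
  have "((%e. x i / (x i - e) * th (Suc p) k f i (y e)) \<longlongrightarrow> x i / (x i - 0) * th p k ?f i x) (at 0)"
   using False by (intro tendsto_mult th tendsto_divide tendsto_diff tendsto_const tendsto_ident_at) simp
  thus ?thesis using False by simp
 qed
 \<comment> \<open>For x_j = 0 the quotient is constantly 1; the limit is still 0, since exponents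
   of p variables vanish at index p.\<close>
 have l2: "((%e. e / (e - x j) * th (Suc p) k f p (y e)) \<longlongrightarrow> 0) (at 0)" for j
 proof (cases "x j = 0")
  case True
  have "\<forall>\<^sub>F e in at 0. th (Suc p) k f p (y e) = e / (e - x j) * th (Suc p) k f p (y e)"
   using True by (auto simp: eventually_at intro!: exI[of _ 1])
  with th(1)[of p] show ?thesis unfolding p0 by (rule Lim_transform_eventually)
 next
  case False
  have "((%e. e / (e - x j) * th (Suc p) k f p (y e)) \<longlongrightarrow> 0 / (0 - x j) * th p k ?f p x) (at 0)"
   using False by (intro tendsto_mult th tendsto_divide tendsto_diff tendsto_const tendsto_ident_at) simp
  thus ?thesis by simp
 qed
 have split: "(\<Sum>i<Suc p. \<Sum>j\<in>{..<Suc p} - {i}. h i j) = (\<Sum>i<p. (\<Sum>j\<in>{..<p} - {i}. h i j) + h i p) + (\<Sum>j<p. h p j)"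
  for h :: "nat => nat => real"
 proof -
  have "{..<Suc p} - {i} = insert p ({..<p} - {i})" if "i < p" for i using that by auto
  moreover have "{..<Suc p} - {p} = {..<p}" by auto
  ultimately show ?thesis by (simp add: add.commute)
 qed
 have op: "jack_operator \<beta> (Suc p) f (y e) = (\<Sum>i<p. th2 (Suc p) k f i (y e)) + th2 (Suc p) k f p (y e)
   + real \<beta> * ((\<Sum>i<p. (\<Sum>j\<in>{..<p} - {i}. x i / (x i - x j) * th (Suc p) k f i (y e)) + x i / (x i - e) * th (Suc p) k f i (y e))
    + (\<Sum>j<p. e / (e - x j) * th (Suc p) k f p (y e)))" for e
 proof -
  have "y e p = e" by (simp add: y_def)
  thus ?thesis unfolding jack_operator_eq[OF f] split by (simp add: y cong: sum.cong_simp)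
 qed
 have "((%e. jack_operator \<beta> (Suc p) f (y e)) \<longlongrightarrow> (\<Sum>i<p. th2 p k ?f i x) + 0
   + real \<beta> * ((\<Sum>i<p. (\<Sum>j\<in>{..<p} - {i}. x i / (x i - x j) * th p k ?f i x) + th p k ?f i x) + (\<Sum>j<p. 0))) (at 0)"
  unfolding op using th(2)[of p]
  by (intro tendsto_add tendsto_sum tendsto_mult tendsto_const th l1 l2) (simp_all add: p0)
 moreover have "(\<Sum>i<p. th2 p k ?f i x) + 0
   + real \<beta> * ((\<Sum>i<p. (\<Sum>j\<in>{..<p} - {i}. x i / (x i - x j) * th p k ?f i x) + th p k ?f i x) + (\<Sum>j<p. 0))
   = jack_operator \<beta> p ?f x + real \<beta> * (real k * ?f x)"
  unfolding jack_operator_eq[OF hpf] sum_th[OF hpf, symmetric] by (simp add: sum.distrib algebra_simps)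
 moreover have "((%e. jack_operator \<beta> (Suc p) f (y e)) \<longlongrightarrow> \<mu> * ?f x) (at 0)"
 proof -
  have "open (- (x ` {..<p} - {0}))" by (intro open_Compl finite_imp_closed) simp
  hence "\<forall>\<^sub>F e in at 0. e \<in> - (x ` {..<p} - {0}) & e ~= 0"
   by (intro eventually_conj eventually_at_in_open' eventually_neq_at_within) simp_all
  hence "\<forall>\<^sub>F e in at 0. \<mu> * f (y e) = jack_operator \<beta> (Suc p) f (y e)"
  proof eventually_elim
   case (elim e)
   hence "inj_on (y e) {..<Suc p}" using x y[of _ e] by (auto simp: inj_on_def y_def image_iff)
   thus ?case using eig by simp
  qed
  moreover have "((%e. \<mu> * f (y e)) \<longlongrightarrow> \<mu> * ?f x) (at 0)"
  proof -
   have fy: "f (y e) = (\<Sum>al\<in>exponents (Suc p) k. ?a al * mon (Suc p) al (y e))" for e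
    by (subst fa) (rule hom_poly_mon)
   have fc: "f (ct p x) = (\<Sum>al\<in>exponents p k. ?a al * mon p al x)"
    using fun_cong[OF fct, of x] by (simp add: hom_poly_mon)
   show ?thesis unfolding fy fc by (intro tendsto_mult tendsto_const T)
  qed
  ultimately show ?thesis by (rule Lim_transform_eventually[rotated])
 qed
 ultimately have "\<mu> * ?f x = jack_operator \<beta> p ?f x + real \<beta> * (real k * ?f x)"
  using tendsto_unique[of "at (0::real)"] by fastforce
 thus ?thesis by (simp add: algebra_simps)
qed

lemma jack_cut:
 assumes f: "hp m k f" and eig: "!!x. inj_on x {..<m} ==> jack_operator \<beta> m f x = \<mu> * f x" and "n <= m"
 shows "EX \<mu>'. ALL x. inj_on x {..<n} --> jack_operator \<beta> n (%x. f (ct n x)) x = \<mu>' * f (ct n x)"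
 using \<open>n <= m\<close>
proof (induction rule: inc_induct)
 case base
 have "f (ct m x) = f x" for x by (rule hp_depends[OF f]) (simp add: ct_def)
 thus ?case using eig by auto
next
 case (step n)
 let ?g = "%x. f (ct (Suc n) x)"
 obtain \<mu>' where "!!x. inj_on x {..<Suc n} ==> jack_operator \<beta> (Suc n) ?g x = \<mu>' * ?g x" using step.IH by blast
 moreover have "hp (Suc n) k ?g"
  unfolding hp_def using cf(1)[OF f] hom_poly_ct[of "Suc n" m k "cf m k f"] step.hyps by (intro exI[of _ "cf m k f"]) (metis Suc_leI ext)
 ultimately have "ALL x. inj_on x {..<n} --> jack_operator \<beta> n (%x. ?g (ct n x)) x = (\<mu>' - real \<beta> * real k) * ?g (ct n x)"
  using jack_cut_step[of n k ?g \<beta> \<mu>'] by blast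
 moreover have "ct (Suc n) (ct n x) = ct n x" for x by (auto simp: ct_def)
 ultimately show ?case by auto
qed

lemma parts_mono: "n <= m ==> parts n k \<subseteq> parts m k"
 using exponents_mono by (auto simp: parts_def)

text \<open>Setting the last variables to 0 turns a family in m variables into one in n variables:
  for partitions with more than n parts every exponent of the support involves a later variable, so
  the polynomial vanishes. Uniqueness of the family identifies the two.\<close>

lemma jack_stability:
 assumes \<beta>: "\<beta> \<in> {1, 2, 4}" and n: "CARD('n::finite) <= CARD('m::finite)" and ka: "ka \<in> parts CARD('n) k"
 shows "jack \<beta> CARD('n) ka x = jack \<beta> CARD('m) ka (ct CARD('n) x)"
proof -
 let ?m = "CARD('m)" and ?n = "CARD('n)"
 define C where "C ka x = p1coef \<beta> ?m k ka * JP \<beta> ?m k ka x" for ka x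
 have fam: "jack_family \<beta> ?m k C" using jack_family_p1coef[OF \<beta>, where 'm = 'm] by (simp add: C_def[abs_def])
 have fam': "(EX a. C nu = hom_poly ?m k a & a nu ~= 0 & (ALL al:exponents ?m k. a al ~= 0 --> dominated al nu))"
  "!!\<pi> x. \<pi> permutes {..<?m} ==> C nu (x \<circ> \<pi>) = C nu x"
  "EX \<mu>. ALL x. inj_on x {..<?m} --> jack_operator \<beta> ?m (C nu) x = \<mu> * C nu x" if "nu \<in> parts ?m k" for nu
  using fam that unfolding jack_family_def by blast+
 have "jack_family \<beta> ?n k (%ka x. C ka (ct ?n x))" unfolding jack_family_def
 proof (intro conjI ballI allI impI)
  fix nu assume \<nu>n: "nu \<in> parts ?n k"
  hence nu: "nu \<in> parts ?m k" using parts_mono[OF n] by blast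
  obtain a where a: "C nu = hom_poly ?m k a" "a nu ~= 0" "ALL al:exponents ?m k. a al ~= 0 --> dominated al nu"
   using fam'(1)[OF nu] by blast
  show "EX a. (%x. C nu (ct ?n x)) = hom_poly ?n k a & a nu ~= 0 & (ALL al:exponents ?n k. a al ~= 0 --> dominated al nu)"
   using a exponents_mono[OF n] by (intro exI[of _ a]) (auto simp: hom_poly_ct[OF n])
  show "EX \<mu>. ALL x. inj_on x {..<?n} --> jack_operator \<beta> ?n (%x. C nu (ct ?n x)) x = \<mu> * C nu (ct ?n x)"
  proof -
   obtain \<mu> where "!!x. inj_on x {..<?m} ==> jack_operator \<beta> ?m (C nu) x = \<mu> * C nu x" using fam'(3)[OF nu] by blast
   moreover have "hp ?m k (C nu)" by (simp add: a(1))
   ultimately show ?thesis using n by (intro jack_cut)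
  qed
  fix \<pi> x assume \<pi>: "\<pi> permutes {..<?n}"
  hence "\<pi> permutes {..<?m}" by (rule permutes_subset) (use n in auto)
  moreover have "\<pi> i < ?n \<longleftrightarrow> i < ?n" for i using permutes_in_image[OF \<pi>, of i] by simp
  hence "ct ?n (x \<circ> \<pi>) = ct ?n x \<circ> \<pi>" by (simp add: ct_def fun_eq_iff)
  ultimately show "C nu (ct ?n (x \<circ> \<pi>)) = C nu (ct ?n x)" using fam'(2)[OF nu] by simp
 next
  fix x
  have "C nu (ct ?n x) = 0" if nu: "nu \<in> parts ?m k" "nu \<notin> parts ?n k" for nu
  proof -
   obtain a where a: "C nu = hom_poly ?m k a" "ALL al:exponents ?m k. a al ~= 0 --> dominated al nu"
    using fam'(1)[OF nu(1)] by blast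
   have "a al = 0" if al: "al \<in> exponents ?n k" for al
   proof (rule ccontr)
    assume "a al ~= 0"
    hence "k <= (\<Sum>i<?n. nu i)" using a(2) al exponents_mono[OF n] unfolding dominated_def exponents_def by auto
    moreover have "(\<Sum>i<?m. nu i) = (\<Sum>i<?n. nu i) + (\<Sum>i\<in>{?n..<?m}. nu i)"
     using n sum.atLeastLessThan_concat[of 0 ?n ?m nu] by (simp add: atLeast0LessThan)
    moreover have "(\<Sum>i<?m. nu i) = k" using nu(1) by (simp add: parts_def exponents_def)
    ultimately have "!!i. ?n <= i ==> i < ?m ==> nu i = 0" by simp
    hence "nu \<in> exponents ?n k" using nu(1) by (intro exponents_restrict[OF n]) (auto simp: parts_def)
    thus False using nu by (simp add: parts_def)
   qed
   thus ?thesis unfolding a(1) hom_poly_ct[OF n] by (simp add: hom_poly_def)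
  qed
  hence "(\<Sum>ka\<in>parts ?n k. C ka (ct ?n x)) = (\<Sum>ka\<in>parts ?m k. C ka (ct ?n x))"
   using parts_mono[OF n] by (intro sum.mono_neutral_left) auto
  also have "... = (\<Sum>i<?m. ct ?n x i) ^ k" using fam by (simp add: jack_family_def)
  also have "(\<Sum>i<?m. ct ?n x i) = (\<Sum>i<?n. x i)" using n by (intro sum.mono_neutral_cong_right) (auto simp: ct_def)
  finally show "(\<Sum>ka\<in>parts ?n k. C ka (ct ?n x)) = (\<Sum>i<?n. x i) ^ k" .
 qed
 from jack_eqI[OF \<beta> this ka] have "jack \<beta> ?n ka x = jack \<beta> ?m ka (ct ?n x)"
  using jack_eq[OF \<beta> subsetD[OF parts_mono[OF n] ka], of "ct ?n x"] by (simp add: C_def)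
 thus ?thesis .
qed

lemma opb_adjoint: "opb (adj X :: quat^'m^'m) \<longleftrightarrow> opb X"
proof -
 have *: "opb (adj X)" if X: "opb X" for X :: "quat^'m^'m" unfolding opb_def
 proof (intro allI impI)
  fix v :: "quat^'m" assume v: "v ~= 0"
  let ?w = "adj X *v v"
  show "norm ?w < norm v"
  proof (cases "?w = 0")
   case False
   have "norm ?w * norm ?w = (X *v ?w) \<bullet> v"
    using inner_adjoint[of "adj X" v ?w] by (simp add: dot_square_norm power2_eq_square inner_commute)
   also have "... <= norm (X *v ?w) * norm v" by (rule norm_cauchy_schwarz)
   also have "... < norm ?w * norm v" using X False by (intro mult_strict_right_mono) (auto simp: opb_def)
   finally show ?thesis using False by simp
  qed (use v in simp)
 qed
 show ?thesis using *[of X] *[of "adj X"] by auto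
qed

lemma norm_adjoint: "norm (adj X) = norm (X :: quat^'m^'m)"
 by (simp add: norm_eq_sqrt_inner inner_mat) (subst qRe_trace_commute, rule refl)

text \<open>The average of F at \<open>D ** adj Y ** I ** Y ** D\<close> over the square ball, with
  I the projection to the first M coordinates, is computed twice: directly, the law of Y D acts on
  I; with Y and its adjoint exchanged, the law of Y I acts on D D. At D = 1 the case M = m
  determines \<theta>, and M = N then gives the ratio.\<close>

lemma jack_one_ratio:
 fixes ka :: "nat => nat"
 defines "b \<equiv> %N :: nat. %l. if l < N then 1 else (0::real)"
 assumes \<beta>: "\<beta> \<in> {1, 2, 4}" and ka: "ka \<in> parts CARD('m::finite) k" and N: "0 < N" "N <= CARD('m)"
 shows "JP \<beta> CARD('m) k ka (b N) * tval \<beta> CARD('m) CARD('m) ka CARD('m) = tval \<beta> CARD('m) CARD('m) ka N * JP \<beta> CARD('m) k ka (%_. 1)"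
  "JP \<beta> CARD('m) k ka (%_. 1) ~= 0"
proof -
 let ?p = "CARD('m)" and ?F = "PM \<beta> k ka :: quat^'m^'m => real"
 interpret jack_setting \<beta> ?p by (rule jack_setting[OF \<beta>])
 note F = PM(1)[OF \<beta> ka]
 define \<theta> where "\<theta> d = (\<integral>Z. lead \<beta> k ka Z \<partial>proj_law \<beta> ?p (dg d :: quat^'m^'m))" for d
 have meas: "(%Z :: quat^'m^'m. ?F (adj Z ** A ** Z)) \<in> borel_measurable borel" for A
  by (rule borel_measurable_continuous_onI, rule continuous_on_compose2[OF hmp_continuous[OF psum_hmp[OF F]] _ subset_UNIV])
    (auto intro!: continuous_intros)
 have main: "PP k ka (b M) * \<theta> d = tval \<beta> ?p ?p ka M * PP k ka (%i. (d i)\<^sup>2)" if M: "0 < M" "M <= ?p" for M d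
 proof -
  let ?D = "dg d :: quat^'m^'m" and ?I = "dgP 0 M :: quat^'m^'m"
  interpret D: inv_law "proj_law \<beta> ?p ?D" \<beta> by (rule inv_law_proj[OF \<beta> _ order_refl]) simp_all
  interpret I: inv_law "proj_law \<beta> ?p ?I" \<beta> by (rule inv_law_proj[OF \<beta> _ order_refl]) simp_all
  have I: "?I = dg (b M)" "adj ?I = ?I" "?I ** ?I = ?I" "?D ** ?D = dg (%i. (d i)\<^sup>2)"
   by (auto simp: dgP_def b_def dg_mult_dg power2_eq_square intro!: dg_cong)
  have "PP k ka (b M) * \<theta> d = D.TT ?F ?I" unfolding I(1) D.TT_eigen[OF ka] \<theta>_def by simp
  also have "... = (\<integral>Y. ?F (adj (Y ** ?D) ** ?I ** (Y ** ?D)) \<partial>ball_law \<beta> ?p)"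
   unfolding D.TT_def by (rule integral_proj_law[OF meas])
  also have "... = (\<integral>Y. ?F (adj (adj Y ** ?I) ** (?D ** ?D) ** (adj Y ** ?I)) \<partial>ball_law \<beta> ?p)"
  proof (intro Bochner_Integration.integral_cong refl)
   fix Y :: "quat^'m^'m"
   have "?F (adj (Y ** ?D) ** ?I ** (Y ** ?D)) = ?F ((?D ** adj Y ** ?I) ** (?I ** Y ** ?D))"
    using I(3) by (simp add: adjoint_mult) (metis matrix_mul_assoc)
   also have "... = ?F ((?I ** Y ** ?D) ** (?D ** adj Y ** ?I))" by (rule psum_commute[OF F])
   finally show "?F (adj (Y ** ?D) ** ?I ** (Y ** ?D)) = ?F (adj (adj Y ** ?I) ** (?D ** ?D) ** (adj Y ** ?I))"
    by (simp only: adjoint_mult adjoint_adjoint I(2) matrix_mul_assoc)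
  qed
  also have "... = (\<integral>Y. ?F (adj (Y ** ?I) ** (?D ** ?D) ** (Y ** ?I)) \<partial>ball_law \<beta> ?p)"
  proof (rule ball_law_isometry[where g = adj])
   show "linear (adj :: quat^'m^'m => quat^'m^'m)" by (intro linearI) simp_all
   have [measurable]: "(%Z :: quat^'m^'m. ?F (adj Z ** (?D ** ?D) ** Z)) \<in> borel_measurable borel" by (rule meas)
   show "(%Y :: quat^'m^'m. ?F (adj (Y ** ?I) ** (?D ** ?D) ** (Y ** ?I))) \<in> borel_measurable borel" by measurable
  qed (auto simp: Fblk_def norm_adjoint opb_adjoint)
  also have "... = I.TT ?F (?D ** ?D)" unfolding I.TT_def by (rule integral_proj_law[OF meas, symmetric])
  also have "... = tval \<beta> ?p ?p ka M * PP k ka (%i. (d i)\<^sup>2)"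
   unfolding I(4) I.TT_eigen[OF ka] using integral_lead[OF \<beta> ka M(1,2) order_refl] by simp
  finally show ?thesis .
 qed
 have bp: "PP k ka (b ?p) = PP k ka (%_. 1)" by (rule hp_depends[OF PP(5)[OF ka]]) (simp add: b_def)
 have tp: "tval \<beta> ?p ?p ka ?p > 0" using \<beta> ka by (intro tval_pos) (auto simp: parts_def exponents_def)
 show nz: "PP k ka (%_. 1) ~= 0"
 proof
  \<comment> \<open>With M = m, a zero at the identity would make the right-hand side vanish for
    every D, so the polynomial would vanish at all positive points.\<close>
  assume 0: "PP k ka (%_. 1) = 0"
  have *: "PP k ka x = 0" if "!!i. 0 < x i" for x
   using main[of ?p "%i. sqrt (x i)"] that tp by (simp add: bp 0 less_imp_le)
  have "PP k ka = (%_. 0)" by (rule hp_eqI[OF PP(5)[OF ka] hp_zero]) (rule *)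
  thus False using cf_scale[OF PP(5)[OF ka], of 0 ka] PP(3)[OF ka] by simp
 qed
 show "PP k ka (b N) * tval \<beta> ?p ?p ka ?p = tval \<beta> ?p ?p ka N * PP k ka (%_. 1)"
  using main[of ?p "%_. 1"] nz main[OF N, of "%_. 1"] by (simp add: bp)
qed

lemma gen_pochhammer_eq:
 assumes "!!i. N <= i ==> ka i = 0"
 shows "gen_pochhammer \<beta> a ka = (\<Prod>s<N. pochhammer (a - real s / 2 * real \<beta>) (ka s))"
proof -
 have "i < N" if "ka i ~= 0" for i using assms that by (metis not_less)
 thus ?thesis unfolding gen_pochhammer_def by (intro prod.mono_neutral_left) auto
qed

lemma parts_zero: "ka \<in> parts n k ==> n <= i ==> ka i = 0"
 by (simp add: parts_def exponents_def)

lemma tval_eq: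
 assumes "ka \<in> parts N k"
 shows "tval \<beta> m n ka N = vol \<beta> m n * (gen_pochhammer \<beta> (real N * real \<beta> / 2) ka
  / gen_pochhammer \<beta> ((real n + real m - 1) * real \<beta> / 2 + 1) ka)"
proof -
 have e: "real \<beta> * (real N - real s) / 2 = real N * real \<beta> / 2 - real s / 2 * real \<beta>"
  "real \<beta> * (real n + real m - 1 - real s) / 2 + 1 = (real n + real m - 1) * real \<beta> / 2 + 1 - real s / 2 * real \<beta>" for s
  by (simp_all add: field_simps)
 have z: "ALL i. N <= i --> ka i = 0" using parts_zero[OF assms] by blast
 have g: "gen_pochhammer \<beta> a ka = (\<Prod>s<N. pochhammer (a - real s / 2 * real \<beta>) (ka s))" for a
  by (rule gen_pochhammer_eq) (use z in blast)
 show ?thesis unfolding g using z by (simp add: tval_def e prod_dividef)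
qed

text \<open>This is \<open>jack_one_ratio\<close> for N = n after stability: the volume, the
  denominators of \<open>tval\<close> and the factor \<open>p1coef\<close> are common to both
  sides.\<close>

lemma hyp1F1_term:
 fixes \<beta> k :: nat
 assumes \<beta>: "\<beta> \<in> {1, 2, 4}" and n: "CARD('n::finite) < CARD('m::finite)" and ka: "ka \<in> parts CARD('n) k"
 defines "m \<equiv> real CARD('m)" and "l \<equiv> real CARD('n)"
 shows "gen_pochhammer \<beta> (m * real \<beta> / 2) ka * jack_mat \<beta> ka (mat 1 :: quat^'n^'n)
  = gen_pochhammer \<beta> (l * real \<beta> / 2) ka * jack_mat \<beta> ka (mat 1 :: quat^'m^'m)"
  and "jack_mat \<beta> ka (mat 1 :: quat^'m^'m) ~= 0"
proof -
 have \<kappa>m: "ka \<in> parts CARD('m) k" using ka parts_mono[of "CARD('n)" "CARD('m)"] n by auto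
 have eig: "eigvals \<beta> (mat 1 :: quat^'x^'x) ! i = 1" if "i < CARD('x::finite)" for i
  using that eigv_dg[OF \<beta>, of "%_. 1" i, where 'm = 'x] hermitianI[of "mat 1 :: quat^'x^'x" \<beta>]
  by (simp add: eigvals_ev[OF \<beta>])
 have jm: "jack_mat \<beta> ka (mat 1 :: quat^'m^'m) = p1coef \<beta> CARD('m) k ka * JP \<beta> CARD('m) k ka (%_. 1)"
  unfolding jack_mat_def jack_eq[OF \<beta> \<kappa>m]
  by (intro arg_cong[where f = "(*) _"] hp_depends[OF jack_setting.PP(5)[OF jack_setting[OF \<beta>] \<kappa>m]]) (simp add: eig)
 have jn: "jack_mat \<beta> ka (mat 1 :: quat^'n^'n) = p1coef \<beta> CARD('m) k ka * JP \<beta> CARD('m) k ka (%i. if i < CARD('n) then 1 else 0)"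
  unfolding jack_mat_def jack_stability[where 'm = 'm, OF \<beta> less_imp_le[OF n] ka] jack_eq[OF \<beta> \<kappa>m]
  by (intro arg_cong[where f = "(*) _"] hp_depends[OF jack_setting.PP(5)[OF jack_setting[OF \<beta>] \<kappa>m]]) (simp add: eig ct_def)
 note r = jack_one_ratio[OF \<beta> \<kappa>m, of "CARD('n)"]
 show "jack_mat \<beta> ka (mat 1 :: quat^'m^'m) ~= 0" unfolding jm using p1coef_nonzero[OF \<beta> \<kappa>m] r(2) n by simp
 have "gen_pochhammer \<beta> ((m + m - 1) * real \<beta> / 2 + 1) ka ~= 0"
 proof -
  have "pochhammer ((m + m - 1) * real \<beta> / 2 + 1 - real s / 2 * real \<beta>) (ka s) > 0" if "s < CARD('m)" for s
  proof (rule pochhammer_pos)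
   have "0 <= real \<beta> * (m + m - 1 - real s) / 2" using that by (intro divide_nonneg_nonneg) (auto simp: m_def)
   thus "0 < (m + m - 1) * real \<beta> / 2 + 1 - real s / 2 * real \<beta>" by (simp add: field_simps)
  qed
  thus ?thesis
   using parts_zero[OF \<kappa>m] by (subst gen_pochhammer_eq[of "CARD('m)"]) (auto dest: less_imp_neq[THEN not_sym])
 qed
 thus "gen_pochhammer \<beta> (m * real \<beta> / 2) ka * jack_mat \<beta> ka (mat 1 :: quat^'n^'n)
  = gen_pochhammer \<beta> (l * real \<beta> / 2) ka * jack_mat \<beta> ka (mat 1 :: quat^'m^'m)"
  using r(1) n vol_pos[of \<beta> "CARD('m)" "CARD('m)"] unfolding jm jn tval_eq[OF \<kappa>m] tval_eq[OF ka] m_def l_def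
  by (simp add: field_simps)
qed

section \<open>From the ball integral to the distribution function of the Wishart matrix\<close>

section \<open>The distribution of the largest eigenvalue\<close>

lemma jack_mat_eq:
 fixes A :: "quat^'m^'m"
 assumes \<beta>: "\<beta> \<in> {1, 2, 4}" and A: "A \<in> hermitian \<beta>" and ka: "ka \<in> parts CARD('m) k"
 shows "jack_mat \<beta> ka A = p1coef \<beta> CARD('m) k ka * JP \<beta> CARD('m) k ka (eigv \<beta> A)"
 unfolding jack_mat_def jack_eq[OF \<beta> ka]
 by (intro arg_cong[where f = "(*) _"] hp_depends[OF jack_setting.PP(5)[OF jack_setting[OF \<beta>] ka]])
   (simp add: eigvals_ev[OF \<beta> A])

lemma ball_power_integral:
 fixes A :: "quat^'m^'m"
 assumes \<beta>: "\<beta> \<in> {1, 2, 4}" and n: "0 < n" "n <= CARD('m)" and A: "A \<in> hermitian \<beta>"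
 shows "(\<integral>Y. qtr (adj Y ** A ** Y) ^ k \<partial>ball_law \<beta> n) = (\<Sum>ka\<in>parts n k. vol \<beta> CARD('m) n *
  (gen_pochhammer \<beta> (real n * real \<beta> / 2) ka / gen_pochhammer \<beta> ((real n + real CARD('m) - 1) * real \<beta> / 2 + 1) ka) * jack_mat \<beta> ka A)"
proof -
 let ?m = "CARD('m)"
 interpret inv_law "ball_law \<beta> n :: (quat^'m^'m) measure" \<beta>
  using inv_law_proj[OF \<beta> n, of "dgP 0 n"] unfolding proj_law_self by simp
 have l: "(\<integral>Z. lead \<beta> k ka Z \<partial>(ball_law \<beta> n :: (quat^'m^'m) measure)) = tval \<beta> ?m n ka n" if "ka \<in> parts ?m k" for ka
  using integral_lead[OF \<beta> that n(1) order_refl n(2)] unfolding proj_law_self .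
 have "(\<integral>Y. qtr (adj Y ** A ** Y) ^ k \<partial>ball_law \<beta> n) = TT (%A. qtr A ^ k) (dg (eigv \<beta> A))"
  using invp_hermitian[OF \<beta> TT_invp[OF psum_hmp[OF psum_qtr]] A] by (simp add: TT_def)
 also have "... = (\<Sum>ka\<in>parts ?m k. tval \<beta> ?m n ka n * jack_mat \<beta> ka A)"
  unfolding TT_qtr by (intro sum.cong refl) (simp add: l jack_mat_eq[OF \<beta> A])
 also have "... = (\<Sum>ka\<in>parts n k. tval \<beta> ?m n ka n * jack_mat \<beta> ka A)"
 proof (rule sum.mono_neutral_right)
  show "ALL ka:parts ?m k - parts n k. tval \<beta> ?m n ka n * jack_mat \<beta> ka A = 0"
  proof
   fix ka assume ka: "ka \<in> parts ?m k - parts n k"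
   have "~ (ALL i. n <= i --> ka i = 0)"
   proof
    assume "ALL i. n <= i --> ka i = 0"
    hence "ka \<in> exponents n k" using ka by (intro exponents_restrict[OF n(2)]) (auto simp: parts_def)
    thus False using ka by (simp add: parts_def)
   qed
   thus "tval \<beta> ?m n ka n * jack_mat \<beta> ka A = 0" unfolding tval_def by auto
  qed
 qed (simp_all add: parts_mono[OF n(2)])
 finally show ?thesis by (simp add: tval_eq)
qed

text \<open>The trace form is bounded on the ball, so the exponential series is dominated termwise
  by a summable one and may be integrated term by term.\<close>

lemma ball_exp_integral:
 fixes A :: "quat^'m^'m"
 assumes \<beta>: "\<beta> \<in> {1, 2, 4}" and n: "0 < n" "n <= CARD('m)"
 defines "z \<equiv> %Y. qtr (adj Y ** A ** Y)"
 shows "(%k. (\<integral>Y. z Y ^ k \<partial>ball_law \<beta> n) / fact k) sums (\<integral>Y. exp (z Y) \<partial>ball_law \<beta> n)"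
  and "integrable (ball_law \<beta> n) (%Y. exp (z Y))"
proof -
 interpret inv_law "ball_law \<beta> n :: (quat^'m^'m) measure" \<beta>
  using inv_law_proj[OF \<beta> n, of "dgP 0 n"] unfolding proj_law_self by simp
 have cz: "continuous_on UNIV z"
  using continuous_congruence[OF psum_hmp[OF psum_qtr[of 1]], of A] by (simp add: z_def)
 show "integrable (ball_law \<beta> n) (%Y. exp (z Y))" by (intro integrable_cont continuous_on_exp cz)
 obtain K where K: "AE Z in (ball_law \<beta> n :: (quat^'m^'m) measure). Z \<in> Fmat \<beta> & norm Z <= K"
  using bound_norm by blast
 have "bounded (z ` cball 0 K)"
  by (intro compact_imp_bounded compact_continuous_image compact_cball continuous_on_subset[OF cz subset_UNIV])
 then obtain B where B: "ALL r:z ` cball 0 K. norm r <= B" unfolding bounded_iff by blast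
 have AE: "AE Y in ball_law \<beta> n. \<bar>z Y\<bar> <= B" using K by eventually_elim (use B in auto)
 let ?f = "%k Y. z Y ^ k / fact k" and ?v = "measure (ball_law \<beta> n :: (quat^'m^'m) measure) UNIV"
 have int: "integrable (ball_law \<beta> n) (?f k)" for k
  by (intro integrable_cont continuous_on_divide continuous_on_power cz continuous_on_const) simp
 have le: "(\<integral>Y. norm (?f k Y) \<partial>ball_law \<beta> n) <= ?v * (B ^ k / fact k)" for k
 proof -
  have "(\<integral>Y. norm (?f k Y) \<partial>ball_law \<beta> n) <= (\<integral>Y. B ^ k / fact k \<partial>(ball_law \<beta> n :: (quat^'m^'m) measure))"
  proof (rule integral_mono_AE[OF integrable_norm[OF int] integrable_const])
   show "AE Y in ball_law \<beta> n. norm (?f k Y) <= B ^ k / fact k" using AE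
   proof eventually_elim
    case (elim Y)
    show ?case using power_mono[OF elim, of k] by (simp add: divide_right_mono power_abs)
   qed
  qed
  thus ?thesis by simp
 qed
 have "summable (%k. ?v * (B ^ k / fact k))"
  by (intro summable_mult) (use summable_exp[of B] in \<open>simp add: divide_inverse mult.commute\<close>)
 hence "summable (%k. \<integral>Y. norm (?f k Y) \<partial>ball_law \<beta> n)"
  by (rule summable_comparison_test'[where N = 0]) (use le in simp)
 moreover have "summable (%k. norm (?f k Y))" for Y
  using summable_norm_exp[of "z Y"] by (simp add: divide_inverse mult.commute)
 ultimately have "(%k. \<integral>Y. ?f k Y \<partial>ball_law \<beta> n) sums (\<integral>Y. (\<Sum>k. ?f k Y) \<partial>ball_law \<beta> n)"
  using int by (intro sums_integral) auto
 moreover have "(\<Sum>k. ?f k Y) = exp (z Y)" for Y by (simp add: exp_def divide_inverse mult.commute)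
 ultimately show "(%k. (\<integral>Y. z Y ^ k \<partial>ball_law \<beta> n) / fact k) sums (\<integral>Y. exp (z Y) \<partial>ball_law \<beta> n)" by simp
qed

lemma ball_exp_hyp1F1:
 fixes A :: "quat^'m::finite^'m" and \<beta> :: nat
 assumes \<beta>: "\<beta> \<in> {1, 2, 4}" and n: "CARD('n::finite) < CARD('m)" and A: "A \<in> hermitian \<beta>"
 shows "(\<integral>Y. exp (qtr (adj Y ** A ** Y)) \<partial>ball_law \<beta> CARD('n)) = vol \<beta> CARD('m) CARD('n)
  * hyp1F1 \<beta> (real CARD('m) * real \<beta> / 2) ((real CARD('n) + real CARD('m) - 1) * real \<beta> / 2 + 1) A (mat 1 :: quat^'n^'n)"
proof -
 let ?m = "CARD('m)" and ?n = "CARD('n)"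
 let ?c = "(real ?n + real ?m - 1) * real \<beta> / 2 + 1"
 let ?t = "%k. \<Sum>ka\<in>parts ?n k. gen_pochhammer \<beta> (real ?m * real \<beta> / 2) ka / gen_pochhammer \<beta> ?c ka
  * (jack_mat \<beta> ka A * jack_mat \<beta> ka (mat 1 :: quat^'n^'n) / (fact k * jack_mat \<beta> ka (mat 1 :: quat^'m^'m)))"
 have "(\<integral>Y. qtr (adj Y ** A ** Y) ^ k \<partial>ball_law \<beta> ?n) / fact k = vol \<beta> ?m ?n * ?t k" for k
  unfolding ball_power_integral[OF \<beta> zero_less_card_finite less_imp_le[OF n] A] sum_divide_distrib sum_distrib_left
 proof (rule sum.cong)
  fix ka assume ka: "ka \<in> parts ?n k"
  note t = hyp1F1_term[OF \<beta> n ka]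
  have "gen_pochhammer \<beta> (real ?m * real \<beta> / 2) ka / gen_pochhammer \<beta> ?c ka
    * (jack_mat \<beta> ka A * jack_mat \<beta> ka (mat 1 :: quat^'n^'n) / (fact k * jack_mat \<beta> ka (mat 1 :: quat^'m^'m)))
   = (gen_pochhammer \<beta> (real ?m * real \<beta> / 2) ka * jack_mat \<beta> ka (mat 1 :: quat^'n^'n)) / gen_pochhammer \<beta> ?c ka
    * (jack_mat \<beta> ka A / (fact k * jack_mat \<beta> ka (mat 1 :: quat^'m^'m)))" by simp
  also have "... = gen_pochhammer \<beta> (real ?n * real \<beta> / 2) ka / gen_pochhammer \<beta> ?c ka * (jack_mat \<beta> ka A / fact k)"
   unfolding t(1) using t(2) by simp
  finally show "vol \<beta> ?m ?n * (gen_pochhammer \<beta> (real ?n * real \<beta> / 2) ka / gen_pochhammer \<beta> ?c ka) * jack_mat \<beta> ka A / fact k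
   = vol \<beta> ?m ?n * (gen_pochhammer \<beta> (real ?m * real \<beta> / 2) ka / gen_pochhammer \<beta> ?c ka
    * (jack_mat \<beta> ka A * jack_mat \<beta> ka (mat 1 :: quat^'n^'n) / (fact k * jack_mat \<beta> ka (mat 1 :: quat^'m^'m))))"
   by simp
 qed simp
 hence "(%k. vol \<beta> ?m ?n * ?t k) sums (\<integral>Y. exp (qtr (adj Y ** A ** Y)) \<partial>ball_law \<beta> ?n)"
  using ball_exp_integral(1)[OF \<beta> zero_less_card_finite less_imp_le[OF n], of A] by simp
 hence "(%k. vol \<beta> ?m ?n * ?t k / vol \<beta> ?m ?n) sums ((\<integral>Y. exp (qtr (adj Y ** A ** Y)) \<partial>ball_law \<beta> ?n) / vol \<beta> ?m ?n)"
  by (rule sums_divide)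
 thus ?thesis using vol_pos[of \<beta> ?m ?n] unfolding hyp1F1_def by (simp add: sums_iff)
qed

text \<open>\<open>opb\<close> tests all quaternion vectors, \<open>max_eigval_less_iff\<close> only
  those over the division algebra; diagonalization over the algebra shows that the eigenvalues
  control both. Passing to the adjoint turns the quadratic form of \<open>Z ** adj Z\<close> into a
  squared norm.\<close>

lemma opb_max_eigval:
 fixes Z :: "quat^'m^'m"
 assumes \<beta>: "\<beta> \<in> {1, 2, 4}" and Z: "Z \<in> Fmat \<beta>" and x: "x > 0"
 shows "max_eigval \<beta> (Z ** adj Z) < x \<longleftrightarrow> opb (Z /\<^sub>R sqrt x)"
proof -
 let ?A = "Z ** adj Z"
 have A: "?A \<in> hermitian \<beta>" by (rule hermitian_gram(2)[OF Z])
 have q: "v \<bullet> (?A *v v) = (norm (adj Z *v v))\<^sup>2" for v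
  by (simp add: inner_adjoint' power2_norm_eq_inner flip: matrix_vector_mul_assoc)
 have "opb (Z /\<^sub>R sqrt x) \<longleftrightarrow> opb (adj (Z /\<^sub>R sqrt x))" by (rule opb_adjoint[symmetric])
 also have "... \<longleftrightarrow> (ALL v. v ~= 0 --> v \<bullet> (?A *v v) < x * (norm v)\<^sup>2)"
 proof -
  have "norm (adj (Z /\<^sub>R sqrt x) *v v) < norm v \<longleftrightarrow> v \<bullet> (?A *v v) < x * (norm v)\<^sup>2" for v
  proof -
   have "norm (adj (Z /\<^sub>R sqrt x) *v v) < norm v \<longleftrightarrow> norm (adj Z *v v) < sqrt x * norm v"
    using x by (simp add: matrix_vector_distribs field_simps)
   also have "... \<longleftrightarrow> (norm (adj Z *v v))\<^sup>2 < (sqrt x * norm v)\<^sup>2"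
    using x by (metis less_le mult_nonneg_nonneg norm_ge_zero power2_less_imp_less power_strict_mono real_sqrt_ge_zero zero_less_numeral)
   finally show ?thesis using x by (simp add: q power_mult_distrib)
  qed
  thus ?thesis by (simp add: opb_def)
 qed
 also have "... \<longleftrightarrow> (ALL v:Fvec \<beta>. v ~= 0 --> v \<bullet> (?A *v v) < x * (norm v)\<^sup>2)"
 proof (intro iffI ballI allI impI)
  fix v :: "quat^'m" assume *: "ALL v:Fvec \<beta>. v ~= 0 --> v \<bullet> (?A *v v) < x * (norm v)\<^sup>2" and v: "v ~= 0"
  obtain U where U: "U \<in> unitary \<beta>" "?A = U ** dg (eigv \<beta> ?A) ** adj U" using eigv(2)[OF \<beta> A] by blast
  let ?u = "adj U *v v"
  have ev: "eigv \<beta> ?A i < x" if i: "i < CARD('m)" for i using eigv_quadratic[OF \<beta> A i] * by force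
  have u: "norm ?u = norm v" using U(1) by (intro unitary_norm) auto
  then obtain i where i: "?u $ i ~= 0" using v by (metis norm_eq_zero vec_eq_iff zero_index)
  have "v \<bullet> (?A *v v) = (\<Sum>i\<in>UNIV. eigv \<beta> ?A (ix i) * (norm (?u $ i))\<^sup>2)" by (rule quadratic_unitary[OF U(2)])
  also have "... < (\<Sum>i\<in>UNIV. x * (norm (?u $ i))\<^sup>2)"
  proof (rule sum_strict_mono_ex1)
   show "ALL i:UNIV. eigv \<beta> ?A (ix i) * (norm (?u $ i))\<^sup>2 <= x * (norm (?u $ i))\<^sup>2"
    by (intro ballI mult_right_mono less_imp_le[OF ev]) simp_all
   show "EX i:UNIV. eigv \<beta> ?A (ix i) * (norm (?u $ i))\<^sup>2 < x * (norm (?u $ i))\<^sup>2"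
    using i ev by (intro bexI[of _ i]) auto
  qed simp
  also have "... = x * (norm v)\<^sup>2" by (simp add: sum_distrib_left[symmetric] norm_vec_sq[symmetric] u)
  finally show "v \<bullet> (?A *v v) < x * (norm v)\<^sup>2" .
 qed blast
 finally show ?thesis unfolding max_eigval_less_iff[OF \<beta> A] by simp
qed

text \<open>Columns are matched through the two enumerations; the added zero columns do not change
  \<open>X ** adj X\<close>.\<close>

definition pad :: "quat^'n^'m => quat^'m^'m" where
 "pad Y = (\<chi> a b. if ix b < CARD('n) then Y $ a $ xi (ix b) else 0)"

lemma pad_gram:
 fixes Y :: "quat^'n::finite^'m::finite"
 assumes n: "CARD('n) <= CARD('m)"
 shows "pad Y ** adj (pad Y) = Y ** adj Y"
proof (rule mat_eqI)
 fix a b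
 let ?g = "%l. Y $ a $ xi l * qcnj (Y $ b $ xi l)"
 have "(pad Y ** adj (pad Y)) $ a $ b = (\<Sum>c\<in>(UNIV::'m set). if ix c < CARD('n) then ?g (ix c) else 0)"
  unfolding matrix_mult_nth by (intro sum.cong) (auto simp: pad_def)
 also have "... = (\<Sum>l<CARD('m). if l < CARD('n) then ?g l else 0)" by (rule sum_ix)
 also have "... = (\<Sum>l<CARD('n). ?g l)" using n by (intro sum.mono_neutral_cong_right) auto
 also have "... = (\<Sum>c\<in>(UNIV::'n set). ?g (ix c))" by (rule sum_ix[symmetric])
 finally show "(pad Y ** adj (pad Y)) $ a $ b = (Y ** adj Y) $ a $ b" by (simp add: matrix_mult_nth)
qed

text \<open>The units 1, i, j, k in the numbering of \<open>mat_of_coords\<close>.\<close>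

definition un :: "nat => quat" where
 "un l = Quat (if l = 0 then 1 else 0) (if l = 1 then 1 else 0) (if l = 2 then 1 else 0) (if l = 3 then 1 else 0)"

lemma un_bij: "\<beta> \<in> {1, 2, 4} ==> bij_betw un {..<\<beta>} (Basis \<inter> Falg \<beta>)"
proof -
 assume \<beta>: "\<beta> \<in> {1, 2, 4}"
 have un: "un 0 = Quat 1 0 0 0" "un 1 = Quat 0 1 0 0" "un 2 = Quat 0 0 1 0" "un 3 = Quat 0 0 0 1"
  by (simp_all add: un_def)
 have lt: "{..<1} = {0::nat}" "{..<2} = {0::nat, 1}" "{..<4} = {0::nat, 1, 2, 3}" by auto
 have "un ` {..<\<beta>} = Basis \<inter> Falg \<beta>"
  using \<beta> unfolding Basis_quat_Falg insert_iff by (elim disjE) (simp_all only: lt un image_insert Basis_quat_def empty_iff, simp_all)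
 moreover have "inj_on un {..<\<beta>}"
 proof (rule inj_onI)
  fix k l assume "k \<in> {..<\<beta>}" "l \<in> {..<\<beta>}" and eq: "un k = un l"
  thus "k = l" using \<beta> by (auto simp: un_def split: if_splits)
 qed
 ultimately show ?thesis by (simp add: bij_betw_def)
qed

lemma pad_coords:
 assumes \<beta>: "\<beta> \<in> {1, 2, 4}" and n: "CARD('n::finite) <= CARD('m::finite)"
 shows "pad (mat_of_coords \<beta> w :: quat^'n^'m) = (\<Sum>(i, j, l)\<in>UNIV \<times> UNIV \<times> {..<\<beta>}. w (i, j, l) *\<^sub>R el i (xi (ix j)) (un l))"
proof (rule mat_eqI)
 fix a b :: 'm
 let ?W = "mat_of_coords \<beta> w :: quat^'n^'m"
 have W: "?W $ i $ j = (\<Sum>l<\<beta>. w (i, j, l) *\<^sub>R un l)" for i j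
 proof -
  have "{..<1} = {0::nat}" "{..<2} = {0::nat, 1}" "{..<4} = {0::nat, 1, 2, 3}" by auto
  thus ?thesis using \<beta> by (elim insertE) (auto simp: mat_of_coords_def un_def quat_eq_iff)
 qed
 have "(\<Sum>(i, j, l)\<in>UNIV \<times> UNIV \<times> {..<\<beta>}. w (i, j, l) *\<^sub>R el i (xi (ix j)) (un l) :: quat^'m^'m)
   = (\<Sum>i\<in>UNIV. \<Sum>j\<in>(UNIV::'n set). \<Sum>l<\<beta>. w (i, j, l) *\<^sub>R el i (xi (ix j)) (un l))"
  by (simp add: sum.cartesian_product)
 hence "(\<Sum>(i, j, l)\<in>UNIV \<times> UNIV \<times> {..<\<beta>}. w (i, j, l) *\<^sub>R el i (xi (ix j)) (un l) :: quat^'m^'m) $ a $ b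
   = (\<Sum>i\<in>UNIV. \<Sum>j\<in>(UNIV::'n set). if a = i then (if b = xi (ix j) then ?W $ a $ j else 0) else 0)"
  unfolding W by (auto simp: el_nth intro!: sum.cong)
 also have "... = (\<Sum>j\<in>UNIV. \<Sum>i\<in>UNIV. if a = i then (if b = xi (ix j) then ?W $ a $ j else 0) else 0)"
  by (rule sum.swap)
 also have "... = (\<Sum>j\<in>UNIV. if b = xi (ix j) then ?W $ a $ j else 0)" by simp
 also have "... = pad ?W $ a $ b"
 proof -
  have ixj: "ix (xi (ix j) :: 'm) = ix j" for j :: 'n using n ix_less[of j] by (intro ix_xi) linarith
  have "b = xi (ix j) \<longleftrightarrow> ix b < CARD('n) & j = xi (ix b)" for j :: 'n using ixj[of j] by auto
  thus ?thesis by (simp add: pad_def)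
 qed
 finally show "pad ?W $ a $ b = (\<Sum>(i, j, l)\<in>UNIV \<times> UNIV \<times> {..<\<beta>}. w (i, j, l) *\<^sub>R el i (xi (ix j)) (un l)) $ a $ b"
  by simp
qed

lemma pad_measurable: "(pad :: quat^'n^'m => quat^'m^'m) \<in> borel_measurable borel"
proof -
 have "continuous_on UNIV (%Y :: quat^'n^'m. if ix b < CARD('n) then Y $ a $ xi (ix b) else 0)" for a and b :: 'm
  by (cases "ix b < CARD('n)") (auto intro!: continuous_intros)
 thus ?thesis unfolding pad_def[abs_def] by (intro borel_measurable_continuous_onI continuous_on_vec_lambda)
qed

text \<open>The coordinates of \<open>lebesgue_Fmat\<close>, carried over by \<open>pad\<close>,
  belong to the orthonormal basis of the block under another indexing; \<open>leb_unique\<close>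
  identifies the measures.\<close>

lemma nn_integral_lebesgue_Fmat:
 fixes g :: "quat^'m::finite^'m => ennreal"
 assumes \<beta>: "\<beta> \<in> {1, 2, 4}" and n: "CARD('n::finite) <= CARD('m)" and g[measurable]: "g \<in> borel_measurable borel"
 shows "(\<integral>\<^sup>+Y. g (pad Y) \<partial>(lebesgue_Fmat \<beta> :: (quat^'n^'m) measure)) = (\<integral>\<^sup>+Z. g Z \<partial>LB \<beta> UNIV {b. ix b < CARD('n)})"
proof -
 note [measurable] = pad_measurable[where 'n = 'n and 'm = 'm]
 let ?I = "UNIV \<times> UNIV \<times> {..<\<beta>} :: ('m \<times> 'n \<times> nat) set" and ?C = "{b::'m. ix b < CARD('n)}"
 let ?e = "%(i, j, q). el i j q :: quat^'m^'m"
 define \<phi> where "\<phi> = (%(i::'m, j::'n, l). (i, xi (ix j) :: 'm, un l))"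
 define e where "e = ?e \<circ> \<phi>"
 have ixj: "ix (xi (ix j) :: 'm) = ix j" for j :: 'n using n ix_less[of j] by (intro ix_xi) linarith
 have inj: "inj_on \<phi> ?I"
 proof (rule inj_onI)
  fix s t assume st: "s \<in> ?I" "t \<in> ?I" and eq: "\<phi> s = \<phi> t"
  obtain i j l i' j' l' where s: "s = (i, j, l)" and t: "t = (i', j', l')" by (metis prod_cases3)
  have "l = l'" using eq st un_bij[OF \<beta>] by (simp add: \<phi>_def s t bij_betw_def inj_on_def)
  moreover have "ix (xi (ix j) :: 'm) = ix (xi (ix j') :: 'm)" using eq by (simp add: \<phi>_def s t)
  hence "j = j'" unfolding ixj by simp
  ultimately show "s = t" using eq by (simp add: \<phi>_def s t)
 qed
 have img: "\<phi> ` ?I = BB \<beta> UNIV ?C"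
 proof -
  have "(%j::'n. xi (ix j) :: 'm) ` UNIV = ?C"
  proof (intro equalityI subsetI)
   fix b assume "b \<in> ?C"
   hence "b = xi (ix (xi (ix b) :: 'n))" by simp
   thus "b \<in> range (%j::'n. xi (ix j))" by (rule range_eqI)
  qed (auto simp: ixj)
  moreover have "\<phi> ` ?I = UNIV \<times> (%j::'n. xi (ix j) :: 'm) ` UNIV \<times> un ` {..<\<beta>}" unfolding \<phi>_def by force
  ultimately show ?thesis using un_bij[OF \<beta>] by (simp add: BB_def bij_betw_def)
 qed
 have o: "orth e ?I" unfolding orth_def
 proof (intro conjI ballI)
  fix s t assume "s \<in> ?I" "t \<in> ?I"
  note st = this
  have "\<phi> s \<in> BB \<beta> UNIV ?C" "\<phi> t \<in> BB \<beta> UNIV ?C" "\<phi> s = \<phi> t \<longleftrightarrow> s = t"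
   using imageI[OF st(1), of \<phi>] imageI[OF st(2), of \<phi>] inj_on_eq_iff[OF inj st] unfolding img .
  thus "e s \<bullet> e t = (if s = t then 1 else 0)"
   using orth_el[where \<beta> = \<beta> and R = UNIV and C = ?C] unfolding orth_def e_def by simp
 qed simp
 have sp: "span (e ` ?I) = span (?e ` BB \<beta> UNIV ?C)" unfolding e_def image_comp[symmetric] img ..
 have sum: "pad (mat_of_coords \<beta> w :: quat^'n^'m) = (\<Sum>s\<in>?I. w s *\<^sub>R e s)" for w
  unfolding pad_coords[OF \<beta> n] by (rule sum.cong) (auto simp: e_def \<phi>_def)
 have "(\<integral>\<^sup>+Y. g (pad Y) \<partial>(lebesgue_Fmat \<beta> :: (quat^'n^'m) measure))
   = (\<integral>\<^sup>+w. g (pad (mat_of_coords \<beta> w :: quat^'n^'m)) \<partial>PiM ?I (%_. lborel))" unfolding lebesgue_Fmat_def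
  by (rule nn_integral_distr[OF mat_of_coords_measurable[OF \<beta>]])
   (unfold measurable_distr_eq1, rule measurable_restrict_space1, measurable)
 also have "... = (\<integral>\<^sup>+Z. g Z \<partial>leb e ?I)" unfolding sum by (rule nn_integral_leb[symmetric]) simp
 also have "... = (\<integral>\<^sup>+Z. g Z \<partial>LB \<beta> UNIV ?C)" unfolding LB_def by (rule leb_unique[OF o orth_el sp g])
 finally show ?thesis .
qed

text \<open>\<open>matrix_inv\<close> is a choice, so a two-sided inverse has to be exhibited first;
  the reciprocal eigenvalues provide it.\<close>

lemma matrix_inv_pos_def:
 fixes \<Sigma> :: "quat^'m^'m"
 assumes \<beta>: "\<beta> \<in> {1, 2, 4}" and \<Sigma>: "\<Sigma> \<in> pos_def \<beta>"
 shows "matrix_inv \<Sigma> \<in> hermitian \<beta>"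
proof -
 have h: "\<Sigma> \<in> hermitian \<beta>" using \<Sigma> by (simp add: pos_def_def)
 obtain U where U: "U \<in> unitary \<beta>" "\<Sigma> = U ** dg (eigv \<beta> \<Sigma>) ** adj U" using eigv(2)[OF \<beta> h] by blast
 have pos: "0 < v \<bullet> (\<Sigma> *v v)" if "v \<in> Fvec \<beta>" "v ~= 0" for v
 proof -
  show ?thesis
   using \<Sigma> that by (simp add: inner_fin fin_def matrix_vector_nth sum_distrib_left mult.assoc pos_def_def)
 qed
 have "eigv \<beta> \<Sigma> i ~= 0" if "i < CARD('m)" for i
  using eigv_quadratic[OF \<beta> h that] pos by (metis less_irrefl norm_zero zero_neq_one)
 hence D: "dg (eigv \<beta> \<Sigma>) ** dg (%i. 1 / eigv \<beta> \<Sigma> i) = (mat 1 :: quat^'m^'m)"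
  unfolding dg_mult_dg dg_simps(2)[symmetric] by (intro dg_cong) simp
 define V where "V = U ** dg (%i. 1 / eigv \<beta> \<Sigma> i) ** adj U"
 have "\<Sigma> ** V = U ** dg (eigv \<beta> \<Sigma>) ** (adj U ** (U ** (dg (%i. 1 / eigv \<beta> \<Sigma> i) ** adj U)))"
  by (subst U(2)) (simp only: V_def matrix_mul_assoc)
 also have "... = U ** (dg (eigv \<beta> \<Sigma>) ** dg (%i. 1 / eigv \<beta> \<Sigma> i)) ** adj U"
  unfolding unitary_cancel(1)[OF U(1)] by (simp only: matrix_mul_assoc)
 finally have V: "\<Sigma> ** V = mat 1" "V ** \<Sigma> = mat 1"
  using unitary_D(3)[OF U(1)] left_inverse_imp_right_inverse by (auto simp: D)
 hence "\<Sigma> ** matrix_inv \<Sigma> = mat 1 & matrix_inv \<Sigma> ** \<Sigma> = mat 1"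
  unfolding matrix_inv_def by (intro someI[where P = "%V. \<Sigma> ** V = mat 1 & V ** \<Sigma> = mat 1"] conjI)
 hence "matrix_inv \<Sigma> = V" using V by (metis matrix_mul_assoc matrix_mul_rid)
 thus ?thesis using hermitian_congruence(2)[OF dg_simps(4) unitary_D(1)[OF U(1)]] by (simp add: V_def)
qed

text \<open>Cross-multiplied, both sides become the product of \<open>g\<close> over r < m +
  n.\<close>

lemma prod_shift_swap:
 fixes g :: "nat => real"
 assumes "!!r. g r ~= 0"
 shows "(\<Prod>r<m. g r / g (r + n)) = (\<Prod>r<n. g r / g (r + m))"
proof -
 have *: "(\<Prod>r<a. g r) * (\<Prod>r<b. g (r + a)) = (\<Prod>r<a + b. g r)" for a b
  by (induction b) (simp_all only: add_Suc_right mult.assoc[symmetric] add.commute[of a], simp_all)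
 have "(\<Prod>r<m. g r) * (\<Prod>r<n. g (r + m)) = (\<Prod>r<n. g r) * (\<Prod>r<m. g (r + n))" unfolding * by (simp add: add.commute)
 thus ?thesis
  using assms by (simp add: prod_dividef prod_zero_iff mult.commute) (simp add: field_simps prod_zero_iff)
qed

lemma vol_eq:
 assumes n: "0 < n"
 shows "vol \<beta> m n = pi powr (real m * real n * real \<beta> / 2) * mv_Gamma \<beta> n ((real n - 1) * real \<beta> / 2 + 1)
  / mv_Gamma \<beta> n ((real n + real m - 1) * real \<beta> / 2 + 1)"
proof -
 define g where "g r = Gamma (real (\<beta> * r) / 2 + 1)" for r
 have g0: "g r ~= 0" for r unfolding g_def by (intro less_imp_neq[THEN not_sym] Gamma_real_pos add_nonneg_pos) auto
 have "vol \<beta> m n = (\<Prod>r<m. pi powr (real (\<beta> * n) / 2) * (g r / g (r + n)))"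
  unfolding vol_def ball_const_def g_def by (intro prod.cong) (simp_all add: algebra_simps)
 also have "... = pi powr (real m * real n * real \<beta> / 2) * (\<Prod>r<m. g r / g (r + n))"
  unfolding prod.distrib by (simp add: powr_powr mult_ac flip: powr_realpow)
 \<comment> \<open>The volume is a product over m rows, \<open>mv_Gamma\<close> one over n factors;
   the exchange reconciles them.\<close>
 also have "(\<Prod>r<m. g r / g (r + n)) = (\<Prod>r<n. g r) / (\<Prod>r<n. g (r + m))"
  using prod_shift_swap[of g n m, OF g0] by (simp add: prod_dividef)
 also have "... = mv_Gamma \<beta> n ((real n - 1) * real \<beta> / 2 + 1) / mv_Gamma \<beta> n ((real n + real m - 1) * real \<beta> / 2 + 1)"
 proof -
  have "(\<Prod>i=1..n. Gamma ((real n + real a - 1) * real \<beta> / 2 + 1 - (real i - 1) * real \<beta> / 2)) = (\<Prod>r<n. g (r + a))" for a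
  \<comment> \<open>\<open>mv_Gamma\<close> lists its factors in reverse order: index i corresponds
    to r = n - i.\<close>
  proof (rule prod.reindex_bij_witness[where i = "%r. n - r" and j = "%i. n - i"])
   fix i assume "i \<in> {1..n}"
   hence "real (\<beta> * (n - i + a)) / 2 + 1 = (real n + real a - 1) * real \<beta> / 2 + 1 - (real i - 1) * real \<beta> / 2"
    by (simp add: field_simps)
   thus "g (n - i + a) = Gamma ((real n + real a - 1) * real \<beta> / 2 + 1 - (real i - 1) * real \<beta> / 2)"
    by (simp only: g_def)
  qed (use n in auto)
  from this[of 0] this[of m] show ?thesis unfolding mv_Gamma_def by simp
 qed
 finally show ?thesis by simp
qed

theorem theorem8:
  fixes M :: "'a measure"
    and W :: "'a \<Rightarrow> quat^'m^'m"
    and \<Sigma> :: "quat^'m^'m"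
    and \<beta> :: nat
    and x :: real
  assumes "prob_space M"
    and "\<beta> \<in> {1, 2, 4}"
    and "CARD('n::finite) < CARD('m::finite)"
    and "\<Sigma> \<in> pos_def \<beta>"
    and "wishart \<beta> TYPE('n) \<Sigma> M W"
    and "x > 0"
  shows "measure M {\<omega> \<in> space M. max_eigval \<beta> (W \<omega>) < x} =
    (let m = real CARD('m); n = real CARD('n); b = real \<beta> in
       mv_Gamma \<beta> CARD('n) ((n - 1) * b / 2 + 1) * (x * b / 2) powr (b * n * m / 2)
       / (mv_Gamma \<beta> CARD('n) ((n + m - 1) * b / 2 + 1) * hdet \<beta> \<Sigma> powr (n * b / 2))
       * hyp1F1 \<beta> (m * b / 2) ((n + m - 1) * b / 2 + 1)
           ((- (b / 2) * x) *\<^sub>R matrix_inv \<Sigma>) (mat 1 :: quat^'n^'n))"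
proof -
 note \<beta> = assms(2) and n = assms(3) and x = assms(6)
 let ?m = "CARD('m)" and ?n = "CARD('n)" and ?C = "{b::'m. ix b < CARD('n)}"
 \<comment> \<open>Includes the factor x that the substitution of \<open>sqrt x *\<^sub>R Z\<close>
   for Z pulls out of the exponent; before it the exponent has \<open>A /\<^sub>R x\<close>.\<close>
 define A where "A = (- (real \<beta> / 2) * x) *\<^sub>R matrix_inv \<Sigma>"
 have A: "A \<in> hermitian \<beta>" using matrix_inv_pos_def[OF \<beta> assms(4)]
  by (auto simp: A_def hermitian_def Falg_def simp del: scaleR_minus_left)
 define c where "c = 1 / ((2 * pi / real \<beta>) powr (real ?m * real ?n * real \<beta> / 2) * hdet \<beta> \<Sigma> powr (real \<beta> * real ?n / 2))"
 have c: "0 <= c" by (simp add: c_def)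
 obtain X :: "'a => quat^'n^'m" where X: "distributed M (lebesgue_Fmat \<beta>) X (%Y. ennreal (wishart_density \<beta> \<Sigma> Y))"
  and W: "ALL \<omega>:space M. W \<omega> = X \<omega> ** adj (X \<omega>)"
  using assms(5) unfolding wishart_def by blast
 let ?N = "lebesgue_Fmat \<beta> :: (quat^'n^'m) measure"
 have sp: "space ?N = Fmat \<beta>" and sN: "sets ?N = sets (restrict_space borel (Fmat \<beta>))"
  by (simp_all add: lebesgue_Fmat_def space_restrict_space)
 have padF: "pad Y \<in> Fmat \<beta>" if "Y \<in> Fmat \<beta>" for Y :: "quat^'n^'m" using that by (simp add: pad_def Fmat_def)
 \<comment> \<open>The event in terms of X, as membership of the padded and rescaled matrix in the
   open ball.\<close>
 define S where "S = {Y \<in> space ?N. opb (pad Y /\<^sub>R sqrt x)}"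
 have m_opb: "(%Y :: quat^'n^'m. ob (pad Y /\<^sub>R sqrt x)) \<in> borel_measurable borel"
  using pad_measurable[where 'n = 'n and 'm = 'm] by measurable
 have qtr_gram: "qtr (B ** (Z ** adj Z)) = qtr (adj Z ** B ** Z)" for B Z :: "quat^'m^'m"
  using qRe_trace_commute[of "B ** Z" "adj Z"] by (simp add: qtr_def matrix_mul_assoc)
 have "continuous_on UNIV (%Z :: quat^'m^'m. qtr (adj Z ** (A /\<^sub>R x) ** Z))"
  using continuous_congruence[OF psum_hmp[OF psum_qtr[of 1]], of "A /\<^sub>R x"] by simp
 hence "(%Z :: quat^'m^'m. exp (qtr ((A /\<^sub>R x) ** (Z ** adj Z)))) \<in> borel_measurable borel"
  unfolding qtr_gram by (intro borel_measurable_continuous_onI continuous_on_exp)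
 hence m_int: "(%Z :: quat^'m^'m. ennreal c * (ennreal (exp (qtr ((A /\<^sub>R x) ** (Z ** adj Z)))) * ob (Z /\<^sub>R sqrt x))) \<in> borel_measurable borel"
  by measurable
 have m_exp: "(%Z :: quat^'m^'m. exp (qtr (adj Z ** A ** Z))) \<in> borel_measurable borel"
  using borel_measurable_integrable[OF ball_exp_integral(2)[OF \<beta> zero_less_card_finite less_imp_le[OF n]]] by simp
 have "S = (%Y. ob (pad Y /\<^sub>R sqrt x)) -` {1} \<inter> space ?N" by (auto simp: S_def ob_def split: if_splits)
 moreover have "(%Y. ob (pad Y /\<^sub>R sqrt x)) \<in> borel_measurable ?N"
  unfolding measurable_cong_sets[OF sN refl] by (rule measurable_restrict_space1[OF m_opb])
 ultimately have S: "S \<in> sets ?N" by auto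
 have XM: "X \<in> measurable M ?N" using X by simp
 have "{\<omega> \<in> space M. max_eigval \<beta> (W \<omega>) < x} = X -` S \<inter> space M"
 proof -
  have "max_eigval \<beta> (W \<omega>) < x \<longleftrightarrow> X \<omega> \<in> S" if \<omega>: "\<omega> \<in> space M" for \<omega>
  proof -
   have XF: "X \<omega> \<in> Fmat \<beta>" using measurable_space[OF XM \<omega>] by (simp add: sp)
   show ?thesis using opb_max_eigval[OF \<beta> padF[OF XF] x] W \<omega> XF n by (simp add: S_def sp pad_gram)
  qed
  thus ?thesis by auto
 qed
 hence "emeasure M {\<omega> \<in> space M. max_eigval \<beta> (W \<omega>) < x} = (\<integral>\<^sup>+Y. ennreal (wishart_density \<beta> \<Sigma> Y) * indicator S Y \<partial>?N)"
  using distributed_emeasure[OF X S] by simp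
 also have "... = (\<integral>\<^sup>+Y. ennreal c * (ennreal (exp (qtr ((A /\<^sub>R x) ** (pad Y ** adj (pad Y))))) * ob (pad Y /\<^sub>R sqrt x)) \<partial>?N)"
 proof (rule nn_integral_cong)
  fix Y assume "Y \<in> space ?N"
  hence "indicator S Y = ob (pad Y /\<^sub>R sqrt x)" by (simp add: S_def ob_def)
  moreover have "A /\<^sub>R x = (- (real \<beta> / 2)) *\<^sub>R matrix_inv \<Sigma>" using x by (simp add: A_def)
  hence "qtr ((A /\<^sub>R x) ** (pad Y ** adj (pad Y))) = - (real \<beta> / 2) * qRe (trace (matrix_inv \<Sigma> ** Y ** adj Y))"
   using n by (simp only: pad_gram[OF less_imp_le] qtr_def matrix_mult_distribs matrix_mul_assoc)
    (simp add: trace_def qRe_sum sum_distrib_left)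
  ultimately show "ennreal (wishart_density \<beta> \<Sigma> Y) * indicator S Y
    = ennreal c * (ennreal (exp (qtr ((A /\<^sub>R x) ** (pad Y ** adj (pad Y))))) * ob (pad Y /\<^sub>R sqrt x))"
   using c unfolding wishart_density_def c_def[symmetric] by (simp add: ennreal_mult' mult.assoc)
 qed
 also have "... = (\<integral>\<^sup>+Z. ennreal c * (ennreal (exp (qtr ((A /\<^sub>R x) ** (Z ** adj Z)))) * ob (Z /\<^sub>R sqrt x)) \<partial>LB \<beta> UNIV ?C)"
  by (rule nn_integral_lebesgue_Fmat[OF \<beta> less_imp_le[OF n] m_int])
 \<comment> \<open>Scaling by sqrt(x) on a space of real dimension \<beta> m n; the Jacobian becomes
   the power of x in the result.\<close>
 also have "... = ennreal (sqrt x ^ (\<beta> * (?m * ?n))) * (\<integral>\<^sup>+Z. ennreal c *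
   (ennreal (exp (qtr ((A /\<^sub>R x) ** ((sqrt x *\<^sub>R Z) ** adj (sqrt x *\<^sub>R Z))))) * ob ((sqrt x *\<^sub>R Z) /\<^sub>R sqrt x)) \<partial>LB \<beta> UNIV ?C)"
  unfolding LB_def using leb_scale[OF finite_BB[of \<beta> UNIV ?C] _ m_int, of "sqrt x"] x n
  by (simp add: card_BB[OF \<beta>] card_ix_less)
 also have "... = ennreal (sqrt x ^ (\<beta> * (?m * ?n))) * (\<integral>\<^sup>+Z. ennreal c * (ob Z * ennreal (exp (qtr (adj Z ** A ** Z)))) \<partial>LB \<beta> UNIV ?C)"
 proof -
  have "qtr ((A /\<^sub>R x) ** ((sqrt x *\<^sub>R Z) ** adj (sqrt x *\<^sub>R Z))) = qtr (adj Z ** A ** Z)" for Z :: "quat^'m^'m"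
  proof -
   have "sqrt x * (inverse x * sqrt x) = 1" using x by (simp add: field_simps)
   thus ?thesis unfolding qtr_gram by (simp add: matrix_mult_distribs)
  qed
  thus ?thesis using x by (simp add: mult.commute)
 qed
 also have "(\<integral>\<^sup>+Z. ennreal c * (ob Z * ennreal (exp (qtr (adj Z ** A ** Z)))) \<partial>LB \<beta> UNIV ?C)
   = ennreal c * (\<integral>\<^sup>+Z. ennreal (exp (qtr (adj Z ** A ** Z))) \<partial>ball_law \<beta> ?n)"
  using m_exp by (simp add: nn_integral_cmult nn_integral_ball_law)
 also have "(\<integral>\<^sup>+Z. ennreal (exp (qtr (adj Z ** A ** Z))) \<partial>ball_law \<beta> ?n) = ennreal (\<integral>Z. exp (qtr (adj Z ** A ** Z)) \<partial>ball_law \<beta> ?n)"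
  by (rule nn_integral_eq_integral[OF ball_exp_integral(2)[OF \<beta> zero_less_card_finite less_imp_le[OF n]]]) simp
 finally have "measure M {\<omega> \<in> space M. max_eigval \<beta> (W \<omega>) < x}
   = sqrt x ^ (\<beta> * (?m * ?n)) * (c * (\<integral>Z. exp (qtr (adj Z ** A ** Z)) \<partial>ball_law \<beta> ?n))"
  using c x by (simp add: measure_def enn2real_mult)
 also have "... = (sqrt x ^ (\<beta> * (?m * ?n)) * c * pi powr (real ?m * real ?n * real \<beta> / 2))
   * (mv_Gamma \<beta> ?n ((real ?n - 1) * real \<beta> / 2 + 1) / mv_Gamma \<beta> ?n ((real ?n + real ?m - 1) * real \<beta> / 2 + 1))
   * hyp1F1 \<beta> (real ?m * real \<beta> / 2) ((real ?n + real ?m - 1) * real \<beta> / 2 + 1) A (mat 1 :: quat^'n^'n)"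
  unfolding ball_exp_hyp1F1[OF \<beta> n A] vol_eq[OF zero_less_card_finite] by simp
 also have "sqrt x ^ (\<beta> * (?m * ?n)) * c * pi powr (real ?m * real ?n * real \<beta> / 2)
   = (x * real \<beta> / 2) powr (real \<beta> * real ?n * real ?m / 2) / hdet \<beta> \<Sigma> powr (real ?n * real \<beta> / 2)"
 proof -
  let ?e = "real ?m * real ?n * real \<beta> / 2"
  have "sqrt x ^ (\<beta> * (?m * ?n)) = x powr ?e"
   using x by (simp add: powr_half_sqrt[symmetric] powr_powr mult_ac flip: powr_realpow)
  \<comment> \<open>The volume carries pi^e and the density (2 pi / \<beta>)^(-e), so pi cancels and
    (\<beta> / 2)^e remains.\<close>
  moreover have "(x * real \<beta> / 2) powr ?e = x powr ?e * pi powr ?e / (2 * pi / real \<beta>) powr ?e"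
   by (auto simp: powr_mult[symmetric] powr_divide[symmetric])
  ultimately show ?thesis by (simp add: c_def mult_ac)
 qed
 finally show ?thesis unfolding Let_def A_def[symmetric] by (simp add: mult_ac)
qed

end
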